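(* Let $\mathcal{V}$ be the set of values $\delta(f)$ as $f$ ranges over all nondegenerate ternary quadratic forms $f\in\mathbb{Z}[t_1,t_2,t_3]$ that are locally ADC. Then $\mathcal{V}$ comprises $0\%$ of the rational numbers in $[0,1]$ in the sense of height: the number of elements of $\mathcal{V}$ of height at most $N$ is $o$ of the number of rational numbers in $[0,1]$ of height at most $N$, as $N\to\infty$. The same holds for the set of values $\delta(f)$ as $f$ ranges over all maximal ternary forms $f\in\mathbb{Z}[t_1,t_2,t_3]$.
   Context: The height of a rational $a/b$ in lowest terms is $\max(|a|,|b|)$. A quadratic form over $\mathbb{Z}_p$ is ADC if every $x\in\mathbb{Z}_p$ represented by it over $\mathbb{Q}_p$ is represented over $\mathbb{Z}_p$; $f$ over $\mathbb{Z}$ is locally ADC if it is ADC over $\mathbb{Z}_p$ for every prime $p$. $f$ corresponds to a $\mathbb{Z}$-lattice $L$ in a quadratic space $(V,q)$ over $\mathbb{Q}$ on which $q$ is $\mathbb{Z}$-valued; $f$ is maximal if no $\mathbb{Z}$-lattice $M\supsetneq L$ in $V$ has $q$ $\mathbb{Z}$-valued on it. $D_f\coloneqq f(\mathbb{Z}^3)\setminus\{0\}$; for $S\subset\mathbb{Z}$ positive (no negative elements), negative (no positive elements) or indefinite (otherwise), its density is $\lim\#(S\cap[1,N])/N$, $\lim\#(S\cap[-N,-1])/N$, or $\lim\#(S\cap[-N,N])/(2N)$ respectively; $\delta(f)$ is the density of $D_f$. *)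

theory Defs
  imports
    "HOL-Analysis.Analysis"
    "HOL-Algebra.QuotRing"
    "HOL-Computational_Algebra.Primes"
    "HOL-Library.Landau_Symbols"
begin

section \<open>Ternary quadratic forms\<close>

text \<open>
  \<open>TForm a b c d e g\<close> is the form
  \<open>a t\<^sub>1\<^sup>2 + b t\<^sub>2\<^sup>2 + c t\<^sub>3\<^sup>2 + d t\<^sub>1 t\<^sub>2 + e t\<^sub>1 t\<^sub>3 + g t\<^sub>2 t\<^sub>3\<close>.  The cross
  coefficients are not required to be even.
\<close>

datatype 'a tform = TForm 'a 'a 'a 'a 'a 'a

fun tform_eval :: "'a::comm_ring_1 tform \<Rightarrow> 'a ^ 3 \<Rightarrow> 'a" where
  "tform_eval (TForm a b c d e g) t =
     a * (t $ 1)\<^sup>2 + b * (t $ 2)\<^sup>2 + c * (t $ 3)\<^sup>2 +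
     d * t $ 1 * t $ 2 + e * t $ 1 * t $ 3 + g * t $ 2 * t $ 3"

text \<open>The same evaluation in a ring given by an explicit carrier.\<close>

fun tform_eval_in :: "('a, 'm) ring_scheme \<Rightarrow> 'a tform \<Rightarrow> 'a ^ 3 \<Rightarrow> 'a" where
  "tform_eval_in R (TForm a b c d e g) t =
     a \<otimes>\<^bsub>R\<^esub> (t $ 1 \<otimes>\<^bsub>R\<^esub> t $ 1) \<oplus>\<^bsub>R\<^esub>
     b \<otimes>\<^bsub>R\<^esub> (t $ 2 \<otimes>\<^bsub>R\<^esub> t $ 2) \<oplus>\<^bsub>R\<^esub>
     c \<otimes>\<^bsub>R\<^esub> (t $ 3 \<otimes>\<^bsub>R\<^esub> t $ 3) \<oplus>\<^bsub>R\<^esub>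
     d \<otimes>\<^bsub>R\<^esub> (t $ 1 \<otimes>\<^bsub>R\<^esub> t $ 2) \<oplus>\<^bsub>R\<^esub>
     e \<otimes>\<^bsub>R\<^esub> (t $ 1 \<otimes>\<^bsub>R\<^esub> t $ 3) \<oplus>\<^bsub>R\<^esub>
     g \<otimes>\<^bsub>R\<^esub> (t $ 2 \<otimes>\<^bsub>R\<^esub> t $ 3)"

text \<open>The quadratic space \<open>(\<rat>\<^sup>3, q)\<close> attached to an integral form, and its polar form.\<close>

definition tform_q :: "int tform \<Rightarrow> rat ^ 3 \<Rightarrow> rat" where
  "tform_q f = tform_eval (map_tform of_int f)"

definition tform_polar :: "int tform \<Rightarrow> rat ^ 3 \<Rightarrow> rat ^ 3 \<Rightarrow> rat" where
  "tform_polar f x y = tform_q f (x + y) - tform_q f x - tform_q f y"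

definition nondegenerate :: "int tform \<Rightarrow> bool" where
  "nondegenerate f \<longleftrightarrow> (\<forall>x. (\<forall>y. tform_polar f x y = 0) \<longrightarrow> x = 0)"


section \<open>Lattices and maximal forms\<close>

definition int_span :: "(rat ^ 3) set \<Rightarrow> (rat ^ 3) set" where
  "int_span B = {\<Sum>b\<in>B. of_int (c b) *s b | c :: rat ^ 3 \<Rightarrow> int. True}"

definition is_lattice :: "(rat ^ 3) set \<Rightarrow> bool" where
  "is_lattice M \<longleftrightarrow> (\<exists>B. finite B \<and> M = int_span B) \<and> vec.span M = UNIV"

definition std_lattice :: "(rat ^ 3) set" where
  "std_lattice = {v. \<forall>i. v $ i \<in> \<int>}"

definition maximal_form :: "int tform \<Rightarrow> bool" where
  "maximal_form f \<longleftrightarrow>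
     \<not> (\<exists>M. is_lattice M \<and> std_lattice \<subset> M \<and> (\<forall>v\<in>M. tform_q f v \<in> \<int>))"


section \<open>The p-adic numbers\<close>

text \<open>
  \<open>\<rat>\<^sub>p\<close> is the completion of \<open>\<rat>\<close> for the p-adic absolute value: the ring of p-adic Cauchy
  sequences modulo the ideal of null sequences.  \<open>\<int>\<^sub>p\<close> is its closed unit ball: since the
  absolute value is discrete away from 0, an element has absolute value at most 1 iff it is
  the class of a Cauchy sequence all of whose terms have absolute value at most 1.
\<close>

definition padic_abs :: "nat \<Rightarrow> rat \<Rightarrow> real" where
  "padic_abs p r = (if r = 0 then 0 else
     real p powi (int (multiplicity (int p) (snd (quotient_of r)))
                  - int (multiplicity (int p) (fst (quotient_of r)))))"

definition padic_cauchy :: "nat \<Rightarrow> (nat \<Rightarrow> rat) \<Rightarrow> bool" where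
  "padic_cauchy p X \<longleftrightarrow> (\<forall>e>0. \<exists>M. \<forall>m\<ge>M. \<forall>n\<ge>M. padic_abs p (X m - X n) < e)"

definition padic_null :: "nat \<Rightarrow> (nat \<Rightarrow> rat) \<Rightarrow> bool" where
  "padic_null p X \<longleftrightarrow> (\<lambda>n. padic_abs p (X n)) \<longlonglongrightarrow> 0"

definition padic_cauchy_ring :: "nat \<Rightarrow> (nat \<Rightarrow> rat) ring" where
  "padic_cauchy_ring p =
     \<lparr>carrier = {X. padic_cauchy p X},
      mult = (\<lambda>X Y n. X n * Y n), one = (\<lambda>_. 1),
      zero = (\<lambda>_. 0), add = (\<lambda>X Y n. X n + Y n)\<rparr>"

definition padic_field :: "nat \<Rightarrow> (nat \<Rightarrow> rat) set ring" where
  "padic_field p = padic_cauchy_ring p Quot {X. padic_null p X}"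

definition padic_ints :: "nat \<Rightarrow> (nat \<Rightarrow> rat) set set" where
  "padic_ints p = {x \<in> carrier (padic_field p). \<exists>X\<in>x. \<forall>n. padic_abs p (X n) \<le> 1}"

definition padic_of_int :: "nat \<Rightarrow> int \<Rightarrow> (nat \<Rightarrow> rat) set" where
  "padic_of_int p k = [k] \<cdot>\<^bsub>padic_field p\<^esub> \<one>\<^bsub>padic_field p\<^esub>"

lemma padic_abs_0 [simp]: "padic_abs p 0 = 0"
  by (simp add: padic_abs_def)

lemma padic_abs_nonneg [simp]: "0 \<le> padic_abs p r"
  by (simp add: padic_abs_def)

lemma padic_abs_frac:
  assumes p: "prime p" and "a \<noteq> 0" "b \<noteq> 0"
  shows "padic_abs p (of_int a / of_int b) =
           real p powi (int (multiplicity (int p) b) - int (multiplicity (int p) a))"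
proof -
  define r where "r = (of_int a / of_int b :: rat)"
  obtain c d where cd: "quotient_of r = (c, d)" by (cases "quotient_of r")
  have d: "d > 0" using quotient_of_denom_pos[OF cd] .
  have r: "r = of_int c / of_int d" using quotient_of_div[OF cd] .
  have r0: "r \<noteq> 0" using assms by (simp add: r_def)
  have c: "c \<noteq> 0" using r r0 by auto
  have "of_int (a * d) = (of_int (c * b) :: rat)"
    using r r_def assms(3) d by (simp add: field_simps)
  hence eq: "a * d = c * b" by (simp only: of_int_eq_iff)
  have pe: "prime_elem (int p)" using p by simp
  have "multiplicity (int p) (a * d) = multiplicity (int p) a + multiplicity (int p) d"
    "multiplicity (int p) (c * b) = multiplicity (int p) c + multiplicity (int p) b"
    using assms c d pe by (simp_all add: prime_elem_multiplicity_mult_distrib)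
  hence "int (multiplicity (int p) b) - int (multiplicity (int p) a)
     = int (multiplicity (int p) d) - int (multiplicity (int p) c)"
    using arg_cong[OF eq, of "multiplicity (int p)"] by linarith
  thus ?thesis using r0 by (simp add: padic_abs_def cd flip: r_def)
qed

lemma rat_as_frac: obtains a b where "r = (of_int a / of_int b :: rat)" "b \<noteq> 0"
  by (metis quotient_of_div quotient_of_denom_pos less_irrefl surj_pair)

lemma padic_abs_mult:
  assumes p: "prime p"
  shows "padic_abs p (r * s) = padic_abs p r * padic_abs p s"
proof (cases "r = 0 \<or> s = 0")
  case False
  obtain a b where r: "r = of_int a / of_int b" "b \<noteq> 0" by (rule rat_as_frac)
  obtain c d where s: "s = of_int c / of_int d" "d \<noteq> 0" by (rule rat_as_frac)
  have nz: "a \<noteq> 0" "c \<noteq> 0" using False r s by auto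
  have p0: "real p \<noteq> 0" using p prime_gt_0_nat by auto
  have rs: "r * s = of_int (a * c) / of_int (b * d)" using r s by simp
  have pe: "prime_elem (int p)" using p by simp
  have "padic_abs p (r * s) =
     real p powi ((int (multiplicity (int p) b) - int (multiplicity (int p) a)) +
       (int (multiplicity (int p) d) - int (multiplicity (int p) c)))"
    unfolding rs using nz r s pe
    by (subst padic_abs_frac[OF p]) (simp_all add: prime_elem_multiplicity_mult_distrib algebra_simps)
  thus ?thesis using nz r s p0 by (simp add: power_int_add padic_abs_frac[OF p])
qed (auto simp: padic_abs_def)

lemma padic_abs_add:
  assumes p: "prime p"
  shows "padic_abs p (r + s) \<le> max (padic_abs p r) (padic_abs p s)"
proof (cases "r = 0 \<or> s = 0 \<or> r + s = 0")
  case False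
  obtain a b where r: "r = of_int a / of_int b" "b \<noteq> 0" by (rule rat_as_frac)
  obtain c d where s: "s = of_int c / of_int d" "d \<noteq> 0" by (rule rat_as_frac)
  define A C D where "A = a * d" and "C = c * b" and "D = b * d"
  have D: "D \<noteq> 0" using r s by (simp add: D_def)
  have r': "r = of_int A / of_int D" and s': "s = of_int C / of_int D"
    using r s by (simp_all add: A_def C_def D_def field_simps)
  have rs: "r + s = of_int (A + C) / of_int D" using D by (simp add: r' s' add_divide_distrib)
  have nz: "A \<noteq> 0" "C \<noteq> 0" "A + C \<noteq> 0" using False r' s' rs by auto
  have p1: "real p \<ge> 1" using prime_ge_1_nat[OF p] by simp
  have nu: "\<not> is_unit (int p)" using p prime_elem_not_unit[of "int p"] by simp
  let ?m = "multiplicity (int p)"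
  have "int p ^ min (?m A) (?m C) dvd A + C"
    by (intro dvd_add; rule dvd_trans[OF le_imp_power_dvd multiplicity_dvd]) auto
  hence "?m (A + C) \<ge> min (?m A) (?m C)"
    using nz nu by (simp add: multiplicity_geI)
  hence "?m A \<le> ?m (A + C) \<or> ?m C \<le> ?m (A + C)" by auto
  hence "padic_abs p (r + s) \<le> padic_abs p r \<or> padic_abs p (r + s) \<le> padic_abs p s"
    unfolding rs unfolding r' s' padic_abs_frac[OF p nz(1) D] padic_abs_frac[OF p nz(2) D]
      padic_abs_frac[OF p nz(3) D]
    using p1 by (meson diff_left_mono of_nat_mono power_int_increasing)
  thus ?thesis by (simp add: le_max_iff_disj)
qed (auto simp: le_max_iff_disj add_eq_0_iff)

lemma padic_abs_minus: "prime p \<Longrightarrow> padic_abs p (- r) = padic_abs p r"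
proof -
  assume p: "prime p"
  have "padic_abs p (- 1) = 1"
    using padic_abs_frac[OF p, of "-1" 1] by (simp add: multiplicity_unit_right)
  thus ?thesis using padic_abs_mult[OF p, of "-1" r] by simp
qed

lemma padic_cauchy_const [simp]: "padic_cauchy p (\<lambda>_. c)"
  by (simp add: padic_cauchy_def)

lemma padic_cauchy_minus: "prime p \<Longrightarrow> padic_cauchy p X \<Longrightarrow> padic_cauchy p (\<lambda>n. - X n)"
  unfolding padic_cauchy_def
  by (metis (no_types, lifting) minus_diff_minus padic_abs_minus)

lemma padic_cauchy_add:
  assumes p: "prime p" and X: "padic_cauchy p X" and Y: "padic_cauchy p Y"
  shows "padic_cauchy p (\<lambda>n. X n + Y n)"
  unfolding padic_cauchy_def
proof (intro allI impI)
  fix e :: real assume e: "e > 0"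
  obtain M where M: "\<And>m n. m \<ge> M \<Longrightarrow> n \<ge> M \<Longrightarrow> padic_abs p (X m - X n) < e"
    using X e unfolding padic_cauchy_def by blast
  obtain L where L: "\<And>m n. m \<ge> L \<Longrightarrow> n \<ge> L \<Longrightarrow> padic_abs p (Y m - Y n) < e"
    using Y e unfolding padic_cauchy_def by blast
  have "padic_abs p (X m + Y m - (X n + Y n)) < e" if "m \<ge> max M L" "n \<ge> max M L" for m n
    using padic_abs_add[OF p, of "X m - X n" "Y m - Y n"] M[of m n] L[of m n] that
    by (simp add: algebra_simps)
  thus "\<exists>M. \<forall>m\<ge>M. \<forall>n\<ge>M. padic_abs p (X m + Y m - (X n + Y n)) < e" by blast
qed

lemma padic_cauchy_bounded:
  assumes p: "prime p" and X: "padic_cauchy p X"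
  obtains B where "B > 0" "\<And>n. padic_abs p (X n) \<le> B"
proof -
  obtain M where M: "\<And>m n. m \<ge> M \<Longrightarrow> n \<ge> M \<Longrightarrow> padic_abs p (X m - X n) < 1"
    using X unfolding padic_cauchy_def by (meson zero_less_one)
  define B where "B = 1 + (\<Sum>k\<le>M. padic_abs p (X k))"
  have s: "padic_abs p (X k) \<le> (\<Sum>k\<le>M. padic_abs p (X k))" if "k \<le> M" for k
    using that by (intro member_le_sum) auto
  have "padic_abs p (X n) \<le> B" for n
  proof (cases "n \<le> M")
    case True thus ?thesis using s[of n] by (simp add: B_def)
  next
    case False
    have "padic_abs p (X n) \<le> max (padic_abs p (X n - X M)) (padic_abs p (X M))"
      using padic_abs_add[OF p, of "X n - X M" "X M"] by simp
    also have "\<dots> \<le> B"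
      using M[of n M] False s[of M] padic_abs_nonneg[of p "X M"] unfolding B_def by linarith
    finally show ?thesis .
  qed
  moreover have "B > 0" unfolding B_def by (intro add_pos_nonneg sum_nonneg) auto
  ultimately show ?thesis using that by blast
qed

lemma padic_cauchy_mult:
  assumes p: "prime p" and X: "padic_cauchy p X" and Y: "padic_cauchy p Y"
  shows "padic_cauchy p (\<lambda>n. X n * Y n)"
  unfolding padic_cauchy_def
proof (intro allI impI)
  fix e :: real assume e: "e > 0"
  obtain B where B: "B > 0" "\<And>n. padic_abs p (X n) \<le> B" using padic_cauchy_bounded[OF p X] by blast
  obtain C where C: "C > 0" "\<And>n. padic_abs p (Y n) \<le> C" using padic_cauchy_bounded[OF p Y] by blast
  obtain M where M: "\<And>m n. m \<ge> M \<Longrightarrow> n \<ge> M \<Longrightarrow> padic_abs p (X m - X n) < e / C"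
    using X e C unfolding padic_cauchy_def by (meson divide_pos_pos)
  obtain L where L: "\<And>m n. m \<ge> L \<Longrightarrow> n \<ge> L \<Longrightarrow> padic_abs p (Y m - Y n) < e / B"
    using Y e B unfolding padic_cauchy_def by (meson divide_pos_pos)
  have "padic_abs p (X m * Y m - X n * Y n) < e" if mn: "m \<ge> max M L" "n \<ge> max M L" for m n
  proof -
    have "padic_abs p (X m * (Y m - Y n)) \<le> B * padic_abs p (Y m - Y n)"
      using B by (simp add: padic_abs_mult[OF p] mult_right_mono)
    also have "\<dots> < e" using L[of m n] mn B by (simp add: field_simps)
    finally have 1: "padic_abs p (X m * (Y m - Y n)) < e" .
    have "padic_abs p ((X m - X n) * Y n) \<le> padic_abs p (X m - X n) * C"
      using C by (simp add: padic_abs_mult[OF p] mult_left_mono)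
    also have "\<dots> < e" using M[of m n] mn C by (simp add: field_simps)
    finally have 2: "padic_abs p ((X m - X n) * Y n) < e" .
    show ?thesis
      using padic_abs_add[OF p, of "X m * (Y m - Y n)" "(X m - X n) * Y n"] 1 2
      by (simp add: algebra_simps)
  qed
  thus "\<exists>M. \<forall>m\<ge>M. \<forall>n\<ge>M. padic_abs p (X m * Y m - X n * Y n) < e" by blast
qed

lemma padic_null_iff: "padic_null p X \<longleftrightarrow> (\<forall>e>0. \<exists>M. \<forall>n\<ge>M. padic_abs p (X n) < e)"
  by (simp add: padic_null_def LIMSEQ_iff)

lemma padic_null_add:
  assumes p: "prime p" and X: "padic_null p X" and Y: "padic_null p Y"
  shows "padic_null p (\<lambda>n. X n + Y n)"
  unfolding padic_null_iff
proof (intro allI impI)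
  fix e :: real assume e: "e > 0"
  obtain M where M: "\<And>n. n \<ge> M \<Longrightarrow> padic_abs p (X n) < e" using X e unfolding padic_null_iff by blast
  obtain L where L: "\<And>n. n \<ge> L \<Longrightarrow> padic_abs p (Y n) < e" using Y e unfolding padic_null_iff by blast
  have "padic_abs p (X n + Y n) < e" if "n \<ge> max M L" for n
    using padic_abs_add[OF p, of "X n" "Y n"] M[of n] L[of n] that by simp
  thus "\<exists>M. \<forall>n\<ge>M. padic_abs p (X n + Y n) < e" by blast
qed

lemma padic_null_minus: "prime p \<Longrightarrow> padic_null p X \<Longrightarrow> padic_null p (\<lambda>n. - X n)"
  by (simp add: padic_null_def padic_abs_minus)

lemma padic_null_mult:
  assumes p: "prime p" and X: "padic_null p X" and Y: "padic_cauchy p Y"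
  shows "padic_null p (\<lambda>n. X n * Y n)"
  unfolding padic_null_iff
proof (intro allI impI)
  fix e :: real assume e: "e > 0"
  obtain C where C: "C > 0" "\<And>n. padic_abs p (Y n) \<le> C" using padic_cauchy_bounded[OF p Y] by blast
  obtain M where M: "\<And>n. n \<ge> M \<Longrightarrow> padic_abs p (X n) < e / C"
    using X e C unfolding padic_null_iff by (meson divide_pos_pos)
  have "padic_abs p (X n * Y n) < e" if "n \<ge> M" for n
  proof -
    have "padic_abs p (X n * Y n) \<le> padic_abs p (X n) * C"
      using C by (simp add: padic_abs_mult[OF p] mult_left_mono)
    also have "\<dots> < e" using M[of n] that C by (simp add: field_simps)
    finally show ?thesis .
  qed
  thus "\<exists>M. \<forall>n\<ge>M. padic_abs p (X n * Y n) < e" by blast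
qed

lemma padic_null_imp_cauchy:
  assumes p: "prime p" and X: "padic_null p X"
  shows "padic_cauchy p X"
  unfolding padic_cauchy_def
proof (intro allI impI)
  fix e :: real assume e: "e > 0"
  obtain M where M: "\<And>n. n \<ge> M \<Longrightarrow> padic_abs p (X n) < e" using X e unfolding padic_null_iff by blast
  have "padic_abs p (X m - X n) < e" if "m \<ge> M" "n \<ge> M" for m n
    using padic_abs_add[OF p, of "X m" "- X n"] M[of m] M[of n] that
    by (simp add: padic_abs_minus[OF p])
  thus "\<exists>M. \<forall>m\<ge>M. \<forall>n\<ge>M. padic_abs p (X m - X n) < e" by blast
qed

lemma padic_cauchy_ring_cring:
  assumes p: "prime p"
  shows "cring (padic_cauchy_ring p)"
proof (rule cringI)
  show "abelian_group (padic_cauchy_ring p)"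
  proof (rule abelian_groupI)
    fix X assume "X \<in> carrier (padic_cauchy_ring p)"
    thus "\<exists>Y\<in>carrier (padic_cauchy_ring p). Y \<oplus>\<^bsub>padic_cauchy_ring p\<^esub> X = \<zero>\<^bsub>padic_cauchy_ring p\<^esub>"
      using padic_cauchy_minus[OF p]
      by (intro bexI[of _ "\<lambda>n. - X n"]) (auto simp: padic_cauchy_ring_def)
  qed (auto simp: padic_cauchy_ring_def padic_cauchy_add[OF p] algebra_simps)
  show "comm_monoid (padic_cauchy_ring p)"
    by (rule comm_monoidI) (auto simp: padic_cauchy_ring_def padic_cauchy_mult[OF p] algebra_simps)
qed (auto simp: padic_cauchy_ring_def algebra_simps)

lemma padic_null_ideal:
  assumes p: "prime p"
  shows "ideal {X. padic_null p X} (padic_cauchy_ring p)"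
proof -
  interpret R: cring "padic_cauchy_ring p" by (rule padic_cauchy_ring_cring[OF p])
  have inv: "\<ominus>\<^bsub>padic_cauchy_ring p\<^esub> X = (\<lambda>n. - X n)" if "padic_cauchy p X" for X
    by (rule R.minus_equality)
      (use that padic_cauchy_minus[OF p] in \<open>auto simp: padic_cauchy_ring_def\<close>)
  show ?thesis
  proof (rule idealI)
    show "ring (padic_cauchy_ring p)" by (rule R.ring_axioms)
    show "subgroup {X. padic_null p X} (add_monoid (padic_cauchy_ring p))"
    proof (rule R.add.subgroupI)
      show "{X. padic_null p X} \<noteq> {}" by (auto simp: padic_null_def intro!: exI[of _ "\<lambda>_. 0"])
      show "\<ominus>\<^bsub>padic_cauchy_ring p\<^esub> X \<in> {X. padic_null p X}" if "X \<in> {X. padic_null p X}" for X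
        using that by (simp add: inv padic_null_imp_cauchy[OF p] padic_null_minus[OF p])
    qed (auto simp: padic_cauchy_ring_def padic_null_imp_cauchy[OF p] padic_null_add[OF p])
  next
    fix X Y assume "X \<in> {X. padic_null p X}" "Y \<in> carrier (padic_cauchy_ring p)"
    hence "padic_null p (\<lambda>n. X n * Y n)"
      using padic_null_mult[OF p] by (simp add: padic_cauchy_ring_def)
    thus "Y \<otimes>\<^bsub>padic_cauchy_ring p\<^esub> X \<in> {X. padic_null p X}"
      "X \<otimes>\<^bsub>padic_cauchy_ring p\<^esub> Y \<in> {X. padic_null p X}"
      by (simp_all add: padic_cauchy_ring_def mult.commute)
  qed
qed

lemma padic_field_cring: "prime p \<Longrightarrow> cring (padic_field p)"
  unfolding padic_field_def
  by (rule ideal.quotient_is_cring[OF padic_null_ideal padic_cauchy_ring_cring])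


section \<open>ADC forms\<close>

definition represented_over ::
    "('a, 'm) ring_scheme \<Rightarrow> 'a set \<Rightarrow> 'a tform \<Rightarrow> 'a \<Rightarrow> bool" where
  "represented_over R A F x \<longleftrightarrow> (\<exists>t. (\<forall>i. t $ i \<in> A) \<and> tform_eval_in R F t = x)"

definition padic_ADC :: "nat \<Rightarrow> (nat \<Rightarrow> rat) set tform \<Rightarrow> bool" where
  "padic_ADC p F \<longleftrightarrow>
     (\<forall>x\<in>padic_ints p.
        represented_over (padic_field p) (carrier (padic_field p)) F x \<longrightarrow>
        represented_over (padic_field p) (padic_ints p) F x)"

definition locally_ADC :: "int tform \<Rightarrow> bool" where
  "locally_ADC f \<longleftrightarrow> (\<forall>p. prime p \<longrightarrow> padic_ADC p (map_tform (padic_of_int p) f))"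


section \<open>Density and height\<close>

definition int_density :: "int set \<Rightarrow> real" where
  "int_density S =
     (if \<forall>x\<in>S. x \<ge> 0 then lim (\<lambda>N. real (card (S \<inter> {1..int N})) / real N)
      else if \<forall>x\<in>S. x \<le> 0 then lim (\<lambda>N. real (card (S \<inter> {- int N..-1})) / real N)
      else lim (\<lambda>N. real (card (S \<inter> {- int N..int N})) / (2 * real N)))"

definition represented_nonzero :: "int tform \<Rightarrow> int set" where
  "represented_nonzero f = range (tform_eval f) - {0}"

definition form_density :: "int tform \<Rightarrow> real" where
  "form_density f = int_density (represented_nonzero f)"

definition rat_height :: "rat \<Rightarrow> int" where
  "rat_height r = max \<bar>fst (quotient_of r)\<bar> \<bar>snd (quotient_of r)\<bar>"

definition height_count :: "real set \<Rightarrow> nat \<Rightarrow> nat" where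
  "height_count S N = card {r :: rat. of_rat r \<in> S \<and> rat_height r \<le> int N}"

end

theory Submission
  imports Defs "HOL-Number_Theory.Number_Theory" "HOL-Real_Asymp.Real_Asymp"
begin

text \<open>
  Let \<open>Loc f p\<close> be the set of integers that \<open>f\<close> represents modulo every power of \<open>p\<close>. Maximality
  and the ADC property both imply that \<open>p\<^sup>2 n \<in> Loc f p\<close> forces \<open>n \<in> Loc f p\<close>. Hence \<open>Loc f p\<close> is a
  union of square classes, and its density is \<open>(i p + j) / (2 (p + 1))\<close> with \<open>i, j \<le> 2\<close> for odd \<open>p\<close>, is
  \<open>j / 12\<close> with \<open>j \<le> 12\<close> for \<open>p = 2\<close>, and is \<open>1\<close> for almost all \<open>p\<close>.

  Almost all integers (of the right sign) that lie in every \<open>Loc f p\<close> are represented by \<open>f\<close>: on a residue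
  class of vectors, along three orthogonal directions, \<open>f\<close> becomes a polynomial
  \<open>l t + Q (\<alpha> t\<^sup>2 + \<beta> r\<^sup>2 + c s\<^sup>2 + \<dots>)\<close> with \<open>l\<close> prime to \<open>Q\<close>. On a box \<open>s \<in> [S, (1 + \<eta>) S)\<close>,
  \<open>t, r < S\<^bsup>3/4\<^esup>\<close> the number of coincidences of its values is, up to a factor close to \<open>1\<close>, the least one
  possible as soon as \<open>Q\<close> is divisible by all small primes, and Cauchy--Schwarz shows that almost all integers of
  the corresponding window are values. Hence \<open>\<delta>(f)\<close> is the product of the local densities.

  Every local factor other than \<open>0\<close> and \<open>1\<close> at an odd prime contributes a factor \<open>2\<close> to the denominator. So a
  value of \<open>\<delta>\<close> either has a denominator divisible by a large power of \<open>2\<close>, or it is a product of boundedly many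
  local factors. The latter products accumulate only slowly: they are covered by finitely many intervals of
  arbitrarily small total length, and so both kinds of rationals are rare.
\<close>

section \<open>Elementary counting\<close>

text \<open>A ternary form may miss integers that it represents locally everywhere, so the global
  step aims only at a statement up to density zero, and for that a second moment is enough. It has
  to be asymptotically sharp: a constant factor lost in the count of coincidences would lose a
  positive proportion of the window. Hence the care with factors 2, and hence the small primes in
  \<open>Q\<close>: a common factor \<open>g\<close> of modulus and coefficient multiplies the
  number of solutions of a congruence by \<open>g\<close>, and the \<open>g\<close> that remain
  contribute a tail of the series of g^(-3/2). The loss is of order \<eta>^2 in a window of relative
  length about 2 \<eta>, so it still sums to O(\<eta>). A linear term prime to \<open>Q\<close>
  requires a base vector whose polar form with one direction has bounded valuation at the primes of
  \<open>Q\<close>; integers divisible by high powers of these primes are given up to obtain it. On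
  the arithmetic side, even boundedly many local factors give infinitely many values, since the
  primes are unbounded. Finiteness is therefore replaced by coverings of small total length.\<close>

text \<open>Cauchy--Schwarz for the fibre sizes \<open>r m\<close>: they add up to
  \<open>card X\<close>, their squares to the number of pairs with equal image. Few coincidences
  therefore mean many values.\<close>

lemma card_squared_le_image_times_coincidences:
  assumes "finite X"
  shows "(card X)\<^sup>2 \<le> card (f ` X) * card {(x, y) \<in> X \<times> X. f x = f y}"
proof -
  define r where "r m = card {x\<in>X. f x = m}" for m
  have s: "card X = (\<Sum>m\<in>f ` X. r m)"
    unfolding r_def using sum.image_gen[OF assms, of "\<lambda>_. 1::nat" f] by simp
  have "{(x, y) \<in> X \<times> X. f x = f y} = (\<Union>m\<in>f ` X. {x\<in>X. f x = m} \<times> {x\<in>X. f x = m})"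
    by auto
  also have "card \<dots> = (\<Sum>m\<in>f ` X. card ({x\<in>X. f x = m} \<times> {x\<in>X. f x = m}))"
    by (rule card_UN_disjoint) (use assms in auto)
  also have "\<dots> = (\<Sum>m\<in>f ` X. (r m)\<^sup>2)"
    by (simp add: r_def card_cartesian_product power2_eq_square)
  finally have c: "card {(x, y) \<in> X \<times> X. f x = f y} = (\<Sum>m\<in>f ` X. (r m)\<^sup>2)" .
  have "real ((card X)\<^sup>2) = (\<Sum>m\<in>f ` X. real (r m))\<^sup>2" by (simp add: s)
  also have "\<dots> \<le> (\<Sum>m\<in>f ` X. (real (r m))\<^sup>2) * card (f ` X)"
    by (rule sum_squared_le_sum_of_squares)
  also have "\<dots> = real (card (f ` X) * card {(x, y) \<in> X \<times> X. f x = f y})"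
    unfolding c by (simp add: mult.commute)
  finally show ?thesis by linarith
qed

text \<open>The blocks \<open>{a..<a + q}\<close> for all \<open>a\<close> in \<open>A\<close> but
  the largest are disjoint and stay in \<open>I\<close>. The block of the largest element may leave
  \<open>I\<close>; it accounts for the \<open>+ 1\<close>.\<close>

lemma card_spaced_le:
  fixes A I :: "int set" and q :: int
  assumes I: "finite I" "\<And>x y z. x \<in> I \<Longrightarrow> y \<in> I \<Longrightarrow> x \<le> z \<Longrightarrow> z \<le> y \<Longrightarrow> z \<in> I"
    and A: "A \<subseteq> I" and q: "q > 0" and d: "\<And>a b. a \<in> A \<Longrightarrow> b \<in> A \<Longrightarrow> q dvd a - b"
  shows "real (card A) \<le> card I / q + 1"
proof (cases "A = {}")
  case False
  have fA: "finite A" using A I finite_subset by blast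
  define M where "M = Max A"
  have M: "M \<in> A" "\<And>a. a \<in> A \<Longrightarrow> a \<le> M" using False fA by (auto simp: M_def)
  have step: "a + q \<le> M" if "a \<in> A - {M}" for a
  proof -
    have "q dvd M - a" "M - a > 0" using that M(2)[of a] d[OF M(1), of a] by auto
    thus ?thesis using zdvd_imp_le by fastforce
  qed
  have inj: "inj_on (\<lambda>(a, i). a + i) ((A - {M}) \<times> {0..<q})"
  proof (rule inj_onI)
    fix v w assume "v \<in> (A - {M}) \<times> {0..<q}" "w \<in> (A - {M}) \<times> {0..<q}"
      "(\<lambda>(a, i). a + i) v = (\<lambda>(a, i). a + i) w"
    moreover obtain a i where v: "v = (a, i)" by (cases v)
    moreover obtain b j where w: "w = (b, j)" by (cases w)
    ultimately have *: "a \<in> A" "b \<in> A" "i \<in> {0..<q}" "j \<in> {0..<q}" "a + i = b + j" by auto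
    have "q dvd a - b" using d *(1,2) by blast
    hence "q dvd j - i" using *(5) by (metis add_diff_cancel_right add.commute diff_diff_eq2 diff_add_cancel)
    hence "j mod q = i mod q" by (simp only: mod_eq_dvd_iff)
    hence "j = i" using *(3,4) by simp
    thus "v = w" using *(5) v w by auto
  qed
  have sub: "(\<lambda>(a, i). a + i) ` ((A - {M}) \<times> {0..<q}) \<subseteq> I"
  proof (rule image_subsetI)
    fix v assume "v \<in> (A - {M}) \<times> {0..<q}"
    moreover obtain a i where v: "v = (a, i)" by (cases v)
    ultimately have *: "a \<in> A" "a \<noteq> M" "i \<in> {0..<q}" by auto
    have "a + i \<in> I" by (rule I(2)[of a M]) (use * A M(1) step[of a] in auto)
    thus "(\<lambda>(a, i). a + i) v \<in> I" by (simp add: v)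
  qed
  have "card ((A - {M}) \<times> {0..<q}) \<le> card I"
    using card_inj_on_le[OF inj sub I(1)] .
  hence "(card A - 1) * nat q \<le> card I"
    using M(1) fA by (simp add: card_cartesian_product)
  hence "(real (card A) - 1) * real_of_int q \<le> real (card I)"
  proof -
    have "card A \<ge> 1" using False fA by (simp add: Suc_le_eq card_gt_0_iff)
    hence "(real (card A) - 1) * real_of_int q = real ((card A - 1) * nat q)"
      using q by (simp add: of_nat_diff)
    thus ?thesis using \<open>(card A - 1) * nat q \<le> card I\<close> by linarith
  qed
  thus ?thesis using q by (simp add: field_simps)
qed (use q in simp)

text \<open>A solution forces \<open>gcd u q\<close> to divide \<open>r\<close>. After division by
  this gcd the coefficient is invertible, so solutions agree modulo \<open>q / gcd u q\<close> and
  \<open>card_spaced_le\<close> applies.\<close>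

lemma card_linear_congruence_le:
  fixes I :: "int set" and q u r :: int
  assumes I: "finite I" "\<And>x y z. x \<in> I \<Longrightarrow> y \<in> I \<Longrightarrow> x \<le> z \<Longrightarrow> z \<le> y \<Longrightarrow> z \<in> I"
    and q: "q > 0" and ne: "{a\<in>I. q dvd a * u + r} \<noteq> {}"
  shows "gcd u q dvd r" "real (card {a\<in>I. q dvd a * u + r}) \<le> gcd u q * card I / q + 1"
proof -
  obtain a0 where a0: "q dvd a0 * u + r" using ne by blast
  have "gcd u q dvd a0 * u + r" "gcd u q dvd a0 * u" using a0 dvd_trans gcd_dvd2 by (blast, simp)
  thus "gcd u q dvd r" using dvd_add_right_iff by blast
  define g where "g = gcd u q"
  have g: "g > 0" using q by (simp add: g_def)
  obtain q' where q': "q = g * q'" by (metis dvd_def gcd_dvd2 g_def)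
  obtain u' where u': "u = g * u'" by (metis dvd_def gcd_dvd1 g_def)
  have q'0: "q' > 0" using q g q' by (simp add: zero_less_mult_iff)
  have cop: "coprime q' u'"
    using g q' u' gcd_mult_distrib_int[of g u' q'] unfolding g_def
    by (metis abs_of_pos coprime_commute coprime_iff_gcd_eq_1 g_def mult_cancel_left2 less_irrefl)
  have "real (card {a\<in>I. q dvd a * u + r}) \<le> card I / q' + 1"
  proof (rule card_spaced_le[OF I _ q'0])
    fix a b assume "a \<in> {a\<in>I. q dvd a * u + r}" "b \<in> {a\<in>I. q dvd a * u + r}"
    hence "q dvd (a * u + r) - (b * u + r)" by (intro dvd_diff) auto
    hence "g * q' dvd g * ((a - b) * u')" by (simp add: q' u' algebra_simps)
    hence "q' dvd (a - b) * u'" using g by simp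
    thus "q' dvd a - b" using cop by (simp add: coprime_dvd_mult_left_iff)
  qed auto
  also have "card I / q' = g * card I / q" using g q'0 by (simp add: q')
  finally show "real (card {a\<in>I. q dvd a * u + r}) \<le> gcd u q * card I / q + 1" by (simp add: g_def)
qed

text \<open>The second hypothesis lets the interval be empty as long as the bound stays
  nonnegative.\<close>

lemma card_int_real_interval:
  fixes x y :: real
  assumes "N \<subseteq> {k::int. x \<le> k \<and> k \<le> y}" "x \<le> y + 1"
  shows "finite N" "real (card N) \<le> y - x + 1"
proof -
  have sub: "N \<subseteq> {\<lceil>x\<rceil>..\<lfloor>y\<rfloor>}" using assms by (auto simp: le_floor_iff ceiling_le_iff)
  thus "finite N" using finite_subset by blast
  have "card N \<le> nat (\<lfloor>y\<rfloor> - \<lceil>x\<rceil> + 1)" using card_mono[OF _ sub] by simp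
  hence "real (card N) \<le> real (nat (\<lfloor>y\<rfloor> - \<lceil>x\<rceil> + 1))" by linarith
  also have "\<dots> \<le> y - x + 1"
  proof (cases "\<lfloor>y\<rfloor> - \<lceil>x\<rceil> + 1 \<ge> 0")
    case True
    hence "real (nat (\<lfloor>y\<rfloor> - \<lceil>x\<rceil> + 1)) = real_of_int \<lfloor>y\<rfloor> - real_of_int \<lceil>x\<rceil> + 1" by simp
    thus ?thesis using of_int_floor_le[of y] le_of_int_ceiling[of x] by linarith
  qed (use assms in simp)
  finally show "real (card N) \<le> y - x + 1" .
qed

lemma sum_inverse_le:
  fixes N :: "int set" and x \<rho> :: real
  assumes "\<And>k. k \<in> N \<Longrightarrow> x \<le> k \<and> k \<le> (1 + \<rho>) * x" "x > 0" "\<rho> \<ge> 0"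
  shows "(\<Sum>k\<in>N. 1 / real_of_int k) \<le> \<rho> + 1 / x"
proof -
  have "x \<le> (1 + \<rho>) * x + 1" using assms by (simp add: algebra_simps)
  hence c: "real (card N) \<le> (1 + \<rho>) * x - x + 1"
    using card_int_real_interval(2)[of N x "(1 + \<rho>) * x"] assms by auto
  have "(\<Sum>k\<in>N. 1 / real_of_int k) \<le> (\<Sum>k\<in>N. 1 / x)"
    using assms by (intro sum_mono divide_left_mono) (auto intro: less_le_trans mult_pos_pos)
  also have "\<dots> = card N / x" by simp
  also have "\<dots> \<le> ((1 + \<rho>) * x - x + 1) / x" using c assms by (intro divide_right_mono) auto
  also have "\<dots> = \<rho> + 1 / x" using assms by (simp add: field_simps)
  finally show ?thesis .
qed

text \<open>A bound uniform in \<open>x\<close>: if \<open>x < 1\<close>, the integers concerned are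
  at least 1 and the interval may be started at 1 instead.\<close>

lemma sum_inverse_le':
  fixes N :: "int set" and x \<rho> :: real
  assumes "\<And>k. k \<in> N \<Longrightarrow> x \<le> k \<and> k \<le> (1 + \<rho>) * x" "x > 0" "\<rho> \<ge> 0"
  shows "(\<Sum>k\<in>N. 1 / real_of_int k) \<le> \<rho> + 1"
proof (cases "x \<ge> 1")
  case True
  have "1 / x \<le> 1" using True by simp
  moreover have "(\<Sum>k\<in>N. 1 / real_of_int k) \<le> \<rho> + 1 / x" by (rule sum_inverse_le) (use assms in auto)
  ultimately show ?thesis by linarith
next
  case False
  have pos: "k \<ge> 1" if "k \<in> N" for k
  proof -
    have "real_of_int k > 0" using assms(1)[OF that] assms(2) by linarith
    thus ?thesis by simp
  qed
  have "(1 + \<rho>) * x \<le> (1 + \<rho>) * 1" using False assms by (intro mult_left_mono) auto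
  moreover have "(\<Sum>k\<in>N. 1 / real_of_int k) \<le> \<rho> + 1 / 1"
  proof (rule sum_inverse_le)
    fix k assume "k \<in> N"
    thus "1 \<le> real_of_int k \<and> real_of_int k \<le> (1 + \<rho>) * 1"
      using assms(1)[of k] pos[of k] calculation by auto
  qed (use assms in auto)
  ultimately
  show ?thesis by simp
qed

section \<open>Inverse square roots, common divisors and the multiplicative energy\<close>

lemma sum_inverse_sqrt_le: "(\<Sum>k=1..n. 1 / sqrt (real k)) \<le> 2 * sqrt (real n)"
proof (induction n)
  case (Suc n)
  have s: "sqrt (Suc n) > 0" by simp
  have "2 * sqrt n * sqrt (Suc n) \<le> n + Suc n"
    using sum_squares_bound[of "sqrt n" "sqrt (Suc n)"] by (simp add: power2_eq_square)
  hence "1 \<le> (2 * sqrt (Suc n) - 2 * sqrt n) * sqrt (Suc n)" by (simp add: algebra_simps)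
  hence "1 / sqrt (Suc n) \<le> 2 * sqrt (Suc n) - 2 * sqrt n"
    using s by (subst divide_le_eq) (simp only: if_True)
  thus ?case using Suc by (simp del: of_nat_Suc)
qed simp

lemma sum_multiples_inverse_sqrt_le:
  fixes H d :: int
  assumes d: "d > 0" and H: "H \<ge> 0"
  shows "(\<Sum>x | x \<noteq> 0 \<and> \<bar>x\<bar> \<le> H \<and> d dvd x. 1 / sqrt \<bar>x\<bar>) \<le> 4 * sqrt H / d"
proof -
  define n where "n = nat (H div d)"
  let ?P = "(\<lambda>k::nat. d * int k) ` {1..n}" and ?M = "(\<lambda>k::nat. - (d * int k)) ` {1..n}"
  have le: "d * int k \<le> H" if "k \<le> n" for k
  proof -
    have "int k \<le> H div d" using that H d by (simp add: n_def pos_imp_zdiv_nonneg_iff le_nat_iff)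
    hence "d * int k \<le> d * (H div d)" using d by simp
    also have "\<dots> \<le> H" using d by (simp add: minus_mod_eq_mult_div [symmetric])
    finally show ?thesis .
  qed
  have set: "{x. x \<noteq> 0 \<and> \<bar>x\<bar> \<le> H \<and> d dvd x} = ?P \<union> ?M"
  proof (intro equalityI subsetI)
    fix x assume "x \<in> {x. x \<noteq> 0 \<and> \<bar>x\<bar> \<le> H \<and> d dvd x}"
    then obtain j where j: "x = d * j" "x \<noteq> 0" "\<bar>x\<bar> \<le> H" by auto
    have "d * \<bar>j\<bar> \<le> H" using j d by (simp add: abs_mult)
    hence "d * \<bar>j\<bar> div d \<le> H div d" using d by (intro zdiv_mono1) auto
    hence jl: "\<bar>j\<bar> \<le> H div d" using d by simp
    have "nat \<bar>j\<bar> \<in> {1..n}" using jl j by (auto simp: n_def)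
    moreover have "x = d * int (nat \<bar>j\<bar>) \<or> x = - (d * int (nat \<bar>j\<bar>))" using j by (cases "j \<ge> 0") auto
    ultimately show "x \<in> ?P \<union> ?M" by blast
  qed (use le d in \<open>auto simp: abs_mult\<close>)
  have dis: "?P \<inter> ?M = {}"
  proof -
    have "d * int k \<noteq> - (d * int j)" if "k \<ge> 1" "j \<ge> 1" for j k
    proof -
      have "d * int k > 0" "d * int j > 0" using that d by auto
      thus ?thesis by linarith
    qed
    thus ?thesis by auto
  qed
  have rd: "real_of_int d > 0" using d by simp
  have one: "(\<Sum>k=1..n. 1 / sqrt (d * int k)) \<le> 2 * sqrt H / d"
  proof -
    have "(\<Sum>k=1..n. 1 / sqrt (d * int k)) = (\<Sum>k=1..n. 1 / sqrt k) / sqrt d"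
      by (simp add: sum_divide_distrib real_sqrt_mult field_simps)
    also have "\<dots> \<le> 2 * sqrt n / sqrt d"
      using sum_inverse_sqrt_le d by (intro divide_right_mono) auto
    also have "2 * sqrt n / sqrt d = 2 * sqrt (n * d) / d"
      using rd by (simp add: real_sqrt_mult field_simps)
    also have "\<dots> \<le> 2 * sqrt H / d"
    proof -
      have "int n * d \<le> H" using le[of n] by (simp add: mult.commute)
      hence "real_of_int (int n * d) \<le> real_of_int H" by (simp only: of_int_le_iff)
      hence "real n * d \<le> H" by simp
      thus ?thesis using rd by (intro divide_right_mono mult_left_mono real_sqrt_le_mono) auto
    qed
    finally show ?thesis .
  qed
  have "(\<Sum>x\<in>?P. 1 / sqrt \<bar>x\<bar>) = (\<Sum>k=1..n. 1 / sqrt (d * int k))"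
    by (subst sum.reindex) (use d in \<open>auto simp: inj_on_def abs_mult\<close>)
  moreover have "(\<Sum>x\<in>?M. 1 / sqrt \<bar>x\<bar>) = (\<Sum>k=1..n. 1 / sqrt (d * int k))"
    by (subst sum.reindex) (use d in \<open>auto simp: inj_on_def abs_mult\<close>)
  ultimately show ?thesis unfolding set using one
    by (subst sum.union_disjoint) (use dis in auto)
qed

text \<open>With \<open>x = g x'\<close>, \<open>y = g y'\<close> and \<open>x'\<close>,
  \<open>y'\<close> coprime, the solutions are \<open>(j y', j x')\<close> with |j| at most
  \<open>H\<close> divided by the maximum of |x'| and |y'|. Replacing this maximum by the geometric
  mean separates \<open>x\<close> from \<open>y\<close> in the bound, apart from the gcd.\<close>

lemma card_proportional_le:
  fixes x y H :: int
  assumes xy: "x \<noteq> 0" "y \<noteq> 0" "\<bar>x\<bar> \<le> H" "\<bar>y\<bar> \<le> H"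
  shows "finite {(u, v). \<bar>u\<bar> \<le> H \<and> \<bar>v\<bar> \<le> H \<and> x * u = y * v}"
    "real (card {(u, v). \<bar>u\<bar> \<le> H \<and> \<bar>v\<bar> \<le> H \<and> x * u = y * v})
       \<le> 3 * H * (gcd x y / (sqrt \<bar>x\<bar> * sqrt \<bar>y\<bar>))"
proof -
  let ?A = "{(u, v). \<bar>u\<bar> \<le> H \<and> \<bar>v\<bar> \<le> H \<and> x * u = y * v}"
  have "?A \<subseteq> {-H..H} \<times> {-H..H}" by auto
  thus fin: "finite ?A" by (rule finite_subset) auto
  define g where "g = gcd x y"
  have g: "g > 0" using xy by (simp add: g_def)
  obtain x' where x': "x = g * x'" by (metis dvd_def gcd_dvd1 g_def)
  obtain y' where y': "y = g * y'" by (metis dvd_def gcd_dvd2 g_def)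
  have cop: "coprime x' y'"
    using g x' y' gcd_mult_distrib_int[of g x' y'] unfolding g_def
    by (metis abs_of_pos coprime_iff_gcd_eq_1 g_def mult_cancel_left2 less_irrefl)
  define m where "m = max \<bar>x'\<bar> \<bar>y'\<bar>"
  have m: "m > 0" "m \<le> H" using xy g x' y'
  proof -
    have "\<bar>x'\<bar> \<le> g * \<bar>x'\<bar>" "\<bar>y'\<bar> \<le> g * \<bar>y'\<bar>" using g by (simp_all add: mult_le_cancel_right1)
    moreover have "g * \<bar>x'\<bar> \<le> H" "g * \<bar>y'\<bar> \<le> H" using xy g by (simp_all add: x' y' abs_mult)
    ultimately show "m \<le> H" unfolding m_def by linarith
    show "m > 0" using xy x' unfolding m_def by auto
  qed
  have sub: "?A \<subseteq> (\<lambda>j. (j * y', j * x')) ` {j. real_of_int (-H) / m \<le> real_of_int j \<and> real_of_int j \<le> real_of_int H / m}"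
  proof clarify
    fix u v assume uv: "\<bar>u\<bar> \<le> H" "\<bar>v\<bar> \<le> H" "x * u = y * v"
    have e: "x' * u = y' * v" using uv(3) g by (simp add: x' y')
    hence "y' dvd u" using cop by (metis coprime_commute coprime_dvd_mult_right_iff dvd_triv_left)
    then obtain j where j: "u = y' * j" by blast
    have v: "v = x' * j" using e j xy y' by auto
    have "\<bar>j\<bar> * m \<le> H" using uv(1,2) unfolding m_def j v by (auto simp: max_def abs_mult mult.commute)
    hence "real_of_int (\<bar>j\<bar> * m) \<le> real_of_int H" by (simp only: of_int_le_iff)
    hence "\<bar>real_of_int j\<bar> \<le> H / m" using m by (simp add: field_simps)
    thus "(u, v) \<in> (\<lambda>j. (j * y', j * x')) ` {j. real_of_int (-H) / m \<le> real_of_int j \<and> real_of_int j \<le> real_of_int H / m}"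
      using j v by (intro image_eqI[of _ _ j]) (auto simp: mult.commute)
  qed
  let ?J = "{j. real_of_int (-H) / m \<le> real_of_int j \<and> real_of_int j \<le> real_of_int H / m}"
  have Hm: "1 \<le> H / m" using m by simp
  have J: "finite ?J" "real (card ?J) \<le> H / m - real_of_int (-H) / m + 1"
    using card_int_real_interval[of ?J "real_of_int (-H) / m" "H / m"] Hm by auto
  have "card ?A \<le> card ?J" using J(1) sub card_image_le card_mono by (meson finite_imageI le_trans)
  hence "real (card ?A) \<le> 3 * (H / m)" using J(2) Hm by auto
  also have "H / m \<le> H * (g / (sqrt \<bar>x\<bar> * sqrt \<bar>y\<bar>))"
  proof -
    have "sqrt \<bar>x'\<bar> * sqrt \<bar>y'\<bar> \<le> sqrt m * sqrt m"
      by (intro mult_mono) (auto simp: m_def)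
    also have "\<dots> = m" using m by simp
    finally have le: "sqrt \<bar>x'\<bar> * sqrt \<bar>y'\<bar> \<le> m" .
    have pos: "sqrt \<bar>x'\<bar> * sqrt \<bar>y'\<bar> > 0" using xy x' y' by auto
    have "sqrt \<bar>x\<bar> * sqrt \<bar>y\<bar> = (sqrt g * sqrt g) * (sqrt \<bar>x'\<bar> * sqrt \<bar>y'\<bar>)"
      using g unfolding x' y' by (simp add: abs_mult real_sqrt_mult del: real_sqrt_mult_self)
    hence "g / (sqrt \<bar>x\<bar> * sqrt \<bar>y\<bar>) = 1 / (sqrt \<bar>x'\<bar> * sqrt \<bar>y'\<bar>)"
      using g by simp
    moreover have "1 / m \<le> 1 / (sqrt \<bar>x'\<bar> * sqrt \<bar>y'\<bar>)" using le pos by (intro divide_left_mono) (auto simp: m)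
    ultimately have "1 / m \<le> g / (sqrt \<bar>x\<bar> * sqrt \<bar>y\<bar>)" by simp
    hence "H * (1 / m) \<le> H * (g / (sqrt \<bar>x\<bar> * sqrt \<bar>y\<bar>))" using m by (intro mult_left_mono) auto
    thus ?thesis by simp
  qed
  finally show "real (card ?A) \<le> 3 * H * (gcd x y / (sqrt \<bar>x\<bar> * sqrt \<bar>y\<bar>))"
    by (simp add: g_def)
qed

text \<open>The gcd is at most the sum of all common divisors \<open>d\<close>. For fixed
  \<open>d\<close> the sum over \<open>x\<close> and \<open>y\<close> becomes the square of a sum
  over multiples of \<open>d\<close>, which leaves 48 H^2 / d. Bounding 1/d by 1/sqrt d is crude,
  but the resulting exponent 5/2 is below 8/3, and this is what boxes of side S^(3/4)
  tolerate.\<close>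

lemma multiplicative_energy_le:
  fixes H :: int
  assumes H: "H \<ge> 1"
  shows "finite {(x, y, u, v). x \<noteq> 0 \<and> y \<noteq> 0 \<and> \<bar>x\<bar> \<le> H \<and> \<bar>y\<bar> \<le> H \<and> \<bar>u\<bar> \<le> H \<and> \<bar>v\<bar> \<le> H \<and> x * u = y * v}"
    (is "finite ?E")
    and "real (card {(x, y, u, v). x \<noteq> 0 \<and> y \<noteq> 0 \<and> \<bar>x\<bar> \<le> H \<and> \<bar>y\<bar> \<le> H \<and> \<bar>u\<bar> \<le> H \<and> \<bar>v\<bar> \<le> H \<and> x * u = y * v})
      \<le> 96 * H^2 * sqrt H"
proof -
  define B where "B = {x. x \<noteq> 0 \<and> \<bar>x\<bar> \<le> H}"
  have fB: "finite B" by (rule finite_subset[of _ "{-H..H}"]) (auto simp: B_def)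
  define A where "A x y = {(u, v). \<bar>u\<bar> \<le> H \<and> \<bar>v\<bar> \<le> H \<and> x * u = y * v}" for x y
  have E: "?E = (SIGMA x:B. SIGMA y:B. A x y)" by (auto simp: B_def A_def)
  have fA: "finite (A x y)" if "x \<in> B" "y \<in> B" for x y
    using card_proportional_le(1) that by (auto simp: A_def B_def)
  show fin: "finite ?E" unfolding E using fB fA by auto
  have gcd_le: "real_of_int (gcd x y) \<le> (\<Sum>d=1..H. if d dvd x \<and> d dvd y then real_of_int d else 0)" if "x \<in> B" for x y
  proof -
    have "gcd x y \<le> \<bar>x\<bar>" using that by (auto simp: B_def intro: zdvd_imp_le)
    hence g: "gcd x y \<in> {1..H}" using that by (auto simp: B_def int_one_le_iff_zero_less)
    have "(\<lambda>d. if d dvd x \<and> d dvd y then real_of_int d else 0) (gcd x y) \<le>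
       (\<Sum>d=1..H. if d dvd x \<and> d dvd y then real_of_int d else 0)"
      by (rule member_le_sum) (use g in auto)
    thus ?thesis by simp
  qed
  have "real (card ?E) = (\<Sum>x\<in>B. \<Sum>y\<in>B. real (card (A x y)))"
    unfolding E using fB fA by simp
  also have "\<dots> \<le> (\<Sum>x\<in>B. \<Sum>y\<in>B. 3 * H * (gcd x y / (sqrt \<bar>x\<bar> * sqrt \<bar>y\<bar>)))"
    unfolding A_def by (intro sum_mono card_proportional_le) (auto simp: B_def)
  also have "\<dots> \<le> (\<Sum>x\<in>B. \<Sum>y\<in>B. 3 * H * ((\<Sum>d=1..H. if d dvd x \<and> d dvd y then real_of_int d else 0) / (sqrt \<bar>x\<bar> * sqrt \<bar>y\<bar>)))"
    using H gcd_le by (intro sum_mono mult_left_mono divide_right_mono) auto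
  also have "\<dots> = (\<Sum>x\<in>B. \<Sum>y\<in>B. \<Sum>d=1..H. 3 * H * (real_of_int d * ((if d dvd x then 1 / sqrt \<bar>x\<bar> else 0) * (if d dvd y then 1 / sqrt \<bar>y\<bar> else 0))))"
    by (simp add: sum_divide_distrib sum_distrib_left if_distrib cong: if_cong)
      (intro sum.cong refl, auto)
  also have "\<dots> = (\<Sum>x\<in>B. \<Sum>d=1..H. \<Sum>y\<in>B. 3 * H * (real_of_int d * ((if d dvd x then 1 / sqrt \<bar>x\<bar> else 0) * (if d dvd y then 1 / sqrt \<bar>y\<bar> else 0))))"
    by (intro sum.cong refl sum.swap)
  also have "\<dots> = (\<Sum>d=1..H. \<Sum>x\<in>B. \<Sum>y\<in>B. 3 * H * (real_of_int d * ((if d dvd x then 1 / sqrt \<bar>x\<bar> else 0) * (if d dvd y then 1 / sqrt \<bar>y\<bar> else 0))))"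
    by (rule sum.swap)
  also have "\<dots> = (\<Sum>d=1..H. 3 * H * (real_of_int d * (\<Sum>x\<in>B. if d dvd x then 1 / sqrt \<bar>x\<bar> else 0)\<^sup>2))"
    unfolding power2_eq_square sum_product by (simp add: sum_distrib_left)
  also have "\<dots> \<le> (\<Sum>d=1..H. 48 * H\<^sup>2 * (1 / sqrt (nat d)))"
  proof (rule sum_mono)
    fix d assume d: "d \<in> {1..H}"
    have set: "{x. x \<noteq> 0 \<and> \<bar>x\<bar> \<le> H \<and> d dvd x} = {x\<in>B. d dvd x}" by (auto simp: B_def)
    have "(\<Sum>x\<in>B. if d dvd x then 1 / sqrt \<bar>x\<bar> else 0) = (\<Sum>x | x \<noteq> 0 \<and> \<bar>x\<bar> \<le> H \<and> d dvd x. 1 / sqrt \<bar>x\<bar>)"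
      unfolding set by (subst sum.inter_filter[OF fB]) (auto intro!: sum.cong)
    also have "\<dots> \<le> 4 * sqrt H / d" by (rule sum_multiples_inverse_sqrt_le) (use d in auto)
    finally have "(\<Sum>x\<in>B. if d dvd x then 1 / sqrt \<bar>x\<bar> else 0)\<^sup>2 \<le> (4 * sqrt H / d)\<^sup>2"
      by (intro power_mono sum_nonneg) auto
    also have "\<dots> = 16 * H / d^2" using H by (simp add: power_divide power_mult_distrib)
    finally have "3 * H * (real_of_int d * (\<Sum>x\<in>B. if d dvd x then 1 / sqrt \<bar>x\<bar> else 0)\<^sup>2) \<le> 3 * H * (real_of_int d * (16 * H / d^2))"
      using H d by (intro mult_left_mono) auto
    also have "\<dots> = 48 * H^2 * (1 / d)" using d by (simp add: power2_eq_square)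
    also have "\<dots> \<le> 48 * H^2 * (1 / sqrt (nat d))"
    proof -
      have "sqrt d \<le> d" using d by (intro real_le_lsqrt) (auto simp: power2_eq_square mult_le_cancel_right1)
      hence "1 / d \<le> 1 / sqrt d" using d by (intro divide_left_mono) auto
      thus ?thesis using d by (intro mult_left_mono) auto
    qed
    finally show "3 * H * (real_of_int d * (\<Sum>x\<in>B. if d dvd x then 1 / sqrt \<bar>x\<bar> else 0)\<^sup>2) \<le> 48 * H\<^sup>2 * (1 / sqrt (nat d))" .
  qed
  also have "\<dots> = 48 * H\<^sup>2 * (\<Sum>d=1..H. 1 / sqrt (nat d))" by (simp add: sum_distrib_left)
  also have "(\<Sum>d=1..H. 1 / sqrt (nat d)) = (\<Sum>k=1..nat H. 1 / sqrt k)"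
    by (rule sum.reindex_bij_witness[of _ int nat]) auto
  also have "48 * H\<^sup>2 * \<dots> \<le> 48 * H\<^sup>2 * (2 * sqrt (nat H))"
    by (intro mult_left_mono sum_inverse_sqrt_le) auto
  finally show "real (card ?E) \<le> 96 * H^2 * sqrt H" using H by simp
qed

section \<open>Almost all integers are values of a quadratic polynomial\<close>

text \<open>\<open>\<mu>\<close> will be the increment of the form on a residue class of vectors,
  divided by the modulus of the class: \<open>t\<close>, \<open>r\<close>, \<open>s\<close> are
  steps along \<open>h1\<close>, \<open>h2\<close>, \<open>e\<close>; \<open>\<alpha>\<close>,
  \<open>\<beta>\<close>, \<open>c\<close> come from the values of the form at these vectors, and
  \<open>l\<close>, \<open>l2\<close>, \<open>l0\<close> from its polar form with the base vector.
  The assumption \<open>cop\<close> says that every prime of 2 \<alpha> \<beta> c divides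
  \<open>Q\<close>, so that a number prime to \<open>Q\<close> can be cancelled against these
  coefficients.\<close>

locale mu_family =
  fixes Q l \<alpha> \<beta> c l0 l2 :: int
  assumes Q: "Q > 0" "even Q" and lQ: "coprime l Q" and nz: "\<alpha> \<noteq> 0" "\<beta> \<noteq> 0" and c: "c > 0"
    and cop: "\<And>g. coprime g Q \<Longrightarrow> coprime g (2 * \<alpha> * \<beta> * c)"
begin

definition \<mu> :: "int \<Rightarrow> int \<Rightarrow> int \<Rightarrow> int" where
  "\<mu> t r s = l * t + Q * (\<alpha> * t\<^sup>2 + l2 * r + l0 * s + \<beta> * r\<^sup>2 + c * s\<^sup>2)"

text \<open>If \<open>\<mu> t r s = \<mu> t' r' s'\<close>, then \<open>t - t' = Q a\<close> for some \<open>a\<close>, and with \<open>t + t' = 2 y\<close> and \<open>k = s' - s\<close> the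
  equation becomes \<open>a u(y) + w(r, r') = k (l0 + c (2 s + k))\<close>.\<close>

definition u :: "int \<Rightarrow> int" where "u y = l + 2 * Q * \<alpha> * y"

definition w :: "int \<Rightarrow> int \<Rightarrow> int" where "w r r' = (r - r') * (l2 + \<beta> * (r + r'))"

text \<open>For arguments in [0, T) the linear forms \<open>u y\<close> and
  \<open>l2 + \<beta> (r + r')\<close> are bounded by multiples of \<open>T\<close> that add up to
  \<open>H T\<close>.\<close>

definition H :: int where "H = \<bar>l\<bar> + 2 * Q * \<bar>\<alpha>\<bar> + \<bar>l2\<bar> + 2 * \<bar>\<beta>\<bar>"

lemma Q_half: "Q = 2 * (Q div 2)" using Q by simp

lemma \<mu>_eq_imp:
  assumes "\<mu> t r s = \<mu> t' r' s'"
  obtains a y where "t = y + Q div 2 * a" "t' = y - Q div 2 * a" "t - t' = Q * a"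
    "a * u y + w r r' = (s' - s) * (l0 + c * (s + s'))"
proof -
  have "l * (t - t') = Q * (\<alpha> * t'\<^sup>2 + l2 * r' + l0 * s' + \<beta> * r'\<^sup>2 + c * s'\<^sup>2 - (\<alpha> * t\<^sup>2 + l2 * r + l0 * s + \<beta> * r\<^sup>2 + c * s\<^sup>2))"
    using assms unfolding \<mu>_def by (simp add: algebra_simps)
  hence "Q dvd l * (t - t')" by simp
  hence "Q dvd t - t'" using lQ by (simp add: coprime_commute coprime_dvd_mult_right_iff)
  then obtain a where a: "t - t' = Q * a" by blast
  define q where "q = Q div 2"
  have q: "Q = 2 * q" using Q_half by (simp add: q_def)
  \<comment> \<open>\<open>Q\<close> is even, so the midpoint \<open>y\<close> of \<open>t\<close>
    and \<open>t'\<close> is an integer.\<close>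
  define y where "y = t' + q * a"
  have t': "t' = y - q * a" and t: "t = y + q * a" using a by (simp_all add: y_def q algebra_simps)
  have "t + t' = 2 * y" using t t' by simp
  hence "Q * (a * u y + w r r') = (t - t') * (l + Q * \<alpha> * (t + t')) + Q * w r r'"
    unfolding a u_def by (simp add: algebra_simps)
  also have "\<dots> = Q * ((s' - s) * (l0 + c * (s + s')))"
    using assms unfolding \<mu>_def w_def by (simp add: algebra_simps power2_eq_square)
  finally have "Q * (a * u y + w r r') = Q * ((s' - s) * (l0 + c * (s + s')))" .
  hence "a * u y + w r r' = (s' - s) * (l0 + c * (s + s'))" using Q by simp
  thus ?thesis using that t t' a q_def by blast
qed

lemma coprime_u_Q: "coprime (u y) Q"
proof -
  have "coprime (l + Q * (2 * \<alpha> * y)) Q"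
    using lQ by (metis coprime_commute gcd_add_mult coprime_iff_gcd_eq_1 mult.commute add.commute)
  thus ?thesis by (simp add: u_def algebra_simps)
qed

lemma coprime_gcd_u: "coprime (gcd (u y) n) Q"
  using coprime_u_Q[of y] by (meson coprime_divisors gcd_dvd1 dvd_refl)

lemma dvd_cancel_c: "coprime g Q \<Longrightarrow> g dvd 2 * c * k \<Longrightarrow> g dvd k"
  using cop[of g] by (metis coprime_dvd_mult_right_iff coprime_mult_right_iff)

lemma u_inj: "u y = u y' \<longleftrightarrow> y = y'" using Q nz by (auto simp: u_def)

end

text \<open>\<open>lo\<close> and \<open>hi\<close> bound \<open>l0 + c (s + s')\<close>, so that \<open>R k \<Delta>\<close> is necessary for a coincidence with \<open>s' - s = k\<close>.\<close>

locale mu_box = mu_family +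
  fixes T K :: int and lo hi :: real
  assumes T: "T \<ge> 1" and lohi: "0 < lo" "lo \<le> hi" and K: "real_of_int (H * T\<^sup>2) \<le> K * lo"
begin

definition R :: "int \<Rightarrow> int \<Rightarrow> bool" where "R k \<Delta> \<longleftrightarrow> k * lo \<le> \<Delta> \<and> \<Delta> \<le> k * hi"

text \<open>For a fixed midpoint \<open>y\<close>: the possible values of
  \<open>(t - t') / Q\<close> when both \<open>t = y + (Q/2) a\<close> and
  \<open>t' = y - (Q/2) a\<close> lie in [0, T).\<close>

definition Af :: "int \<Rightarrow> int set" where
  "Af y = {a. 0 \<le> y - Q div 2 * a \<and> y - Q div 2 * a < T \<and> 0 \<le> y + Q div 2 * a \<and> y + Q div 2 * a < T}"

definition Zs :: "(int \<times> int \<times> int) set" where "Zs = {0..<T} \<times> {0..<T} \<times> {0..<T}"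

definition \<Delta> :: "int \<times> int \<times> int \<Rightarrow> int \<Rightarrow> int" where "\<Delta> = (\<lambda>(y, r, r') a. a * u y + w r r')"

definition \<rho> :: real where "\<rho> = hi / lo - 1"

text \<open>An expected number of solutions: if \<open>u\<close> and \<open>2 c k\<close> have the
  gcd \<open>g\<close>, a solvable congruence modulo \<open>2 c k\<close> holds for a proportion
  \<open>g / (2 c k)\<close> of the \<open>a\<close>. This is summed over the multiples
  \<open>k\<close> of \<open>g\<close> that the size of \<open>D\<close> allows.\<close>

definition F :: "int \<Rightarrow> int \<Rightarrow> real" where
  "F g D = (\<Sum>k\<in>{1..K}. if g dvd k \<and> R k D then g / (2 * c * k) else 0)"

lemma finite_Zs [simp]: "finite Zs" by (simp add: Zs_def)

lemma q_pos: "Q div 2 > 0" using Q by (auto elim: evenE)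

lemma Af_abs: "a \<in> Af y \<Longrightarrow> Q * \<bar>a\<bar> < T"
proof -
  assume "a \<in> Af y"
  moreover have "Q * a = Q div 2 * a + Q div 2 * a" by (subst Q_half) (simp add: algebra_simps)
  ultimately have "\<bar>Q * a\<bar> < T" by (simp only: Af_def mem_Collect_eq) linarith
  thus ?thesis using Q by (simp add: abs_mult)
qed

lemma Af_abs': "a \<in> Af y \<Longrightarrow> \<bar>a\<bar> < T"
proof -
  assume "a \<in> Af y"
  hence "Q * \<bar>a\<bar> < T" by (rule Af_abs)
  moreover have "\<bar>a\<bar> \<le> Q * \<bar>a\<bar>" using Q by (simp add: mult_le_cancel_right1)
  ultimately show ?thesis by linarith
qed

lemma finite_Af [simp]: "finite (Af y)"
  by (rule finite_subset[of _ "{-T..T}"]) (use Af_abs' in force)+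

lemma Af_convex: "a \<in> Af y \<Longrightarrow> b \<in> Af y \<Longrightarrow> a \<le> z \<Longrightarrow> z \<le> b \<Longrightarrow> z \<in> Af y"
proof -
  assume *: "a \<in> Af y" "b \<in> Af y" "a \<le> z" "z \<le> b"
  have "Q div 2 * a \<le> Q div 2 * z" "Q div 2 * z \<le> Q div 2 * b"
    using * q_pos by (simp_all add: mult_left_mono)
  thus ?thesis using *(1,2) unfolding Af_def by auto
qed

lemma card_Af: "real (card (Af y)) \<le> 2 * T / Q + 1"
proof -
  have "Af y \<subseteq> {a. real_of_int (-T) / Q \<le> real_of_int a \<and> real_of_int a \<le> real_of_int T / Q}"
  proof
    fix a assume "a \<in> Af y"
    hence "Q * \<bar>a\<bar> \<le> T" using Af_abs by force
    hence "real_of_int (Q * \<bar>a\<bar>) \<le> T" by (simp only: of_int_le_iff)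
    hence "\<bar>real_of_int a\<bar> \<le> T / Q" using Q by (simp add: field_simps)
    thus "a \<in> {a. real_of_int (-T) / Q \<le> real_of_int a \<and> real_of_int a \<le> real_of_int T / Q}" by auto
  qed
  moreover have "real_of_int (-T) / Q \<le> T / Q + 1" using T Q by (simp add: field_simps)
  ultimately have "real (card (Af y)) \<le> T / Q - real_of_int (-T) / Q + 1" by (rule card_int_real_interval)
  thus ?thesis by simp
qed

lemma \<Delta>_le: assumes "z \<in> Zs" "a \<in> Af (fst z)" shows "\<Delta> z a \<le> H * T\<^sup>2"
proof -
  obtain y r r' where z: "z = (y, r, r')" by (metis prod_cases3)
  have y: "0 \<le> y" "y < T" "0 \<le> r" "r < T" "0 \<le> r'" "r' < T" using assms by (auto simp: z Zs_def)
  have a: "\<bar>a\<bar> \<le> T" using Af_abs' assms by (force simp: z)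
  have "\<bar>u y\<bar> \<le> \<bar>l\<bar> + \<bar>2 * Q * \<alpha> * y\<bar>" unfolding u_def by (rule abs_triangle_ineq)
  also have "\<dots> = \<bar>l\<bar> + 2 * Q * \<bar>\<alpha>\<bar> * y" using Q y by (simp add: abs_mult)
  also have "\<dots> \<le> \<bar>l\<bar> * T + 2 * Q * \<bar>\<alpha>\<bar> * T"
    using Q y T by (intro add_mono mult_left_mono) (auto simp: mult_le_cancel_left1)
  finally have u: "\<bar>u y\<bar> \<le> (\<bar>l\<bar> + 2 * Q * \<bar>\<alpha>\<bar>) * T" by (simp add: algebra_simps)
  have "\<bar>l2 + \<beta> * (r + r')\<bar> \<le> \<bar>l2\<bar> + \<bar>\<beta> * (r + r')\<bar>" by (rule abs_triangle_ineq)
  also have "\<dots> = \<bar>l2\<bar> + \<bar>\<beta>\<bar> * (r + r')" using y by (simp add: abs_mult)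
  also have "\<dots> \<le> \<bar>l2\<bar> * T + \<bar>\<beta>\<bar> * (2 * T)"
    using y T by (intro add_mono mult_left_mono) (auto simp: mult_le_cancel_left1)
  finally have v: "\<bar>l2 + \<beta> * (r + r')\<bar> \<le> (\<bar>l2\<bar> + 2 * \<bar>\<beta>\<bar>) * T" by (simp add: algebra_simps)
  have "\<Delta> z a \<le> \<bar>a\<bar> * \<bar>u y\<bar> + \<bar>r - r'\<bar> * \<bar>l2 + \<beta> * (r + r')\<bar>"
    unfolding \<Delta>_def z w_def by (simp flip: abs_mult)
  also have "\<dots> \<le> T * ((\<bar>l\<bar> + 2 * Q * \<bar>\<alpha>\<bar>) * T) + T * ((\<bar>l2\<bar> + 2 * \<bar>\<beta>\<bar>) * T)"
    using a u v y by (intro add_mono mult_mono) auto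
  also have "\<dots> = H * T\<^sup>2" by (simp add: H_def algebra_simps power2_eq_square)
  finally show ?thesis .
qed

lemma F_nonpos: "D \<le> 0 \<Longrightarrow> F g D = 0"
proof -
  assume D: "D \<le> 0"
  have "\<not> R k D" if "k \<in> {1..K}" for k
  proof
    assume "R k D"
    hence "real_of_int k * lo \<le> D" by (simp add: R_def)
    moreover have "real_of_int k * lo > 0" using that lohi by auto
    moreover have "real_of_int D \<le> 0" using D by simp
    ultimately show False by linarith
  qed
  thus ?thesis unfolding F_def by (intro sum.neutral) auto
qed

lemma \<rho>_nonneg: "\<rho> \<ge> 0" using lohi by (simp add: \<rho>_def)

text \<open>With \<open>k = g k'\<close> the sum is 1/(2c) times the sum of 1/k' over integers
  between D/(g hi) and D/(g lo), an interval of ratio 1 + \<rho>. The first bound holds for every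
  positive \<open>D\<close>; the second, for \<open>g = 1\<close>, is the sharp one once
  \<open>D\<close> is large against \<open>hi\<close>.\<close>

lemma F_le:
  assumes g: "g \<ge> 1" and D: "D > 0"
  shows "F g D \<le> 1 / (2 * c) * (\<rho> + 1)" "F 1 D \<le> 1 / (2 * c) * (\<rho> + hi / D)"
proof -
  define N where "N g = {k'. g * k' \<in> {1..K} \<and> R (g * k') D}" for g
  define x where "x g = D / (real_of_int g * hi)" for g
  have rc: "real_of_int c > 0" using c by simp
  have F: "F g D = 1 / (2 * c) * (\<Sum>k'\<in>N g. 1 / real_of_int k')" if g: "g \<ge> 1" for g
  proof -
    have "F g D = (\<Sum>k\<in>{k\<in>{1..K}. g dvd k \<and> R k D}. g / (2 * c * k))"
      unfolding F_def by (subst sum.inter_filter) auto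
    also have "\<dots> = (\<Sum>k'\<in>N g. 1 / (2 * c * real_of_int k'))"
    proof (rule sum.reindex_bij_witness[of _ "\<lambda>k'. g * k'" "\<lambda>k. k div g"])
      fix k assume k: "k \<in> {k\<in>{1..K}. g dvd k \<and> R k D}"
      thus "g * (k div g) = k" "k div g \<in> N g" by (auto simp: N_def)
      from k obtain j where j: "k = g * j" by blast
      have "j \<noteq> 0" using k j by auto
      thus "1 / (2 * c * real_of_int (k div g)) = g / (2 * c * k)" using g c by (simp add: j field_simps)
    qed (use g in \<open>auto simp: N_def\<close>)
    also have "\<dots> = 1 / (2 * c) * (\<Sum>k'\<in>N g. 1 / real_of_int k')"
      by (simp add: sum_distrib_left)
    finally show ?thesis .
  qed
  have x: "x g > 0" if "g \<ge> 1" for g using that D lohi by (simp add: x_def)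
  have N: "x g \<le> k' \<and> k' \<le> (1 + \<rho>) * x g" if "k' \<in> N g" "g \<ge> 1" for k' g
  proof -
    have h: "hi > 0" using lohi by linarith
    have g: "real_of_int g > 0" using that by simp
    have "real_of_int (g * k') * lo \<le> D" "D \<le> real_of_int (g * k') * hi" using that by (auto simp: N_def R_def)
    hence "D / (real_of_int g * hi) \<le> k'" "k' \<le> D / (real_of_int g * lo)"
      using g h lohi by (simp_all add: field_simps)
    moreover have "D / (real_of_int g * lo) = (1 + \<rho>) * x g" using h lohi g by (simp add: x_def \<rho>_def field_simps)
    ultimately show ?thesis by (simp add: x_def)
  qed
  have "(\<Sum>k'\<in>N g. 1 / real_of_int k') \<le> \<rho> + 1"
    by (rule sum_inverse_le'[OF N x \<rho>_nonneg]) (use g in auto)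
  thus "F g D \<le> 1 / (2 * c) * (\<rho> + 1)" unfolding F[OF g] using rc by (intro mult_left_mono) auto
  have "(\<Sum>k'\<in>N 1. 1 / real_of_int k') \<le> \<rho> + 1 / x 1"
    by (rule sum_inverse_le[OF N x \<rho>_nonneg]) auto
  thus "F 1 D \<le> 1 / (2 * c) * (\<rho> + hi / D)" unfolding F[OF order_refl] using rc by (intro mult_left_mono) (auto simp: x_def)
qed

end

section \<open>Coincidences with distinct \<open>s\<close>: fibres and the main term\<close>

context mu_box begin

definition wz :: "int \<times> int \<times> int \<Rightarrow> int" where "wz = (\<lambda>(y, r, r'). w r r')"

lemma \<Delta>_eq: "\<Delta> z a = a * u (fst z) + wz z" by (cases z) (auto simp: \<Delta>_def wz_def)

text \<open>For given \<open>k > 0\<close> and \<open>(y, r, r')\<close> the number \<open>a\<close> solves a linear congruence modulo \<open>2 c k\<close>, and then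
  \<open>s\<close> is determined. The common factor \<open>g\<close> of \<open>u\<close> and \<open>2 c k\<close> is prime to \<open>Q\<close>, so \<open>g > 1\<close> has no small
  prime factor and contributes little.\<close>

definition fib :: "int \<Rightarrow> int \<times> int \<times> int \<Rightarrow> int set" where
  "fib k z = {a\<in>Af (fst z). R k (\<Delta> z a) \<and> 2 * c * k dvd \<Delta> z a - k * (l0 + c * k)}"

text \<open>\<open>\<Delta>\<close> is linear in \<open>a\<close>, so the \<open>a\<close> of
  admissible size form an interval and \<open>card_linear_congruence_le\<close> applies. The gcd
  \<open>g\<close> of \<open>u\<close> and \<open>2 c k\<close> is prime to \<open>Q\<close>, hence
  divides \<open>k\<close> and then \<open>wz z\<close>. It accounts for one summand of the sum over
  all \<open>g\<close>; such a sum, unlike a gcd, can be interchanged with the sums over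
  \<open>k\<close> and \<open>z\<close>.\<close>

lemma card_fib_le:
  assumes k: "k \<in> {1..K}"
  shows "real (card (fib k z)) \<le> 1 + (\<Sum>g\<in>{g\<in>{1..K}. coprime g Q}. if g dvd u (fst z) \<and> g dvd wz z
     then (\<Sum>a\<in>Af (fst z). if g dvd k \<and> R k (\<Delta> z a) then g / (2 * c * k) else 0) else 0)"
    (is "_ \<le> 1 + sum ?f _")
proof (cases "fib k z = {}")
  case True
  have "sum ?f {g\<in>{1..K}. coprime g Q} \<ge> 0" using k c by (intro sum_nonneg) (auto intro!: sum_nonneg)
  thus ?thesis using True by simp
next
  case False
  define U where "U = u (fst z)"
  define I where "I = {a\<in>Af (fst z). R k (\<Delta> z a)}"
  have fI: "finite I" by (simp add: I_def)
  have conv: "x' \<in> I" if "x \<in> I" "y \<in> I" "x \<le> x'" "x' \<le> y" for x y x'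
  proof -
    have "\<Delta> z x \<le> \<Delta> z x' \<and> \<Delta> z x' \<le> \<Delta> z y \<or> \<Delta> z y \<le> \<Delta> z x' \<and> \<Delta> z x' \<le> \<Delta> z x"
      using that unfolding \<Delta>_eq by (cases "u (fst z) \<ge> 0") (auto intro: mult_right_mono mult_right_mono_neg)
    hence "real_of_int (\<Delta> z x) \<le> \<Delta> z x' \<and> real_of_int (\<Delta> z x') \<le> \<Delta> z y \<or> real_of_int (\<Delta> z y) \<le> \<Delta> z x' \<and> real_of_int (\<Delta> z x') \<le> \<Delta> z x"
      by simp
    hence "R k (\<Delta> z x')" using that(1,2) unfolding I_def R_def by auto
    thus ?thesis using Af_convex[OF _ _ that(3,4)] that(1,2) by (auto simp: I_def)
  qed
  have ck: "2 * c * k > 0" using k c by simp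
  have fib: "fib k z = {a\<in>I. 2 * c * k dvd a * U + (wz z - k * (l0 + c * k))}"
    unfolding fib_def I_def \<Delta>_eq U_def by (auto simp: algebra_simps)
  define g where "g = gcd U (2 * c * k)"
  have ne: "{a\<in>I. 2 * c * k dvd a * U + (wz z - k * (l0 + c * k))} \<noteq> {}" using False fib by simp
  note cl = card_linear_congruence_le[OF fI conv ck ne]
  have cg: "coprime g Q" unfolding g_def U_def by (rule coprime_gcd_u)
  have gk: "g dvd k" using dvd_cancel_c[OF cg] by (simp add: g_def)
  have "g dvd wz z - k * (l0 + c * k)" using cl(1) by (simp add: g_def)
  hence "g dvd (wz z - k * (l0 + c * k)) + k * (l0 + c * k)" using gk by (intro dvd_add) auto
  hence gw: "g dvd wz z" by simp
  have gU: "g dvd u (fst z)" by (simp add: g_def U_def)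
  have "g > 0" using c k by (simp add: g_def)
  hence gK: "g \<in> {g\<in>{1..K}. coprime g Q}" using gk k zdvd_imp_le[of g k] cg by auto
  have "finite {g\<in>{1..K}. coprime g Q}" by (rule finite_subset[of _ "{1..K}"]) auto
  hence "?f g \<le> sum ?f {g\<in>{1..K}. coprime g Q}"
    using k c gK by (intro member_le_sum) (auto intro!: sum_nonneg)
  moreover have "?f g = g * card I / (2 * c * k)"
  proof -
    have "?f g = (\<Sum>a\<in>Af (fst z). if R k (\<Delta> z a) then g / (2 * c * k) else 0)" using gU gw gk by simp
    also have "\<dots> = (\<Sum>a\<in>I. g / (2 * c * k))" unfolding I_def by (subst sum.inter_filter) auto
    finally show ?thesis by simp
  qed
  moreover have "real (card (fib k z)) \<le> g * card I / (2 * c * k) + 1"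
    using cl(2) unfolding fib g_def by simp
  ultimately show ?thesis by linarith
qed

lemma card_Zs: "real (card Zs) = T ^ 3"
  using T by (simp add: Zs_def card_cartesian_product power3_eq_cube)

text \<open>Moving the sum over \<open>k\<close> to the inside turns the proportions into
  \<open>F\<close>; the \<open>1\<close> per congruence accounts for the term with
  \<open>K\<close>.\<close>

lemma sum_fib_le:
  "(\<Sum>k\<in>{1..K}. \<Sum>z\<in>Zs. real (card (fib k z))) \<le> \<bar>K\<bar> * T ^ 3 +
     (\<Sum>g\<in>{g\<in>{1..K}. coprime g Q}. \<Sum>z\<in>{z\<in>Zs. g dvd u (fst z) \<and> g dvd wz z}. \<Sum>a\<in>Af (fst z). F g (\<Delta> z a))"
proof -
  define GG where "GG = {g\<in>{1..K}. coprime g Q}"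
  define P where "P g z \<longleftrightarrow> g dvd u (fst z) \<and> g dvd wz z" for g z
  define h where "h k g z a = (if g dvd k \<and> R k (\<Delta> z a) then real_of_int g / (2 * c * k) else 0)" for k g z a
  have "(\<Sum>k\<in>{1..K}. \<Sum>z\<in>Zs. real (card (fib k z))) \<le>
     (\<Sum>k\<in>{1..K}. \<Sum>z\<in>Zs. 1 + (\<Sum>g\<in>GG. if P g z then (\<Sum>a\<in>Af (fst z). h k g z a) else 0))"
    unfolding GG_def P_def h_def by (intro sum_mono card_fib_le)
  also have "\<dots> = real (nat K) * T ^ 3 + (\<Sum>k\<in>{1..K}. \<Sum>z\<in>Zs. \<Sum>g\<in>GG. if P g z then (\<Sum>a\<in>Af (fst z). h k g z a) else 0)"
    by (simp add: sum.distrib card_Zs)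
  also have "(\<Sum>k\<in>{1..K}. \<Sum>z\<in>Zs. \<Sum>g\<in>GG. if P g z then (\<Sum>a\<in>Af (fst z). h k g z a) else 0) =
     (\<Sum>k\<in>{1..K}. \<Sum>g\<in>GG. \<Sum>z\<in>Zs. if P g z then (\<Sum>a\<in>Af (fst z). h k g z a) else 0)"
    by (intro sum.cong refl sum.swap)
  also have "\<dots> = (\<Sum>g\<in>GG. \<Sum>k\<in>{1..K}. \<Sum>z\<in>Zs. if P g z then (\<Sum>a\<in>Af (fst z). h k g z a) else 0)"
    by (rule sum.swap)
  also have "\<dots> = (\<Sum>g\<in>GG. \<Sum>z\<in>Zs. \<Sum>k\<in>{1..K}. if P g z then (\<Sum>a\<in>Af (fst z). h k g z a) else 0)"
    by (intro sum.cong refl sum.swap)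
  also have "\<dots> = (\<Sum>g\<in>GG. \<Sum>z\<in>Zs. if P g z then (\<Sum>a\<in>Af (fst z). F g (\<Delta> z a)) else 0)"
  proof (intro sum.cong refl)
    fix g z
    have "(\<Sum>k\<in>{1..K}. \<Sum>a\<in>Af (fst z). h k g z a) = (\<Sum>a\<in>Af (fst z). F g (\<Delta> z a))"
      unfolding F_def h_def by (rule sum.swap)
    thus "(\<Sum>k\<in>{1..K}. if P g z then (\<Sum>a\<in>Af (fst z). h k g z a) else 0) = (if P g z then (\<Sum>a\<in>Af (fst z). F g (\<Delta> z a)) else 0)"
      by simp
  qed
  also have "\<dots> = (\<Sum>g\<in>GG. \<Sum>z\<in>{z\<in>Zs. P g z}. \<Sum>a\<in>Af (fst z). F g (\<Delta> z a))"
    by (intro sum.cong[of GG] refl) (simp add: sum.inter_filter)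
  finally have "(\<Sum>k\<in>{1..K}. \<Sum>z\<in>Zs. real (card (fib k z))) \<le> real (nat K) * T ^ 3 +
     (\<Sum>g\<in>GG. \<Sum>z\<in>{z\<in>Zs. P g z}. \<Sum>a\<in>Af (fst z). F g (\<Delta> z a))" .
  moreover have "real (nat K) * T ^ 3 \<le> \<bar>real_of_int K\<bar> * T ^ 3" using T by (intro mult_right_mono) auto
  ultimately show ?thesis unfolding GG_def P_def by simp
qed

definition GG :: "((int \<times> int \<times> int) \<times> int) set" where "GG = Sigma Zs (\<lambda>z. Af (fst z))"

lemma finite_GG [simp]: "finite GG" by (simp add: GG_def)

text \<open>Exchanging the two points (\<open>r\<close> with \<open>r'\<close>, \<open>a\<close>
  with \<open>- a\<close>) changes the sign of \<open>\<Delta>\<close>. This regains the factor 2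
  that is paid when both orders of a coincidence are counted.\<close>

lemma card_pos_GG: "2 * card {(z, a)\<in>GG. \<Delta> z a > 0} \<le> card GG"
proof -
  define sw where "sw = (\<lambda>((y::int, r::int, r'::int), a::int). ((y, r', r), - a))"
  have neg: "sw ` {(z, a)\<in>GG. \<Delta> z a > 0} \<subseteq> {(z, a)\<in>GG. \<Delta> z a < 0}"
  proof (rule image_subsetI)
    fix v assume v: "v \<in> {(z, a)\<in>GG. \<Delta> z a > 0}"
    obtain y r r' a where e: "v = ((y, r, r'), a)" by (metis surj_pair)
    have "\<Delta> (y, r', r) (- a) = - \<Delta> (y, r, r') a" by (simp add: \<Delta>_def w_def algebra_simps)
    moreover have "((y, r', r), - a) \<in> GG" using v by (auto simp: e GG_def Zs_def Af_def)
    ultimately show "sw v \<in> {(z, a)\<in>GG. \<Delta> z a < 0}" using v by (simp add: e sw_def)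
  qed
  have fin: "finite {(z, a)\<in>GG. P z a}" for P by (rule finite_subset[OF _ finite_GG]) auto
  have io: "inj_on sw A" for A by (auto simp: sw_def inj_on_def)
  have "card {(z, a)\<in>GG. \<Delta> z a > 0} = card (sw ` {(z, a)\<in>GG. \<Delta> z a > 0})"
    by (rule card_image[OF io, symmetric])
  also have "\<dots> \<le> card {(z, a)\<in>GG. \<Delta> z a < 0}"
    by (intro card_mono neg fin)
  finally have "2 * card {(z, a)\<in>GG. \<Delta> z a > 0} \<le> card {(z, a)\<in>GG. \<Delta> z a > 0} + card {(z, a)\<in>GG. \<Delta> z a < 0}"
    by simp
  also have "\<dots> = card ({(z, a)\<in>GG. \<Delta> z a > 0} \<union> {(z, a)\<in>GG. \<Delta> z a < 0})"
    by (rule card_Un_disjoint[symmetric]) (use fin in auto)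
  also have "\<dots> \<le> card GG" by (intro card_mono) auto
  finally show ?thesis .
qed

lemma card_residue_le:
  fixes m :: int
  assumes "m > 0" "\<And>x y. x \<in> A \<Longrightarrow> y \<in> A \<Longrightarrow> m dvd x - y" "A \<subseteq> {0..<T}"
  shows "real (card A) \<le> T / m + 1"
  using card_spaced_le[of "{0..<T}" A m] assms T by auto

text \<open>\<open>(y, a)\<close> stands for a pair \<open>(t, t')\<close> with \<open>t'\<close>
  congruent to \<open>t\<close> modulo \<open>Q\<close>. Counting these pairs is sharp, whereas
  \<open>card_Af\<close> applied to each \<open>y\<close> would lose a factor 2.\<close>

lemma card_GG: "real (card GG) \<le> T ^ 3 * (T / Q + 1)"
proof -
  define D where "D = Sigma {0..<T} (\<lambda>y. Af y)"
  define E where "E = Sigma {0..<T} (\<lambda>t. {t'\<in>{0..<T}. Q dvd t' - t})"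
  have fE: "finite E" by (rule finite_subset[of _ "{0..<T} \<times> {0..<T}"]) (auto simp: E_def)
  have q: "Q div 2 \<noteq> 0" using q_pos by simp
  have "inj_on (\<lambda>(y, a). (y + Q div 2 * a, y - Q div 2 * a)) D"
  proof (rule inj_onI)
    fix v v' assume *: "(\<lambda>(y, a). (y + Q div 2 * a, y - Q div 2 * a)) v = (\<lambda>(y, a). (y + Q div 2 * a, y - Q div 2 * a)) v'"
    obtain y a y' a' where v: "v = (y, a)" "v' = (y', a')" by (metis surj_pair)
    have "y + Q div 2 * a = y' + Q div 2 * a'" "y - Q div 2 * a = y' - Q div 2 * a'" using * by (auto simp: v)
    hence "y = y'" "Q div 2 * a = Q div 2 * a'" by linarith+
    thus "v = v'" using q by (simp add: v)
  qed
  moreover have "(\<lambda>(y, a). (y + Q div 2 * a, y - Q div 2 * a)) ` D \<subseteq> E"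
  proof -
    have "Q dvd (y - Q div 2 * a) - (y + Q div 2 * a)" for y a
    proof -
      have "(y - Q div 2 * a) - (y + Q div 2 * a) = - (2 * (Q div 2) * a)" by simp
      also have "\<dots> = - (Q * a)" using Q_half by presburger
      finally show ?thesis by (metis dvd_minus_iff dvd_triv_left)
    qed
    thus ?thesis by (auto simp: D_def E_def Af_def)
  qed
  ultimately have "card D \<le> card E" using fE card_inj_on_le by blast
  moreover have "real (card E) \<le> T * (T / Q + 1)"
  proof -
    have "real (card E) = (\<Sum>t\<in>{0..<T}. real (card {t'\<in>{0..<T}. Q dvd t' - t}))"
      unfolding E_def by (subst card_SigmaI) (auto intro: finite_subset[of _ "{0..<T}"])
    also have "\<dots> \<le> (\<Sum>t\<in>{0..<T}. T / Q + 1)"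
    proof (intro sum_mono card_residue_le)
      fix t x y assume "x \<in> {t'\<in>{0..<T}. Q dvd t' - t}" "y \<in> {t'\<in>{0..<T}. Q dvd t' - t}"
      hence "Q dvd (x - t) - (y - t)" using dvd_diff[of Q "x - t" "y - t"] by auto
      thus "Q dvd x - y" by simp
    qed (use Q in auto)
    finally show ?thesis using T by simp
  qed
  ultimately have D: "real (card D) \<le> T * (T / Q + 1)" by linarith
  have "real (card GG) = (\<Sum>z\<in>Zs. real (card (Af (fst z))))" by (simp add: GG_def)
  also have "\<dots> = (\<Sum>y\<in>{0..<T}. \<Sum>_\<in>{0..<T} \<times> {0..<T}. real (card (Af y)))"
    unfolding Zs_def by (subst sum.cartesian_product') simp
  also have "\<dots> = T\<^sup>2 * (\<Sum>y\<in>{0..<T}. real (card (Af y)))"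
    using T by (simp add: card_cartesian_product sum_distrib_left power2_eq_square)
  also have "(\<Sum>y\<in>{0..<T}. real (card (Af y))) = card D" by (simp add: D_def)
  also have "T\<^sup>2 * real (card D) \<le> T\<^sup>2 * (T * (T / Q + 1))" using D by (intro mult_left_mono) auto
  finally show ?thesis by (simp add: power2_eq_square power3_eq_cube algebra_simps)
qed

text \<open>If |u| > B, the condition confines \<open>a\<close> to an interval of length at most
  V/B. Since \<open>u\<close> is injective, |u| is at most \<open>B\<close> for at most 2 B + 1
  values of \<open>y\<close>, and for these \<open>card_Af\<close> is used.\<close>

lemma card_small_\<Delta>:
  fixes B V :: real
  assumes B: "B \<ge> 1" and V: "V \<ge> 0"
  shows "real (card {(z, a)\<in>GG. 0 < \<Delta> z a \<and> \<Delta> z a \<le> V}) \<le> T\<^sup>2 * ((2 * B + 1) * (2 * T / Q + 1) + T * (V / B + 1))"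
proof -
  define N where "N z = {a\<in>Af (fst z). 0 < \<Delta> z a \<and> \<Delta> z a \<le> V}" for z
  have N: "real (card (N z)) \<le> (if \<bar>u (fst z)\<bar> \<le> B then 2 * T / Q + 1 else 0) + (V / B + 1)" for z
  proof (cases "\<bar>u (fst z)\<bar> \<le> B")
    case True
    have "card (N z) \<le> card (Af (fst z))" unfolding N_def by (intro card_mono) auto
    hence "real (card (N z)) \<le> 2 * T / Q + 1" using card_Af[of "fst z"] by linarith
    moreover have "V / B + 1 \<ge> 0" using B V by simp
    ultimately show ?thesis using True by simp
  next
    case False
    define U where "U = real_of_int (u (fst z))"
    define W where "W = real_of_int (wz z)"
    have U: "\<bar>U\<bar> > B" using False by (simp add: U_def)
    have D: "0 < a * U + W" "a * U + W \<le> V" if "a \<in> N z" for a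
      using that unfolding N_def \<Delta>_eq U_def W_def by (auto simp flip: of_int_mult of_int_add)
    have VU: "V / \<bar>U\<bar> \<le> V / B" using U B V by (intro divide_left_mono) auto
    have "real (card (N z)) \<le> V / \<bar>U\<bar> + 1"
    proof (cases "U > 0")
      case True
      have "N z \<subseteq> {a. - W / U \<le> real_of_int a \<and> real_of_int a \<le> (V - W) / U}"
        using D True by (force simp: field_simps)
      moreover have "- W / U \<le> (V - W) / U + 1" using True V by (simp add: field_simps)
      ultimately have "real (card (N z)) \<le> (V - W) / U - (- W / U) + 1" by (rule card_int_real_interval)
      thus ?thesis using True by (simp add: field_simps)
    next
      case False
      hence U0: "U < 0" using U B by auto
      have "N z \<subseteq> {a. (V - W) / U \<le> real_of_int a \<and> real_of_int a \<le> - W / U}"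
        using D U0 by (force simp: field_simps)
      moreover have "(V - W) / U \<le> - W / U + 1" using U0 V by (simp add: field_simps)
      ultimately have "real (card (N z)) \<le> - W / U - (V - W) / U + 1" by (rule card_int_real_interval)
      thus ?thesis using U0 by (simp add: field_simps)
    qed
    thus ?thesis using VU False by simp
  qed
  have card_y: "real (card {y\<in>{0..<T}. \<bar>u y\<bar> \<le> B}) \<le> 2 * B + 1"
  proof -
    have "inj_on u {y\<in>{0..<T}. \<bar>u y\<bar> \<le> B}" using u_inj by (auto simp: inj_on_def)
    hence "card {y\<in>{0..<T}. \<bar>u y\<bar> \<le> B} = card (u ` {y\<in>{0..<T}. \<bar>u y\<bar> \<le> B})" by (simp add: card_image)
    also have "real \<dots> \<le> B - (- B) + 1"
      by (rule card_int_real_interval) (use B in \<open>auto simp: abs_le_iff\<close>)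
    finally show ?thesis by simp
  qed
  have "{(z, a)\<in>GG. 0 < \<Delta> z a \<and> \<Delta> z a \<le> V} = Sigma Zs N" by (auto simp: GG_def N_def)
  hence "real (card {(z, a)\<in>GG. 0 < \<Delta> z a \<and> \<Delta> z a \<le> V}) = (\<Sum>z\<in>Zs. real (card (N z)))"
    by (simp add: N_def)
  also have "\<dots> \<le> (\<Sum>z\<in>Zs. (if \<bar>u (fst z)\<bar> \<le> B then 2 * T / Q + 1 else 0) + (V / B + 1))"
    by (intro sum_mono N)
  also have "\<dots> = (\<Sum>y\<in>{0..<T}. \<Sum>_\<in>{0..<T} \<times> {0..<T}. (if \<bar>u y\<bar> \<le> B then 2 * T / Q + 1 else 0) + (V / B + 1))"
    unfolding Zs_def by (subst sum.cartesian_product') simp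
  also have "\<dots> = T\<^sup>2 * ((\<Sum>y\<in>{0..<T}. if \<bar>u y\<bar> \<le> B then 2 * T / Q + 1 else 0) + T * (V / B + 1))"
    using T by (simp add: card_cartesian_product sum.distrib sum_distrib_left power2_eq_square distrib_left)
  also have "(\<Sum>y\<in>{0..<T}. if \<bar>u y\<bar> \<le> B then 2 * T / Q + 1 else 0) = card {y\<in>{0..<T}. \<bar>u y\<bar> \<le> B} * (2 * T / Q + 1)"
    by (subst sum.inter_filter[symmetric]) auto
  also have "T\<^sup>2 * (card {y\<in>{0..<T}. \<bar>u y\<bar> \<le> B} * (2 * T / Q + 1) + T * (V / B + 1)) \<le>
     T\<^sup>2 * ((2 * B + 1) * (2 * T / Q + 1) + T * (V / B + 1))"
    using card_y T Q by (intro mult_left_mono add_mono mult_right_mono) auto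
  finally show ?thesis .
qed

end

text \<open>The function h^(-3/2). It is multiplicative, so sums over factorisations become products
  of sums, and its series converges, so sums over large \<open>h\<close> are small.\<close>

definition e32 :: "int \<Rightarrow> real" where "e32 h = 1 / (real_of_int h * sqrt h)"

lemma e32_mult: "e32 (h * h') = e32 h * e32 h'"
  by (simp add: e32_def real_sqrt_mult)

lemma e32_nonneg: "h \<ge> 0 \<Longrightarrow> e32 h \<ge> 0" by (simp add: e32_def)

section \<open>The contributions of the common divisors \<open>g = 1\<close> and
  \<open>g > 1\<close>\<close>

context mu_box begin

text \<open>For \<open>\<Delta>\<close> above hi/\<theta> the sharp bound of \<open>F_le\<close>
  gives \<rho> + \<theta>. The smaller positive \<open>\<Delta>\<close> cost at most 1 more each and
  are left to \<open>card_small_\<Delta>\<close>.\<close>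

lemma sum_F_one_le:
  assumes \<theta>: "\<theta> > 0"
  shows "(\<Sum>z\<in>Zs. \<Sum>a\<in>Af (fst z). F 1 (\<Delta> z a)) \<le>
     1 / (2 * c) * ((\<rho> + \<theta>) * card {(z, a)\<in>GG. \<Delta> z a > 0} + card {(z, a)\<in>GG. 0 < \<Delta> z a \<and> \<Delta> z a \<le> hi / \<theta>})"
proof -
  have pt: "F 1 D \<le> 1 / (2 * c) * ((if D > 0 then \<rho> + \<theta> else 0) + (if 0 < D \<and> D \<le> hi / \<theta> then 1 else 0))" for D
  proof (cases "D > 0")
    case True
    have rD: "real_of_int D > 0" using True by simp
    show ?thesis
    proof (cases "D \<le> hi / \<theta>")
      case le: True
      have "F 1 D \<le> 1 / (2 * c) * (\<rho> + 1)" using F_le(1)[OF order_refl True] .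
      also have "\<dots> \<le> 1 / (2 * c) * (\<rho> + \<theta> + 1)" using \<theta> c by (intro mult_left_mono) auto
      finally show ?thesis using True le by simp
    next
      case False
      have "hi / D \<le> \<theta>" using False rD \<theta> by (simp add: field_simps)
      hence "1 / (2 * c) * (\<rho> + hi / D) \<le> 1 / (2 * c) * (\<rho> + \<theta>)" using c by (intro mult_left_mono) auto
      thus ?thesis using F_le(2)[OF order_refl True] True False by simp
    qed
  qed (simp add: F_nonpos)
  have "(\<Sum>z\<in>Zs. \<Sum>a\<in>Af (fst z). F 1 (\<Delta> z a)) = (\<Sum>(z, a)\<in>GG. F 1 (\<Delta> z a))"
    unfolding GG_def by (rule sum.Sigma) auto
  also have "\<dots> \<le> (\<Sum>(z, a)\<in>GG. 1 / (2 * c) * ((if \<Delta> z a > 0 then \<rho> + \<theta> else 0) + (if 0 < \<Delta> z a \<and> \<Delta> z a \<le> hi / \<theta> then 1 else 0)))"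
    by (intro sum_mono) (use pt in auto)
  also have "\<dots> = 1 / (2 * c) * ((\<Sum>p\<in>GG. if (case p of (z, a) \<Rightarrow> \<Delta> z a > 0) then \<rho> + \<theta> else 0) + (\<Sum>p\<in>GG. if (case p of (z, a) \<Rightarrow> 0 < \<Delta> z a \<and> \<Delta> z a \<le> hi / \<theta>) then 1 else 0))"
    by (simp add: sum_distrib_left sum.distrib case_prod_beta distrib_left)
  also have "(\<Sum>p\<in>GG. if (case p of (z, a) \<Rightarrow> \<Delta> z a > 0) then \<rho> + \<theta> else 0) = (\<rho> + \<theta>) * card {p\<in>GG. case p of (z, a) \<Rightarrow> \<Delta> z a > 0}"
    by (subst sum.inter_filter[symmetric]) auto
  also have "(\<Sum>p\<in>GG. if (case p of (z, a) \<Rightarrow> 0 < \<Delta> z a \<and> \<Delta> z a \<le> hi / \<theta>) then 1 else 0) = real (card {p\<in>GG. case p of (z, a) \<Rightarrow> 0 < \<Delta> z a \<and> \<Delta> z a \<le> hi / \<theta>})"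
    by (subst sum.inter_filter[symmetric]) auto
  also have "{p\<in>GG. case p of (z, a) \<Rightarrow> \<Delta> z a > 0} = {(z, a)\<in>GG. \<Delta> z a > 0}" by auto
  also have "{p\<in>GG. case p of (z, a) \<Rightarrow> 0 < \<Delta> z a \<and> \<Delta> z a \<le> hi / \<theta>} = {(z, a)\<in>GG. 0 < \<Delta> z a \<and> \<Delta> z a \<le> hi / \<theta>}" by auto
  finally show ?thesis .
qed

text \<open>\<open>u\<close> is linear in \<open>y\<close> with a slope prime to \<open>g\<close>,
  so \<open>y\<close> is determined modulo \<open>g\<close>; \<open>g \<le> T\<close> absorbs the
  additional 1.\<close>

lemma card_u_multiples:
  assumes g: "g \<in> {1..K}" "coprime g Q" "K \<le> T"
  shows "real (card {y\<in>{0..<T}. g dvd u y}) \<le> 2 * T / g"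
proof -
  have "coprime g (2 * Q * \<alpha>)" using g cop[of g] by simp
  hence d: "g dvd x - y" if "g dvd u x" "g dvd u y" for x y
  proof -
    have "g dvd u x - u y" using that by (rule dvd_diff)
    also have "u x - u y = 2 * Q * \<alpha> * (x - y)" by (simp add: u_def algebra_simps)
    finally show ?thesis using \<open>coprime g (2 * Q * \<alpha>)\<close> by (simp add: coprime_dvd_mult_right_iff)
  qed
  have "real (card {y\<in>{0..<T}. g dvd u y}) \<le> T / g + 1"
    by (rule card_residue_le) (use g d in auto)
  also have "1 \<le> T / g" using g by simp
  finally show ?thesis by simp
qed

text \<open>\<open>w\<close> is a product of two linear factors. If \<open>g\<close> divides it,
  then \<open>g = h h'\<close> with \<open>h\<close> dividing the first factor and \<open>h'\<close>
  the second. Since \<beta> is prime to \<open>g\<close>, each of the two conditions determines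
  \<open>r'\<close> from \<open>r\<close> modulo its divisor, and the larger divisor is at least
  sqrt g.\<close>

lemma card_w_multiples:
  assumes g: "g \<in> {1..K}" "coprime g Q" "K \<le> T"
  shows "real (card {(r, r')\<in>{0..<T} \<times> {0..<T}. g dvd w r r'}) \<le>
     (\<Sum>h\<in>{1..K}. \<Sum>h'\<in>{1..K}. if h * h' = g then 2 * T\<^sup>2 / sqrt g else 0)"
proof -
  define P where "P = {(h, h')\<in>{1..K} \<times> {1..K}. h * h' = g}"
  have fP: "finite P" by (rule finite_subset[of _ "{1..K} \<times> {1..K}"]) (auto simp: P_def)
  define X where "X = (\<lambda>(h, h'). {(r, r')\<in>{0..<T} \<times> {0..<T}. h dvd r - r' \<and> h' dvd l2 + \<beta> * (r + r')})"
  have fX: "finite (X p)" for p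
    by (rule finite_subset[of _ "{0..<T} \<times> {0..<T}"]) (auto simp: X_def split: prod.splits)
  have sub: "{(r, r')\<in>{0..<T} \<times> {0..<T}. g dvd w r r'} \<subseteq> (\<Union>p\<in>P. X p)"
  proof safe
    fix r r' assume r: "r \<in> {0..<T}" "r' \<in> {0..<T}" "g dvd w r r'"
    define h where "h = gcd (r - r') g"
    have h0: "h > 0" using g by (simp add: h_def)
    obtain h' where h': "g = h * h'" by (metis dvd_def gcd_dvd2 h_def)
    obtain j where j: "r - r' = h * j" by (metis dvd_def gcd_dvd1 h_def)
    have "h * gcd j h' = h" using h0 gcd_mult_distrib_int[of h j h'] unfolding j[symmetric] h'[symmetric] h_def[symmetric] by simp
    hence cj: "coprime j h'" using h0 by (simp add: coprime_iff_gcd_eq_1)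
    have "h * h' dvd h * (j * (l2 + \<beta> * (r + r')))" using r(3) unfolding w_def j h' by (simp add: mult.assoc)
    hence "h' dvd j * (l2 + \<beta> * (r + r'))" using h0 by simp
    hence "h' dvd l2 + \<beta> * (r + r')" using cj by (simp add: coprime_commute coprime_dvd_mult_right_iff)
    moreover have h'0: "h' > 0" using g h0 h' zero_less_mult_pos[of h h'] by auto
    moreover have "h \<le> g" "h' \<le> g" using h0 h'0 unfolding h' by (simp_all add: mult_le_cancel_left1 mult_le_cancel_right1)
    hence "h \<le> K" "h' \<le> K" using g(1) by auto
    ultimately have "(h, h') \<in> P" "(r, r') \<in> X (h, h')" using g h0 r(1,2) j h' by (auto simp: P_def X_def)
    thus "(r, r') \<in> (\<Union>p\<in>P. X p)" by blast
  qed
  have bd: "real (card (X p)) \<le> 2 * T\<^sup>2 / sqrt g" if "p \<in> P" for p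
  proof -
    obtain h h' where p: "p = (h, h')" by (cases p)
    have hh: "h \<ge> 1" "h' \<ge> 1" "h \<le> K" "h' \<le> K" "h * h' = g" using that by (auto simp: p P_def)
    have XS: "X p = Sigma {0..<T} (\<lambda>r. {r'\<in>{0..<T}. h dvd r - r' \<and> h' dvd l2 + \<beta> * (r + r')})"
      by (auto simp: X_def p)
    have key: "real (card (X p)) \<le> T * (T / m + 1)" if m: "m \<ge> 1"
      "\<And>r x y. h dvd r - x \<and> h' dvd l2 + \<beta> * (r + x) \<Longrightarrow> h dvd r - y \<and> h' dvd l2 + \<beta> * (r + y) \<Longrightarrow> m dvd x - y" for m :: int
    proof -
      have "real (card (X p)) = (\<Sum>r\<in>{0..<T}. real (card {r'\<in>{0..<T}. h dvd r - r' \<and> h' dvd l2 + \<beta> * (r + r')}))"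
        unfolding XS by (subst card_SigmaI) (auto intro: finite_subset[of _ "{0..<T}"])
      also have "\<dots> \<le> (\<Sum>r\<in>{0..<T}. T / m + 1)"
      proof (intro sum_mono card_residue_le)
        fix r x y assume "x \<in> {r'\<in>{0..<T}. h dvd r - r' \<and> h' dvd l2 + \<beta> * (r + r')}"
          "y \<in> {r'\<in>{0..<T}. h dvd r - r' \<and> h' dvd l2 + \<beta> * (r + r')}"
        thus "m dvd x - y" using m(2)[of r x y] by auto
      qed (use m in auto)
      finally show ?thesis using T by simp
    qed
    have 1: "real (card (X p)) \<le> T * (T / h + 1)"
    proof (rule key)
      fix r x y assume "h dvd r - x \<and> h' dvd l2 + \<beta> * (r + x)" "h dvd r - y \<and> h' dvd l2 + \<beta> * (r + y)"
      hence "h dvd (r - y) - (r - x)" using dvd_diff[of h "r - y" "r - x"] by blast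
      thus "h dvd x - y" by simp
    qed (use hh in auto)
    have "h' dvd g" using hh by auto
    hence "coprime h' \<beta>" using cop[OF g(2)] by (metis coprime_divisors coprime_mult_right_iff dvd_refl)
    have 2: "real (card (X p)) \<le> T * (T / h' + 1)"
    proof (rule key)
      fix r x y assume "h dvd r - x \<and> h' dvd l2 + \<beta> * (r + x)" "h dvd r - y \<and> h' dvd l2 + \<beta> * (r + y)"
      hence "h' dvd (l2 + \<beta> * (r + x)) - (l2 + \<beta> * (r + y))"
        using dvd_diff[of h' "l2 + \<beta> * (r + x)" "l2 + \<beta> * (r + y)"] by blast
      hence "h' dvd \<beta> * (x - y)" by (simp add: algebra_simps)
      thus "h' dvd x - y" using \<open>coprime h' \<beta>\<close> by (simp add: coprime_dvd_mult_right_iff)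
    qed (use hh in auto)
    have rg: "real_of_int g = real_of_int h * h'" using hh by auto
    have small: "T * (T / m + 1) \<le> 2 * T\<^sup>2 / sqrt g" if m: "m \<ge> 1" "m \<le> K" "sqrt g \<le> m" for m :: int
    proof -
      have "1 \<le> T / m" using m g by simp
      hence "T * (T / m + 1) \<le> T * (T / m + T / m)" using T by (intro mult_left_mono) auto
      also have "\<dots> = 2 * T\<^sup>2 / m" by (simp add: power2_eq_square)
      also have "\<dots> \<le> 2 * T\<^sup>2 / sqrt g" using m g by (intro divide_left_mono) auto
      finally show ?thesis .
    qed
    show ?thesis
    proof (cases "h \<le> h'")
      case True
      have "sqrt g \<le> h'" using True hh unfolding rg by (intro real_le_lsqrt) (auto simp: power2_eq_square)
      thus ?thesis using 2 small[of h'] hh by linarith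
    next
      case False
      have "sqrt g \<le> h" using False hh unfolding rg by (intro real_le_lsqrt) (auto simp: power2_eq_square)
      thus ?thesis using 1 small[of h] hh by linarith
    qed
  qed
  have "card {(r, r')\<in>{0..<T} \<times> {0..<T}. g dvd w r r'} \<le> card (\<Union>p\<in>P. X p)"
    using sub fP fX by (intro card_mono) auto
  also have "\<dots> \<le> (\<Sum>p\<in>P. card (X p))" using fP by (rule card_UN_le)
  finally have "real (card {(r, r')\<in>{0..<T} \<times> {0..<T}. g dvd w r r'}) \<le> (\<Sum>p\<in>P. real (card (X p)))" by (simp flip: of_nat_sum)
  also have "\<dots> \<le> (\<Sum>p\<in>P. 2 * T\<^sup>2 / sqrt g)" by (intro sum_mono bd)
  also have "\<dots> = (\<Sum>p\<in>{1..K} \<times> {1..K}. if (case p of (h, h') \<Rightarrow> h * h' = g) then 2 * T\<^sup>2 / sqrt g else 0)"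
  proof -
    have "P = {p\<in>{1..K} \<times> {1..K}. case p of (h, h') \<Rightarrow> h * h' = g}" by (auto simp: P_def)
    thus ?thesis by (simp only:) (rule sum.inter_filter, simp)
  qed
  also have "\<dots> = (\<Sum>h\<in>{1..K}. \<Sum>h'\<in>{1..K}. if h * h' = g then 2 * T\<^sup>2 / sqrt g else 0)"
    by (subst sum.cartesian_product) (simp add: case_prod_beta)
  finally show ?thesis .
qed

definition tail :: real where "tail = (\<Sum>h\<in>{h\<in>{2..K}. coprime h Q}. e32 h)"

text \<open>For a factorisation g = h h' the product of 2 T / g and 2 T^2 / sqrt g is 4 T^3 times
  \<open>e32 h * e32 h'\<close>. All pairs of numbers prime to \<open>Q\<close> except (1, 1)
  together contribute (1 + tail)^2 - 1.\<close>

lemma sum_divisor_pairs_le: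
  assumes KT: "K \<le> T"
  shows "(\<Sum>g\<in>{g\<in>{2..K}. coprime g Q}. real (card {y\<in>{0..<T}. g dvd u y}) * real (card {(r, r')\<in>{0..<T} \<times> {0..<T}. g dvd w r r'}))
     \<le> 4 * T ^ 3 * ((1 + tail)\<^sup>2 - 1)"
proof (cases "K \<ge> 1")
  case False
  thus ?thesis by (simp add: tail_def)
next
  case True
  define C where "C = {g\<in>{1..K}. coprime g Q}"
  have fC: "finite C" by (rule finite_subset[of _ "{1..K}"]) (auto simp: C_def)
  have C1: "{g\<in>{2..K}. coprime g Q} = C - {1}" "1 \<in> C" using True by (auto simp: C_def)
  have "(\<Sum>g\<in>C - {1}. real (card {y\<in>{0..<T}. g dvd u y}) * real (card {(r, r')\<in>{0..<T} \<times> {0..<T}. g dvd w r r'}))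
     \<le> (\<Sum>g\<in>C - {1}. (2 * T / g) * (\<Sum>h\<in>{1..K}. \<Sum>h'\<in>{1..K}. if h * h' = g then 2 * T\<^sup>2 / sqrt g else 0))"
    using card_u_multiples card_w_multiples KT T by (intro sum_mono mult_mono) (auto simp: C_def)
  also have "\<dots> = (\<Sum>g\<in>C - {1}. (\<Sum>h\<in>{1..K}. \<Sum>h'\<in>{1..K}. if h * h' = g then 4 * T ^ 3 * (e32 h * e32 h') else 0))"
  proof (rule sum.cong[OF refl])
    fix g assume g: "g \<in> C - {1}"
    have "(2 * T / g) * (if h * h' = g then 2 * T\<^sup>2 / sqrt g else 0) = (if h * h' = g then 4 * T ^ 3 * (e32 h * e32 h') else 0)" for h h'
      using g unfolding e32_mult[symmetric] by (auto simp: e32_def C_def power2_eq_square power3_eq_cube ac_simps)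
    thus "(2 * T / g) * (\<Sum>h\<in>{1..K}. \<Sum>h'\<in>{1..K}. if h * h' = g then 2 * T\<^sup>2 / sqrt g else 0) =
      (\<Sum>h\<in>{1..K}. \<Sum>h'\<in>{1..K}. if h * h' = g then 4 * T ^ 3 * (e32 h * e32 h') else 0)"
      unfolding sum_distrib_left by simp
  qed
  also have "\<dots> = (\<Sum>g\<in>C - {1}. \<Sum>p\<in>{1..K} \<times> {1..K}. if fst p * snd p = g then 4 * T ^ 3 * (e32 (fst p) * e32 (snd p)) else 0)"
    by (subst sum.cartesian_product) (simp add: case_prod_beta)
  also have "\<dots> = (\<Sum>p\<in>{1..K} \<times> {1..K}. \<Sum>g\<in>C - {1}. if fst p * snd p = g then 4 * T ^ 3 * (e32 (fst p) * e32 (snd p)) else 0)"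
    by (rule sum.swap)
  also have "\<dots> = (\<Sum>p\<in>{1..K} \<times> {1..K}. if fst p * snd p \<in> C - {1} then 4 * T ^ 3 * (e32 (fst p) * e32 (snd p)) else 0)"
    using fC by (intro sum.cong refl) (simp add: sum.delta)
  also have "\<dots> \<le> (\<Sum>p\<in>C \<times> C - {(1, 1)}. 4 * T ^ 3 * (e32 (fst p) * e32 (snd p)))"
  proof -
    have "(\<Sum>p\<in>{1..K} \<times> {1..K}. if fst p * snd p \<in> C - {1} then 4 * T ^ 3 * (e32 (fst p) * e32 (snd p)) else 0)
       = (\<Sum>p\<in>{p\<in>{1..K} \<times> {1..K}. fst p * snd p \<in> C - {1}}. 4 * T ^ 3 * (e32 (fst p) * e32 (snd p)))"
      by (rule sum.inter_filter[symmetric]) simp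
    also have "\<dots> \<le> (\<Sum>p\<in>C \<times> C - {(1, 1)}. 4 * T ^ 3 * (e32 (fst p) * e32 (snd p)))"
      using fC T by (intro sum_mono2) (auto simp: C_def intro!: mult_nonneg_nonneg e32_nonneg)
    finally show ?thesis .
  qed
  also have "\<dots> = 4 * T ^ 3 * (\<Sum>p\<in>C \<times> C - {(1, 1)}. e32 (fst p) * e32 (snd p))" by (simp add: sum_distrib_left)
  also have "(\<Sum>p\<in>C \<times> C - {(1, 1)}. e32 (fst p) * e32 (snd p)) = (\<Sum>p\<in>C \<times> C. e32 (fst p) * e32 (snd p)) - 1"
    using fC C1 by (subst sum_diff1) (auto simp: e32_def)
  also have "(\<Sum>p\<in>C \<times> C. e32 (fst p) * e32 (snd p)) = (sum e32 C)\<^sup>2"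
    by (simp add: power2_eq_square sum_product sum.cartesian_product case_prod_beta)
  also have "sum e32 C = 1 + tail"
    unfolding tail_def C1(1) using fC C1(2) by (subst sum.remove[of C 1]) (auto simp: e32_def)
  finally show ?thesis by (simp only: C1)
qed

text \<open>For \<open>g > 1\<close> the crude bound for \<open>F\<close> suffices, because so few
  triples have both divisibilities.\<close>

lemma sum_F_big_le:
  assumes KT: "K \<le> T"
  shows "(\<Sum>g\<in>{g\<in>{2..K}. coprime g Q}. \<Sum>z\<in>{z\<in>Zs. g dvd u (fst z) \<and> g dvd wz z}. \<Sum>a\<in>Af (fst z). F g (\<Delta> z a))
    \<le> 1 / (2 * c) * (\<rho> + 1) * (2 * T / Q + 1) * (4 * T ^ 3 * ((1 + tail)\<^sup>2 - 1))"
proof -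
  define M where "M = 1 / (2 * c) * (\<rho> + 1)"
  have M: "M \<ge> 0" using c \<rho>_nonneg by (simp add: M_def)
  define NN where "NN g = {y\<in>{0..<T}. g dvd u y} \<times> {(r, r')\<in>{0..<T} \<times> {0..<T}. g dvd w r r'}" for g
  have NN: "{z\<in>Zs. g dvd u (fst z) \<and> g dvd wz z} = NN g" for g by (auto simp: Zs_def NN_def wz_def)
  have "(\<Sum>g\<in>{g\<in>{2..K}. coprime g Q}. \<Sum>z\<in>NN g. \<Sum>a\<in>Af (fst z). F g (\<Delta> z a)) \<le>
    (\<Sum>g\<in>{g\<in>{2..K}. coprime g Q}. \<Sum>z\<in>NN g. M * (2 * T / Q + 1))"
  proof (intro sum_mono)
    fix g z assume g: "g \<in> {g\<in>{2..K}. coprime g Q}"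
    have "(\<Sum>a\<in>Af (fst z). F g (\<Delta> z a)) \<le> (\<Sum>a\<in>Af (fst z). M)"
    proof (rule sum_mono)
      fix a show "F g (\<Delta> z a) \<le> M"
        using F_le(1)[of g "\<Delta> z a"] F_nonpos[of "\<Delta> z a" g] g M by (cases "\<Delta> z a > 0") (auto simp: M_def)
    qed
    also have "\<dots> \<le> M * (2 * T / Q + 1)" using card_Af M by (simp add: mult.commute mult_left_mono)
    finally show "(\<Sum>a\<in>Af (fst z). F g (\<Delta> z a)) \<le> M * (2 * T / Q + 1)" .
  qed
  also have "\<dots> = M * (2 * T / Q + 1) * (\<Sum>g\<in>{g\<in>{2..K}. coprime g Q}. real (card {y\<in>{0..<T}. g dvd u y}) * real (card {(r, r')\<in>{0..<T} \<times> {0..<T}. g dvd w r r'}))"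
    unfolding NN_def by (simp add: card_cartesian_product sum_distrib_left algebra_simps)
  also have "\<dots> \<le> M * (2 * T / Q + 1) * (4 * T ^ 3 * ((1 + tail)\<^sup>2 - 1))"
    using M T Q by (intro mult_left_mono sum_divisor_pairs_le KT) auto
  finally show ?thesis unfolding NN M_def .
qed

text \<open>The leading part is \<rho> T^4 / (2 c Q). The remaining terms come from the
  \<open>1\<close> per congruence, from \<theta>, from small \<open>\<Delta>\<close> and from
  \<open>g > 1\<close>.\<close>

lemma sum_fib_le':
  assumes KT: "K \<le> T" and K1: "K \<ge> 1" and \<theta>: "\<theta> > 0" and B: "B \<ge> 1"
  shows "2 * (\<Sum>k\<in>{1..K}. \<Sum>z\<in>Zs. real (card (fib k z))) \<le> 2 * (K * T ^ 3) +
     1 / (2 * c) * ((\<rho> + \<theta>) * (T ^ 3 * (T / Q + 1)) + 2 * (T\<^sup>2 * ((2 * B + 1) * (2 * T / Q + 1) + T * (hi / \<theta> / B + 1)))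
       + 8 * (\<rho> + 1) * (2 * T / Q + 1) * T ^ 3 * ((1 + tail)\<^sup>2 - 1))"
proof -
  define f where "f g = (\<Sum>z\<in>{z\<in>Zs. g dvd u (fst z) \<and> g dvd wz z}. \<Sum>a\<in>Af (fst z). F g (\<Delta> z a))" for g
  have C: "{g\<in>{1..K}. coprime g Q} = insert 1 {g\<in>{2..K}. coprime g Q}" using K1 by auto
  have fin: "finite {g\<in>{2..K}. coprime g Q}" by (rule finite_subset[of _ "{2..K}"]) auto
  have r1: "(\<Sum>k\<in>{1..K}. \<Sum>z\<in>Zs. real (card (fib k z))) \<le> K * T ^ 3 + (f 1 + sum f {g\<in>{2..K}. coprime g Q})"
    using sum_fib_le K1 fin unfolding f_def[symmetric] C by simp
  have r2: "f 1 \<le> 1 / (2 * c) * ((\<rho> + \<theta>) * card {(z, a)\<in>GG. \<Delta> z a > 0} + card {(z, a)\<in>GG. 0 < \<Delta> z a \<and> \<Delta> z a \<le> hi / \<theta>})"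
    using sum_F_one_le[OF \<theta>] by (simp add: f_def)
  have r3: "2 * (1 / (2 * c) * ((\<rho> + \<theta>) * card {(z, a)\<in>GG. \<Delta> z a > 0} + card {(z, a)\<in>GG. 0 < \<Delta> z a \<and> \<Delta> z a \<le> hi / \<theta>}))
     \<le> 1 / (2 * c) * ((\<rho> + \<theta>) * (T ^ 3 * (T / Q + 1)) + 2 * (T\<^sup>2 * ((2 * B + 1) * (2 * T / Q + 1) + T * (hi / \<theta> / B + 1))))"
  proof -
    have "2 * real (card {(z, a)\<in>GG. \<Delta> z a > 0}) \<le> T ^ 3 * (T / Q + 1)"
      using card_pos_GG card_GG by linarith
    hence "(\<rho> + \<theta>) * (2 * real (card {(z, a)\<in>GG. \<Delta> z a > 0})) \<le> (\<rho> + \<theta>) * (T ^ 3 * (T / Q + 1))"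
      using \<rho>_nonneg \<theta> by (intro mult_left_mono) auto
    moreover have "real (card {(z, a)\<in>GG. 0 < \<Delta> z a \<and> \<Delta> z a \<le> hi / \<theta>}) \<le> T\<^sup>2 * ((2 * B + 1) * (2 * T / Q + 1) + T * (hi / \<theta> / B + 1))"
      by (rule card_small_\<Delta>) (use B \<theta> lohi in auto)
    ultimately have "2 * ((\<rho> + \<theta>) * card {(z, a)\<in>GG. \<Delta> z a > 0} + card {(z, a)\<in>GG. 0 < \<Delta> z a \<and> \<Delta> z a \<le> hi / \<theta>})
      \<le> (\<rho> + \<theta>) * (T ^ 3 * (T / Q + 1)) + 2 * (T\<^sup>2 * ((2 * B + 1) * (2 * T / Q + 1) + T * (hi / \<theta> / B + 1)))" by argo
    hence "1 / (2 * c) * (2 * ((\<rho> + \<theta>) * card {(z, a)\<in>GG. \<Delta> z a > 0} + card {(z, a)\<in>GG. 0 < \<Delta> z a \<and> \<Delta> z a \<le> hi / \<theta>}))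
      \<le> 1 / (2 * c) * ((\<rho> + \<theta>) * (T ^ 3 * (T / Q + 1)) + 2 * (T\<^sup>2 * ((2 * B + 1) * (2 * T / Q + 1) + T * (hi / \<theta> / B + 1))))"
      using c by (intro mult_left_mono) auto
    thus ?thesis by argo
  qed
  have r4: "sum f {g\<in>{2..K}. coprime g Q} \<le> 1 / (2 * c) * (\<rho> + 1) * (2 * T / Q + 1) * (4 * T ^ 3 * ((1 + tail)\<^sup>2 - 1))"
    unfolding f_def by (rule sum_F_big_le[OF KT])
  have r5: "2 * (1 / (2 * c) * (\<rho> + 1) * (2 * T / Q + 1) * (4 * T ^ 3 * ((1 + tail)\<^sup>2 - 1))) = 1 / (2 * c) * (8 * (\<rho> + 1) * (2 * T / Q + 1) * T ^ 3 * ((1 + tail)\<^sup>2 - 1))"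
  proof -
    have "2 * (x * A * B * (4 * C * D)) = x * (8 * A * B * C * D)" for x A B C D :: real by simp
    thus ?thesis unfolding of_int_mult of_int_numeral .
  qed
  have gen: "2 * S \<le> kk + (A + D)" if "S \<le> k + (f1 + g1)" "f1 \<le> a1" "2 * a1 \<le> A" "g1 \<le> b1" "2 * b1 = D" "2 * k = kk"
    for S k f1 g1 a1 A b1 D kk :: real using that by linarith
  show ?thesis unfolding distrib_left[of "1 / (2 * c)" "_ + _" "8 * _ * _ * _ * _"]
    by (rule gen[OF r1 r2 r3 r4 r5]) simp
qed

end

section \<open>Coincidences with equal \<open>s\<close>, and the total count\<close>

context mu_family begin

definition \<mu>' :: "int \<times> int \<times> int \<Rightarrow> int" where "\<mu>' = (\<lambda>(s, t, r). \<mu> t r s)"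

lemma H_ge_1: "H \<ge> 1"
proof -
  have "1 \<le> 2 * Q * \<bar>\<alpha>\<bar>" using Q nz by (simp add: int_one_le_iff_zero_less)
  thus ?thesis by (simp add: H_def)
qed

text \<open>For equal \<open>s\<close> a coincidence reads (t - t') (l + Q \<alpha> (t + t')) = - Q
  (r - r') (l2 + \<beta> (r + r')). For \<open>t \<noteq> t'\<close> this is an equation x u = y v
  with entries of size O(T), counted by the multiplicative energy; \<open>t = t'\<close> is counted
  directly.\<close>

lemma card_coincidences_fixed_s:
  fixes T :: int
  assumes T: "T \<ge> 1"
  shows "real (card {((t, r), (t', r')) \<in> ({0..<T} \<times> {0..<T}) \<times> ({0..<T} \<times> {0..<T}). \<mu> t r s = \<mu> t' r' s})
     \<le> 2 * T\<^sup>2 + 96 * (H * Q * T)\<^sup>2 * sqrt (H * Q * T)"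
proof -
  define A where "A = {((t, r), (t', r')) \<in> ({0..<T} \<times> {0..<T}) \<times> ({0..<T} \<times> {0..<T}). \<mu> t r s = \<mu> t' r' s}"
  have fA: "finite A" by (rule finite_subset[of _ "({0..<T} \<times> {0..<T}) \<times> ({0..<T} \<times> {0..<T})"]) (auto simp: A_def)
  define M where "M = H * Q * T"
  have M1: "T \<le> M" "Q * T \<le> M" "H * T \<le> M" "M \<ge> 1"
  proof -
    have "1 * 1 \<le> H * Q" using H_ge_1 Q by (intro mult_mono) auto
    hence "1 * T \<le> H * Q * T" using T by (intro mult_right_mono) auto
    thus "T \<le> M" by (simp add: M_def)
    thus "M \<ge> 1" using T by linarith
    have "1 * Q \<le> H * Q" using H_ge_1 Q by (intro mult_right_mono) auto
    hence "Q * T \<le> H * Q * T" using T by (intro mult_right_mono) auto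
    thus "Q * T \<le> M" by (simp add: M_def)
    have "H * 1 \<le> H * Q" using H_ge_1 Q by (intro mult_left_mono) auto
    hence "H * T \<le> H * Q * T" using T by (intro mult_right_mono) auto
    thus "H * T \<le> M" by (simp add: M_def)
  qed
  have eq: "(t - t') * (l + Q * \<alpha> * (t + t')) = - (Q * (r - r')) * (l2 + \<beta> * (r + r'))" if "\<mu> t r s = \<mu> t' r' s" for t r t' r'
    using that unfolding \<mu>_def by (simp add: algebra_simps power2_eq_square)
  \<comment> \<open>The number is congruent to \<open>l\<close> modulo \<open>Q\<close>, hence prime
    to the even number \<open>Q\<close>.\<close>
  have un: "l + Q * \<alpha> * x \<noteq> 0" for x
  proof
    assume "l + Q * \<alpha> * x = 0"
    hence "l = Q * (- \<alpha> * x)" by (simp add: algebra_simps)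
    hence "Q dvd l" by (rule dvdI)
    hence "is_unit Q" using lQ by (meson coprime_common_divisor dvd_refl)
    thus False using Q by auto
  qed
  define A1 where "A1 = {((t, r), (t', r')) \<in> A. t = t'}"
  define A2 where "A2 = {((t, r), (t', r')) \<in> A. t \<noteq> t'}"
  have AU: "A = A1 \<union> A2" by (auto simp: A1_def A2_def)
  \<comment> \<open>For \<open>t = t'\<close> either \<open>r' = r\<close> or \<open>r'\<close> is
    the root of the other factor, so \<open>(t, r)\<close> and one bit determine the pair.\<close>
  have "card A1 \<le> card (({0..<T} \<times> {0..<T}) \<times> {False, True})"
  proof (rule card_inj_on_le[of "\<lambda>((t, r), (t', r')). ((t, r), r = r')"])
    show "inj_on (\<lambda>((t, r), (t', r')). ((t, r), r = r')) A1"
    proof (rule inj_onI)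
      fix x y assume xy: "x \<in> A1" "y \<in> A1" "(\<lambda>((t, r), (t', r')). ((t, r), r = r')) x = (\<lambda>((t, r), (t', r')). ((t, r), r = r')) y"
      obtain t r t' r' where x: "x = ((t, r), (t', r'))" by (metis surj_pair)
      obtain p q p' q' where y: "y = ((p, q), (p', q'))" by (metis surj_pair)
      have e: "p = t" "q = r" "(r = r') = (r = q')" "t' = t" "p' = t" "\<mu> t r s = \<mu> t' r' s" "\<mu> p q s = \<mu> p' q' s"
        using xy by (auto simp: x y A1_def A_def)
      have "r' = q'"
      proof (cases "r = r'")
        case False
        have "l2 + \<beta> * (r + r') = 0" "l2 + \<beta> * (r + q') = 0"
          using eq[OF e(6)] eq[OF e(7)] e False Q by auto
        hence "\<beta> * (r + r') = \<beta> * (r + q')" by linarith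
        thus ?thesis using nz by simp
      qed (use e in auto)
      thus "x = y" using e x y by simp
    qed
  qed (auto simp: A1_def A_def)
  hence "real (card A1) \<le> real (card (({0..<T} \<times> {0..<T}) \<times> {False, True}))" by (rule of_nat_mono)
  hence c1: "real (card A1) \<le> 2 * T\<^sup>2" using T by (simp add: card_cartesian_product power2_eq_square)
  define E where "E = {(x, y, u, v). x \<noteq> 0 \<and> y \<noteq> 0 \<and> \<bar>x\<bar> \<le> M \<and> \<bar>y\<bar> \<le> M \<and> \<bar>u\<bar> \<le> M \<and> \<bar>v\<bar> \<le> M \<and> x * u = y * v}"
  have E: "finite E" "real (card E) \<le> 96 * M^2 * sqrt M"
    unfolding E_def using multiplicative_energy_le[OF M1(4)] by auto
  define \<phi> where "\<phi> = (\<lambda>((t, r), (t', r')). (t - t', - (Q * (r - r')), l + Q * \<alpha> * (t + t'), l2 + \<beta> * (r + r')))"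
  have "card A2 \<le> card E"
  proof (rule card_inj_on_le[of \<phi>])
    have "inj \<phi>"
    proof (rule injI)
      fix x y assume xy: "\<phi> x = \<phi> y"
      obtain t r t' r' where x: "x = ((t, r), (t', r'))" by (metis surj_pair)
      obtain p q p' q' where y: "y = ((p, q), (p', q'))" by (metis surj_pair)
      have "t - t' = p - p'" "r - r' = q - q'" "t + t' = p + p'" "r + r' = q + q'"
        using xy Q nz by (auto simp: x y \<phi>_def)
      thus "x = y" by (simp add: x y)
    qed
    thus "inj_on \<phi> A2" by (rule inj_on_subset) simp
    show "\<phi> ` A2 \<subseteq> E"
    proof (rule image_subsetI)
      fix x assume x2: "x \<in> A2"
      obtain t r t' r' where x: "x = ((t, r), (t', r'))" by (metis surj_pair)
      have rg: "0 \<le> t" "t < T" "0 \<le> r" "r < T" "0 \<le> t'" "t' < T" "0 \<le> r'" "r' < T" "t \<noteq> t'"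
        and m: "\<mu> t r s = \<mu> t' r' s" using x2 by (auto simp: x A2_def A_def)
      note eq' = eq[OF m]
      have "(t - t') * (l + Q * \<alpha> * (t + t')) \<noteq> 0" using rg un by simp
      hence ne: "Q * (r - r') \<noteq> 0" using eq' by auto
      have b1: "\<bar>t - t'\<bar> \<le> M" using rg M1 by linarith
      have "\<bar>Q * (r - r')\<bar> \<le> Q * T" using rg Q by (simp add: abs_mult)
      hence b2: "\<bar>- (Q * (r - r'))\<bar> \<le> M" using M1 by linarith
      have "\<bar>l + Q * \<alpha> * (t + t')\<bar> \<le> \<bar>l\<bar> + \<bar>Q * \<alpha> * (t + t')\<bar>" by (rule abs_triangle_ineq)
      also have "\<bar>Q * \<alpha> * (t + t')\<bar> = Q * \<bar>\<alpha>\<bar> * (t + t')" using rg Q by (simp add: abs_mult)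
      also have "\<bar>l\<bar> + Q * \<bar>\<alpha>\<bar> * (t + t') \<le> \<bar>l\<bar> * T + Q * \<bar>\<alpha>\<bar> * (2 * T)"
        using T rg Q by (intro add_mono mult_left_mono) (auto simp: mult_le_cancel_left1)
      also have "\<dots> = (\<bar>l\<bar> + 2 * Q * \<bar>\<alpha>\<bar>) * T" by (simp add: algebra_simps)
      also have "\<dots> \<le> H * T" using T by (intro mult_right_mono) (auto simp: H_def)
      finally have b3: "\<bar>l + Q * \<alpha> * (t + t')\<bar> \<le> M" using M1 by linarith
      have "\<bar>l2 + \<beta> * (r + r')\<bar> \<le> \<bar>l2\<bar> + \<bar>\<beta> * (r + r')\<bar>" by (rule abs_triangle_ineq)
      also have "\<bar>\<beta> * (r + r')\<bar> = \<bar>\<beta>\<bar> * (r + r')" using rg by (simp add: abs_mult)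
      also have "\<bar>l2\<bar> + \<bar>\<beta>\<bar> * (r + r') \<le> \<bar>l2\<bar> * T + \<bar>\<beta>\<bar> * (2 * T)"
        using T rg by (intro add_mono mult_left_mono) (auto simp: mult_le_cancel_left1)
      also have "\<dots> = (\<bar>l2\<bar> + 2 * \<bar>\<beta>\<bar>) * T" by (simp add: algebra_simps)
      also have "\<dots> \<le> H * T" using T Q by (intro mult_right_mono) (auto simp: H_def)
      finally have b4: "\<bar>l2 + \<beta> * (r + r')\<bar> \<le> M" using M1 by linarith
      show "\<phi> x \<in> E" unfolding E_def \<phi>_def x using b1 b2 b3 b4 ne eq' rg by simp
    qed
  qed (use E in auto)
  hence "real (card A2) \<le> 96 * M^2 * sqrt M" using E by linarith
  moreover have "real (card A) \<le> real (card A1) + real (card A2)" unfolding AU using card_Un_le[of A1 A2] by linarith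
  ultimately show ?thesis using c1 unfolding A_def[symmetric] M_def by linarith
qed

end

context mu_box begin

text \<open>Pairs with \<open>s < s'\<close> and with \<open>s > s'\<close> are equinumerous. For
  the former, k lo \<le> \<Delta> \<le> H T^2 gives k \<le> K, so \<open>k\<close>, the triple
  \<open>z\<close> and \<open>a\<close> lie in the ranges over which \<open>fib\<close> is
  summed.\<close>

lemma card_coincidences_le:
  fixes Ss :: "int set"
  assumes fS: "finite Ss" and S: "\<And>s s'. s \<in> Ss \<Longrightarrow> s' \<in> Ss \<Longrightarrow> lo \<le> l0 + c * (s + s') \<and> l0 + c * (s + s') \<le> hi"
  shows "real (card {(x, x') \<in> (Ss \<times> {0..<T} \<times> {0..<T}) \<times> (Ss \<times> {0..<T} \<times> {0..<T}). \<mu>' x = \<mu>' x'}) \<le>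
    card Ss * (2 * T\<^sup>2 + 96 * (H * Q * T)\<^sup>2 * sqrt (H * Q * T)) + 2 * (\<Sum>k\<in>{1..K}. \<Sum>z\<in>Zs. real (card (fib k z)))"
proof -
  define X where "X = Ss \<times> {0..<T} \<times> {0..<T}"
  have fX: "finite X" using fS by (simp add: X_def)
  define E where "E = {(x, x') \<in> X \<times> X. \<mu>' x = \<mu>' x'}"
  define E0 where "E0 = {(x, x') \<in> E. fst x = fst x'}"
  define Ep where "Ep = {(x, x') \<in> E. fst x < fst x'}"
  define Em where "Em = {(x, x') \<in> E. fst x > fst x'}"
  have fE: "finite E" by (rule finite_subset[of _ "X \<times> X"]) (use fX in \<open>auto simp: E_def\<close>)
  have fp: "finite Ep" by (rule finite_subset[OF _ fE]) (auto simp: Ep_def)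
  have "Em = (\<lambda>(x, x'). (x', x)) ` Ep" by (auto simp: Em_def Ep_def E_def)
  hence cm: "card Em \<le> card Ep" using fp card_image_le by simp
  have "E = E0 \<union> (Ep \<union> Em)" by (auto simp: E0_def Ep_def Em_def)
  hence "card E = card (E0 \<union> (Ep \<union> Em))" by (rule arg_cong)
  hence "card E \<le> card E0 + (card Ep + card Em)"
    using card_Un_le[of E0 "Ep \<union> Em"] card_Un_le[of Ep Em] by linarith
  hence cE: "card E \<le> card E0 + 2 * card Ep" using cm by linarith
  have "real (card E0) \<le> card Ss * (2 * T\<^sup>2 + 96 * (H * Q * T)\<^sup>2 * sqrt (H * Q * T))"
  proof -
    define C where "C s = {((t, r), (t', r')) \<in> ({0..<T} \<times> {0..<T}) \<times> ({0..<T} \<times> {0..<T}). \<mu> t r s = \<mu> t' r' s}" for s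
    have fC: "finite (C s)" for s by (rule finite_subset[of _ "({0..<T} \<times> {0..<T}) \<times> ({0..<T} \<times> {0..<T})"]) (auto simp: C_def)
    have "E0 \<subseteq> (\<lambda>(s, ((t, r), (t', r'))). ((s, t, r), (s, t', r'))) ` Sigma Ss C"
    proof
      fix x assume x: "x \<in> E0"
      obtain s t r s' t' r' where e: "x = ((s, t, r), (s', t', r'))" by (metis surj_pair)
      have "(s, ((t, r), (t', r'))) \<in> Sigma Ss C" "s' = s" using x by (auto simp: e E0_def E_def X_def C_def \<mu>'_def)
      thus "x \<in> (\<lambda>(s, ((t, r), (t', r'))). ((s, t, r), (s, t', r'))) ` Sigma Ss C" by (intro image_eqI) (auto simp: e)
    qed
    hence "card E0 \<le> card (Sigma Ss C)"
      by (meson card_image_le card_mono finite_SigmaI finite_imageI le_trans fS fC)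
    also have "card (Sigma Ss C) = (\<Sum>s\<in>Ss. card (C s))" using fS fC by simp
    finally have "real (card E0) \<le> (\<Sum>s\<in>Ss. real (card (C s)))" by (simp flip: of_nat_sum)
    also have "\<dots> \<le> (\<Sum>s\<in>Ss. 2 * T\<^sup>2 + 96 * (H * Q * T)\<^sup>2 * sqrt (H * Q * T))"
      unfolding C_def by (rule sum_mono) (rule card_coincidences_fixed_s[OF T])
    finally show ?thesis by simp
  qed
  moreover have "real (card Ep) \<le> (\<Sum>k\<in>{1..K}. \<Sum>z\<in>Zs. real (card (fib k z)))"
  proof -
    define \<Omega> where "\<Omega> = (SIGMA k:{1..K}. SIGMA z:Zs. fib k z)"
    have ff: "finite (fib k z)" for k z by (simp add: fib_def)
    have f\<Omega>: "finite \<Omega>" unfolding \<Omega>_def using ff by (intro finite_SigmaI) auto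
    define q where "q = Q div 2"
    \<comment> \<open>\<open>s\<close> is recovered by solving \<Delta> = k (l0 + c (2 s +
      k)).\<close>
    define \<Phi> where "\<Phi> = (\<lambda>(k, ((y, r, r'), a)). let s = (\<Delta> (y, r, r') a - k * (l0 + c * k)) div (2 * c * k) in ((s, y + q * a, r), (s + k, y - q * a, r')))"
    have "Ep \<subseteq> \<Phi> ` \<Omega>"
    proof
      fix x assume x: "x \<in> Ep"
      obtain s t r s' t' r' where e: "x = ((s, t, r), (s', t', r'))" by (metis surj_pair)
      have S': "s \<in> Ss" "s' \<in> Ss" "s < s'" and rg: "0 \<le> t" "t < T" "0 \<le> r" "r < T" "0 \<le> t'" "t' < T" "0 \<le> r'" "r' < T"
        and m: "\<mu> t r s = \<mu> t' r' s'" using x by (auto simp: e Ep_def E_def X_def \<mu>'_def)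
      obtain a y where ay: "t = y + q * a" "t' = y - q * a" "t - t' = Q * a"
        and D: "a * u y + w r r' = (s' - s) * (l0 + c * (s + s'))"
        using \<mu>_eq_imp[OF m] unfolding q_def by metis
      define k where "k = s' - s"
      have k: "k \<ge> 1" using S' by (simp add: k_def)
      define z where "z = (y, r, r')"
      have "t + t' = 2 * y" using ay by simp
      hence "0 \<le> y" "y < T" using rg by auto
      hence z: "z \<in> Zs" using rg by (simp add: z_def Zs_def)
      have a: "a \<in> Af (fst z)" using rg ay by (simp add: z_def Af_def q_def)
      have Dz: "\<Delta> z a = k * (l0 + c * (s + s'))" using D by (simp add: \<Delta>_def z_def k_def)
      have Rk: "R k (\<Delta> z a)"
      proof -
        have "lo \<le> l0 + c * (s + s')" "l0 + c * (s + s') \<le> hi" using S S' by auto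
        hence "real_of_int k * lo \<le> real_of_int k * (l0 + c * (s + s'))" "real_of_int k * (l0 + c * (s + s')) \<le> real_of_int k * hi"
          using k by (auto intro!: mult_left_mono simp del: of_int_add of_int_mult)
        thus ?thesis unfolding R_def Dz by simp
      qed
      have "real_of_int k * lo \<le> \<Delta> z a" using Rk by (simp add: R_def)
      also have "real_of_int (\<Delta> z a) \<le> real_of_int (H * T\<^sup>2)" using \<Delta>_le[OF z a] by (simp only: of_int_le_iff)
      also have "\<dots> \<le> K * lo" by (rule K)
      finally have kK: "k \<le> K" using lohi by simp
      have dv: "\<Delta> z a - k * (l0 + c * k) = 2 * c * k * s"
        unfolding Dz k_def by (simp add: algebra_simps)
      have "(k, (z, a)) \<in> \<Omega>" using k kK z a Rk dv by (simp add: \<Omega>_def fib_def)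
      moreover have "\<Phi> (k, (z, a)) = x"
      proof -
        have "(\<Delta> z a - k * (l0 + c * k)) div (2 * c * k) = s" unfolding dv using k c by simp
        thus ?thesis using ay k_def by (simp add: \<Phi>_def z_def e)
      qed
      ultimately show "x \<in> \<Phi> ` \<Omega>" by (metis image_eqI)
    qed
    hence "card Ep \<le> card \<Omega>" by (meson card_image_le card_mono finite_imageI le_trans f\<Omega>)
    also have "card \<Omega> = (\<Sum>k\<in>{1..K}. \<Sum>z\<in>Zs. card (fib k z))" unfolding \<Omega>_def using ff by simp
    finally show ?thesis by (simp flip: of_nat_sum)
  qed
  ultimately show ?thesis using cE unfolding E_def X_def by linarith
qed

end

text \<open>The exponent lies between 2/3 and 1. Above 2/3 the coincidences with equal
  \<open>s\<close>, about S T^(5/2), are negligible against T^4; below 1 so is K T^3, about T^5 / S,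
  and the box still maps into a short window.\<close>

definition box_side :: "real \<Rightarrow> int" where "box_side S = \<lfloor>S powr (3/4)\<rfloor>"

lemma box_side_limits:
  "((\<lambda>S. 1 / real_of_int (box_side S)) \<longlongrightarrow> 0) at_top"
  "((\<lambda>S. 1 / sqrt (real_of_int (box_side S))) \<longlongrightarrow> 0) at_top"
  "((\<lambda>S. S / (real_of_int (box_side S) * sqrt (real_of_int (box_side S)))) \<longlongrightarrow> 0) at_top"
  "((\<lambda>S. real_of_int (box_side S) / S) \<longlongrightarrow> 0) at_top"
  "filterlim (\<lambda>S. real_of_int (box_side S)) at_top at_top"
  unfolding box_side_def by real_asymp+

text \<open>If no \<open>h\<close> with 1 < h \<le> w is prime to \<open>Q\<close>, the sum is part
  of the tail beyond \<open>w\<close> of the convergent series of n^(-3/2).\<close>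

lemma tail_bound_exists:
  fixes \<tau> :: real
  assumes "\<tau> > 0"
  obtains w :: nat where "w \<ge> 1" "\<And>Q K. (\<And>h::int. 1 < h \<Longrightarrow> h \<le> int w \<Longrightarrow> \<not> coprime h Q) \<Longrightarrow>
    (\<Sum>h\<in>{h\<in>{2..K}. coprime h Q}. e32 h) \<le> \<tau>"
proof -
  define f where "f n = real n powr (-(3/2))" for n
  have sm: "summable f" unfolding f_def by (subst summable_real_powr_iff) simp
  obtain N where N: "\<And>n. n \<ge> N \<Longrightarrow> norm (\<Sum>i. f (i + n)) < \<tau>"
    using suminf_exist_split[OF assms sm] by blast
  have "(\<Sum>h\<in>{h\<in>{2..K}. coprime h Q}. e32 h) \<le> \<tau>"
    if h: "\<And>h::int. 1 < h \<Longrightarrow> h \<le> int (Suc N) \<Longrightarrow> \<not> coprime h Q" for Q K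
  proof -
    define A where "A = {h\<in>{2..K}. coprime h Q}"
    have fA: "finite A" by (rule finite_subset[of _ "{2..K}"]) (auto simp: A_def)
    have big: "x > int (Suc N)" if "x \<in> A" for x using h[of x] that by (force simp: A_def)
    define g where "g x = nat x - Suc N" for x
    have inj: "inj_on g A"
    proof (rule inj_onI)
      fix x y assume *: "x \<in> A" "y \<in> A" "g x = g y"
      have "nat x = nat y" using big[OF *(1)] big[OF *(2)] *(3) unfolding g_def by linarith
      thus "x = y" using big[OF *(1)] big[OF *(2)] by linarith
    qed
    have "(\<Sum>h\<in>A. e32 h) = (\<Sum>h\<in>A. f (g h + Suc N))"
    proof (rule sum.cong[OF refl])
      fix x assume "x \<in> A"
      hence x: "x > int (Suc N)" by (rule big)
      hence "g x + Suc N = nat x" unfolding g_def by linarith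
      moreover have "e32 x = f (nat x)"
      proof -
        have "real_of_int x powr (3/2) = real_of_int x powr (1 + 1/2)" by simp
        also have "\<dots> = real_of_int x * sqrt x" using x by (subst powr_add) (simp add: powr_half_sqrt)
        finally show ?thesis using x by (simp add: e32_def f_def powr_minus_divide)
      qed
      ultimately show "e32 x = f (g x + Suc N)" by simp
    qed
    also have "\<dots> = (\<Sum>n\<in>g ` A. f (n + Suc N))" by (simp add: sum.reindex[OF inj])
    also have "\<dots> \<le> (\<Sum>n. f (n + Suc N))"
      by (rule sum_le_suminf[OF summable_ignore_initial_segment[OF sm]]) (use fA in \<open>auto simp: f_def\<close>)
    also have "\<dots> \<le> \<tau>" using N[of "Suc N"] by simp
    finally show ?thesis by (simp add: A_def)
  qed
  thus ?thesis by (intro that[of "Suc N"]) auto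
qed

text \<open>Windows of ratio \<Lambda> are taken from \<open>Y\<close> downwards until \<Lambda> X0
  is reached. Their bounds form a geometric series with sum at most \<kappa> / (\<Lambda> - 1) Y;
  the initial stretch costs at most \<Lambda> X0. The induction is on the number of windows.\<close>

lemma density_le_of_windows:
  fixes U :: "int set" and \<Lambda> \<kappa> X0 :: real
  assumes \<Lambda>: "\<Lambda> > 1" and \<kappa>: "\<kappa> \<ge> 0" and X0: "X0 > 0"
    and W: "\<And>X. X \<ge> X0 \<Longrightarrow> real (card {m\<in>U. X < m \<and> m \<le> \<Lambda> * X}) \<le> \<kappa> * X" and Y: "Y > 0"
  shows "real (card {m\<in>U. 0 < m \<and> real_of_int m \<le> Y}) \<le> \<Lambda> * X0 + \<kappa> / (\<Lambda> - 1) * Y"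
proof -
  have fin: "finite {m\<in>U. 0 < m \<and> real_of_int m \<le> Y}" for Y
    by (rule finite_subset[of _ "{0..\<lfloor>Y\<rfloor>}"]) (auto simp: le_floor_iff)
  have base: "real (card {m\<in>U. 0 < m \<and> real_of_int m \<le> Y}) \<le> Y" if "Y > 0" for Y
  proof -
    have "real (card {m\<in>U. 0 < m \<and> real_of_int m \<le> Y}) \<le> Y - 1 + 1"
      by (rule card_int_real_interval) (use that in auto)
    thus ?thesis by simp
  qed
  obtain n where n: "Y \<le> \<Lambda> ^ n * X0"
  proof -
    obtain n where "Y / X0 < \<Lambda> ^ n" using real_arch_pow[OF \<Lambda>] by blast
    hence "Y \<le> \<Lambda> ^ n * X0" using X0 by (simp add: field_simps)
    thus ?thesis using that by blast
  qed
  show ?thesis using n Y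
  proof (induction n arbitrary: Y)
    case 0
    have "1 * X0 \<le> \<Lambda> * X0" using \<Lambda> X0 by (intro mult_right_mono) auto
    moreover have "0 \<le> \<kappa> / (\<Lambda> - 1) * Y" using \<Lambda> X0 \<kappa> 0 by simp
    moreover have "Y \<le> X0" using 0 by simp
    ultimately show ?case using base[of Y] 0 by linarith
  next
    case (Suc n)
    show ?case
    proof (cases "Y \<le> \<Lambda> * X0")
      case True
      have "0 \<le> \<kappa> / (\<Lambda> - 1) * Y" using \<Lambda> \<kappa> Suc by simp
      thus ?thesis using base[of Y] Suc True by linarith
    next
      case False
      define Z where "Z = Y / \<Lambda>"
      have Z: "Z > 0" "Z \<ge> X0" "Z \<le> \<Lambda> ^ n * X0" "Y = \<Lambda> * Z" "Z \<le> Y"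
        using Suc False \<Lambda> by (auto simp: Z_def field_simps)
      have "{m\<in>U. 0 < m \<and> real_of_int m \<le> Y} \<subseteq> {m\<in>U. 0 < m \<and> real_of_int m \<le> Z} \<union> {m\<in>U. Z < m \<and> m \<le> \<Lambda> * Z}"
        using Z by auto
      moreover have "finite {m\<in>U. Z < m \<and> m \<le> \<Lambda> * Z}"
        by (rule finite_subset[OF _ fin[of Y]]) (use Z in auto)
      ultimately have "card {m\<in>U. 0 < m \<and> real_of_int m \<le> Y} \<le> card ({m\<in>U. 0 < m \<and> real_of_int m \<le> Z} \<union> {m\<in>U. Z < m \<and> m \<le> \<Lambda> * Z})"
        using fin by (intro card_mono) auto
      also have "\<dots> \<le> card {m\<in>U. 0 < m \<and> real_of_int m \<le> Z} + card {m\<in>U. Z < m \<and> m \<le> \<Lambda> * Z}" by (rule card_Un_le)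
      finally have "real (card {m\<in>U. 0 < m \<and> real_of_int m \<le> Y}) \<le> (\<Lambda> * X0 + \<kappa> / (\<Lambda> - 1) * Z) + \<kappa> * Z"
        using Suc.IH[OF Z(3,1)] W[OF Z(2)] by linarith
      also have "\<kappa> * Z = \<kappa> / (\<Lambda> - 1) * Y - \<kappa> / (\<Lambda> - 1) * Z"
      proof -
        define d where "d = \<kappa> / (\<Lambda> - 1)"
        have "\<kappa> = d * (\<Lambda> - 1)" using \<Lambda> by (simp add: d_def)
        hence "\<kappa> * Z = d * (\<Lambda> - 1) * Z" by simp
        thus ?thesis unfolding d_def[symmetric] Z(4) by (simp add: algebra_simps)
      qed
      finally show ?thesis by simp
    qed
  qed
qed

section \<open>Limits, and the proportion of integers that are not values\<close>

context mu_family begin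

definition Ss :: "real \<Rightarrow> real \<Rightarrow> int set" where "Ss \<eta> S = {s. S \<le> real_of_int s \<and> real_of_int s < (1 + \<eta>) * S}"

lemma card_Ss:
  assumes "\<eta> > 0" "S > 0"
  shows "finite (Ss \<eta> S)" "real (card (Ss \<eta> S)) \<le> \<eta> * S + 1" "\<eta> * S - 1 \<le> real (card (Ss \<eta> S))"
proof -
  have e: "Ss \<eta> S = {\<lceil>S\<rceil>..<\<lceil>(1 + \<eta>) * S\<rceil>}" by (auto simp: Ss_def less_ceiling_iff ceiling_le_iff)
  show "finite (Ss \<eta> S)" by (simp add: e)
  have le: "\<lceil>S\<rceil> \<le> \<lceil>(1 + \<eta>) * S\<rceil>" using assms by (intro ceiling_mono) (simp add: mult_le_cancel_right1)
  have "real (card (Ss \<eta> S)) = \<lceil>(1 + \<eta>) * S\<rceil> - \<lceil>S\<rceil>" using le by (simp add: e)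
  moreover have "(1 + \<eta>) * S = S + \<eta> * S" by (simp add: algebra_simps)
  ultimately show "real (card (Ss \<eta> S)) \<le> \<eta> * S + 1" "\<eta> * S - 1 \<le> real (card (Ss \<eta> S))"
    by (simp_all, linarith+)
qed

abbreviation "rc \<equiv> real_of_int c"
abbreviation "rQ \<equiv> real_of_int Q"
abbreviation "rH \<equiv> real_of_int H"
abbreviation "rl \<equiv> \<bar>real_of_int l0\<bar>"

text \<open>The bound for the coincidences divided by T^4 / (2 c Q). Its five terms come from equal
  \<open>s\<close>, from the \<open>1\<close> per congruence (K T^3), from the main part, from small
  \<open>\<Delta>\<close> (with B = sqrt T), and from \<open>g > 1\<close>, where \<kappa> stands
  for (1 + \<tau>)^2 - 1.\<close>

definition energy_bound :: "real \<Rightarrow> real \<Rightarrow> real \<Rightarrow> real" where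
  "energy_bound \<eta> \<kappa> S = (let T = real_of_int (box_side S); lo = 2 * rc * S - rl; hi = 2 * rc * ((1 + \<eta>) * S) + rl; \<theta> = \<eta>\<^sup>2 / 4 in
     2 * rc * rQ * (\<eta> * S + 1) * (2 / T\<^sup>2 + 96 * (rH * rQ)\<^sup>2 * sqrt (rH * rQ) / (T * sqrt T)) + 4 * rc * rQ * (rH * T / lo + 1 / T)
     + (hi / lo - 1 + \<theta>) * (1 + rQ / T) + 2 * ((2 * sqrt T + 1) * (2 * T + rQ) / T\<^sup>2 + rQ * (hi / \<theta> / sqrt T + 1) / T)
     + 8 * (hi / lo) * (2 + rQ / T) * \<kappa>)"

text \<open>The summand \<eta> is what Cauchy--Schwarz forces to first order, since about \<eta> S
  T^2 triples have their values in a window of length about 2 \<eta> c Q S^2. The rest is of second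
  order in \<eta> once \<kappa> is small.\<close>

lemma energy_bound_tendsto:
  assumes \<eta>: "\<eta> > 0"
  shows "(energy_bound \<eta> \<kappa> \<longlongrightarrow> \<eta> + \<eta>\<^sup>2 / 4 + 16 * (1 + \<eta>) * \<kappa>) at_top"
proof -
  note L = box_side_limits
  have c0: "rc > 0" using c by simp
  define lo where "lo S = 2 * rc * S - rl" for S
  define hi where "hi S = 2 * rc * ((1 + \<eta>) * S) + rl" for S
  have S0: "((\<lambda>S::real. 1 / S) \<longlongrightarrow> 0) at_top" by real_asymp
  have ev: "eventually (\<lambda>S. S > 0 \<and> lo S > 0 \<and> box_side S \<ge> 1) at_top"
  proof -
    have "eventually (\<lambda>S. S > rl) at_top" by (rule eventually_gt_at_top)
    moreover have "eventually (\<lambda>S. real_of_int (box_side S) \<ge> 1) at_top"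
      using L(5) unfolding filterlim_at_top by blast
    ultimately show ?thesis
    proof eventually_elim
      case (elim S)
      have "2 * rc * S \<ge> 1 * S" using c elim by (intro mult_right_mono) auto
      thus ?case using elim by (auto simp: lo_def)
    qed
  qed
  have hl: "((\<lambda>S. hi S / lo S) \<longlongrightarrow> 1 + \<eta>) at_top"
  proof -
    have "((\<lambda>S. (2 * rc * (1 + \<eta>) + rl * (1 / S)) / (2 * rc - rl * (1 / S))) \<longlongrightarrow> (2 * rc * (1 + \<eta>) + rl * 0) / (2 * rc - rl * 0)) at_top"
      using c0 by (intro tendsto_intros S0) auto
    moreover have "eventually (\<lambda>S. (2 * rc * (1 + \<eta>) + rl * (1 / S)) / (2 * rc - rl * (1 / S)) = hi S / lo S) at_top"
      using ev
    proof eventually_elim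
      case (elim S)
      have "hi S = S * (2 * rc * (1 + \<eta>) + rl * (1 / S))" "lo S = S * (2 * rc - rl * (1 / S))"
        using elim by (simp_all add: hi_def lo_def field_simps)
      thus ?case using elim by simp
    qed
    ultimately show ?thesis using c0 by (simp add: tendsto_cong)
  qed
  have Tlo: "((\<lambda>S. real_of_int (box_side S) / lo S) \<longlongrightarrow> 0) at_top"
  proof -
    have A: "((\<lambda>S. (real_of_int (box_side S) / S) / (2 * rc - rl * (1 / S))) \<longlongrightarrow> 0 / (2 * rc - rl * 0)) at_top"
      using c0 by (intro tendsto_intros S0 L) auto
    have B: "eventually (\<lambda>S. (real_of_int (box_side S) / S) / (2 * rc - rl * (1 / S)) = real_of_int (box_side S) / lo S) at_top"
      using ev
    proof eventually_elim
      case (elim S)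
      have "lo S = S * (2 * rc - rl * (1 / S))" using elim by (simp add: lo_def field_simps)
      thus ?case using elim by simp
    qed
    show ?thesis using Lim_transform_eventually[OF A B] by simp
  qed
  define x where "x S = 1 / real_of_int (box_side S)" for S
  define y where "y S = 1 / sqrt (real_of_int (box_side S))" for S
  define z where "z S = S / (real_of_int (box_side S) * sqrt (real_of_int (box_side S)))" for S
  have xyz: "(x \<longlongrightarrow> 0) at_top" "(y \<longlongrightarrow> 0) at_top" "(z \<longlongrightarrow> 0) at_top"
    using L unfolding x_def y_def z_def by auto
  define \<theta> where "\<theta> = \<eta>\<^sup>2 / 4"
  have \<theta>: "\<theta> > 0" using \<eta> by (simp add: \<theta>_def)
  define C where "C = 96 * ((rH * rQ))\<^sup>2 * sqrt (rH * rQ)"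
  \<comment> \<open>\<open>energy_bound\<close> rewritten in terms of quantities with known
    limits.\<close>
  define G where "G S = 2 * rc * rQ * (2 * (\<eta> * (z S * y S) + (x S)\<^sup>2) + C * (\<eta> * z S + x S * y S)) + 4 * rc * rQ * (rH * (real_of_int (box_side S) / lo S) + x S)
     + (hi S / lo S - 1 + \<theta>) * (1 + rQ * x S) + 2 * ((2 * y S + x S) * (2 + rQ * x S) + rQ * ((2 * rc * (1 + \<eta>) * z S + rl * (x S * y S)) / \<theta> + x S))
     + 8 * (hi S / lo S) * (2 + rQ * x S) * \<kappa>" for S
  have "(G \<longlongrightarrow> 2 * rc * rQ * (2 * (\<eta> * (0 * 0) + 0\<^sup>2) + C * (\<eta> * 0 + 0 * 0)) + 4 * rc * rQ * (rH * 0 + 0)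
     + (1 + \<eta> - 1 + \<theta>) * (1 + rQ * 0) + 2 * ((2 * 0 + 0) * (2 + rQ * 0) + rQ * ((2 * rc * (1 + \<eta>) * 0 + rl * (0 * 0)) / \<theta> + 0))
     + 8 * (1 + \<eta>) * (2 + rQ * 0) * \<kappa>) at_top"
    unfolding G_def using \<theta> by (intro tendsto_intros xyz hl Tlo) auto
  hence G: "(G \<longlongrightarrow> \<eta> + \<eta>\<^sup>2 / 4 + 16 * (1 + \<eta>) * \<kappa>) at_top" by (simp add: \<theta>_def algebra_simps)
  have "eventually (\<lambda>S. G S = energy_bound \<eta> \<kappa> S) at_top"
    using ev
  proof eventually_elim
    case (elim S)
    define T where "T = real_of_int (box_side S)"
    have T: "T \<ge> 1" using elim by (simp add: T_def)
    define R where "R = sqrt T"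
    have R: "R > 0" "T = R * R" using T by (simp_all add: R_def)
    have e1: "2 * rc * rQ * (2 * (\<eta> * (z S * y S) + (x S)\<^sup>2) + C * (\<eta> * z S + x S * y S)) = 2 * rc * rQ * (\<eta> * S + 1) * (2 / T\<^sup>2 + C / (T * sqrt T))"
      unfolding x_def y_def z_def T_def[symmetric] R_def[symmetric] R(2)
      using R(1) by (simp add: field_simps power2_eq_square)
    have e2: "4 * rc * rQ * (rH * (real_of_int (box_side S) / lo S) + x S) = 4 * rc * rQ * (rH * T / lo S + 1 / T)"
      by (simp add: x_def T_def)
    have e3: "(2 * y S + x S) * (2 + rQ * x S) + rQ * ((2 * rc * (1 + \<eta>) * z S + rl * (x S * y S)) / \<theta> + x S)
        = (2 * sqrt T + 1) * (2 * T + rQ) / T\<^sup>2 + rQ * (hi S / \<theta> / sqrt T + 1) / T"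
      unfolding x_def y_def z_def T_def[symmetric] R_def[symmetric] R(2) hi_def
      using R(1) \<theta> by (simp add: field_simps power2_eq_square)
    show ?case
      unfolding G_def energy_bound_def Let_def T_def[symmetric] lo_def[symmetric] hi_def[symmetric] \<theta>_def[symmetric]
        e1 e2 e3 by (simp add: x_def T_def C_def lo_def hi_def)
  qed
  thus ?thesis using G by (simp add: tendsto_cong)
qed

end

context mu_family begin

lemma energy_le:
  fixes S \<eta> \<tau> :: real
  defines "T \<equiv> box_side S" and "lo \<equiv> 2 * rc * S - rl" and "hi \<equiv> 2 * rc * ((1 + \<eta>) * S) + rl"
  assumes \<eta>: "\<eta> > 0" and S: "S > 0" and T: "T \<ge> 1" and lo: "lo > 0"
    and KT: "rH * T / lo + 1 / T \<le> 1"
    and tail: "\<And>K. (\<Sum>h\<in>{h\<in>{2..K}. coprime h Q}. e32 h) \<le> \<tau>"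
  shows "real (card {(x, x') \<in> (Ss \<eta> S \<times> {0..<T} \<times> {0..<T}) \<times> (Ss \<eta> S \<times> {0..<T} \<times> {0..<T}). \<mu>' x = \<mu>' x'})
     \<le> T ^ 4 / (2 * rc * rQ) * energy_bound \<eta> ((1 + \<tau>)\<^sup>2 - 1) S"
proof -
  have c0: "rc > 0" and Q0: "rQ > 0" using c Q by auto
  have rT: "real_of_int T \<ge> 1" using T by simp
  \<comment> \<open>This \<open>K\<close> satisfies H T^2 \<le> K lo and exceeds H T^2 / lo by at
    most 1, so \<open>KT\<close> yields K \<le> T.\<close>
  define K where "K = \<lfloor>rH * T\<^sup>2 / lo\<rfloor> + 1"
  have K1: "rH * T\<^sup>2 / lo \<le> K" "K \<le> rH * T\<^sup>2 / lo + 1" unfolding K_def by linarith+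
  have "rH * T\<^sup>2 / lo \<ge> 0" using H_ge_1 lo by (intro divide_nonneg_pos mult_nonneg_nonneg) auto
  hence K2: "K \<ge> 1" by (simp add: K_def)
  have K3: "K \<le> T"
  proof -
    have "rH * T\<^sup>2 / lo + 1 = (rH * T / lo + 1 / T) * T" using rT by (simp add: field_simps power2_eq_square)
    also have "\<dots> \<le> 1 * real_of_int T" using KT rT by (intro mult_right_mono) auto
    finally show ?thesis using K1 by linarith
  qed
  have lohi: "lo \<le> hi"
  proof -
    have "rc * S \<le> rc * ((1 + \<eta>) * S)" using c0 S \<eta> by (intro mult_left_mono) auto
    thus ?thesis by (auto simp: lo_def hi_def)
  qed
  interpret mu_box Q l \<alpha> \<beta> c l0 l2 T K lo hi
  proof unfold_locales
    show "real_of_int (H * T\<^sup>2) \<le> K * lo" using K1(1) lo by (simp add: field_simps)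
  qed (use T lo lohi in auto)
  define \<theta> where "\<theta> = \<eta>\<^sup>2 / 4"
  \<comment> \<open>With this cut the main errors from small \<open>\<Delta>\<close>, of order
    T^(7/2) and S T^(5/2), are both o(T^4).\<close>
  define B where "B = sqrt T"
  have B1: "B \<ge> 1" using rT by (simp add: B_def)
  have BT: "real_of_int T = B\<^sup>2" using rT by (simp add: B_def)
  have \<theta>: "\<theta> > 0" using \<eta> by (simp add: \<theta>_def)
  have fS: "finite (Ss \<eta> S)" and cS: "real (card (Ss \<eta> S)) \<le> \<eta> * S + 1" using card_Ss[OF \<eta> S] by auto
  have "real (card {(x, x') \<in> (Ss \<eta> S \<times> {0..<T} \<times> {0..<T}) \<times> (Ss \<eta> S \<times> {0..<T} \<times> {0..<T}). \<mu>' x = \<mu>' x'}) \<le>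
    card (Ss \<eta> S) * (2 * T\<^sup>2 + 96 * (H * Q * T)\<^sup>2 * sqrt (H * Q * T)) + 2 * (\<Sum>k\<in>{1..K}. \<Sum>z\<in>Zs. real (card (fib k z)))"
  proof (rule card_coincidences_le[OF fS])
    fix s s' assume "s \<in> Ss \<eta> S" "s' \<in> Ss \<eta> S"
    hence "2 * S \<le> real_of_int s + s'" "real_of_int s + s' \<le> 2 * ((1 + \<eta>) * S)" by (auto simp: Ss_def)
    hence "rc * (2 * S) \<le> rc * (real_of_int s + s')" "rc * (real_of_int s + s') \<le> rc * (2 * ((1 + \<eta>) * S))"
      using c0 by (auto intro!: mult_left_mono)
    thus "lo \<le> l0 + c * (s + s') \<and> l0 + c * (s + s') \<le> hi" unfolding lo_def hi_def
      by (simp add: abs_if)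
  qed
  also have "\<dots> \<le> (\<eta> * S + 1) * (2 * T\<^sup>2 + 96 * (H * Q * T)\<^sup>2 * sqrt (H * Q * T)) + (2 * (K * T ^ 3) +
     1 / (2 * c) * ((\<rho> + \<theta>) * (T ^ 3 * (T / Q + 1)) + 2 * (T\<^sup>2 * ((2 * B + 1) * (2 * T / Q + 1) + T * (hi / \<theta> / B + 1)))
       + 8 * (\<rho> + 1) * (2 * T / Q + 1) * T ^ 3 * ((1 + tail)\<^sup>2 - 1)))"
    using cS H_ge_1 Q T by (intro add_mono mult_right_mono sum_fib_le'[OF K3 K2 \<theta> B1]) auto
  also have "\<dots> \<le> T ^ 4 / (2 * rc * rQ) * energy_bound \<eta> ((1 + \<tau>)\<^sup>2 - 1) S"
  proof -
    define k' where "k' = (1 + tail)\<^sup>2 - 1"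
    define \<kappa> where "\<kappa> = (1 + \<tau>)\<^sup>2 - 1"
    have t0: "tail \<ge> 0" unfolding tail_def by (intro sum_nonneg e32_nonneg) auto
    have "tail \<le> \<tau>" unfolding tail_def by (rule tail)
    hence kk: "k' \<le> \<kappa>" using t0 unfolding k'_def \<kappa>_def by (intro diff_right_mono power_mono) auto
    define t where "t = real_of_int T"
    have t: "t = B\<^sup>2" "t \<ge> 1" using BT rT by (simp_all add: t_def)
    have B0: "B > 0" using B1 by simp
    have hl: "\<rho> = hi / lo - 1" by (simp add: \<rho>_def)
    have sq: "sqrt (H * Q * T) = sqrt (rH * rQ) * B" by (simp add: real_sqrt_mult B_def)
    have e1: "(\<eta> * S + 1) * (2 * T\<^sup>2 + 96 * (H * Q * T)\<^sup>2 * sqrt (H * Q * T)) =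
       t ^ 4 / (2 * rc * rQ) * (2 * rc * rQ * (\<eta> * S + 1) * (2 / t\<^sup>2 + 96 * (rH * rQ)\<^sup>2 * sqrt (rH * rQ) / (t * B)))"
    proof -
      have g1: "t ^ 4 / (2 * rc * rQ) * (2 * rc * rQ * (\<eta> * S + 1) * (2 / t\<^sup>2 + X / (t * B))) = (\<eta> * S + 1) * (2 * t\<^sup>2 + X * (t ^ 4 / (t * B)))" for X
        using c0 Q0 t B0 by (simp add: field_simps power2_eq_square power4_eq_xxxx)
      have g2: "t ^ 4 / (t * B) = t\<^sup>2 * B" using B0 unfolding t(1) by (simp add: field_simps flip: power_Suc power_add power_mult)
      show ?thesis unfolding g1 g2 sq by (simp add: t_def power_mult_distrib mult_ac)
    qed
    have e2: "real_of_int (2 * (K * T ^ 3)) \<le> t ^ 4 / (2 * rc * rQ) * (4 * rc * rQ * (rH * t / lo + 1 / t))"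
    proof -
      have "t ^ 4 / (2 * rc * rQ) * (4 * rc * rQ * (rH * t / lo + 1 / t)) = 2 * ((rH * t\<^sup>2 / lo + 1) * t ^ 3)"
        using c0 Q0 t(2) lo by (simp add: field_simps power2_eq_square power4_eq_xxxx power3_eq_cube)
      moreover have "K * t ^ 3 \<le> (rH * t\<^sup>2 / lo + 1) * t ^ 3" using K1(2) t(2) by (intro mult_right_mono) (auto simp: t_def)
      ultimately show ?thesis by (simp add: t_def)
    qed
    have e3: "1 / (2 * c) * ((\<rho> + \<theta>) * (T ^ 3 * (T / Q + 1))) = t ^ 4 / (2 * rc * rQ) * ((hi / lo - 1 + \<theta>) * (1 + rQ / t))"
      using c0 Q0 t(2) lo unfolding hl by (simp add: field_simps t_def[symmetric] power4_eq_xxxx power3_eq_cube)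
    have e4: "1 / (2 * c) * (2 * (T\<^sup>2 * ((2 * B + 1) * (2 * T / Q + 1) + T * (hi / \<theta> / B + 1)))) =
       t ^ 4 / (2 * rc * rQ) * (2 * ((2 * B + 1) * (2 * t + rQ) / t\<^sup>2 + rQ * (hi / \<theta> / B + 1) / t))"
    proof -
      have "1 / (2 * rc) * (2 * (t\<^sup>2 * ((2 * B + 1) * (2 * t / rQ + 1) + t * Y))) =
       t ^ 4 / (2 * rc * rQ) * (2 * ((2 * B + 1) * (2 * t + rQ) / t\<^sup>2 + rQ * Y / t))" for Y
        using c0 Q0 t(2) by (simp add: field_simps power4_eq_xxxx power2_eq_square)
      thus ?thesis by (simp add: t_def)
    qed
    have e5: "1 / (2 * c) * (8 * (\<rho> + 1) * (2 * T / Q + 1) * T ^ 3 * k') \<le> t ^ 4 / (2 * rc * rQ) * (8 * (hi / lo) * (2 + rQ / t) * \<kappa>)"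
    proof -
      have "1 / (2 * c) * (8 * (\<rho> + 1) * (2 * T / Q + 1) * T ^ 3 * k') = t ^ 4 / (2 * rc * rQ) * (8 * (hi / lo) * (2 + rQ / t) * k')"
        using c0 Q0 t(2) lo unfolding hl by (simp add: field_simps t_def[symmetric] power4_eq_xxxx power3_eq_cube)
      also have "\<dots> \<le> t ^ 4 / (2 * rc * rQ) * (8 * (hi / lo) * (2 + rQ / t) * \<kappa>)"
        using kk lohi lo c0 Q0 t(2) by (intro mult_left_mono) auto
      finally show ?thesis .
    qed
    have gen: "a1 + (a2 + y * (a3 + a4 + a5)) \<le> x * (b1 + b2 + b3 + b4 + b5)"
      if "a1 = x * b1" "a2 \<le> x * b2" "y * a3 = x * b3" "y * a4 = x * b4" "y * a5 \<le> x * b5" for a1 a2 a3 a4 a5 x y b1 b2 b3 b4 b5 :: real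
      using that by (simp add: distrib_left)
    have eb: "energy_bound \<eta> \<kappa> S = 2 * rc * rQ * (\<eta> * S + 1) * (2 / t\<^sup>2 + 96 * (rH * rQ)\<^sup>2 * sqrt (rH * rQ) / (t * B))
      + 4 * rc * rQ * (rH * t / lo + 1 / t) + (hi / lo - 1 + \<theta>) * (1 + rQ / t)
      + 2 * ((2 * B + 1) * (2 * t + rQ) / t\<^sup>2 + rQ * (hi / \<theta> / B + 1) / t) + 8 * (hi / lo) * (2 + rQ / t) * \<kappa>"
      unfolding energy_bound_def Let_def T_def[symmetric] lo_def[symmetric] hi_def[symmetric] \<theta>_def[symmetric] t_def B_def by simp
    show ?thesis unfolding k'_def[symmetric] \<kappa>_def[symmetric] eb of_int_power t_def[symmetric]
      using gen[OF e1 e2 e3 e4 e5] by (simp only: of_int_power t_def[symmetric])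
  qed
  finally show ?thesis by (simp only: of_int_power)
qed

text \<open>\<open>t\<close> and \<open>r\<close> stay below T = o(S), so \<open>\<mu>\<close> is Q
  c s^2 up to a small multiple of S^2.\<close>

lemma \<mu>_window:
  fixes S \<eta> :: real
  assumes s: "s \<in> Ss \<eta> S" and t: "t \<in> {0..<box_side S}" and r: "r \<in> {0..<box_side S}" and S: "S > 0" and \<eta>: "0 < \<eta>" "\<eta> \<le> 1/2"
    and e: "(\<bar>l\<bar> + Q * (\<bar>\<alpha>\<bar> + \<bar>l2\<bar> + \<bar>\<beta>\<bar>)) * (box_side S / S)\<^sup>2 + 2 * Q * \<bar>l0\<bar> * (1 / S) \<le> e"
  shows "rQ * rc * S\<^sup>2 - e * S\<^sup>2 \<le> \<mu> t r s" "\<mu> t r s \<le> rQ * rc * ((1 + \<eta>)\<^sup>2 * S\<^sup>2) + e * S\<^sup>2"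
proof -
  define T where "T = real_of_int (box_side S)"
  have T1: "T \<ge> 1" "0 \<le> real_of_int t" "real_of_int t \<le> T" "0 \<le> real_of_int r" "real_of_int r \<le> T"
    using t r by (auto simp: T_def)
  have s1: "S \<le> s" "real_of_int s < (1 + \<eta>) * S" using s by (auto simp: Ss_def)
  have "(1 + \<eta>) * S \<le> 2 * S" using \<eta> S by (intro mult_right_mono) auto
  hence s2: "0 \<le> real_of_int s" "real_of_int s \<le> 2 * S" using s1 S by linarith+
  have Q0: "rQ > 0" "rc > 0" using Q c by auto
  have TT2: "T \<le> T\<^sup>2" using T1 by (simp add: power2_eq_square)
  have t2: "(real_of_int t)\<^sup>2 \<le> T\<^sup>2" "(real_of_int r)\<^sup>2 \<le> T\<^sup>2" using T1 by (auto intro: power_mono)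
  define er where "er = real_of_int l * t + rQ * (real_of_int \<alpha> * (real_of_int t)\<^sup>2 + real_of_int l2 * r + real_of_int l0 * s + real_of_int \<beta> * (real_of_int r)\<^sup>2)"
  have m: "real_of_int (\<mu> t r s) = rQ * rc * (real_of_int s)\<^sup>2 + er"
    by (simp add: \<mu>_def er_def algebra_simps)
  have b: "\<bar>x * y\<bar> \<le> \<bar>x\<bar> * z" if "0 \<le> y" "y \<le> z" for x y z :: real using that by (simp add: abs_mult mult_left_mono)
  have "\<bar>er\<bar> \<le> \<bar>real_of_int l\<bar> * T\<^sup>2 + rQ * (\<bar>real_of_int \<alpha>\<bar> * T\<^sup>2 + \<bar>real_of_int l2\<bar> * T\<^sup>2 + rl * (2 * S) + \<bar>real_of_int \<beta>\<bar> * T\<^sup>2)"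
  proof -
    have 1: "\<bar>real_of_int l * t\<bar> \<le> \<bar>real_of_int l\<bar> * T\<^sup>2" using T1 TT2 by (intro b) auto
    have 2: "\<bar>real_of_int \<alpha> * (real_of_int t)\<^sup>2\<bar> \<le> \<bar>real_of_int \<alpha>\<bar> * T\<^sup>2" using t2 by (intro b) auto
    have 3: "\<bar>real_of_int l2 * r\<bar> \<le> \<bar>real_of_int l2\<bar> * T\<^sup>2" using T1 TT2 by (intro b) auto
    have 4: "\<bar>real_of_int l0 * s\<bar> \<le> rl * (2 * S)" using s2 by (intro b) auto
    have 5: "\<bar>real_of_int \<beta> * (real_of_int r)\<^sup>2\<bar> \<le> \<bar>real_of_int \<beta>\<bar> * T\<^sup>2" using t2 by (intro b) auto
    have "\<bar>real_of_int \<alpha> * (real_of_int t)\<^sup>2 + real_of_int l2 * r + real_of_int l0 * s + real_of_int \<beta> * (real_of_int r)\<^sup>2\<bar> \<le>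
      \<bar>real_of_int \<alpha>\<bar> * T\<^sup>2 + \<bar>real_of_int l2\<bar> * T\<^sup>2 + rl * (2 * S) + \<bar>real_of_int \<beta>\<bar> * T\<^sup>2" using 2 3 4 5 by linarith
    hence "\<bar>rQ * (real_of_int \<alpha> * (real_of_int t)\<^sup>2 + real_of_int l2 * r + real_of_int l0 * s + real_of_int \<beta> * (real_of_int r)\<^sup>2)\<bar> \<le>
      rQ * (\<bar>real_of_int \<alpha>\<bar> * T\<^sup>2 + \<bar>real_of_int l2\<bar> * T\<^sup>2 + rl * (2 * S) + \<bar>real_of_int \<beta>\<bar> * T\<^sup>2)"
      using Q0 by (simp add: abs_mult)
    thus ?thesis unfolding er_def using 1 by linarith
  qed
  also have "\<dots> = ((\<bar>l\<bar> + Q * (\<bar>\<alpha>\<bar> + \<bar>l2\<bar> + \<bar>\<beta>\<bar>)) * (T / S)\<^sup>2 + 2 * Q * \<bar>l0\<bar> * (1 / S)) * S\<^sup>2"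
    using S by (simp add: field_simps power2_eq_square)
  also have "\<dots> \<le> e * S\<^sup>2" using e by (intro mult_right_mono) (auto simp: T_def)
  finally have er: "\<bar>er\<bar> \<le> e * S\<^sup>2" .
  have "S\<^sup>2 \<le> (real_of_int s)\<^sup>2" using s1 S by (intro power_mono) auto
  hence 1: "rQ * rc * S\<^sup>2 \<le> rQ * rc * (real_of_int s)\<^sup>2" using Q0 by (intro mult_left_mono) auto
  have "(real_of_int s)\<^sup>2 \<le> ((1 + \<eta>) * S)\<^sup>2" using s1 s2 by (intro power_mono) auto
  hence 2: "rQ * rc * (real_of_int s)\<^sup>2 \<le> rQ * rc * ((1 + \<eta>)\<^sup>2 * S\<^sup>2)" using Q0 by (intro mult_left_mono) (auto simp: power_mult_distrib)
  show "rQ * rc * S\<^sup>2 - e * S\<^sup>2 \<le> \<mu> t r s" "\<mu> t r s \<le> rQ * rc * ((1 + \<eta>)\<^sup>2 * S\<^sup>2) + e * S\<^sup>2"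
    unfolding m using 1 2 er by linarith+
qed

end

context mu_family begin

text \<open>The window contains about (2 \<eta> + \<eta>^2) Q c S^2 integers, and Cauchy--Schwarz
  finds about (2 \<eta> - 2 \<eta>^2) Q c S^2 values in a slight enlargement of it. The difference,
  of order \<eta>^2, bounds what is missed.\<close>

lemma unrepresented_window:
  fixes \<eta> \<tau> :: real
  assumes \<eta>: "0 < \<eta>" "\<eta> \<le> 1/2"
    and tail: "\<And>K. (\<Sum>h\<in>{h\<in>{2..K}. coprime h Q}. e32 h) \<le> \<tau>"
    and \<tau>: "16 * (1 + \<eta>) * ((1 + \<tau>)\<^sup>2 - 1) \<le> \<eta>\<^sup>2 / 4"
  shows "eventually (\<lambda>S. real (card {m. (\<forall>t r s. \<mu> t r s \<noteq> m) \<and> rQ * rc * S\<^sup>2 < m \<and> m \<le> (1 + \<eta>)\<^sup>2 * (rQ * rc * S\<^sup>2)})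
     \<le> 4 * \<eta>\<^sup>2 * (rQ * rc * S\<^sup>2)) at_top"
proof -
  have c0: "rc > 0" and Q0: "rQ > 0" using c Q by auto
  define \<kappa> where "\<kappa> = (1 + \<tau>)\<^sup>2 - 1"
  \<comment> \<open>Enlarging the window by e S^2 on both sides costs a quarter of \<eta>^2 Q c
    S^2.\<close>
  define e where "e = rQ * rc * \<eta>\<^sup>2 / 8"
  have e0: "e > 0" using c0 Q0 \<eta> by (simp add: e_def)
  note L = box_side_limits
  have S0: "((\<lambda>S::real. 1 / S) \<longlongrightarrow> 0) at_top" by real_asymp
  have "\<eta> + \<eta>\<^sup>2 / 4 + 16 * (1 + \<eta>) * \<kappa> < \<eta> + \<eta>\<^sup>2"
  proof -
    have "\<eta>\<^sup>2 > 0" using \<eta> by simp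
    thus ?thesis using \<tau> unfolding \<kappa>_def by linarith
  qed
  hence ev1: "eventually (\<lambda>S. energy_bound \<eta> \<kappa> S < \<eta> + \<eta>\<^sup>2) at_top"
    using order_tendstoD(2)[OF energy_bound_tendsto[OF \<eta>(1), of \<kappa>]] by blast
  have ev2: "eventually (\<lambda>S. rH * box_side S / (2 * rc * S - rl) + 1 / box_side S < 1) at_top"
  proof -
    have "((\<lambda>S. rH * ((box_side S / S) / (2 * rc - rl * (1 / S))) + 1 / box_side S) \<longlongrightarrow> rH * (0 / (2 * rc - rl * 0)) + 0) at_top"
      using c0 by (intro tendsto_intros S0 L) auto
    hence "eventually (\<lambda>S. rH * ((box_side S / S) / (2 * rc - rl * (1 / S))) + 1 / box_side S < 1) at_top"
      by (intro order_tendstoD) auto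
    thus ?thesis using eventually_gt_at_top[of 0]
    proof eventually_elim
      case (elim S)
      have "2 * rc * S - rl = S * (2 * rc - rl * (1 / S))" using elim by (simp add: field_simps)
      thus ?case using elim by simp
    qed
  qed
  have ev3: "eventually (\<lambda>S. (\<bar>l\<bar> + Q * (\<bar>\<alpha>\<bar> + \<bar>l2\<bar> + \<bar>\<beta>\<bar>)) * (box_side S / S)\<^sup>2 + 2 * Q * \<bar>l0\<bar> * (1 / S) < e) at_top"
  proof -
    have "((\<lambda>S. (\<bar>l\<bar> + Q * (\<bar>\<alpha>\<bar> + \<bar>l2\<bar> + \<bar>\<beta>\<bar>)) * (box_side S / S)\<^sup>2 + 2 * Q * \<bar>l0\<bar> * (1 / S)) \<longlongrightarrow> real_of_int (\<bar>l\<bar> + Q * (\<bar>\<alpha>\<bar> + \<bar>l2\<bar> + \<bar>\<beta>\<bar>)) * 0\<^sup>2 + real_of_int (2 * Q * \<bar>l0\<bar>) * 0) at_top"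
      by (intro tendsto_intros S0 L)
    thus ?thesis using e0 by (intro order_tendstoD) auto
  qed
  have ev4: "eventually (\<lambda>S. 1 \<le> real_of_int (box_side S)) at_top" using L(5) unfolding filterlim_at_top by blast
  \<comment> \<open>The first bound makes \<open>lo\<close> positive, the second makes \<eta> S - 1
    positive, and the third lets the terms linear in \<open>S\<close> disappear in \<eta>^2
    S^2.\<close>
  have ev5: "eventually (\<lambda>S. S > rl \<and> S > 1 / \<eta> \<and> S > 40 / \<eta>\<^sup>2) at_top"
    by (intro eventually_conj eventually_gt_at_top)
  show ?thesis using ev1 ev2 ev3 ev4 ev5
  proof eventually_elim
    case (elim S)
    define T where "T = box_side S"
    define A where "A = rQ * rc"
    have A0: "A \<ge> 1"
    proof -
      have "1 * 1 \<le> rQ * rc" using Q c by (intro mult_mono) auto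
      thus ?thesis by (simp add: A_def)
    qed
    have S1: "S > 0" "S > 40 / \<eta>\<^sup>2" "\<eta> * S > 1" using elim \<eta> by (auto simp: field_simps)
    have T1: "T \<ge> 1" using elim by (simp add: T_def)
    have "2 * rc * S \<ge> 1 * S" using c S1 by (intro mult_right_mono) auto
    hence lo: "2 * rc * S - rl > 0" using elim by linarith
    define X where "X = Ss \<eta> S \<times> {0..<T} \<times> {0..<T}"
    note cS = card_Ss[OF \<eta>(1) S1(1)]
    have fX: "finite X" using cS by (simp add: X_def)
    define E where "E = card {(x, x') \<in> X \<times> X. \<mu>' x = \<mu>' x'}"
    have "real E \<le> T ^ 4 / (2 * rc * rQ) * energy_bound \<eta> \<kappa> S"
      unfolding E_def X_def T_def \<kappa>_def of_int_power
      by (rule energy_le[OF \<eta>(1) S1(1) _ lo _ tail]) (use T1 elim in \<open>auto simp: T_def\<close>)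
    also have "\<dots> \<le> T ^ 4 / (2 * rc * rQ) * (\<eta> + \<eta>\<^sup>2)"
      using elim c0 Q0 T1 by (intro mult_left_mono) auto
    also have "\<dots> = T ^ 4 * (\<eta> + \<eta>\<^sup>2) / (2 * A)" by (simp add: A_def mult.commute)
    finally have E: "real E \<le> T ^ 4 * (\<eta> + \<eta>\<^sup>2) / (2 * A)" .
    have cX: "real (card X) = card (Ss \<eta> S) * real_of_int T ^ 2"
      using T1 by (simp add: X_def card_cartesian_product power2_eq_square)
    have "(card X)\<^sup>2 \<le> card (\<mu>' ` X) * E" unfolding E_def by (rule card_squared_le_image_times_coincidences[OF fX])
    hence "real ((card X)\<^sup>2) \<le> real (card (\<mu>' ` X) * E)" by (rule of_nat_mono)
    hence "(card (Ss \<eta> S))\<^sup>2 * real_of_int T ^ 4 \<le> card (\<mu>' ` X) * real E" by (simp add: cX power_mult_distrib)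
    also have "\<dots> \<le> card (\<mu>' ` X) * (T ^ 4 * (\<eta> + \<eta>\<^sup>2) / (2 * A))" using E by (intro mult_left_mono) auto
    finally have "real_of_int T ^ 4 * (real (card (Ss \<eta> S)))\<^sup>2 \<le> real_of_int T ^ 4 * (card (\<mu>' ` X) * ((\<eta> + \<eta>\<^sup>2) / (2 * A)))"
      by (simp add: mult_ac)
    moreover have T4: "real_of_int T ^ 4 > 0" using T1 by simp
    ultimately have "(real (card (Ss \<eta> S)))\<^sup>2 \<le> card (\<mu>' ` X) * ((\<eta> + \<eta>\<^sup>2) / (2 * A))"
      by (simp only: mult_le_cancel_left_pos[OF T4])
    moreover have "(\<eta> * S - 1)\<^sup>2 \<le> (real (card (Ss \<eta> S)))\<^sup>2"
      using cS(3) S1(3) by (simp add: power_mono)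
    ultimately have q: "(\<eta> * S - 1)\<^sup>2 \<le> card (\<mu>' ` X) * ((\<eta> + \<eta>\<^sup>2) / (2 * A))" by linarith
    \<comment> \<open>A polynomial substitute for dividing (\<eta> S - 1)^2 by \<eta> +
      \<eta>^2.\<close>
    have img: "2 * A * (\<eta> * S\<^sup>2 - \<eta>\<^sup>2 * S\<^sup>2 - 2 * S) \<le> card (\<mu>' ` X)"
    proof -
      have "(\<eta> * S\<^sup>2 - \<eta>\<^sup>2 * S\<^sup>2 - 2 * S) * (\<eta> + \<eta>\<^sup>2) = (\<eta> * S - 1)\<^sup>2 - 1 - \<eta>^4 * S\<^sup>2 - 2 * \<eta>\<^sup>2 * S"
        by (simp add: algebra_simps power2_eq_square power4_eq_xxxx)
      also have "\<dots> \<le> (\<eta> * S - 1)\<^sup>2"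
      proof -
        have "\<eta>^4 * S\<^sup>2 \<ge> 0" "2 * \<eta>\<^sup>2 * S \<ge> 0" using S1 \<eta> by auto
        thus ?thesis by linarith
      qed
      also note q
      finally have "(2 * A * (\<eta> * S\<^sup>2 - \<eta>\<^sup>2 * S\<^sup>2 - 2 * S)) * (\<eta> + \<eta>\<^sup>2) \<le> card (\<mu>' ` X) * (\<eta> + \<eta>\<^sup>2)"
        using A0 by (simp add: field_simps)
      moreover have "\<eta> + \<eta>\<^sup>2 > 0" using \<eta> by (simp add: add_pos_pos)
      ultimately show ?thesis by (simp only: mult_le_cancel_right_pos)
    qed
    define N where "N = {m. (\<forall>t r s. \<mu> t r s \<noteq> m) \<and> rQ * rc * S\<^sup>2 < m \<and> m \<le> (1 + \<eta>)\<^sup>2 * (rQ * rc * S\<^sup>2)}"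
    define W where "W = {m::int. A * S\<^sup>2 - e * S\<^sup>2 \<le> m \<and> m \<le> A * ((1 + \<eta>)\<^sup>2 * S\<^sup>2) + e * S\<^sup>2}"
    have eS: "e * S\<^sup>2 \<ge> 0" using e0 by simp
    have NW: "N \<subseteq> W" unfolding N_def W_def A_def using eS by (auto simp: mult_ac)
    have XW: "\<mu>' ` X \<subseteq> W"
    proof (rule image_subsetI)
      fix x assume x: "x \<in> X"
      obtain s t r where e: "x = (s, t, r)" by (metis prod_cases3)
      have "s \<in> Ss \<eta> S" "t \<in> {0..<box_side S}" "r \<in> {0..<box_side S}" using x by (auto simp: e X_def T_def)
      from \<mu>_window[OF this S1(1) \<eta>] elim(3) show "\<mu>' x \<in> W" by (auto simp: e \<mu>'_def W_def A_def less_imp_le)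
    qed
    have NX: "N \<inter> \<mu>' ` X = {}" by (auto simp: N_def \<mu>'_def)
    have W: "finite W" "real (card W) \<le> A * ((1 + \<eta>)\<^sup>2 * S\<^sup>2) + e * S\<^sup>2 - (A * S\<^sup>2 - e * S\<^sup>2) + 1"
    proof -
      have "A * S\<^sup>2 \<le> A * ((1 + \<eta>)\<^sup>2 * S\<^sup>2)" using A0 \<eta> by (intro mult_left_mono) (auto simp: mult_le_cancel_right1)
      hence "A * S\<^sup>2 - e * S\<^sup>2 \<le> A * ((1 + \<eta>)\<^sup>2 * S\<^sup>2) + e * S\<^sup>2 + 1" using eS by linarith
      thus "finite W" "real (card W) \<le> A * ((1 + \<eta>)\<^sup>2 * S\<^sup>2) + e * S\<^sup>2 - (A * S\<^sup>2 - e * S\<^sup>2) + 1"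
        using card_int_real_interval[of W "A * S\<^sup>2 - e * S\<^sup>2" "A * ((1 + \<eta>)\<^sup>2 * S\<^sup>2) + e * S\<^sup>2"] by (auto simp: W_def)
    qed
    have "card N + card (\<mu>' ` X) = card (N \<union> \<mu>' ` X)"
      using finite_subset[OF NW W(1)] fX NX by (intro card_Un_disjoint[symmetric]) auto
    also have "\<dots> \<le> card W" using NW XW W(1) by (intro card_mono) auto
    finally have "card N + card (\<mu>' ` X) \<le> card W" .
    hence "real (card N) \<le> A * ((1 + \<eta>)\<^sup>2 * S\<^sup>2) + e * S\<^sup>2 - (A * S\<^sup>2 - e * S\<^sup>2) + 1 - 2 * A * (\<eta> * S\<^sup>2 - \<eta>\<^sup>2 * S\<^sup>2 - 2 * S)"
      using W(2) img by linarith
    also have "\<dots> = 3 * (A * \<eta>\<^sup>2 * S\<^sup>2) + 2 * (e * S\<^sup>2) + 1 + 4 * A * S"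
      by (simp add: algebra_simps power2_eq_square)
    also have "\<dots> \<le> 4 * (A * \<eta>\<^sup>2 * S\<^sup>2)"
    proof -
      have 1: "2 * (e * S\<^sup>2) = (A * \<eta>\<^sup>2 * S\<^sup>2) / 4" by (simp add: e_def A_def)
      have "40 \<le> \<eta>\<^sup>2 * S" using S1(2) \<eta> by (simp add: field_simps)
      hence "40 * (A * S) \<le> (\<eta>\<^sup>2 * S) * (A * S)" using A0 S1 by (intro mult_right_mono) auto
      hence 2: "40 * (A * S) \<le> A * \<eta>\<^sup>2 * S\<^sup>2" by (simp add: power2_eq_square mult_ac)
      have "S > 1" using S1(3) \<eta> mult_right_mono[of \<eta> 1 S] S1(1) by linarith
      hence "1 * 1 \<le> A * S" using A0 by (intro mult_mono) auto
      thus ?thesis using 1 2 by linarith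
    qed
    finally show ?case unfolding N_def A_def by (simp add: mult_ac)
  qed
qed

text \<open>A loss of 4 \<eta>^2 in a window of relative length 2 \<eta> + \<eta>^2 is a proportion
  of at most 2 \<eta>; a further \<eta> Y absorbs the initial part.\<close>

theorem unrepresented_density_le:
  fixes \<eta> \<tau> :: real
  assumes \<eta>: "0 < \<eta>" "\<eta> \<le> 1/2"
    and tail: "\<And>K. (\<Sum>h\<in>{h\<in>{2..K}. coprime h Q}. e32 h) \<le> \<tau>"
    and \<tau>: "16 * (1 + \<eta>) * ((1 + \<tau>)\<^sup>2 - 1) \<le> \<eta>\<^sup>2 / 4"
  shows "\<exists>N0. \<forall>Y\<ge>N0. real (card {m. (\<forall>t r s. \<mu> t r s \<noteq> m) \<and> 0 < m \<and> real_of_int m \<le> Y}) \<le> 3 * \<eta> * Y"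
proof -
  define U where "U = {m. \<forall>t r s. \<mu> t r s \<noteq> m}"
  define A where "A = rQ * rc"
  have A0: "A > 0" using Q c by (simp add: A_def)
  obtain S0 where S0: "\<And>S. S \<ge> S0 \<Longrightarrow> real (card {m\<in>U. A * S\<^sup>2 < m \<and> m \<le> (1 + \<eta>)\<^sup>2 * (A * S\<^sup>2)}) \<le> 4 * \<eta>\<^sup>2 * (A * S\<^sup>2)"
    using unrepresented_window[OF \<eta> tail \<tau>] unfolding eventually_at_top_linorder U_def A_def by auto
  define S1 where "S1 = max S0 1"
  define X0 where "X0 = A * S1\<^sup>2"
  have X0: "X0 > 0" using A0 by (simp add: X0_def S1_def)
  have W: "real (card {m\<in>U. X < m \<and> m \<le> (1 + \<eta>)\<^sup>2 * X}) \<le> (4 * \<eta>\<^sup>2) * X" if "X \<ge> X0" for X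
  proof -
    define S where "S = sqrt (X / A)"
    have "X / A \<ge> S1\<^sup>2" using that A0 by (simp add: X0_def field_simps)
    hence "S \<ge> S1" unfolding S_def by (intro real_le_rsqrt)
    moreover have "A * S\<^sup>2 = X" using A0 X0 that by (simp add: S_def)
    ultimately show ?thesis using S0[of S] by (simp add: S1_def)
  qed
  define \<Lambda> where "\<Lambda> = (1 + \<eta>)\<^sup>2"
  have "\<Lambda> - 1 = 2 * \<eta> + \<eta> * \<eta>" by (simp add: \<Lambda>_def power2_eq_square algebra_simps)
  moreover have "\<eta> * \<eta> > 0" using \<eta> by simp
  ultimately have L: "\<Lambda> > 1" "\<Lambda> - 1 \<ge> 2 * \<eta>" using \<eta> by linarith+
  have k: "4 * \<eta>\<^sup>2 / (\<Lambda> - 1) \<le> 2 * \<eta>"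
  proof -
    have "4 * \<eta>\<^sup>2 / (\<Lambda> - 1) \<le> 4 * \<eta>\<^sup>2 / (2 * \<eta>)" using L \<eta> by (intro divide_left_mono) auto
    thus ?thesis using \<eta> by (simp add: power2_eq_square)
  qed
  have "real (card {m\<in>U. 0 < m \<and> real_of_int m \<le> Y}) \<le> 3 * \<eta> * Y" if Y: "Y \<ge> max 1 (\<Lambda> * X0 / \<eta>)" for Y
  proof -
    have "real (card {m\<in>U. 0 < m \<and> real_of_int m \<le> Y}) \<le> \<Lambda> * X0 + 4 * \<eta>\<^sup>2 / (\<Lambda> - 1) * Y"
      by (rule density_le_of_windows[OF L(1) _ X0 W[folded \<Lambda>_def]]) (use Y in auto)
    also have "4 * \<eta>\<^sup>2 / (\<Lambda> - 1) * Y \<le> 2 * \<eta> * Y" using k Y by (intro mult_right_mono) auto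
    also have "\<Lambda> * X0 \<le> \<eta> * Y" using Y \<eta> by (simp add: field_simps)
    finally show ?thesis by (simp add: mult_ac)
  qed
  thus ?thesis unfolding U_def by (intro exI[of _ "max 1 (\<Lambda> * X0 / \<eta>)"]) auto
qed

end

section \<open>Local and global representation\<close>

definition polar :: "int tform \<Rightarrow> int ^ 3 \<Rightarrow> int ^ 3 \<Rightarrow> int" where
  "polar f x y = tform_eval f (x + y) - tform_eval f x - tform_eval f y"

lemma tform_eval_add: "tform_eval f (x + y) = tform_eval f x + tform_eval f y + polar f x y"
  by (simp add: polar_def)

lemma tform_eval_scale: "tform_eval f (k *s x) = k\<^sup>2 * tform_eval f x"
  by (cases f) (simp add: power2_eq_square algebra_simps)

lemma polar_add_left: "polar f (x + y) z = polar f x z + polar f y z"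
  by (cases f) (simp add: polar_def power2_eq_square algebra_simps)

lemma polar_scale_left: "polar f (k *s x) y = k * polar f x y"
  by (cases f) (simp add: polar_def power2_eq_square algebra_simps)

lemma polar_sym: "polar f x y = polar f y x"
  by (simp add: polar_def add.commute)

lemma polar_add_right: "polar f z (x + y) = polar f z x + polar f z y"
  by (metis polar_add_left polar_sym)

lemma polar_scale_right: "polar f y (k *s x) = k * polar f y x"
  by (metis polar_scale_left polar_sym)

lemma polar_self: "polar f x x = 2 * tform_eval f x"
  by (cases f) (simp add: polar_def power2_eq_square algebra_simps)

lemmas polar_simps = polar_add_left polar_add_right polar_scale_left polar_scale_right polar_self

lemma tform_eval_0 [simp]: "tform_eval f 0 = 0"
  by (cases f) simp

lemma polar_eq_sum_axis:
  "polar f x y = (\<Sum>i\<in>UNIV. y $ i * polar f x (axis i 1))"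
proof -
  have y: "y = (y $ 1) *s axis 1 1 + (y $ 2) *s axis 2 1 + (y $ 3) *s axis 3 1"
    by (simp add: vec_eq_iff forall_3 axis_def)
  show ?thesis by (subst y) (simp only: polar_add_right polar_scale_right sum_3)
qed

text \<open>By compactness these are the integers represented over the p-adic integers. Stated by
  congruences, the notion needs the p-adic field only where the ADC condition enters.\<close>

definition Loc :: "int tform \<Rightarrow> nat \<Rightarrow> int set" where
  "Loc f p = {n. \<forall>k. \<exists>x. int p ^ k dvd tform_eval f x - n}"

lemma LocD: "n \<in> Loc f p \<Longrightarrow> \<exists>x. int p ^ k dvd tform_eval f x - n" by (auto simp: Loc_def)

lemma range_subset_Loc: "range (tform_eval f) \<subseteq> Loc f p"
  by (auto simp: Loc_def) (metis diff_self dvd_0_right)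

lemma dvd_power_mono_int: "(p::int) ^ k dvd a \<Longrightarrow> j \<le> k \<Longrightarrow> p ^ j dvd a"
  by (meson dvd_trans le_imp_power_dvd)

text \<open>Newton lifting one power of \<open>p\<close> at a time. The factor \<open>p\<close>
  before the quadratic coefficient makes the derivative congruent to the unit \<open>b\<close>
  everywhere, also for p = 2.\<close>

lemma hensel_exists:
  fixes b c k :: int
  assumes p: "prime p" and b: "\<not> int p dvd b"
  shows "\<exists>x. int p ^ n dvd b * x + int p * k * x\<^sup>2 - c"
proof (induction n)
  case (Suc n)
  define P where "P = int p"
  have "prime P" using p by (simp add: P_def)
  hence cop: "coprime b P" using b by (metis P_def coprime_commute prime_imp_coprime)
  obtain x j where x: "b * x + P * k * x\<^sup>2 - c = P ^ n * j" using Suc by (auto simp: P_def)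
  obtain y where y: "[b * y = - j] (mod P)" using cong_solve_coprime_int[OF cop]
    by (metis cong_scalar_right mult.assoc mult_1 cong_def)
  hence "P dvd b * y + j" by (simp add: cong_iff_dvd_diff)
  then obtain i where i: "b * y + j = P * i" by blast
  have "b * (x + P ^ n * y) + P * k * (x + P ^ n * y)\<^sup>2 - c
      = (b * x + P * k * x\<^sup>2 - c) + P ^ n * (b * y) + P ^ Suc n * (k * (2 * x * y + P ^ n * y\<^sup>2))"
    by (simp add: algebra_simps power2_eq_square)
  also have "\<dots> = P ^ n * (b * y + j) + P ^ Suc n * (k * (2 * x * y + P ^ n * y\<^sup>2))"
    unfolding x by (simp add: algebra_simps)
  also have "\<dots> = P ^ Suc n * (i + k * (2 * x * y + P ^ n * y\<^sup>2))"
    unfolding i by (simp add: algebra_simps)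
  finally show ?case unfolding P_def by (metis dvd_triv_left)
qed simp

text \<open>The difference of the two equations is \<open>x - y\<close> times a number congruent to
  \<open>b\<close> modulo \<open>p\<close>.\<close>

lemma hensel_unique:
  fixes b c k :: int
  assumes p: "prime p" and b: "\<not> int p dvd b"
    and "int p ^ n dvd b * x + int p * k * x\<^sup>2 - c" "int p ^ n dvd b * y + int p * k * y\<^sup>2 - c"
  shows "int p ^ n dvd x - y"
proof -
  have "int p ^ n dvd (b * x + int p * k * x\<^sup>2 - c) - (b * y + int p * k * y\<^sup>2 - c)"
    using assms(3,4) by (rule dvd_diff)
  hence d: "int p ^ n dvd (x - y) * (b + int p * (k * (x + y)))" by (simp add: algebra_simps power2_eq_square)
  have "\<not> int p dvd b + int p * (k * (x + y))" using b by (simp add: dvd_add_left_iff)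
  hence "coprime (int p ^ n) (b + int p * (k * (x + y)))"
    using p by (metis coprime_power_left_iff prime_imp_coprime prime_nat_int_transfer)
  thus ?thesis using d by (simp add: coprime_dvd_mult_left_iff)
qed

text \<open>Euler's identity: the polar form of \<open>x\<close> with itself is twice the value at
  \<open>x\<close>. If p^(K+1) divided all partial derivatives, it would divide 2 n. Removing the 2
  costs one power of \<open>p\<close>, and only for p = 2; hence the exponents \<open>K\<close> and
  \<open>Suc K\<close>.\<close>

lemma exists_axis_not_dvd:
  assumes p: "prime p" and n: "\<not> int p ^ K dvd n" and x: "int p ^ Suc K dvd tform_eval f x - n"
  shows "\<exists>i. \<not> int p ^ Suc K dvd polar f x (axis i 1)"
proof (rule ccontr)
  assume "\<not> ?thesis"
  hence "int p ^ Suc K dvd polar f x x"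
    unfolding polar_eq_sum_axis[of f x x] by (intro dvd_sum) auto
  hence "int p ^ Suc K dvd 2 * tform_eval f x" by (simp add: polar_self)
  moreover have "int p ^ Suc K dvd 2 * (tform_eval f x - n)" using x by (rule dvd_mult)
  ultimately have "int p ^ Suc K dvd 2 * tform_eval f x - 2 * (tform_eval f x - n)" by (rule dvd_diff)
  hence d: "int p ^ Suc K dvd 2 * n" by (simp add: algebra_simps)
  have "int p ^ K dvd n"
  proof (cases "p = 2")
    case True thus ?thesis using d by simp
  next
    case False
    have "coprime p 2" by (rule primes_coprime[OF p two_is_prime_nat False])
    hence "coprime (int p) 2" by (metis coprime_int_iff of_nat_numeral)
    hence "coprime (int p ^ Suc K) 2" by (simp del: power_Suc)
    hence "int p ^ Suc K dvd n" using d by (simp only: coprime_dvd_mult_right_iff)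
    thus ?thesis by (rule dvd_power_mono_int) simp
  qed
  thus False using n by simp
qed

section \<open>Local solutions transversal to a given direction\<close>

lemma prime_power_split:
  fixes a :: int
  assumes p: "prime p" and a: "\<not> int p ^ Suc K dvd a"
  obtains r b where "a = int p ^ r * b" "\<not> int p dvd b" "r \<le> K"
proof -
  have a0: "a \<noteq> 0" using a by auto
  have "\<not> is_unit (int p)" using p by (auto simp: prime_gt_1_nat not_prime_unit)
  then obtain b where b: "a = int p ^ multiplicity (int p) a * b" "\<not> int p dvd b"
    using multiplicity_decompose'[of a "int p"] a0 by (metis mult.commute)
  moreover have "multiplicity (int p) a \<le> K"
  proof (rule ccontr)
    assume "\<not> ?thesis"
    hence "int p ^ Suc K dvd a" by (intro multiplicity_dvd') simp
    thus False using a by simp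
  qed
  ultimately show ?thesis using that by blast
qed

text \<open>If the coordinate along \<open>h\<close> degenerates at \<open>p\<close>, move a solution by \<open>p\<^sup>J h\<close> and
  correct it along a coordinate axis transversal to the quadric.\<close>

lemma Loc_transversal:
  assumes p: "prime p" and h: "tform_eval f h \<noteq> 0"
  obtains J where "\<And>n L. n \<in> Loc f p \<Longrightarrow> \<not> int p ^ K dvd n \<Longrightarrow>
    \<exists>x. int p ^ L dvd tform_eval f x - n \<and> \<not> int p ^ J dvd polar f x h"
proof -
  define P where "P = int p"
  have P: "prime P" using p by (simp add: P_def)
  have P1: "P > 1" using p prime_gt_1_nat by (simp add: P_def)
  define \<alpha> where "\<alpha> = tform_eval f h"
  obtain A where A: "\<not> P ^ A dvd 2 * \<alpha>"
  proof -
    have "finite {k. P ^ k dvd 2 * \<alpha>}" using h P by (intro finite_divisor_powers) (auto simp: \<alpha>_def not_prime_unit)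
    hence "{k. P ^ k dvd 2 * \<alpha>} \<noteq> UNIV" by auto
    thus ?thesis using that by blast
  qed
  \<comment> \<open>\<open>j\<close> exceeds r + A for every valuation r \<le> K that can occur
    below.\<close>
  define j where "j = K + A + 1"
  have "\<exists>x. P ^ L dvd tform_eval f x - n \<and> \<not> P ^ (2 * j) dvd polar f x h"
    if n: "n \<in> Loc f p" "\<not> P ^ K dvd n" for n L
  proof -
    define M where "M = L + 2 * j"
    obtain x where x: "P ^ M dvd tform_eval f x - n" using LocD[OF n(1)] unfolding P_def by blast
    have xL: "P ^ L dvd tform_eval f x - n" using x by (rule dvd_power_mono_int) (simp add: M_def)
    show ?thesis
    proof (cases "P ^ (2 * j) dvd polar f x h")
      case False thus ?thesis using xL by blast
    next
      case True
      have "P ^ Suc K dvd tform_eval f x - n" using x by (rule dvd_power_mono_int) (simp add: M_def j_def)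
      then obtain i where i: "\<not> P ^ Suc K dvd polar f x (axis i 1)"
        using exists_axis_not_dvd[OF p] n(2) unfolding P_def by blast
      define g where "g = (axis i 1 :: int ^ 3)"
      obtain r b0 where rb0: "polar f x g = P ^ r * b0" "\<not> P dvd b0" "r \<le> K"
        using prime_power_split[OF p] i unfolding P_def g_def by metis
      define b where "b = b0 + P ^ (j - r) * polar f h g"
      have rj: "r < j" using rb0 by (simp add: j_def)
      have b: "\<not> P dvd b" unfolding b_def using rb0(2) rj by (simp add: dvd_add_left_iff)
      have pb: "polar f x g + P ^ j * polar f h g = P ^ r * b"
        using rj unfolding b_def rb0 by (simp add: distrib_left flip: power_add mult.assoc)
      obtain y where y: "polar f x h = P ^ (2 * j) * y" using True by blast
      \<comment> \<open>The excess of the exponent 2 j over 2 r + 1; the correction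
        \<open>\<mu>\<close> turns out to be divisible by p^q.\<close>
      define q where "q = 2 * j - (2 * r + 1)"
      have q: "2 * j = (2 * r + 1) + q" using rj by (simp add: q_def)
      define R where "R = P ^ q * (P ^ j * y + \<alpha>)"
      have R: "P ^ j * polar f x h + (P ^ j)\<^sup>2 * \<alpha> = P ^ (2 * r + 1) * R"
      proof -
        have "P ^ j * polar f x h + (P ^ j)\<^sup>2 * \<alpha> = P ^ (2 * j) * (P ^ j * y + \<alpha>)"
          unfolding y by (simp add: algebra_simps power_mult power_even_eq)
        also have "P ^ (2 * j) = P ^ (2 * r + 1) * P ^ q" by (subst q) (simp add: power_add)
        finally show ?thesis by (simp add: R_def mult.assoc)
      qed
      obtain \<mu> where \<mu>: "P ^ M dvd b * \<mu> + P * tform_eval f g * \<mu>\<^sup>2 - (- R)"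
        using hensel_exists[OF p, of b M "tform_eval f g" "- R"] b unfolding P_def by blast
      define z where "z = x + P ^ j *s h + (P ^ (r + 1) * \<mu>) *s g"
      have fz: "tform_eval f z - n = (tform_eval f x - n) + P ^ (2 * r + 1) * (b * \<mu> + P * tform_eval f g * \<mu>\<^sup>2 - (- R))"
      proof -
        have "tform_eval f z = tform_eval f x + (P ^ j * polar f x h + (P ^ j)\<^sup>2 * \<alpha>)
           + P ^ (r + 1) * \<mu> * (polar f x g + P ^ j * polar f h g) + (P ^ (r + 1) * \<mu>)\<^sup>2 * tform_eval f g"
          unfolding z_def tform_eval_add tform_eval_scale polar_simps \<alpha>_def by (simp add: algebra_simps)
        also have "\<dots> = tform_eval f x + P ^ (2 * r + 1) * R + P ^ (r + 1) * \<mu> * (P ^ r * b) + (P ^ (r + 1) * \<mu>)\<^sup>2 * tform_eval f g"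
          unfolding R pb by simp
        also have "P ^ (r + 1) * \<mu> * (P ^ r * b) = P ^ (2 * r + 1) * (b * \<mu>)"

        proof -
          have "P ^ (2 * r + 1) = P ^ (r + 1) * P ^ r" by (simp add: mult_2 flip: power_add)
          thus ?thesis by (simp only: mult_ac)
        qed
        also have "(P ^ (r + 1) * \<mu>)\<^sup>2 = P ^ (2 * r + 1) * (P * \<mu>\<^sup>2)"

        proof -
          have "P ^ (2 * r + 1) * P = P ^ (r + 1) * P ^ (r + 1)" by (simp add: mult_2 flip: power_add)
          hence "P ^ (2 * r + 1) * (P * (\<mu> * \<mu>)) = P ^ (r + 1) * P ^ (r + 1) * (\<mu> * \<mu>)" by (simp only: mult.assoc[symmetric])
          thus ?thesis by (simp only: power2_eq_square mult_ac)
        qed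
        finally show ?thesis by (simp add: algebra_simps)
      qed
      have "P ^ M dvd tform_eval f z - n" unfolding fz by (intro dvd_add x dvd_mult \<mu>)
      hence zL: "P ^ L dvd tform_eval f z - n" by (rule dvd_power_mono_int) (simp add: M_def)
      \<comment> \<open>The correction along \<open>g\<close> changes the polar form with
        \<open>h\<close> by a multiple of p^(2j - r), whereas the move along \<open>h\<close>
        changes it by 2 \<alpha> p^j, which is not divisible by p^(2j - r).\<close>
      have "\<not> P ^ (2 * j) dvd polar f z h"
      proof
        assume D: "P ^ (2 * j) dvd polar f z h"
        have "P ^ q dvd b * \<mu> + P * tform_eval f g * \<mu>\<^sup>2 - 0"
        proof -
          have "P ^ q dvd b * \<mu> + P * tform_eval f g * \<mu>\<^sup>2 - (- R)" using \<mu> by (rule dvd_power_mono_int) (simp add: M_def q_def)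
          moreover have "P ^ q dvd R" by (simp add: R_def)
          ultimately have "P ^ q dvd (b * \<mu> + P * tform_eval f g * \<mu>\<^sup>2 - (- R)) - R" by (rule dvd_diff)
          thus ?thesis by simp
        qed
        hence "P ^ q dvd \<mu> - 0"
          using hensel_unique[OF p, of b q \<mu> "tform_eval f g" 0 0] b unfolding P_def by simp
        then obtain m where m: "\<mu> = P ^ q * m" by auto
        have e: "r + 1 + q = 2 * j - r" using rj by (simp add: q_def)
        have le: "P ^ (2 * j - r) dvd P ^ (2 * j)" by (rule le_imp_power_dvd) simp
        have "polar f z h = polar f x h + P ^ j * (2 * \<alpha>) + P ^ (r + 1) * \<mu> * polar f g h"
          unfolding z_def polar_simps \<alpha>_def by simp
        hence "P ^ j * (2 * \<alpha>) = polar f z h - polar f x h - P ^ (2 * j - r) * (m * polar f g h)"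
          unfolding m e[symmetric] by (simp add: power_add algebra_simps)
        moreover have "P ^ (2 * j - r) dvd polar f z h - polar f x h - P ^ (2 * j - r) * (m * polar f g h)"
          using D True le by (intro dvd_diff) (auto intro: dvd_trans)
        ultimately have "P ^ (2 * j - r) dvd P ^ j * (2 * \<alpha>)" by simp
        moreover have "P ^ (2 * j - r) = P ^ j * P ^ (j - r)" using rj by (simp add: mult_2 flip: power_add)
        ultimately have "P ^ (j - r) dvd 2 * \<alpha>" using P1 by simp
        hence "P ^ A dvd 2 * \<alpha>" by (rule dvd_power_mono_int) (use rb0 in \<open>simp add: j_def\<close>)
        thus False using A by simp
      qed
      thus ?thesis using zL by blast
    qed
  qed
  thus ?thesis using that[of "2 * j"] by (simp add: P_def)
qed

section \<open>Primes without local condition, and p-adic squares\<close>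

lemma quadratic_residues_card:
  assumes p: "prime p" "odd p"
  shows "card ((\<lambda>z. z\<^sup>2 mod int p) ` {0..int (p div 2)}) = p div 2 + 1"
proof -
  have "inj_on (\<lambda>z. z\<^sup>2 mod int p) {0..int (p div 2)}"
  proof (rule inj_onI)
    fix x y assume xy: "x \<in> {0..int (p div 2)}" "y \<in> {0..int (p div 2)}" "x\<^sup>2 mod int p = y\<^sup>2 mod int p"
    have "int p dvd x\<^sup>2 - y\<^sup>2" using xy(3) by (simp add: mod_eq_dvd_iff)
    hence "int p dvd (x - y) * (x + y)" by (simp add: power2_eq_square algebra_simps)
    hence d: "int p dvd x - y \<or> int p dvd x + y" using p by (simp add: prime_dvd_mult_iff)
    have "int p = 2 * int (p div 2) + 1" using p(2) by presburger
    hence b: "x + y < int p" "0 \<le> x + y" "\<bar>x - y\<bar> < int p" using xy by auto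
    from d show "x = y"
    proof
      assume "int p dvd x - y"
      thus ?thesis using b dvd_imp_le_int[of "x - y" "int p"] by force
    next
      assume "int p dvd x + y"
      hence "x + y = 0" using b zdvd_not_zless[of "x + y" "int p"] by fastforce
      thus ?thesis using xy by auto
    qed
  qed
  thus ?thesis by (subst card_image) auto
qed

text \<open>Pigeonhole: a x^2 and n - c - b y^2 each take (p + 1)/2 values modulo \<open>p\<close>,
  so they have one in common.\<close>

lemma ternary_mod_prime:
  fixes a b c n :: int
  assumes p: "prime p" "odd p" and "\<not> int p dvd a" "\<not> int p dvd b"
  shows "\<exists>x y. int p dvd a * x\<^sup>2 + b * y\<^sup>2 + c - n"
proof -
  define Sq where "Sq = (\<lambda>z. z\<^sup>2 mod int p) ` {0..int (p div 2)}"
  have p0: "int p > 0" using p by (simp add: prime_gt_0_nat)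
  define F where "F s = (a * s) mod int p" for s
  define G where "G s = (n - c - b * s) mod int p" for s
  have Sq: "Sq \<subseteq> {0..<int p}" using p0 by (auto simp: Sq_def)
  have inj: "x = y" if xy: "x \<in> {0..<int p}" "y \<in> {0..<int p}" "int p dvd k * (x - y)" "\<not> int p dvd k" for x y k
  proof -
    have "int p dvd x - y" using xy p by (simp add: prime_dvd_mult_iff)
    hence "x mod int p = y mod int p" by (simp add: mod_eq_dvd_iff)
    thus ?thesis using xy by simp
  qed
  have iF: "inj_on F Sq"
  proof (rule inj_onI)
    fix x y assume *: "x \<in> Sq" "y \<in> Sq" "F x = F y"
    hence "int p dvd a * (x - y)" by (simp add: F_def mod_eq_dvd_iff algebra_simps)
    moreover have "x \<in> {0..<int p}" "y \<in> {0..<int p}" using Sq * by auto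
    ultimately show "x = y" using inj assms by blast
  qed
  have iG: "inj_on G Sq"
  proof (rule inj_onI)
    fix x y assume *: "x \<in> Sq" "y \<in> Sq" "G x = G y"
    hence "int p dvd b * (y - x)" by (simp add: G_def mod_eq_dvd_iff algebra_simps)
    moreover have "x \<in> {0..<int p}" "y \<in> {0..<int p}" using Sq * by auto
    ultimately have "y = x" using inj assms by blast
    thus "x = y" by simp
  qed
  have cS: "card Sq = p div 2 + 1" unfolding Sq_def by (rule quadratic_residues_card[OF p])
  have fS: "finite Sq" by (simp add: Sq_def)
  have "F ` Sq \<inter> G ` Sq \<noteq> {}"
  proof
    assume emp: "F ` Sq \<inter> G ` Sq = {}"
    have "card (F ` Sq \<union> G ` Sq) = 2 * (p div 2 + 1)"
      using emp fS iF iG cS by (simp add: card_Un_disjoint card_image)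
    moreover have "card (F ` Sq \<union> G ` Sq) \<le> card {0..<int p}"
      using p0 by (intro card_mono) (auto simp: F_def G_def)
    ultimately show False using p(2) by simp
  qed
  then obtain s s' where s: "s \<in> Sq" "s' \<in> Sq" "F s = G s'" by blast
  obtain x where x: "s = x\<^sup>2 mod int p" using s by (auto simp: Sq_def)
  obtain y where y: "s' = y\<^sup>2 mod int p" using s by (auto simp: Sq_def)
  have "(a * x\<^sup>2) mod int p = (n - c - b * y\<^sup>2) mod int p"
    using s(3) unfolding F_def G_def x y by (metis mod_diff_right_eq mod_mult_right_eq)
  hence "int p dvd a * x\<^sup>2 + b * y\<^sup>2 + c - n" by (simp add: mod_eq_dvd_iff algebra_simps)
  thus ?thesis by blast
qed

text \<open>The coordinate along \<open>h2\<close> is kept congruent to 1. The derivative in it is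
  then the unit 2 c, even for \<open>n\<close> divisible by \<open>p\<close>, and a solution modulo
  \<open>p\<close> lifts.\<close>

lemma Loc_unramified:
  assumes p: "prime p" and orth: "polar f e h1 = 0" "polar f e h2 = 0" "polar f h1 h2 = 0"
    and nd: "\<not> int p dvd 2 * tform_eval f e * tform_eval f h1 * tform_eval f h2"
  shows "Loc f p = UNIV"
proof -
  define a b c where "a = tform_eval f e" and "b = tform_eval f h1" and "c = tform_eval f h2"
  have pp: "prime (int p)" using p by simp
  have nd': "\<not> int p dvd 2" "\<not> int p dvd a" "\<not> int p dvd b" "\<not> int p dvd c"
    using nd by (auto simp: a_def b_def c_def)
  have "odd p"
  proof
    assume "even p"
    hence "p = 2" using p primes_dvd_imp_eq two_is_prime_nat by blast
    thus False using nd'(1) by simp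
  qed
  have "n \<in> Loc f p" for n
    unfolding Loc_def
  proof (intro CollectI allI)
    fix k
    obtain x y where xy: "int p dvd a * x\<^sup>2 + b * y\<^sup>2 + c - n"
      using ternary_mod_prime[OF p \<open>odd p\<close> nd'(2,3)] by blast
    then obtain j where j: "a * x\<^sup>2 + b * y\<^sup>2 + c - n = int p * j" by blast
    have "\<not> int p dvd 2 * c" using nd' pp by (simp add: prime_dvd_mult_iff)
    then obtain m where m: "int p ^ k dvd 2 * c * m + int p * c * m\<^sup>2 - (- j)"
      using hensel_exists[OF p] by blast
    define v where "v = x *s e + y *s h1 + (1 + int p * m) *s h2"
    have "tform_eval f v = a * x\<^sup>2 + b * y\<^sup>2 + c * (1 + int p * m)\<^sup>2"
      using orth unfolding v_def tform_eval_add tform_eval_scale polar_simps a_def b_def c_def by (simp add: algebra_simps)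
    hence "tform_eval f v - n = (a * x\<^sup>2 + b * y\<^sup>2 + c - n) + int p * (2 * c * m + int p * c * m\<^sup>2)"
      by (simp add: algebra_simps power2_eq_square)
    also have "\<dots> = int p * (2 * c * m + int p * c * m\<^sup>2 - (- j))" unfolding j by (simp add: algebra_simps)
    finally show "\<exists>x. int p ^ k dvd tform_eval f x - n" using m by (metis dvd_mult)
  qed
  thus ?thesis by auto
qed

text \<open>The root is sought as a + 4 m for p = 2, where agreement modulo 8 is needed, and as a +
  p m for odd \<open>p\<close>. After division both become the equation of
  \<open>hensel_exists\<close>.\<close>

lemma padic_square:
  fixes a u :: int
  assumes p: "prime p" and a: "\<not> int p dvd a" and u: "int p ^ (if p = 2 then 3 else 1) dvd u - a\<^sup>2"
  shows "\<exists>z. int p ^ k dvd z\<^sup>2 - u"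
proof (cases "p = 2")
  case True
  obtain j where j: "u - a\<^sup>2 = 8 * j" using u True by auto
  obtain m where m: "int p ^ k dvd a * m + int p * 1 * m\<^sup>2 - j" using hensel_exists[OF p a] by blast
  have "(a + 4 * m)\<^sup>2 - u = 8 * (a * m + int p * 1 * m\<^sup>2 - j)"
    using j True by (simp add: algebra_simps power2_eq_square)
  thus ?thesis using m by (metis dvd_mult)
next
  case False
  obtain j where j: "u - a\<^sup>2 = int p * j" using u False by auto
  have pp: "prime (int p)" using p by simp
  have "\<not> int p dvd 2" using False p by (metis of_nat_dvd_iff of_nat_numeral primes_dvd_imp_eq two_is_prime_nat)
  hence "\<not> int p dvd 2 * a" using a pp by (simp add: prime_dvd_mult_iff)
  then obtain m where m: "int p ^ k dvd 2 * a * m + int p * 1 * m\<^sup>2 - j" using hensel_exists[OF p] by blast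
  have "(a + int p * m)\<^sup>2 - u = int p * (2 * a * m + int p * 1 * m\<^sup>2 - j)"
    using j by (simp add: algebra_simps power2_eq_square)
  thus ?thesis using m by (metis dvd_mult)
qed

lemma Loc_mult_padic_square:
  assumes n: "n \<in> Loc f p" and u: "\<And>k. \<exists>z. int p ^ k dvd z\<^sup>2 - u"
  shows "u * n \<in> Loc f p"
  unfolding Loc_def
proof (intro CollectI allI)
  fix k
  obtain x where x: "int p ^ k dvd tform_eval f x - n" using LocD[OF n] by blast
  obtain z where z: "int p ^ k dvd z\<^sup>2 - u" using u by blast
  have "tform_eval f (z *s x) - u * n = z\<^sup>2 * (tform_eval f x - n) + (z\<^sup>2 - u) * n"
    by (simp add: tform_eval_scale algebra_simps)
  thus "\<exists>x. int p ^ k dvd tform_eval f x - u * n" using x z by (metis dvd_add dvd_mult dvd_mult2)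
qed

lemma Loc_cancel_unit_square:
  assumes p: "prime p" and z: "\<not> int p dvd z" and n: "z\<^sup>2 * n \<in> Loc f p"
  shows "n \<in> Loc f p"
  unfolding Loc_def
proof (intro CollectI allI)
  fix k
  obtain x where x: "int p ^ k dvd tform_eval f x - z\<^sup>2 * n" using LocD[OF n] by blast
  have "coprime z (int p ^ k)" using z p by (metis coprime_commute coprime_power_left_iff prime_imp_coprime prime_nat_int_transfer)
  then obtain y where "[z * y = 1] (mod int p ^ k)" using cong_solve_coprime_int by blast
  hence y: "int p ^ k dvd z * y - 1" by (simp add: cong_iff_dvd_diff)
  have "tform_eval f (y *s x) - n = y\<^sup>2 * (tform_eval f x - z\<^sup>2 * n) + (z * y - 1) * ((z * y + 1) * n)"
    by (simp add: tform_eval_scale algebra_simps power2_eq_square)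
  thus "\<exists>x. int p ^ k dvd tform_eval f x - n" using x y by (metis dvd_add dvd_mult dvd_mult2)
qed

section \<open>From residue classes of vectors to almost all integers\<close>

lemma tform_eval_cong:
  assumes "\<And>i. m dvd (x - y) $ i"
  shows "m dvd tform_eval f x - tform_eval f y" "m dvd polar f x h - polar f y h"
proof -
  have "\<forall>i. \<exists>z. (x - y) $ i = m * z" using assms by blast
  then obtain z where z: "\<And>i. (x - y) $ i = m * z i" by metis
  have "x - y = m *s (\<chi> i. z i)" using z by (simp add: vec_eq_iff)
  hence x: "x = y + m *s (\<chi> i. z i)" by (metis add.commute diff_add_cancel)
  show "m dvd tform_eval f x - tform_eval f y" "m dvd polar f x h - polar f y h"
    unfolding x tform_eval_add tform_eval_scale polar_simps by (simp_all add: power2_eq_square)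
qed

lemma chinese_remainder_vec:
  fixes X :: "nat \<Rightarrow> int ^ 3"
  assumes "finite P" "\<And>p. p \<in> P \<Longrightarrow> prime p"
  shows "\<exists>x. \<forall>p\<in>P. \<forall>i. int p ^ L dvd (x - X p) $ i"
  using assms
proof (induction P rule: finite_induct)
  case (insert p P)
  then obtain x where x: "\<forall>p\<in>P. \<forall>i. int p ^ L dvd (x - X p) $ i" by auto
  define M where "M = (\<Prod>q\<in>P. int q ^ L)"
  have "coprime M (int p ^ L)"
    unfolding M_def
  proof (rule prod_coprime_left)
    fix q assume "q \<in> P"
    hence "coprime q p" using insert by (metis insertCI primes_coprime)
    thus "coprime (int q ^ L) (int p ^ L)" by (metis coprime_int_iff coprime_power_left_iff coprime_power_right_iff)
  qed
  then obtain y where y: "[M * y = 1] (mod int p ^ L)" using cong_solve_coprime_int by blast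
  define x' where "x' = x + (M * y) *s (X p - x)"
  have "int p ^ L dvd (x' - X p) $ i" for i
  proof -
    have "(x' - X p) $ i = (M * y - 1) * (X p - x) $ i" by (simp add: x'_def algebra_simps)
    thus ?thesis using y by (simp add: cong_iff_dvd_diff)
  qed
  moreover have "int q ^ L dvd (x' - X q) $ i" if "q \<in> P" for q i
  proof -
    have "int q ^ L dvd M" unfolding M_def using insert that by (intro dvd_prodI) auto
    moreover have "(x' - X q) $ i = (x - X q) $ i + M * (y * (X p - x) $ i)" by (simp add: x'_def algebra_simps)
    ultimately show ?thesis using x that by (simp only:) (intro dvd_add dvd_mult2, auto)
  qed
  ultimately show ?case by blast
qed simp

text \<open>Since p^J does not divide the polar value \<open>l1\<close> for any prime
  \<open>p\<close> of \<open>Q1\<close>, the gcd \<open>d\<close> of \<open>l1\<close> and Q1^J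
  contains the full part of \<open>l1\<close> at these primes, and l = l1 / d is prime to
  \<open>Q1\<close>. Steps of d Q along \<open>h1\<close> and of d^2 Q^2 along \<open>h2\<close> and
  \<open>e\<close> then change the form by \<open>Z\<close> times a polynomial
  \<open>\<mu>\<close>.\<close>

lemma card_unrepresented_class_le:
  fixes \<eta> \<tau> :: real and Q1 :: int and w J :: nat and f :: "int tform" and e h1 h2 x0 :: "int ^ 3"
  defines "Z \<equiv> Q1 ^ (2 * J + 1)"
  assumes orth: "polar f e h1 = 0" "polar f e h2 = 0" "polar f h1 h2 = 0"
    and c: "tform_eval f e > 0" and nz: "tform_eval f h1 \<noteq> 0" "tform_eval f h2 \<noteq> 0"
    and Q1: "Q1 > 0" "2 * tform_eval f h1 * tform_eval f h2 * tform_eval f e dvd Q1"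
    and \<eta>: "0 < \<eta>" "\<eta> \<le> 1/2" and \<tau>: "16 * (1 + \<eta>) * ((1 + \<tau>)\<^sup>2 - 1) \<le> \<eta>\<^sup>2 / 4"
    and w: "\<And>Q K. (\<And>h::int. 1 < h \<Longrightarrow> h \<le> int w \<Longrightarrow> \<not> coprime h Q) \<Longrightarrow>
      (\<Sum>h\<in>{h\<in>{2..K}. coprime h Q}. e32 h) \<le> \<tau>"
    and wQ: "\<And>h::int. 1 < h \<Longrightarrow> h \<le> int w \<Longrightarrow> \<not> coprime h Q1"
    and J: "\<And>p. prime p \<Longrightarrow> int p dvd Q1 \<Longrightarrow> \<not> int p ^ J dvd polar f x0 h1"
  shows "\<exists>N0. \<forall>Y\<ge>N0. real (card {n. 0 < n \<and> real_of_int n \<le> Y \<and> Z dvd n - tform_eval f x0 \<and> n \<notin> range (tform_eval f)}) \<le> 4 * \<eta> * Y / Z"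
proof -
  define \<alpha> \<beta> c where "\<alpha> = tform_eval f h1" and "\<beta> = tform_eval f h2" and "c = tform_eval f e"
  define l1 where "l1 = polar f x0 h1"
  define d where "d = gcd l1 (Q1 ^ J)"
  define l where "l = l1 div d"
  define E where "E = Q1 ^ J div d"
  have Q1J: "Q1 ^ J \<noteq> 0" using Q1 by simp
  have d0: "d > 0" using Q1J by (simp add: d_def)
  have l1: "l1 = d * l" by (simp add: l_def d_def)
  have E: "Q1 ^ J = d * E" by (simp add: E_def d_def)
  have cop0: "coprime l E" unfolding l_def E_def d_def using Q1J by (intro div_gcd_coprime) auto
  have copl: "coprime l Q1"
  proof (rule ccontr)
    assume "\<not> coprime l Q1"
    hence "\<not> is_unit (gcd l Q1)" by (simp add: coprime_iff_gcd_eq_1)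
    moreover have "gcd l Q1 \<noteq> 0" using Q1 by simp
    ultimately obtain q where "prime q" "q dvd gcd l Q1" using prime_divisor_exists by blast
    hence q: "prime q" "q dvd l" "q dvd Q1" by auto
    define p where "p = nat q"
    have p: "prime p" "int p = q" using q by (auto simp: p_def prime_ge_0_int prime_nat_iff_prime)
    \<comment> \<open>Either \<open>q\<close> divides \<open>E\<close>, against the coprimality of
      \<open>l\<close> and \<open>E\<close>, or q^J divides \<open>d\<close> and hence the polar
      value.\<close>
    show False
    proof (cases "q dvd E")
      case True
      thus ?thesis using cop0 q by (meson coprime_common_divisor not_prime_unit)
    next
      case False
      have "q ^ J dvd d * E" unfolding E[symmetric] using q(3) by (rule dvd_power_same)
      moreover have "coprime (q ^ J) E" using False q(1) by (meson coprime_power_left_iff prime_imp_coprime)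
      ultimately have "q ^ J dvd d" by (simp add: coprime_dvd_mult_left_iff)
      hence "q ^ J dvd l1" unfolding d_def by auto
      thus ?thesis using J[OF p(1)] p q by (simp add: l1_def)
    qed
  qed
  \<comment> \<open>Chosen so that d^2 Q equals \<open>Z\<close>, a modulus that does not depend on
    \<open>x0\<close>.\<close>
  define Q where "Q = Q1 * E\<^sup>2"
  have E0: "E > 0" using E Q1 d0 by (metis zero_less_mult_pos zero_less_power)
  have Q0: "Q > 0" using Q1 E0 by (simp add: Q_def)
  have Z: "Z = d\<^sup>2 * Q"
  proof -
    have "Z = Q1 * (Q1 ^ J * Q1 ^ J)" unfolding Z_def by (simp add: mult_2 power_add)
    thus ?thesis unfolding Q_def E by (simp add: power2_eq_square mult_ac)
  qed
  have QZ: "Q dvd Z" and dZ: "d dvd Z" by (simp_all add: Z power2_eq_square)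
  have Z0: "Z > 0" using Z Q0 d0 by simp
  have copZ: "coprime g Z" if "coprime g Q" for g
  proof -
    have "coprime g Q1" using that by (simp add: Q_def)
    thus ?thesis unfolding Z_def by simp
  qed
  have "coprime l Z" unfolding Z_def using copl by simp
  hence copQ: "coprime l Q" using QZ by (meson coprime_divisors dvd_refl)
  interpret mu_family Q l \<alpha> "d\<^sup>2 * Q\<^sup>2 * \<beta>" "d\<^sup>2 * Q\<^sup>2 * c" "polar f x0 e" "polar f x0 h2"
  proof
    show "Q > 0" by (rule Q0)
    have "2 dvd Q1" using Q1(2) by (meson dvd_mult_left)
    thus "even Q" by (simp add: Q_def)
    show "coprime l Q" by (rule copQ)
    show "\<alpha> \<noteq> 0" "d\<^sup>2 * Q\<^sup>2 * \<beta> \<noteq> 0" "d\<^sup>2 * Q\<^sup>2 * c > 0" using nz assms(5) d0 Q0 by (auto simp: \<alpha>_def \<beta>_def c_def)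
    fix g assume g: "coprime g Q"
    have "coprime g Z" by (rule copZ[OF g])
    hence "coprime g d" using dZ by (meson coprime_divisors dvd_refl)
    moreover have "coprime g Q1" using g by (simp add: Q_def)
    hence "coprime g (2 * \<alpha> * \<beta> * c)" using Q1(2) unfolding \<alpha>_def \<beta>_def c_def by (meson coprime_divisors dvd_refl)
    ultimately show "coprime g (2 * \<alpha> * (d\<^sup>2 * Q\<^sup>2 * \<beta>) * (d\<^sup>2 * Q\<^sup>2 * c))" using g by simp
  qed
  have rep: "tform_eval f (x0 + (d * Q * t) *s h1 + (d\<^sup>2 * Q\<^sup>2 * r) *s h2 + (d\<^sup>2 * Q\<^sup>2 * s) *s e) = tform_eval f x0 + Z * \<mu> t r s" for t r s
  proof -
    have o: "polar f h1 e = 0" "polar f h2 e = 0" "polar f h1 h2 = 0" using orth by (simp_all add: polar_sym)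
    have "tform_eval f (x0 + (d * Q * t) *s h1 + (d\<^sup>2 * Q\<^sup>2 * r) *s h2 + (d\<^sup>2 * Q\<^sup>2 * s) *s e) =
       tform_eval f x0 + (d * Q * t)\<^sup>2 * \<alpha> + (d * Q * t) * l1 + (d\<^sup>2 * Q\<^sup>2 * r)\<^sup>2 * \<beta> + (d\<^sup>2 * Q\<^sup>2 * r) * polar f x0 h2
        + (d\<^sup>2 * Q\<^sup>2 * s)\<^sup>2 * c + (d\<^sup>2 * Q\<^sup>2 * s) * polar f x0 e"
      unfolding tform_eval_add tform_eval_scale polar_simps o \<alpha>_def \<beta>_def c_def l1_def by simp
    thus ?thesis unfolding Z \<mu>_def l1 by (simp add: algebra_simps power2_eq_square)
  qed
  have "\<not> coprime h Q" if "1 < h" "h \<le> int w" for h using wQ[OF that] by (simp add: Q_def)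
  hence tl: "(\<Sum>h\<in>{h\<in>{2..K}. coprime h Q}. e32 h) \<le> \<tau>" for K by (rule w)
  obtain N0 where N0: "\<And>Y. Y \<ge> N0 \<Longrightarrow> real (card {m. (\<forall>t r s. \<mu> t r s \<noteq> m) \<and> 0 < m \<and> real_of_int m \<le> Y}) \<le> 3 * \<eta> * Y"
    using unrepresented_density_le[OF \<eta> tl \<tau>] by blast
  define n0 where "n0 = tform_eval f x0"
  have rZ: "real_of_int Z > 0" using Z0 by simp
  define C where "C = \<bar>real_of_int n0\<bar>"
  have main: "real (card {n. 0 < n \<and> real_of_int n \<le> Y \<and> Z dvd n - n0 \<and> n \<notin> range (tform_eval f)}) \<le> 4 * \<eta> * Y / Z"
    if Y: "Y \<ge> C" "Y \<ge> \<bar>N0\<bar> * Z" "Y \<ge> (3 * \<eta> * C + C + Z) / \<eta>" for Y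
  proof -
    \<comment> \<open>\<open>A\<close> collects the positive \<open>m\<close> that are missed,
      \<open>B\<close> the boundedly many m \<le> 0 for which n0 + Z m can still be
      positive.\<close>
    define A where "A = {m. (\<forall>t r s. \<mu> t r s \<noteq> m) \<and> 0 < m \<and> real_of_int m \<le> (Y + C) / Z}"
    define B where "B = {m::int. - (C / Z) \<le> real_of_int m \<and> real_of_int m \<le> 0}"
    have "C / Z \<ge> 0" using rZ by (simp add: C_def)
    hence CZ: "- (C / Z) \<le> 0 + 1" by linarith
    have fB: "finite B" "real (card B) \<le> C / Z + 1"
      using card_int_real_interval[OF _ CZ, of B] by (auto simp: B_def)
    have fA: "finite A" by (rule finite_subset[of _ "{0..\<lfloor>(Y + C) / Z\<rfloor>}"]) (auto simp: A_def le_floor_iff)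
    have "{n. 0 < n \<and> real_of_int n \<le> Y \<and> Z dvd n - n0 \<and> n \<notin> range (tform_eval f)} \<subseteq> (\<lambda>m. n0 + Z * m) ` (A \<union> B)"
    proof
      fix n assume "n \<in> {n. 0 < n \<and> real_of_int n \<le> Y \<and> Z dvd n - n0 \<and> n \<notin> range (tform_eval f)}"
      hence n: "0 < n" "real_of_int n \<le> Y" "Z dvd n - n0" "n \<notin> range (tform_eval f)" by auto
      obtain m where m: "n - n0 = Z * m" using n(3) by blast
      have nm: "n = n0 + Z * m" using m by simp
      have un: "\<mu> t r s \<noteq> m" for t r s using rep[of t r s] n(4) nm unfolding n0_def by (metis rangeI)
      have rm: "real_of_int Z * m = n - real_of_int n0" using m by (simp flip: of_int_mult of_int_diff)
      have "m \<in> A \<union> B"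
      proof (cases "m > 0")
        case True
        have "real_of_int m * Z \<le> Y + C" using rm n(2) by (simp add: C_def mult.commute)
        hence "real_of_int m \<le> (Y + C) / Z" using rZ by (simp add: field_simps)
        thus ?thesis using un True by (simp add: A_def)
      next
        case False
        have "real_of_int m * Z \<ge> - C" using rm n(1) by (simp add: C_def mult.commute)
        hence "- (C / Z) \<le> real_of_int m" using rZ by (simp add: field_simps)
        thus ?thesis using False by (simp add: B_def)
      qed
      thus "n \<in> (\<lambda>m. n0 + Z * m) ` (A \<union> B)" using nm by blast
    qed
    hence "card {n. 0 < n \<and> real_of_int n \<le> Y \<and> Z dvd n - n0 \<and> n \<notin> range (tform_eval f)} \<le> card (A \<union> B)"
      using fA fB by (meson card_image_le card_mono finite_UnI finite_imageI le_trans)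
    also have "\<dots> \<le> card A + card B" by (rule card_Un_le)
    finally have "real (card {n. 0 < n \<and> real_of_int n \<le> Y \<and> Z dvd n - n0 \<and> n \<notin> range (tform_eval f)}) \<le> card A + (C / Z + 1)"
      using fB(2) by linarith
    also have "real (card A) \<le> 3 * \<eta> * ((Y + C) / Z)"
    proof -
      have "N0 * Z \<le> \<bar>N0\<bar> * Z" using rZ by (intro mult_right_mono) auto
      hence "N0 * Z \<le> Y + C" using Y by (simp add: C_def)
      hence "N0 \<le> (Y + C) / Z" using rZ by (simp add: field_simps)
      thus ?thesis unfolding A_def by (rule N0)
    qed
    also have "3 * \<eta> * ((Y + C) / Z) + (C / Z + 1) = (3 * \<eta> * Y + (3 * \<eta> * C + C + Z)) / Z" using rZ by (simp add: field_simps)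
    also have "\<dots> \<le> 4 * \<eta> * Y / Z"
    proof -
      have "3 * \<eta> * C + C + Z \<le> \<eta> * Y" using Y(3) \<eta> by (simp add: field_simps)
      hence "3 * \<eta> * Y + (3 * \<eta> * C + C + Z) \<le> 4 * \<eta> * Y" by (simp add: mult_ac)
      thus ?thesis using rZ by (intro divide_right_mono) auto
    qed
    finally show ?thesis by simp
  qed
  show ?thesis unfolding n0_def[symmetric]
    by (intro exI[of _ "Max {C, \<bar>N0\<bar> * Z, (3 * \<eta> * C + C + Z) / \<eta>}"] allI impI main) auto
qed

lemma dvd_of_prime_powers:
  fixes Z a :: int
  assumes Z: "Z > 0" and a: "\<And>p. prime p \<Longrightarrow> int p dvd Z \<Longrightarrow> int p ^ multiplicity (int p) Z dvd a"
  shows "Z dvd a"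
proof (cases "a = 0")
  case False
  show ?thesis
  proof (rule multiplicity_le_imp_dvd)
    fix q :: int assume q: "prime q"
    show "multiplicity q Z \<le> multiplicity q a"
    proof (cases "q dvd Z")
      case True
      have "prime (nat q)" "int (nat q) = q" using q by (auto simp: prime_ge_0_int prime_nat_iff_prime)
      hence "q ^ multiplicity q Z dvd a" using a[of "nat q"] True by simp
      thus ?thesis using False q by (intro multiplicity_geI) (auto simp: not_prime_unit)
    qed (simp add: not_dvd_imp_multiplicity_0)
  qed (use Z in auto)
qed simp

lemma card_multiples_le:
  fixes m :: int and Y :: real
  assumes m: "m > 0" and Y: "Y \<ge> 0"
  shows "finite {n. 0 < n \<and> real_of_int n \<le> Y \<and> m dvd n}" "real (card {n. 0 < n \<and> real_of_int n \<le> Y \<and> m dvd n}) \<le> Y / m"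
proof -
  have "{n. 0 < n \<and> real_of_int n \<le> Y \<and> m dvd n} \<subseteq> (\<lambda>k. m * k) ` {1..\<lfloor>Y / m\<rfloor>}"
  proof
    fix n assume "n \<in> {n. 0 < n \<and> real_of_int n \<le> Y \<and> m dvd n}"
    hence n: "0 < n" "real_of_int n \<le> Y" "m dvd n" by auto
    then obtain k where "n = m * k" by blast
    note k = this n(1,2)
    have "k > 0" using k m by (simp add: zero_less_mult_iff)
    moreover have "real_of_int k \<le> Y / m" using k m by (simp add: field_simps)
    ultimately show "n \<in> (\<lambda>k. m * k) ` {1..\<lfloor>Y / m\<rfloor>}" using k by (auto simp: le_floor_iff)
  qed
  moreover have "finite ((\<lambda>k. m * k) ` {1..\<lfloor>Y / m\<rfloor>})" by simp
  ultimately show "finite {n. 0 < n \<and> real_of_int n \<le> Y \<and> m dvd n}"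
    and "real (card {n. 0 < n \<and> real_of_int n \<le> Y \<and> m dvd n}) \<le> Y / m"
  proof -
    assume s: "{n. 0 < n \<and> real_of_int n \<le> Y \<and> m dvd n} \<subseteq> (\<lambda>k. m * k) ` {1..\<lfloor>Y / m\<rfloor>}"
    show "finite {n. 0 < n \<and> real_of_int n \<le> Y \<and> m dvd n}" by (rule finite_subset[OF s]) simp
    have "card {n. 0 < n \<and> real_of_int n \<le> Y \<and> m dvd n} \<le> card ((\<lambda>k. m * k) ` {1..\<lfloor>Y / m\<rfloor>})"
      by (rule card_mono[OF _ s]) simp
    also have "\<dots> \<le> card {1..\<lfloor>Y / m\<rfloor>}" by (rule card_image_le) simp
    also have "\<dots> = nat \<lfloor>Y / m\<rfloor>" by simp
    finally have "real (card {n. 0 < n \<and> real_of_int n \<le> Y \<and> m dvd n}) \<le> real (nat \<lfloor>Y / m\<rfloor>)" by (rule of_nat_mono)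
    also have "\<dots> = real_of_int \<lfloor>Y / m\<rfloor>" using m Y by simp
    finally show "real (card {n. 0 < n \<and> real_of_int n \<le> Y \<and> m dvd n}) \<le> Y / m" by linarith
  qed
qed

text \<open>Order of the choices: \<open>w\<close> from \<tau>, \<open>Q1\<close> from
  \<open>w\<close>, \<open>K\<close> from the primes of \<open>Q1\<close>, \<open>J\<close> from
  \<open>K\<close> by \<open>Loc_transversal\<close>, and the modulus \<open>Z\<close> from
  \<open>J\<close>. Integers divisible by p^K for some \<open>p\<close> in \<open>P\<close> are
  discarded; every other locally represented integer is congruent modulo \<open>Z\<close> to a value
  at a vector with controlled polar form, and \<open>card_unrepresented_class_le\<close> treats its
  class.\<close>

theorem almost_all_represented:
  fixes \<epsilon> :: real
  assumes orth: "polar f e h1 = 0" "polar f e h2 = 0" "polar f h1 h2 = 0"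
    and c: "tform_eval f e > 0" and nz: "tform_eval f h1 \<noteq> 0" "tform_eval f h2 \<noteq> 0" and \<epsilon>0: "\<epsilon> > 0"
  shows "\<exists>N0. \<forall>Y\<ge>N0. real (card {n. 0 < n \<and> real_of_int n \<le> Y \<and> (\<forall>p. prime p \<longrightarrow> n \<in> Loc f p) \<and> n \<notin> range (tform_eval f)}) \<le> \<epsilon> * Y"
proof -
  define \<eta> where "\<eta> = min \<epsilon> 1 / 12"
  have \<eta>: "0 < \<eta>" "\<eta> \<le> 1/2" "12 * \<eta> \<le> \<epsilon>" using \<epsilon>0 by (auto simp: \<eta>_def)
  \<comment> \<open>With this \<tau> the left side of the condition is at most 24 times 3 \<tau>,
    that is 72/400 of \<eta>^2.\<close>
  define \<tau> where "\<tau> = \<eta>\<^sup>2 / 400"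
  have \<tau>0: "\<tau> > 0" using \<eta> by (simp add: \<tau>_def)
  have \<tau>: "16 * (1 + \<eta>) * ((1 + \<tau>)\<^sup>2 - 1) \<le> \<eta>\<^sup>2 / 4"
  proof -
    have "\<eta>\<^sup>2 \<le> 1\<^sup>2" using \<eta> by (intro power_mono) auto
    hence "\<tau> \<le> 1" by (simp add: \<tau>_def)
    hence "\<tau> * \<tau> \<le> 1 * \<tau>" using \<tau>0 by (intro mult_right_mono) auto
    hence 1: "(1 + \<tau>)\<^sup>2 - 1 \<le> 3 * \<tau>" by (simp add: power2_eq_square algebra_simps)
    have "16 * (1 + \<eta>) * ((1 + \<tau>)\<^sup>2 - 1) \<le> 24 * ((1 + \<tau>)\<^sup>2 - 1)" using \<eta> \<tau>0 by (intro mult_right_mono) auto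
    also have "\<dots> \<le> 24 * (3 * \<tau>)" using 1 by simp
    also have "\<dots> \<le> \<eta>\<^sup>2 / 4" by (simp add: \<tau>_def)
    finally show ?thesis .
  qed
  obtain w :: nat where w: "\<And>Q K. (\<And>h::int. 1 < h \<Longrightarrow> h \<le> int w \<Longrightarrow> \<not> coprime h Q) \<Longrightarrow>
    (\<Sum>h\<in>{h\<in>{2..K}. coprime h Q}. e32 h) \<le> \<tau>" using tail_bound_exists[OF \<tau>0] by metis
  \<comment> \<open>Contains the primes of bad reduction and, through the factorial, all primes up
    to \<open>w\<close>.\<close>
  define Q1 where "Q1 = \<bar>2 * tform_eval f h1 * tform_eval f h2 * tform_eval f e\<bar> * int (fact w)"
  have Q1: "Q1 > 0" "2 * tform_eval f h1 * tform_eval f h2 * tform_eval f e dvd Q1"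
    using c nz by (auto simp: Q1_def)
  have wQ: "\<not> coprime h Q1" if h: "1 < h" "h \<le> int w" for h :: int
  proof
    assume co: "coprime h Q1"
    have "nat h dvd fact w" using h by (intro dvd_fact) auto
    hence "int (nat h) dvd int (fact w)" by (simp only: int_dvd_int_iff)
    hence "h dvd Q1" using h by (simp add: Q1_def)
    hence "is_unit h" using co by (meson coprime_common_divisor dvd_refl)
    thus False using h by simp
  qed
  define P where "P = {p. prime p \<and> int p dvd Q1}"
  have fP: "finite P"
  proof (rule finite_subset)
    show "P \<subseteq> {..nat Q1}"
    proof
      fix p assume "p \<in> P"
      hence "int p \<le> Q1" using Q1 zdvd_imp_le by (auto simp: P_def)
      thus "p \<in> {..nat Q1}" by auto
    qed
  qed simp
  have Pp: "prime p" if "p \<in> P" for p using that by (simp add: P_def)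
  \<comment> \<open>Each prime in \<open>P\<close> discards integers of density at most
    2^(-K).\<close>
  obtain K where K: "real (card P) / 2 ^ K \<le> \<eta>"
  proof -
    obtain K where "real (card P) / \<eta> < 2 ^ K" using real_arch_pow[of 2] by auto
    hence "real (card P) / 2 ^ K \<le> \<eta>" using \<eta> by (simp add: field_simps)
    thus ?thesis using that by blast
  qed
  have "\<exists>J. \<forall>n L. n \<in> Loc f p \<longrightarrow> \<not> int p ^ K dvd n \<longrightarrow> (\<exists>x. int p ^ L dvd tform_eval f x - n \<and> \<not> int p ^ J dvd polar f x h1)"
    if "p \<in> P" for p using Loc_transversal[OF Pp[OF that] nz(1), of K] by metis
  then obtain Jf where Jf: "\<And>p n L. p \<in> P \<Longrightarrow> n \<in> Loc f p \<Longrightarrow> \<not> int p ^ K dvd n \<Longrightarrow>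
     \<exists>x. int p ^ L dvd tform_eval f x - n \<and> \<not> int p ^ (Jf p) dvd polar f x h1" by metis
  define J where "J = (\<Sum>p\<in>P. Jf p)"
  have JJ: "Jf p \<le> J" if "p \<in> P" for p unfolding J_def using that fP by (intro member_le_sum) auto
  define Z where "Z = Q1 ^ (2 * J + 1)"
  have Z0: "Z > 0" using Q1 by (simp add: Z_def)
  \<comment> \<open>Large enough to preserve the polar condition modulo p^J and to reach the power
    of \<open>p\<close> in \<open>Z\<close>.\<close>
  define L where "L = J + (\<Sum>p\<in>P. multiplicity (int p) Z)"
  have good: "\<exists>x. Z dvd n - tform_eval f x \<and> (\<forall>p. prime p \<longrightarrow> int p dvd Q1 \<longrightarrow> \<not> int p ^ J dvd polar f x h1)"
    if n: "\<And>p. prime p \<Longrightarrow> n \<in> Loc f p" "\<And>p. p \<in> P \<Longrightarrow> \<not> int p ^ K dvd n" for n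
  proof -
    have "\<exists>x. int p ^ L dvd tform_eval f x - n \<and> \<not> int p ^ J dvd polar f x h1" if p: "p \<in> P" for p
      using Jf[OF p n(1)[OF Pp[OF p]] n(2)[OF p], of L] JJ[OF p] by (meson dvd_power_mono_int)
    then obtain X where X: "\<And>p. p \<in> P \<Longrightarrow> int p ^ L dvd tform_eval f (X p) - n \<and> \<not> int p ^ J dvd polar f (X p) h1" by metis
    obtain x where x: "\<And>p i. p \<in> P \<Longrightarrow> int p ^ L dvd (x - X p) $ i" using chinese_remainder_vec[OF fP Pp, of L X] by blast
    have "int p ^ L dvd tform_eval f x - n" if p: "p \<in> P" for p
    proof -
      have "int p ^ L dvd (tform_eval f x - tform_eval f (X p)) + (tform_eval f (X p) - n)"
        using tform_eval_cong(1)[OF x[OF p]] X[OF p] by (intro dvd_add) auto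
      thus ?thesis by simp
    qed
    moreover have "multiplicity (int p) Z \<le> L" if p: "p \<in> P" for p
      unfolding L_def using member_le_sum[OF p, of "\<lambda>p. multiplicity (int p) Z"] fP by simp
    ultimately have d: "int p ^ multiplicity (int p) Z dvd tform_eval f x - n" if p: "p \<in> P" for p
      using p by (meson dvd_power_mono_int)
    have "Z dvd tform_eval f x - n"
    proof (rule dvd_of_prime_powers[OF Z0 d])
      fix p assume p: "prime p" "int p dvd Z"
      hence "int p dvd Q1" unfolding Z_def using prime_dvd_power by (metis prime_nat_int_transfer)
      thus "p \<in> P" using p by (simp add: P_def)
    qed
    hence "Z dvd n - tform_eval f x" by (simp add: dvd_diff_commute)
    moreover have "\<not> int p ^ J dvd polar f x h1" if "prime p" "int p dvd Q1" for p
    proof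
      have p: "p \<in> P" using that by (simp add: P_def)
      assume "int p ^ J dvd polar f x h1"
      moreover have "int p ^ J dvd polar f x h1 - polar f (X p) h1"
        using tform_eval_cong(2)[OF x[OF p]] by (rule dvd_power_mono_int) (simp add: L_def)
      ultimately have "int p ^ J dvd polar f x h1 - (polar f x h1 - polar f (X p) h1)" by (rule dvd_diff)
      thus False using X[OF p] by simp
    qed
    ultimately show ?thesis by blast
  qed
  define Good where "Good x r \<longleftrightarrow> Z dvd r - tform_eval f x \<and> (\<forall>p. prime p \<longrightarrow> int p dvd Q1 \<longrightarrow> \<not> int p ^ J dvd polar f x h1)" for x r
  define G where "G = {r\<in>{0..<Z}. \<exists>x. Good x r}"
  have fG: "finite G" "card G \<le> nat Z"
  proof -
    have s: "G \<subseteq> {0..<Z}" by (auto simp: G_def)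
    show "finite G" by (rule finite_subset[OF s]) simp
    show "card G \<le> nat Z" using card_mono[OF _ s] by simp
  qed
  define U where "U r Y = {n. 0 < n \<and> real_of_int n \<le> Y \<and> Z dvd n - r \<and> n \<notin> range (tform_eval f)}" for r Y
  have "\<exists>N0. \<forall>Y\<ge>N0. real (card (U r Y)) \<le> 4 * \<eta> * Y / Z" if r: "r \<in> G" for r
  proof -
    obtain x where x: "Good x r" using r by (auto simp: G_def)
    have e: "Z dvd n - r \<longleftrightarrow> Z dvd n - tform_eval f x" for n
    proof -
      have "n - tform_eval f x = (n - r) + (r - tform_eval f x)" by simp
      thus ?thesis using x unfolding Good_def by (metis dvd_add_left_iff)
    qed
    show ?thesis unfolding U_def e unfolding Z_def
      by (rule card_unrepresented_class_le[OF orth c nz Q1 \<eta>(1,2) \<tau> w wQ]) (use x in \<open>auto simp: Good_def\<close>)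
  qed
  then obtain N where N: "\<And>r Y. r \<in> G \<Longrightarrow> Y \<ge> N r \<Longrightarrow> real (card (U r Y)) \<le> 4 * \<eta> * Y / Z" by metis
  define N1 where "N1 = (\<Sum>r\<in>G. \<bar>N r\<bar>)"
  have N1: "N r \<le> N1" if "r \<in> G" for r
    using member_le_sum[OF that, of "\<lambda>r. \<bar>N r\<bar>"] fG by (simp add: N1_def)
  have "real (card {n. 0 < n \<and> real_of_int n \<le> Y \<and> (\<forall>p. prime p \<longrightarrow> n \<in> Loc f p) \<and> n \<notin> range (tform_eval f)}) \<le> \<epsilon> * Y"
    if Y: "Y \<ge> max 0 N1" for Y
  proof -
    define V where "V p = {n. 0 < n \<and> real_of_int n \<le> Y \<and> int p ^ K dvd n}" for p
    have ppos: "int p ^ K > 0" if "p \<in> P" for p using Pp[OF that] by (simp add: prime_gt_0_nat)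
    have fV: "finite (V p)" "real (card (V p)) \<le> Y / 2 ^ K" if p: "p \<in> P" for p
    proof -
      show "finite (V p)" unfolding V_def by (rule card_multiples_le[OF ppos[OF p]]) (use Y in auto)
      have "real (card (V p)) \<le> Y / real_of_int (int p ^ K)"
        unfolding V_def by (rule card_multiples_le[OF ppos[OF p]]) (use Y in auto)
      also have "\<dots> \<le> Y / 2 ^ K"
      proof -
        have "(2::real) ^ K \<le> real p ^ K" using prime_ge_2_nat[OF Pp[OF p]] by (intro power_mono) auto
        thus ?thesis using Y by (intro divide_left_mono) (auto intro!: mult_pos_pos simp: prime_gt_0_nat[OF Pp[OF p]])
      qed
      finally show "real (card (V p)) \<le> Y / 2 ^ K" .
    qed
    have fU: "finite (U r Y)" for r
      by (rule finite_subset[of _ "{0..\<lfloor>Y\<rfloor>}"]) (auto simp: U_def le_floor_iff)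
    have "{n. 0 < n \<and> real_of_int n \<le> Y \<and> (\<forall>p. prime p \<longrightarrow> n \<in> Loc f p) \<and> n \<notin> range (tform_eval f)} \<subseteq> (\<Union>r\<in>G. U r Y) \<union> (\<Union>p\<in>P. V p)"
    proof
      fix n assume "n \<in> {n. 0 < n \<and> real_of_int n \<le> Y \<and> (\<forall>p. prime p \<longrightarrow> n \<in> Loc f p) \<and> n \<notin> range (tform_eval f)}"
      hence n: "0 < n" "real_of_int n \<le> Y" "\<And>p. prime p \<Longrightarrow> n \<in> Loc f p" "n \<notin> range (tform_eval f)" by auto
      show "n \<in> (\<Union>r\<in>G. U r Y) \<union> (\<Union>p\<in>P. V p)"
      proof (cases "\<exists>p\<in>P. int p ^ K dvd n")
        case True thus ?thesis using n by (auto simp: V_def)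
      next
        case False
        then obtain x where x: "Good x n" using good[OF n(3)] unfolding Good_def by blast
        define r where "r = n mod Z"
        have nr: "Z dvd n - r" by (simp add: r_def minus_mod_eq_mult_div)
        have "Z dvd r - tform_eval f x"
        proof -
          have "Z dvd (n - tform_eval f x) - (n - r)" using x nr dvd_diff[of Z "n - tform_eval f x" "n - r"] by (auto simp: Good_def)
          thus ?thesis by simp
        qed
        hence "r \<in> G" using x Z0 by (auto simp: G_def Good_def r_def)
        thus ?thesis using n nr by (auto simp: U_def)
      qed
    qed
    hence "card {n. 0 < n \<and> real_of_int n \<le> Y \<and> (\<forall>p. prime p \<longrightarrow> n \<in> Loc f p) \<and> n \<notin> range (tform_eval f)} \<le> card ((\<Union>r\<in>G. U r Y) \<union> (\<Union>p\<in>P. V p))"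
      using fG fU fV fP by (intro card_mono) auto
    also have "\<dots> \<le> card (\<Union>r\<in>G. U r Y) + card (\<Union>p\<in>P. V p)" by (rule card_Un_le)
    also have "\<dots> \<le> (\<Sum>r\<in>G. card (U r Y)) + (\<Sum>p\<in>P. card (V p))"
      using fG fP by (intro add_mono card_UN_le) auto
    finally have "real (card {n. 0 < n \<and> real_of_int n \<le> Y \<and> (\<forall>p. prime p \<longrightarrow> n \<in> Loc f p) \<and> n \<notin> range (tform_eval f)}) \<le> (\<Sum>r\<in>G. real (card (U r Y))) + (\<Sum>p\<in>P. real (card (V p)))"
      by (simp flip: of_nat_sum of_nat_add)
    also have "(\<Sum>r\<in>G. real (card (U r Y))) \<le> (\<Sum>r\<in>G. 4 * \<eta> * Y / Z)"
      using Y N1 by (intro sum_mono N) force+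
    also have "(\<Sum>r\<in>G. 4 * \<eta> * Y / Z) \<le> Z * (4 * \<eta> * Y / Z)"
    proof -
      have "real (card G) \<le> Z" using fG(2) Z0 by linarith
      hence "real (card G) * (4 * \<eta> * Y / Z) \<le> Z * (4 * \<eta> * Y / Z)"
        using Y \<eta> Z0 by (intro mult_right_mono) auto
      thus ?thesis by (simp only: sum_constant)
    qed
    also have "Z * (4 * \<eta> * Y / Z) = 4 * \<eta> * Y" using Z0 by simp
    also have "(\<Sum>p\<in>P. real (card (V p))) \<le> (\<Sum>p\<in>P. Y / 2 ^ K)" by (intro sum_mono fV)
    also have "(\<Sum>p\<in>P. Y / 2 ^ K) = real (card P) / 2 ^ K * Y" by simp
    also have "\<dots> \<le> \<eta> * Y" using K Y by (intro mult_right_mono) auto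
    finally have "real (card {n. 0 < n \<and> real_of_int n \<le> Y \<and> (\<forall>p. prime p \<longrightarrow> n \<in> Loc f p) \<and> n \<notin> range (tform_eval f)}) \<le> 4 * \<eta> * Y + \<eta> * Y" by simp
    also have "\<dots> = 5 * \<eta> * Y" by simp
    also have "\<dots> \<le> \<epsilon> * Y" using \<eta> Y by (intro mult_right_mono) auto
    finally show ?thesis .
  qed
  thus ?thesis by blast
qed

section \<open>The rational quadratic space, orthogonal triples and the negated form\<close>

definition rvec :: "int ^ 3 \<Rightarrow> rat ^ 3" where "rvec x = (\<chi> i. of_int (x $ i))"

lemma tform_q_rvec: "tform_q f (rvec x) = of_int (tform_eval f x)"
  by (cases f) (simp add: tform_q_def rvec_def)

lemma rvec_add: "rvec (x + y) = rvec x + rvec y" by (simp add: rvec_def vec_eq_iff)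

lemma rvec_axis: "rvec (axis i 1) = axis i 1" by (simp add: rvec_def vec_eq_iff axis_def)

lemma tform_polar_rvec: "tform_polar f (rvec x) (rvec y) = of_int (polar f x y)"
  by (simp add: tform_polar_def polar_def tform_q_rvec flip: rvec_add)

lemma tform_q_scale: "tform_q f (k *s x) = k\<^sup>2 * tform_q f x"
  by (cases f) (simp add: tform_q_def power2_eq_square algebra_simps)

lemma tform_polar_add_right: "tform_polar f z (x + y) = tform_polar f z x + tform_polar f z y"
  by (cases f) (simp add: tform_polar_def tform_q_def power2_eq_square algebra_simps)

lemma tform_polar_scale_right: "tform_polar f y (k *s x) = k * tform_polar f y x"
  by (cases f) (simp add: tform_polar_def tform_q_def power2_eq_square algebra_simps)

lemma tform_polar_sym: "tform_polar f x y = tform_polar f y x"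
  by (simp add: tform_polar_def add.commute)

lemma tform_polar_scale_left: "tform_polar f (k *s x) y = k * tform_polar f x y"
  by (metis tform_polar_scale_right tform_polar_sym)

lemma tform_polar_eq_sum_axis:
  "tform_polar f x y = (\<Sum>i\<in>UNIV. y $ i * tform_polar f x (axis i 1))"
proof -
  have y: "y = (y $ 1) *s axis 1 1 + (y $ 2) *s axis 2 1 + (y $ 3) *s axis 3 1"
    by (simp add: vec_eq_iff forall_3 axis_def)
  show ?thesis by (subst y) (simp only: tform_polar_add_right tform_polar_scale_right sum_3)
qed

lemma nondegenerate_int:
  assumes "nondegenerate f" "\<And>y. polar f x y = 0"
  shows "x = 0"
proof -
  have "tform_polar f (rvec x) y = 0" for y
    unfolding tform_polar_eq_sum_axis[of f "rvec x" y]
    by (simp add: tform_polar_rvec assms(2) flip: rvec_axis)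
  hence "rvec x = 0" using assms(1) by (auto simp: nondegenerate_def)
  thus ?thesis by (simp add: rvec_def vec_eq_iff)
qed

text \<open>The identity makes \<open>\<pi>\<close> behave like a multiple of an orthogonal
  projection. If the form vanished on its image, so would the polar form there, and the image would
  lie in the radical.\<close>

lemma exists_anisotropic_image:
  fixes \<pi> :: "int ^ 3 \<Rightarrow> int ^ 3"
  assumes f: "nondegenerate f" and add: "\<And>y z. \<pi> (y + z) = \<pi> y + \<pi> z"
    and A: "A \<noteq> 0" and \<pi>: "\<And>y z. A * polar f (\<pi> y) z = polar f (\<pi> y) (\<pi> z)"
    and ne: "\<exists>y. \<pi> y \<noteq> 0"
  shows "\<exists>y. tform_eval f (\<pi> y) \<noteq> 0"
proof (rule ccontr)
  assume "\<not> ?thesis"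
  hence z: "tform_eval f (\<pi> y) = 0" for y by blast
  have "polar f (\<pi> y) (\<pi> z) = 0" for y z by (simp add: polar_def z flip: add)
  hence "polar f (\<pi> y) z = 0" for y z using \<pi>[of y z] A by simp
  hence "\<pi> y = 0" for y using nondegenerate_int[OF f] by blast
  thus False using ne by blast
qed

text \<open>Gram--Schmidt with denominators cleared: \<open>\<pi>\<close> is 2 a times the
  projection to the orthogonal complement of \<open>e\<close>, and \<open>\<sigma>\<close> is 4 a b
  times the projection to that of \<open>e\<close> and \<open>h\<close>, where \<open>a\<close> and
  \<open>b\<close> are the values at \<open>e\<close> and \<open>h\<close>.\<close>

lemma orthogonal_triple_exists:
  assumes f: "nondegenerate f" and e: "tform_eval f e \<noteq> 0"
  obtains h1 h2 where "polar f e h1 = 0" "polar f e h2 = 0" "polar f h1 h2 = 0"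
    "tform_eval f h1 \<noteq> 0" "tform_eval f h2 \<noteq> 0"
proof -
  define a where "a = tform_eval f e"
  have a0: "a \<noteq> 0" using e by (simp add: a_def)
  define \<pi> where "\<pi> y = (2 * a) *s y + (- polar f e y) *s e" for y
  have oe: "polar f e (\<pi> y) = 0" for y by (simp add: \<pi>_def polar_simps a_def)
  have p1: "2 * a * polar f (\<pi> y) z = polar f (\<pi> y) (\<pi> z)" for y z
  proof -
    have "polar f (\<pi> y) (\<pi> z) = 2 * a * polar f (\<pi> y) z - polar f e z * polar f e (\<pi> y)"
      unfolding \<pi>_def[of z] polar_add_right polar_scale_right by (simp add: polar_sym)
    thus ?thesis by (simp add: oe)
  qed
  have "\<exists>y. tform_eval f (\<pi> y) \<noteq> 0"
  proof (rule exists_anisotropic_image[OF f _ _ p1])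
    show "\<pi> (y + z) = \<pi> y + \<pi> z" for y z
      by (simp add: \<pi>_def polar_add_right vec_eq_iff algebra_simps)
    show "2 * a \<noteq> 0" using a0 by simp
    show "\<exists>y. \<pi> y \<noteq> 0"
    proof (rule ccontr)
      assume "\<not> ?thesis"
      hence z: "\<pi> y $ j = 0" for y j by simp
      have eq: "2 * a * (axis i 1 :: int ^ 3) $ j = polar f e (axis i 1) * e $ j" for i j :: 3
        using z[of "axis i 1" j] by (simp add: \<pi>_def)
      have "2 * a = polar f e (axis 1 1) * e $ 1" "2 * a = polar f e (axis 2 1) * e $ 2" "0 = polar f e (axis 1 1) * e $ 2"
        using eq[of 1 1] eq[of 2 2] eq[of 1 2] by (simp_all add: axis_def)
      thus False using a0 by auto
    qed
  qed
  then obtain y1 where y1: "tform_eval f (\<pi> y1) \<noteq> 0" by blast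
  define h where "h = \<pi> y1"
  define b where "b = tform_eval f h"
  have b0: "b \<noteq> 0" using y1 by (simp add: b_def h_def)
  have oh: "polar f e h = 0" "polar f h e = 0" using oe by (simp_all add: h_def polar_sym)
  define A where "A = 4 * a * b"
  have A0: "A \<noteq> 0" using a0 b0 by (simp add: A_def)
  define \<sigma> where "\<sigma> y = A *s y + (- 2 * b * polar f e y) *s e + (- 2 * a * polar f h y) *s h" for y
  have se: "polar f e (\<sigma> y) = 0" for y by (simp add: \<sigma>_def polar_simps oh A_def a_def)
  have sh: "polar f h (\<sigma> y) = 0" for y by (simp add: \<sigma>_def polar_simps oh A_def b_def)
  have p2: "A * polar f (\<sigma> y) z = polar f (\<sigma> y) (\<sigma> z)" for y z
  proof -
    have "polar f (\<sigma> y) (\<sigma> z) = A * polar f (\<sigma> y) z - 2 * b * polar f e z * polar f e (\<sigma> y) - 2 * a * polar f h z * polar f h (\<sigma> y)"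
      unfolding \<sigma>_def[of z] polar_add_right polar_scale_right by (simp add: polar_sym)
    thus ?thesis by (simp add: se sh)
  qed
  have "\<exists>y. tform_eval f (\<sigma> y) \<noteq> 0"
  proof (rule exists_anisotropic_image[OF f _ A0 p2])
    show "\<sigma> (y + z) = \<sigma> y + \<sigma> z" for y z
      by (simp add: \<sigma>_def polar_add_right vec_eq_iff algebra_simps)
    show "\<exists>y. \<sigma> y \<noteq> 0"
    proof (rule ccontr)
      assume "\<not> ?thesis"
      hence z: "\<sigma> y $ j = 0" for y j by simp
      define P where "P i = 2 * b * polar f e (axis i 1)" for i :: 3
      define R where "R i = 2 * a * polar f h (axis i 1)" for i :: 3
      have eq: "A * (axis i 1 :: int ^ 3) $ j = P i * e $ j + R i * h $ j" for i j :: 3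
        using z[of "axis i 1" j] by (simp add: \<sigma>_def P_def R_def)
      \<comment> \<open>If \<open>\<sigma>\<close> vanished, \<open>A\<close> times the identity
        matrix would have rank at most 2. The equations for the third basis vector give A v = 0, and
        the upper left block has determinant A^2, which is a multiple of \<open>v\<close>.\<close>
      define v where "v = e $ 1 * h $ 2 - e $ 2 * h $ 1"
      have E: "A = P 1 * e $ 1 + R 1 * h $ 1" "0 = P 1 * e $ 2 + R 1 * h $ 2" "A = P 2 * e $ 2 + R 2 * h $ 2"
        "0 = P 2 * e $ 1 + R 2 * h $ 1" "A = P 3 * e $ 3 + R 3 * h $ 3" "0 = P 3 * e $ 1 + R 3 * h $ 1" "0 = P 3 * e $ 2 + R 3 * h $ 2"
        using eq[of 1 1] eq[of 1 2] eq[of 2 2] eq[of 2 1] eq[of 3 3] eq[of 3 1] eq[of 3 2] by (simp_all add: axis_def)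
      have "A * v = (P 3 * e $ 3 + R 3 * h $ 3) * v" by (simp flip: E(5))
      also have "\<dots> = (P 3 * e $ 3 + R 3 * h $ 3) * v + (0 * (e $ 2 * h $ 3 - e $ 3 * h $ 2) + 0 * (e $ 3 * h $ 1 - e $ 1 * h $ 3))" by simp
      also have "\<dots> = (P 3 * e $ 3 + R 3 * h $ 3) * v + ((P 3 * e $ 1 + R 3 * h $ 1) * (e $ 2 * h $ 3 - e $ 3 * h $ 2) + (P 3 * e $ 2 + R 3 * h $ 2) * (e $ 3 * h $ 1 - e $ 1 * h $ 3))"
        by (simp only: E(6)[symmetric] E(7)[symmetric])
      also have "\<dots> = 0" by (simp add: v_def algebra_simps)
      finally have v0: "v = 0" using A0 by simp
      have "A * A - 0 * 0 = (P 1 * e $ 1 + R 1 * h $ 1) * (P 2 * e $ 2 + R 2 * h $ 2) - (P 1 * e $ 2 + R 1 * h $ 2) * (P 2 * e $ 1 + R 2 * h $ 1)"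
        by (simp only: E(1)[symmetric] E(2)[symmetric] E(3)[symmetric] E(4)[symmetric])
      also have "\<dots> = (P 1 * R 2 - P 2 * R 1) * v" by (simp add: v_def algebra_simps)
      finally show False using v0 A0 by simp
    qed
  qed
  then obtain y2 where "tform_eval f (\<sigma> y2) \<noteq> 0" by blast
  thus ?thesis using that[of h "\<sigma> y2"] oh se sh b0 by (simp add: b_def)
qed

lemma nondegenerate_nonzero:
  assumes f: "nondegenerate f"
  shows "\<exists>e. tform_eval f e \<noteq> 0"
proof (rule ccontr)
  assume "\<not> ?thesis"
  hence "polar f x y = 0" for x y by (simp add: polar_def)
  hence "(axis 1 1 :: int ^ 3) = 0" using nondegenerate_int[OF f] by blast
  thus False by (simp add: axis_eq_0_iff)
qed

definition neg_tform :: "int tform \<Rightarrow> int tform" where "neg_tform f = map_tform uminus f"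

lemma neg_tform_eval: "tform_eval (neg_tform f) x = - tform_eval f x"
  by (cases f) (simp add: neg_tform_def algebra_simps)

lemma neg_tform_polar: "tform_polar (neg_tform f) x y = - tform_polar f x y"
  by (cases f) (simp add: neg_tform_def tform_polar_def tform_q_def algebra_simps)

lemma neg_tform_nondegenerate: "nondegenerate f \<Longrightarrow> nondegenerate (neg_tform f)"
  by (simp add: nondegenerate_def neg_tform_polar)

lemma mem_Loc_neg_tform: "n \<in> Loc (neg_tform f) p \<longleftrightarrow> - n \<in> Loc f p"
proof -
  have "int p ^ k dvd tform_eval (neg_tform f) x - n \<longleftrightarrow> int p ^ k dvd tform_eval f x - (- n)" for k x
    unfolding neg_tform_eval by (metis dvd_minus_iff minus_diff_commute diff_minus_eq_add minus_diff_eq uminus_add_conv_diff)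
  thus ?thesis by (simp add: Loc_def)
qed

section \<open>The density as a product of local densities\<close>

definition periodic_density :: "int \<Rightarrow> int set \<Rightarrow> real \<Rightarrow> bool" where
  "periodic_density m A d \<longleftrightarrow> m > 0 \<and> (\<forall>n k. n + m * k \<in> A \<longleftrightarrow> n \<in> A) \<and> real (card (A \<inter> {0..<m})) = d * m"

lemma periodic_densityD: "periodic_density m A d \<Longrightarrow> n + m * k \<in> A \<longleftrightarrow> n \<in> A" "periodic_density m A d \<Longrightarrow> m > 0" "periodic_density m A d \<Longrightarrow> real (card (A \<inter> {0..<m})) = d * m"
  by (auto simp: periodic_density_def)

lemma card_translate:
  fixes A :: "int set"
  shows "card (A \<inter> {x..<y}) = card ((\<lambda>n. n + t) -` A \<inter> {x - t..<y - t})"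
  by (rule bij_betw_same_card[of "\<lambda>n. n - t"])
    (rule bij_betw_byWitness[where f' = "\<lambda>n. n + t"]; auto)

lemma card_split_int:
  fixes A :: "int set"
  assumes "x \<le> y" "y \<le> z"
  shows "card (A \<inter> {x..<z}) = card (A \<inter> {x..<y}) + card (A \<inter> {y..<z})"
proof -
  have "A \<inter> {x..<z} = (A \<inter> {x..<y}) \<union> (A \<inter> {y..<z})" using assms by auto
  thus ?thesis by (simp only:) (rule card_Un_disjoint, auto)
qed

lemma periodic_density_period:
  assumes "periodic_density m A d"
  shows "real (card (A \<inter> {x..<x + m})) = d * m"
proof -
  have m: "m > 0" using assms periodic_densityD by blast
  define t where "t = x div m"
  define y where "y = x mod m"
  have x: "x = y + m * t" by (simp add: t_def y_def)
  have y: "0 \<le> y" "y < m" using m by (simp_all add: y_def)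
  have inv: "(\<lambda>n. n + m * s) -` A = A" for s using periodic_densityD(1)[OF assms] by auto
  have "card (A \<inter> {x..<x + m}) = card (A \<inter> {y..<y + m})"
    using card_translate[of A x "x + m" "m * t"] by (simp add: inv x)
  also have "\<dots> = card (A \<inter> {y..<m}) + card (A \<inter> {m..<m + y})" using y card_split_int[of y m "y + m" A] by (simp add: add.commute)
  also have "card (A \<inter> {m..<m + y}) = card (A \<inter> {0..<y})"
    using card_translate[of A m "m + y" "m * 1"] unfolding inv by simp
  also have "card (A \<inter> {y..<m}) + card (A \<inter> {0..<y}) = card (A \<inter> {0..<m})" using y card_split_int[of 0 y m A] by simp
  finally show ?thesis using periodic_densityD(3)[OF assms] by simp
qed

lemma periodic_density_periods:
  assumes "periodic_density m A d"
  shows "real (card (A \<inter> {x..<x + m * int k})) = d * m * k"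
proof (induction k)
  case (Suc k)
  have m: "m > 0" using assms periodic_densityD by blast
  have "real (card (A \<inter> {x..<x + m * int (Suc k)})) = real (card (A \<inter> {x..<x + m * int k})) + real (card (A \<inter> {x + m * int k..<(x + m * int k) + m}))"
    using m card_split_int[of x "x + m * int k" "x + m * int (Suc k)" A] by (simp add: algebra_simps)
  thus ?case using Suc periodic_density_period[OF assms, of "x + m * int k"] by (simp add: algebra_simps)
qed simp

lemma periodic_density_interval:
  assumes "periodic_density m A d"
  shows "\<bar>real (card (A \<inter> {x..<x + int N})) - d * N\<bar> \<le> m"
proof -
  have m: "m > 0" using assms periodic_densityD by blast
  define k where "k = N div nat m"
  define r where "r = N mod nat m"
  have N: "int N = m * int k + int r" using m
    by (metis div_mult_mod_eq k_def r_def mult.commute of_nat_add of_nat_mult int_nat_eq less_imp_le)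
  have r: "int r < m"
  proof -
    have "r < nat m" unfolding r_def using m by (intro mod_less_divisor) simp
    thus ?thesis by linarith
  qed
  have dm: "0 \<le> d * m" "d * m \<le> m"
  proof -
    show "0 \<le> d * m" using periodic_densityD(3)[OF assms] by (metis of_nat_0_le_iff)
    have "card (A \<inter> {0..<m}) \<le> card {0..<m}" by (rule card_mono) auto
    hence "real (card (A \<inter> {0..<m})) \<le> real (card {0..<m})" by (rule of_nat_mono)
    also have "\<dots> = m" using m by simp
    finally show "d * m \<le> m" unfolding periodic_densityD(3)[OF assms] .
  qed
  have d: "0 \<le> d" "d \<le> 1" using dm m by (auto simp: zero_le_mult_iff)
  have "card (A \<inter> {x..<x + int N}) = card (A \<inter> {x..<x + m * int k}) + card (A \<inter> {x + m * int k..<x + int N})"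
    using m N by (intro card_split_int) auto
  hence c: "real (card (A \<inter> {x..<x + int N})) = d * m * k + real (card (A \<inter> {x + m * int k..<x + int N}))"
    using periodic_density_periods[OF assms, of x k] by simp
  have "card (A \<inter> {x + m * int k..<x + int N}) \<le> card {x + m * int k..<x + int N}" by (rule card_mono) auto
  hence c2: "real (card (A \<inter> {x + m * int k..<x + int N})) \<le> r" using N by simp
  have "d * N = d * m * k + d * r"
  proof -
    have "real N = real_of_int m * k + r" using N by (metis of_int_add of_int_mult of_int_of_nat_eq)
    thus ?thesis by (simp add: algebra_simps)
  qed
  moreover have "0 \<le> d * r" using d by simp
  moreover have "d * r \<le> 1 * real r" using d by (intro mult_right_mono) auto
  moreover have "real r \<le> m" using r by linarith
  ultimately show ?thesis using c c2 by auto
qed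

lemma periodic_density_mult:
  assumes "periodic_density m A d" "k > 0"
  shows "periodic_density (m * k) A d"
proof -
  have "real (card (A \<inter> {0..<0 + m * int (nat k)})) = d * m * nat k" by (rule periodic_density_periods[OF assms(1)])
  thus ?thesis using assms unfolding periodic_density_def by (simp add: mult.assoc)
qed

lemma periodic_density_union:
  assumes "periodic_density m A a" "periodic_density m B b" "A \<inter> B = {}"
  shows "periodic_density m (A \<union> B) (a + b)"
proof -
  have "card ((A \<union> B) \<inter> {0..<m}) = card (A \<inter> {0..<m}) + card (B \<inter> {0..<m})"
    unfolding Int_Un_distrib2 using assms(3) by (intro card_Un_disjoint) auto
  thus ?thesis using assms by (simp add: periodic_density_def distrib_right)
qed

lemma periodic_density_scale:
  assumes "periodic_density m A a" "k > 0"
  shows "periodic_density (k * m) ((\<lambda>n. k * n) ` A) (a / k)"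
  unfolding periodic_density_def
proof (intro conjI allI)
  show "k * m > 0" using assms by (simp add: periodic_density_def)
  show "n + k * m * t \<in> (\<lambda>n. k * n) ` A \<longleftrightarrow> n \<in> (\<lambda>n. k * n) ` A" for n t
  proof
    assume "n + k * m * t \<in> (\<lambda>n. k * n) ` A"
    then obtain x where x: "x \<in> A" "n + k * m * t = k * x" by auto
    have "n = k * (x + m * (- t))" using x(2) by (simp add: algebra_simps)
    moreover have "x + m * (- t) \<in> A" using x periodic_densityD(1)[OF assms(1)] by blast
    ultimately show "n \<in> (\<lambda>n. k * n) ` A" by blast
  next
    assume "n \<in> (\<lambda>n. k * n) ` A"
    then obtain x where x: "x \<in> A" "n = k * x" by auto
    have "n + k * m * t = k * (x + m * t)" using x(2) by (simp add: algebra_simps)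
    moreover have "x + m * t \<in> A" using x periodic_densityD(1)[OF assms(1)] by blast
    ultimately show "n + k * m * t \<in> (\<lambda>n. k * n) ` A" by blast
  qed
  have "(\<lambda>n. k * n) ` A \<inter> {0..<k * m} = (\<lambda>n. k * n) ` (A \<inter> {0..<m})"
    using assms(2) by (auto simp: zero_le_mult_iff)
  moreover have "inj_on (\<lambda>n. k * n) (A \<inter> {0..<m})" using assms(2) by (auto simp: inj_on_def)
  ultimately have "card ((\<lambda>n. k * n) ` A \<inter> {0..<k * m}) = card (A \<inter> {0..<m})" by (simp add: card_image)
  thus "real (card ((\<lambda>n. k * n) ` A \<inter> {0..<k * m})) = a / k * (k * m)" using periodic_densityD(3)[OF assms(1)] assms(2) by simp
qed

lemma periodic_density_inter:
  assumes A: "periodic_density m A a" and B: "periodic_density k B b" and co: "coprime m k"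
  shows "periodic_density (m * k) (A \<inter> B) (a * b)"
  unfolding periodic_density_def
proof (intro conjI allI)
  have mk: "m > 0" "k > 0" using A B periodic_densityD by blast+
  show "m * k > 0" using mk by simp
  show "n + m * k * t \<in> A \<inter> B \<longleftrightarrow> n \<in> A \<inter> B" for n t
  proof -
    have "n + m * k * t \<in> A \<longleftrightarrow> n \<in> A" using periodic_densityD(1)[OF A, of n "k * t"] by (simp add: mult.assoc)
    moreover have "n + m * k * t \<in> B \<longleftrightarrow> n \<in> B" using periodic_densityD(1)[OF B, of n "m * t"] by (simp add: mult_ac)
    ultimately show ?thesis by blast
  qed
  have md: "x mod m \<in> A \<longleftrightarrow> x \<in> A" "x mod k \<in> B \<longleftrightarrow> x \<in> B" for x
  proof -
    have "x mod m + m * (x div m) = x" "x mod k + k * (x div k) = x" by simp_all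
    thus "x mod m \<in> A \<longleftrightarrow> x \<in> A" "x mod k \<in> B \<longleftrightarrow> x \<in> B"
      using periodic_densityD(1)[OF A, of "x mod m" "x div m"] periodic_densityD(1)[OF B, of "x mod k" "x div k"] by simp_all
  qed
  have "bij_betw (\<lambda>x. (x mod m, x mod k)) (A \<inter> B \<inter> {0..<m * k}) ((A \<inter> {0..<m}) \<times> (B \<inter> {0..<k}))"
    unfolding bij_betw_def
  proof (intro conjI)
    show "inj_on (\<lambda>x. (x mod m, x mod k)) (A \<inter> B \<inter> {0..<m * k})"
    proof (rule inj_onI)
      fix x y assume *: "x \<in> A \<inter> B \<inter> {0..<m * k}" "y \<in> A \<inter> B \<inter> {0..<m * k}" "(x mod m, x mod k) = (y mod m, y mod k)"
      hence "m dvd x - y" "k dvd x - y" by (simp_all add: mod_eq_dvd_iff)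
      hence "m * k dvd x - y" using co by (rule divides_mult)
      hence "x mod (m * k) = y mod (m * k)" by (simp add: mod_eq_dvd_iff)
      thus "x = y" using * by simp
    qed
    show "(\<lambda>x. (x mod m, x mod k)) ` (A \<inter> B \<inter> {0..<m * k}) = (A \<inter> {0..<m}) \<times> (B \<inter> {0..<k})"
    proof (intro equalityI subsetI)
      fix v assume "v \<in> (\<lambda>x. (x mod m, x mod k)) ` (A \<inter> B \<inter> {0..<m * k})"
      thus "v \<in> (A \<inter> {0..<m}) \<times> (B \<inter> {0..<k})" using md mk by auto
    next
      fix v assume "v \<in> (A \<inter> {0..<m}) \<times> (B \<inter> {0..<k})"
      then obtain s t where v: "v = (s, t)" "s \<in> A" "s \<in> {0..<m}" "t \<in> B" "t \<in> {0..<k}" by auto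
      obtain x where x: "[x = s] (mod m)" "[x = t] (mod k)" using binary_chinese_remainder_int[OF co] by blast
      define y where "y = x mod (m * k)"
      have y: "y mod m = s" "y mod k = t" "y \<in> {0..<m * k}"
        using x v mk by (simp_all add: y_def cong_def mod_mod_cancel)
      hence "y \<in> A" "y \<in> B" using md[of y] v by auto
      thus "v \<in> (\<lambda>x. (x mod m, x mod k)) ` (A \<inter> B \<inter> {0..<m * k})" using y v(1) by force
    qed
  qed
  hence "card (A \<inter> B \<inter> {0..<m * k}) = card ((A \<inter> {0..<m}) \<times> (B \<inter> {0..<k}))"
    by (rule bij_betw_same_card)
  hence "card (A \<inter> B \<inter> {0..<m * k}) = card (A \<inter> {0..<m}) * card (B \<inter> {0..<k})"
    by (simp only: card_cartesian_product)
  thus "real (card (A \<inter> B \<inter> {0..<m * k})) = a * b * (m * k)"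
    using periodic_densityD(3)[OF A] periodic_densityD(3)[OF B] by (simp add: mult_ac)
qed

lemma periodic_density_Inter:
  fixes A :: "nat \<Rightarrow> int set" and d :: "nat \<Rightarrow> real"
  assumes "finite P" "\<And>p. p \<in> P \<Longrightarrow> prime p" "\<And>p. p \<in> P \<Longrightarrow> periodic_density (int p ^ k p) (A p) (d p)"
  shows "periodic_density (\<Prod>p\<in>P. int p ^ k p) (\<Inter>p\<in>P. A p) (\<Prod>p\<in>P. d p)"
  using assms
proof (induction P rule: finite_induct)
  case empty thus ?case by (simp add: periodic_density_def)
next
  case (insert p P)
  have "coprime (\<Prod>q\<in>P. int q ^ k q) (int p ^ k p)"
  proof (rule prod_coprime_left)
    fix q assume "q \<in> P"
    hence "coprime q p" using insert by (metis insertCI primes_coprime)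
    thus "coprime (int q ^ k q) (int p ^ k p)" by (metis coprime_int_iff coprime_power_left_iff coprime_power_right_iff)
  qed
  hence "periodic_density ((\<Prod>q\<in>P. int q ^ k q) * int p ^ k p) ((\<Inter>p\<in>P. A p) \<inter> A p) ((\<Prod>p\<in>P. d p) * d p)"
    using insert by (intro periodic_density_inter) auto
  thus ?case using insert by (simp add: mult.commute Int_commute)
qed

section \<open>The density of a union of square classes at one prime\<close>

locale padic_square_classes =
  fixes p :: nat and L :: "int set"
  assumes p: "prime p"
    and mult_sq: "\<And>n u. n \<in> L \<Longrightarrow> (\<And>k. \<exists>z. int p ^ k dvd z\<^sup>2 - u) \<Longrightarrow> u * n \<in> L"
    and cancel_unit: "\<And>n z. \<not> int p dvd z \<Longrightarrow> z\<^sup>2 * n \<in> L \<Longrightarrow> n \<in> L"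
    and cancel_p: "\<And>n. (int p)\<^sup>2 * n \<in> L \<Longrightarrow> n \<in> L"
begin

text \<open>Units that are congruent modulo p^ex lie in the same square class: modulo
  \<open>p\<close> for odd \<open>p\<close>, modulo 8 for p = 2.\<close>

abbreviation ex :: nat where "ex \<equiv> (if p = 2 then 3 else 1)"

definition A :: "nat \<Rightarrow> int set" where "A v = {w. \<not> int p dvd w \<and> int p ^ v * w \<in> L}"

definition cnt :: "nat \<Rightarrow> nat" where "cnt v = card (A v \<inter> {0..<int p ^ ex})"

text \<open>Valuations \<open>v\<close> and \<open>v + 2\<close> have the same unit parts, so the
  density is that of valuations 0 and 1 times the geometric series in 1 / p^2.\<close>

definition \<delta> :: real where "\<delta> = (cnt 0 + cnt 1 / p) / p ^ ex / (1 - 1 / p\<^sup>2)"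

text \<open>The part of \<open>L\<close> with valuations below 2 j is periodic, which
  \<open>L\<close> itself need not be.\<close>

definition trunc :: "nat \<Rightarrow> int set" where "trunc j = {n\<in>L. \<not> int p ^ (2 * j) dvd n}"

lemma p_pos: "int p > 0" "real p > 1" using prime_gt_1_nat[OF p] by auto

lemma pp: "prime (int p)" using p by simp

text \<open>w w' is a p-adic square, and multiplying p^v w by it gives w^2 times p^v w', from which
  the unit square w^2 can be cancelled.\<close>

lemma A_mult_square:
  assumes w: "w \<in> A v" and z: "\<not> int p dvd z" and w': "int p ^ ex dvd w' - w * z\<^sup>2"
  shows "w' \<in> A v"
proof -
  have nw: "\<not> int p dvd w" and wL: "int p ^ v * w \<in> L" using w by (auto simp: A_def)
  have "int p dvd int p ^ ex" by (intro dvd_power) auto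
  hence "int p dvd w' - w * z\<^sup>2" using w' dvd_trans by blast
  hence nw': "\<not> int p dvd w'"
  proof -
    have "\<not> int p dvd w * z\<^sup>2" using nw z pp by (simp add: prime_dvd_mult_iff prime_dvd_power_iff)
    thus ?thesis using \<open>int p dvd w' - w * z\<^sup>2\<close> by (metis diff_diff_eq2 diff_add_cancel dvd_diff_left_iff dvd_diff_right_iff)
  qed
  have "\<exists>y. int p ^ k dvd y\<^sup>2 - w * w'" for k
  proof (rule padic_square[OF p])
    show "\<not> int p dvd w * z" using nw z pp by (simp add: prime_dvd_mult_iff)
    have "w * w' - (w * z)\<^sup>2 = w * (w' - w * z\<^sup>2)" by (simp add: algebra_simps power2_eq_square)
    thus "int p ^ ex dvd w * w' - (w * z)\<^sup>2" using w' by simp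
  qed
  hence "(w * w') * (int p ^ v * w) \<in> L" using mult_sq wL by blast
  hence "w\<^sup>2 * (int p ^ v * w') \<in> L" by (simp add: power2_eq_square mult_ac)
  hence "int p ^ v * w' \<in> L" using cancel_unit nw by blast
  thus ?thesis using nw' by (simp add: A_def)
qed

lemma A_periodic: "periodic_density (int p ^ ex) (A v) (cnt v / p ^ ex)"
  unfolding periodic_density_def
proof (intro conjI allI)
  have one: "\<not> int p dvd 1" using pp not_prime_unit by blast
  have imp: "n + int p ^ ex * k \<in> A v" if "n \<in> A v" for n k
    by (rule A_mult_square[OF that one]) simp
  show "n + int p ^ ex * k \<in> A v \<longleftrightarrow> n \<in> A v" for n k
    using imp[of n k] imp[of "n + int p ^ ex * k" "- k"] by auto
  show "real (card (A v \<inter> {0..<int p ^ ex})) = cnt v / p ^ ex * (int p ^ ex)"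
    using p_pos by (simp add: cnt_def)
qed (use p_pos in auto)

text \<open>Split by valuation 0, 1 and at least 2. Elements of the last kind come from
  \<open>trunc j\<close> because p^2 may be cancelled in \<open>L\<close>.\<close>

lemma trunc_Suc: "trunc (Suc j) = (A 0 \<union> (\<lambda>n. int p * n) ` A 1) \<union> (\<lambda>n. (int p)\<^sup>2 * n) ` trunc j"
proof (intro equalityI subsetI)
  fix n assume n: "n \<in> trunc (Suc j)"
  show "n \<in> (A 0 \<union> (\<lambda>n. int p * n) ` A 1) \<union> (\<lambda>n. (int p)\<^sup>2 * n) ` trunc j"
  proof (cases "int p dvd n")
    case False thus ?thesis using n by (simp add: trunc_def A_def)
  next
    case True
    then obtain m where m: "n = int p * m" by blast
    show ?thesis
    proof (cases "int p dvd m")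
      case False
      hence "m \<in> A 1" using n m by (simp add: trunc_def A_def)
      thus ?thesis using m by blast
    next
      case True
      then obtain k where k: "m = int p * k" by blast
      have nk: "n = (int p)\<^sup>2 * k" by (simp add: m k power2_eq_square)
      have "k \<in> L" using n nk cancel_p by (simp add: trunc_def)
      moreover have "\<not> int p ^ (2 * j) dvd k"
      proof
        assume "int p ^ (2 * j) dvd k"
        hence "(int p)\<^sup>2 * int p ^ (2 * j) dvd n" unfolding nk by (rule mult_dvd_mono[OF dvd_refl])
        thus False using n by (simp add: trunc_def power2_eq_square mult.assoc)
      qed
      ultimately show ?thesis using nk by (auto simp: trunc_def)
    qed
  qed
next
  fix n assume "n \<in> (A 0 \<union> (\<lambda>n. int p * n) ` A 1) \<union> (\<lambda>n. (int p)\<^sup>2 * n) ` trunc j"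
  then consider "n \<in> A 0" | m where "n = int p * m" "m \<in> A 1" | m where "n = (int p)\<^sup>2 * m" "m \<in> trunc j" by blast
  thus "n \<in> trunc (Suc j)"
  proof cases
    case 1
    have "\<not> int p ^ (2 * Suc j) dvd n"
    proof
      assume "int p ^ (2 * Suc j) dvd n"
      hence "int p ^ 1 dvd n" by (rule dvd_power_mono_int) simp
      thus False using 1 by (simp add: A_def)
    qed
    thus ?thesis using 1 by (simp add: trunc_def A_def)
  next
    case 2
    have "\<not> int p ^ (2 * Suc j) dvd n"
    proof
      assume "int p ^ (2 * Suc j) dvd n"
      hence "int p ^ 2 dvd n" by (rule dvd_power_mono_int) simp
      hence "int p dvd m" using 2(1) p_pos by (simp add: power2_eq_square)
      thus False using 2 by (simp add: A_def)
    qed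
    thus ?thesis using 2 by (simp add: trunc_def A_def)
  next
    case 3
    have "(int p)\<^sup>2 * m \<in> L" using 3 by (intro mult_sq) (auto simp: trunc_def intro: exI[of _ "int p"])
    moreover have "\<not> int p ^ (2 * Suc j) dvd n"
    proof
      assume "int p ^ (2 * Suc j) dvd n"
      hence "(int p)\<^sup>2 * int p ^ (2 * j) dvd (int p)\<^sup>2 * m" using 3 by (simp add: power2_eq_square)
      hence "int p ^ (2 * j) dvd m" using p_pos by simp
      thus False using 3 by (simp add: trunc_def)
    qed
    ultimately show ?thesis using 3 by (simp add: trunc_def)
  qed
qed

text \<open>By \<open>trunc_Suc\<close> the densities satisfy d' = g + d / p^2, where
  \<open>g\<close> is the density of valuations 0 and 1; the fixed point of this recursion is
  \<open>\<delta>\<close>.\<close>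

lemma trunc_density: "\<exists>k. periodic_density (int p ^ k) (trunc j) (\<delta> * (1 - 1 / p ^ (2 * j)))"
proof (induction j)
  case 0
  have "periodic_density (int p ^ 0) (trunc 0) (\<delta> * (1 - 1 / p ^ (2 * 0)))" by (simp add: periodic_density_def trunc_def)
  thus ?case by blast
next
  case (Suc j)
  then obtain k where k: "periodic_density (int p ^ k) (trunc j) (\<delta> * (1 - 1 / p ^ (2 * j)))" by blast
  define M where "M = int p ^ (k + ex + 2)"
  have M1: "M = int p ^ ex * int p ^ (k + 2)" "M = (int p * int p ^ ex) * int p ^ (k + 1)" "M = ((int p)\<^sup>2 * int p ^ k) * int p ^ ex"
    by (simp_all add: M_def power_add power2_eq_square)
  have a0: "periodic_density M (A 0) (cnt 0 / p ^ ex)" unfolding M1(1) by (rule periodic_density_mult[OF A_periodic]) (use p_pos in auto)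
  have a1: "periodic_density M ((\<lambda>n. int p * n) ` A 1) (cnt 1 / p ^ ex / int p)"
    unfolding M1(2) by (rule periodic_density_mult[OF periodic_density_scale[OF A_periodic]]) (use p_pos in auto)
  have a2: "periodic_density M ((\<lambda>n. (int p)\<^sup>2 * n) ` trunc j) (\<delta> * (1 - 1 / p ^ (2 * j)) / real_of_int ((int p)\<^sup>2))"
    unfolding M1(3) by (rule periodic_density_mult[OF periodic_density_scale[OF k]]) (use p_pos in auto)
  have d1: "A 0 \<inter> (\<lambda>n. int p * n) ` A 1 = {}" by (auto simp: A_def)
  have d2: "(A 0 \<union> (\<lambda>n. int p * n) ` A 1) \<inter> (\<lambda>n. (int p)\<^sup>2 * n) ` trunc j = {}"
    using p_pos by (auto simp: A_def power2_eq_square)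
  have "periodic_density M (trunc (Suc j)) (cnt 0 / p ^ ex + cnt 1 / p ^ ex / int p + \<delta> * (1 - 1 / p ^ (2 * j)) / real_of_int ((int p)\<^sup>2))"
    unfolding trunc_Suc by (intro periodic_density_union a0 a1 a2 d1 d2)
  moreover have "cnt 0 / p ^ ex + cnt 1 / p ^ ex / int p + \<delta> * (1 - 1 / p ^ (2 * j)) / real_of_int ((int p)\<^sup>2) = \<delta> * (1 - 1 / p ^ (2 * Suc j))"
  proof -
    define g where "g = cnt 0 / p ^ ex + cnt 1 / p ^ ex / int p"
    define x where "x = 1 / (real p)\<^sup>2"
    have "x < 1"
    proof -
      have "1\<^sup>2 < (real p)\<^sup>2" using p_pos by (intro power_strict_mono) auto
      thus ?thesis unfolding x_def by (subst divide_less_eq_1_pos) (use p_pos in auto)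
    qed
    have "\<delta> = g / (1 - x)" by (simp add: \<delta>_def g_def x_def add_divide_distrib mult.commute)
    hence g: "g = \<delta> * (1 - x)" using \<open>x < 1\<close> by simp
    have "\<delta> * (1 - 1 / p ^ (2 * j)) / real_of_int ((int p)\<^sup>2) = \<delta> * x * (1 - 1 / p ^ (2 * j))" by (simp add: x_def)
    moreover have "1 / real p ^ (2 * Suc j) = x * (1 / p ^ (2 * j))" by (simp add: x_def power2_eq_square)
    ultimately show ?thesis unfolding g_def[symmetric] g by (simp add: algebra_simps)
  qed
  ultimately show ?case unfolding M_def by metis
qed

text \<open>Modulo \<open>p\<close> the unit parts are a union of cosets of the group of nonzero
  squares, which has index 2.\<close>

lemma cnt_odd:
  assumes odd: "odd p"
  shows "\<exists>i\<le>2. 2 * cnt v = i * (p - 1)"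
proof -
  have ex1: "ex = 1" using odd by auto
  have cnt: "cnt v = card (A v \<inter> {0..<int p})" by (simp add: cnt_def ex1)
  define Sq where "Sq = (\<lambda>z. z\<^sup>2 mod int p) ` {0..int (p div 2)}"
  have cS: "card Sq = p div 2 + 1" unfolding Sq_def by (rule quadratic_residues_card[OF p odd])
  have S0: "0 \<in> Sq" unfolding Sq_def by (rule image_eqI[of _ _ 0]) auto
  have fS: "finite Sq" by (simp add: Sq_def)
  have Ss: "Sq \<subseteq> {0..<int p}" using p_pos by (auto simp: Sq_def)
  define C where "C w = (\<lambda>s. (w * s) mod int p) ` (Sq - {0})" for w
  have cC: "card (C w) = p div 2" if w: "\<not> int p dvd w" for w
  proof -
    have "inj_on (\<lambda>s. (w * s) mod int p) (Sq - {0})"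
    proof (rule inj_onI)
      fix x y assume xy: "x \<in> Sq - {0}" "y \<in> Sq - {0}" "(w * x) mod int p = (w * y) mod int p"
      have "int p dvd w * (x - y)" using xy(3) by (simp add: mod_eq_dvd_iff algebra_simps)
      hence "int p dvd x - y" using w pp by (simp add: prime_dvd_mult_iff)
      hence "x mod int p = y mod int p" by (simp add: mod_eq_dvd_iff)
      moreover have "x \<in> {0..<int p}" "y \<in> {0..<int p}" using xy Ss by auto
      ultimately show "x = y" by simp
    qed
    thus ?thesis unfolding C_def using S0 fS cS by (simp add: card_image card_Diff_singleton)
  qed
  have CA: "C w \<subseteq> A v \<inter> {0..<int p}" if w: "w \<in> A v" for w
  proof
    fix x assume "x \<in> C w"
    then obtain s where s: "s \<in> Sq" "s \<noteq> 0" "x = (w * s) mod int p" by (auto simp: C_def)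
    then obtain z where z: "s = z\<^sup>2 mod int p" by (auto simp: Sq_def)
    have nz: "\<not> int p dvd z"
    proof
      assume "int p dvd z"
      hence "int p dvd z\<^sup>2" by (simp add: power2_eq_square)
      thus False using s z by simp
    qed
    have "x mod int p = (w * z\<^sup>2) mod int p" using s z by (simp add: mod_mult_right_eq)
    hence "int p ^ ex dvd x - w * z\<^sup>2" by (simp only: mod_eq_dvd_iff ex1 power_one_right)
    hence "x \<in> A v" using A_mult_square[OF w nz] by blast
    thus "x \<in> A v \<inter> {0..<int p}" using s p_pos by simp
  qed
  have fin: "finite (A v \<inter> {0..<int p})" by simp
  have tot: "A v \<inter> {0..<int p} \<subseteq> {1..<int p}"
  proof
    fix x assume x: "x \<in> A v \<inter> {0..<int p}"
    have "x \<noteq> 0" using x by (auto simp: A_def)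
    thus "x \<in> {1..<int p}" using x by auto
  qed
  have p2: "2 * (p div 2) = p - 1" using odd by presburger
  have le: "cnt v \<le> p - 1" using card_mono[OF _ tot] by (simp add: cnt)
  show ?thesis
  proof (cases "A v \<inter> {0..<int p} = {}")
    case True thus ?thesis by (intro exI[of _ 0]) (simp add: cnt)
  next
    case False
    then obtain w where w: "w \<in> A v" "w \<in> {0..<int p}" by blast
    have nw: "\<not> int p dvd w" using w by (simp add: A_def)
    show ?thesis
    proof (cases "A v \<inter> {0..<int p} \<subseteq> C w")
      case True
      hence "A v \<inter> {0..<int p} = C w" using CA[OF w(1)] by blast
      thus ?thesis using cC[OF nw] p2 by (intro exI[of _ 1]) (simp add: cnt)
    next
      case False
      then obtain w' where w': "w' \<in> A v" "w' \<in> {0..<int p}" "w' \<notin> C w" by blast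
      have nw': "\<not> int p dvd w'" using w' by (simp add: A_def)
      have "C w \<inter> C w' = {}"
      proof (rule ccontr)
        assume "\<not> ?thesis"
        then obtain s s' where s: "s \<in> Sq" "s \<noteq> 0" "s' \<in> Sq" "s' \<noteq> 0" "(w * s) mod int p = (w' * s') mod int p" by (auto simp: C_def)
        obtain z where z: "s = z\<^sup>2 mod int p" using s by (auto simp: Sq_def)
        obtain z' where z': "s' = z'\<^sup>2 mod int p" using s by (auto simp: Sq_def)
        have nz': "\<not> int p dvd z'"
        proof
          assume "int p dvd z'"
          hence "int p dvd z'\<^sup>2" by (simp add: power2_eq_square)
          thus False using s z' by simp
        qed
        have "coprime z' (int p)" using nz' pp by (metis coprime_commute prime_imp_coprime)
        then obtain y where y: "[z' * y = 1] (mod int p)" using cong_solve_coprime_int by blast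
        have e: "[w * z\<^sup>2 = w' * z'\<^sup>2] (mod int p)" using s(5) unfolding z z' cong_def by (simp add: mod_mult_right_eq)
        have "[w' * (z' * y)\<^sup>2 = w' * 1\<^sup>2] (mod int p)" using y by (intro cong_mult cong_pow cong_refl)
        hence "[w' = w' * z'\<^sup>2 * y\<^sup>2] (mod int p)" by (simp add: power_mult_distrib mult.assoc cong_sym)
        also have "[w' * z'\<^sup>2 * y\<^sup>2 = w * z\<^sup>2 * y\<^sup>2] (mod int p)" using e by (intro cong_mult cong_sym[OF e] cong_refl)
        finally have e2: "[w' = w * (z * y)\<^sup>2] (mod int p)" by (simp add: power_mult_distrib mult.assoc)
        define t where "t = (z * y) mod int p"
        \<comment> \<open>Up to sign every residue lies in the range used to define
          \<open>Sq\<close>.\<close>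
        obtain t' where t': "t' \<in> {0..int (p div 2)}" "t'\<^sup>2 mod int p = t\<^sup>2 mod int p"
        proof (cases "t \<le> int (p div 2)")
          case True
          moreover have "t \<ge> 0" using p_pos by (simp add: t_def)
          ultimately show ?thesis using that[of t] by simp
        next
          case False
          have "t < int p" using p_pos by (simp add: t_def)
          moreover have "int p = 2 * int (p div 2) + 1" using odd by presburger
          ultimately have "int p - t \<in> {0..int (p div 2)}" using False by auto
          moreover have "(int p - t)\<^sup>2 mod int p = t\<^sup>2 mod int p"
          proof -
            have "(int p - t)\<^sup>2 = t\<^sup>2 + int p * (int p - 2 * t)" by (simp add: power2_eq_square algebra_simps)
            thus ?thesis by simp
          qed
          ultimately show ?thesis using that by blast
        qed
        define s2 where "s2 = t'\<^sup>2 mod int p"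
        have s2: "s2 \<in> Sq" unfolding s2_def Sq_def by (rule image_eqI[OF refl t'(1)])
        have "s2 = (z * y)\<^sup>2 mod int p" using t' by (simp add: s2_def t_def power_mod)
        hence e3: "w' = (w * s2) mod int p" using e2 w'(2) unfolding cong_def by (simp add: mod_mult_right_eq)
        have "s2 \<noteq> 0" using e3 nw' by auto
        hence "w' \<in> C w" using e3 s2 by (auto simp: C_def)
        thus False using w' by simp
      qed
      hence "card (C w \<union> C w') = p div 2 + p div 2"
        using cC[OF nw] cC[OF nw'] by (subst card_Un_disjoint) (auto simp: C_def fS)
      moreover have "card (C w \<union> C w') \<le> cnt v" unfolding cnt using CA[OF w(1)] CA[OF w'(1)] fin by (intro card_mono) auto
      ultimately have "cnt v = p - 1" using le p2 by linarith
      thus ?thesis by (intro exI[of _ 2]) simp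
    qed
  qed
qed

lemma \<delta>_odd:
  assumes odd: "odd p"
  shows "\<exists>i j :: nat. i \<le> 2 \<and> j \<le> 2 \<and> \<delta> = (real i * real p + real j) / (2 * (real p + 1))"
proof -
  obtain i where i: "i \<le> 2" "2 * cnt 0 = i * (p - 1)" using cnt_odd[OF odd] by blast
  obtain j where j: "j \<le> 2" "2 * cnt 1 = j * (p - 1)" using cnt_odd[OF odd] by blast
  have ex1: "ex = 1" using odd by auto
  have p1: "real p > 1" by (rule p_pos)
  have "real (2 * cnt 0) = real i * (real p - 1)" "real (2 * cnt 1) = real j * (real p - 1)"
    unfolding i j using prime_gt_0_nat[OF p] by (simp_all add: of_nat_diff)
  hence c: "real (cnt 0) = real i * (real p - 1) / 2" "real (cnt 1) = real j * (real p - 1) / 2" by simp_all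
  have e: "1 - 1 / (real p)\<^sup>2 = (real p - 1) * (real p + 1) / (real p)\<^sup>2"
    using p1 by (simp add: field_simps power2_eq_square)
  have "i \<le> 2 \<and> j \<le> 2 \<and> \<delta> = (real i * p + j) / (2 * (real p + 1))"
  proof (intro conjI i(1) j(1))
    have "\<delta> = (cnt 0 + cnt 1 / p) / p / (1 - 1 / (real p)\<^sup>2)" unfolding \<delta>_def ex1 by simp
    also have "\<dots> = (cnt 0 + cnt 1 / p) / p / ((real p - 1) * (real p + 1) / (real p)\<^sup>2)" unfolding e by (rule refl)
    also have "\<dots> = (cnt 0 * real p + cnt 1) / ((real p - 1) * (real p + 1))"
    proof -
      have "(a + b / x) / x / (D / x\<^sup>2) = (a * x + b) / D" if "x > 1" "D > 0" for a b x D :: real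
        using that by (simp add: field_simps power2_eq_square)
      thus ?thesis using p1 by simp
    qed
    also have "cnt 0 * real p + cnt 1 = (real p - 1) * ((real i * p + j) / 2)" unfolding c by (simp add: algebra_simps add_divide_distrib)
    finally show "\<delta> = (real i * p + j) / (2 * (real p + 1))" using p1 by simp
  qed
  thus ?thesis by blast
qed

lemma \<delta>_two:
  assumes two: "p = 2"
  shows "\<exists>j\<le>12. \<delta> = real j / 12"
proof -
  have b: "cnt v \<le> 4" for v
  proof -
    have "A v \<inter> {0..<int p ^ ex} \<subseteq> {1, 3, 5, 7}"
    proof
      fix x assume x: "x \<in> A v \<inter> {0..<int p ^ ex}"
      have "\<not> int p dvd x" using x by (simp add: A_def)
      hence "odd x" "0 \<le> x" "x < 8" using two x by auto
      thus "x \<in> {1, 3, 5, 7}" by simp presburger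
    qed
    hence "cnt v \<le> card {1, 3, 5, 7 :: int}" unfolding cnt_def by (intro card_mono) auto
    thus ?thesis by simp
  qed
  have "\<delta> = real (2 * cnt 0 + cnt 1) / 12"
  proof -
    define a b x where "a = real (cnt 0)" and "b = real (cnt 1)" and "x = real p"
    have ex3: "ex = 3" and x2: "x = 2" using two by (simp_all add: x_def)
    have "\<delta> = (a + b / x) / x ^ 3 / (1 - 1 / x\<^sup>2)" unfolding \<delta>_def ex3 a_def b_def x_def by simp
    also have "\<dots> = (2 * a + b) / 12" unfolding x2 by (simp add: field_simps)
    finally show ?thesis by (simp add: a_def b_def)
  qed
  moreover have "2 * cnt 0 + cnt 1 \<le> 12" using b[of 0] b[of 1] by linarith
  ultimately show ?thesis by blast
qed

end

section \<open>Intersecting the local conditions, and the density of a form\<close>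

lemma Loc_padic_square_classes:
  assumes "prime p" "\<And>n. (int p)\<^sup>2 * n \<in> Loc f p \<Longrightarrow> n \<in> Loc f p"
  shows "padic_square_classes p (Loc f p)"
proof
  show "u * n \<in> Loc f p" if "n \<in> Loc f p" "\<And>k. \<exists>z. int p ^ k dvd z\<^sup>2 - u" for n u
    by (rule Loc_mult_padic_square[OF that])
  show "n \<in> Loc f p" if "\<not> int p dvd z" "z\<^sup>2 * n \<in> Loc f p" for n z
    by (rule Loc_cancel_unit_square[OF assms(1) that])
qed (use assms in auto)

lemma card_multiples_interval:
  fixes m x :: int
  assumes "m > 0"
  shows "real (card {n\<in>{x..<x + int N}. m dvd n}) \<le> N / m + 1"
proof -
  have "real (card {n\<in>{x..<x + int N}. m dvd n}) \<le> card {x..<x + int N} / m + 1"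
    by (rule card_spaced_le[of "{x..<x + int N}"]) (use assms in \<open>auto intro: dvd_diff\<close>)
  thus ?thesis by simp
qed

text \<open>The truncated sets are periodic with coprime periods, so their densities multiply. What
  truncation removes is divisible by p^(2j) for some \<open>p\<close> in \<open>P\<close>, and has
  density at most card P / 4^j.\<close>

lemma Inter_uniform_density:
  fixes L :: "nat \<Rightarrow> int set" and \<epsilon> :: real
  assumes fP: "finite P" and sc: "\<And>p. p \<in> P \<Longrightarrow> padic_square_classes p (L p)" and \<epsilon>: "\<epsilon> > 0"
  defines "D \<equiv> (\<Prod>p\<in>P. padic_square_classes.\<delta> p (L p))"
  shows "\<exists>N0. \<forall>x N. N \<ge> N0 \<longrightarrow> \<bar>real (card ((\<Inter>p\<in>P. L p) \<inter> {x..<x + int N})) - D * N\<bar> \<le> \<epsilon> * N"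
proof -
  define \<delta> where "\<delta> p = padic_square_classes.\<delta> p (L p)" for p
  define Tr where "Tr j p = padic_square_classes.trunc p (L p) j" for j p
  have pr: "prime p" if "p \<in> P" for p using sc[OF that] by (simp add: padic_square_classes.p)
  have p2: "real p \<ge> 2" if "p \<in> P" for p using prime_ge_2_nat[OF pr[OF that]] by simp
  have lim1: "(\<lambda>j. \<delta> p * (1 - 1 / real p ^ (2 * j))) \<longlonglongrightarrow> \<delta> p * (1 - 0)" if "p \<in> P" for p
  proof (intro tendsto_intros)
    have "(\<lambda>j. (1 / (real p)\<^sup>2) ^ j) \<longlonglongrightarrow> 0"
    proof (rule LIMSEQ_realpow_zero)
      have "1\<^sup>2 < (real p)\<^sup>2" using p2[OF that] by (intro power_strict_mono) auto
      thus "1 / (real p)\<^sup>2 < 1" using p2[OF that] by (subst divide_less_eq_1_pos) auto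
    qed simp
    thus "(\<lambda>j. 1 / real p ^ (2 * j)) \<longlonglongrightarrow> 0" by (simp add: power_mult power_divide)
  qed
  have lim2: "(\<lambda>j. \<Prod>p\<in>P. \<delta> p * (1 - 1 / real p ^ (2 * j))) \<longlonglongrightarrow> (\<Prod>p\<in>P. \<delta> p * (1 - 0))"
    by (intro tendsto_prod lim1)
  have lim3: "(\<lambda>j. real (card P) * (1 / 4) ^ j) \<longlonglongrightarrow> real (card P) * 0"
    by (intro tendsto_intros LIMSEQ_realpow_zero) auto
  have e1: "eventually (\<lambda>j. \<bar>(\<Prod>p\<in>P. \<delta> p * (1 - 1 / real p ^ (2 * j))) - D\<bar> < \<epsilon> / 4) sequentially"
    using tendstoD[OF lim2, of "\<epsilon> / 4"] \<epsilon> by (simp add: D_def \<delta>_def dist_real_def)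
  have e2: "eventually (\<lambda>j. real (card P) * (1 / 4) ^ j < \<epsilon> / 4) sequentially"
    using order_tendstoD(2)[OF lim3, of "\<epsilon> / 4"] \<epsilon> by simp
  obtain j where j: "\<bar>(\<Prod>p\<in>P. \<delta> p * (1 - 1 / real p ^ (2 * j))) - D\<bar> < \<epsilon> / 4" "real (card P) * (1 / 4) ^ j < \<epsilon> / 4"
    using eventually_happens'[OF sequentially_bot eventually_conj[OF e1 e2]] by blast
  define Dj where "Dj = (\<Prod>p\<in>P. \<delta> p * (1 - 1 / real p ^ (2 * j)))"
  have "\<exists>k. periodic_density (int p ^ k) (Tr j p) (\<delta> p * (1 - 1 / real p ^ (2 * j)))" if "p \<in> P" for p
    using padic_square_classes.trunc_density[OF sc[OF that], of j] by (simp add: Tr_def \<delta>_def)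
  then obtain k where k: "\<And>p. p \<in> P \<Longrightarrow> periodic_density (int p ^ k p) (Tr j p) (\<delta> p * (1 - 1 / real p ^ (2 * j)))" by metis
  define M where "M = (\<Prod>p\<in>P. int p ^ k p)"
  have pd: "periodic_density M (\<Inter>p\<in>P. Tr j p) Dj" unfolding M_def Dj_def by (rule periodic_density_Inter[OF fP pr k])
  have M0: "M > 0" using pd periodic_densityD by blast
  define N0 where "N0 = nat \<lceil>(M + card P) / (\<epsilon> / 4)\<rceil>"
  have "\<bar>real (card ((\<Inter>p\<in>P. L p) \<inter> {x..<x + int N})) - D * N\<bar> \<le> \<epsilon> * N" if N: "N \<ge> N0" for x N
  proof -
    define I where "I = (\<Inter>p\<in>P. L p) \<inter> {x..<x + int N}"
    define T where "T = (\<Inter>p\<in>P. Tr j p) \<inter> {x..<x + int N}"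
    define V where "V p = {n\<in>{x..<x + int N}. int p ^ (2 * j) dvd n}" for p
    have TI: "T \<subseteq> I" unfolding T_def I_def Tr_def
      using sc by (auto simp: padic_square_classes.trunc_def)
    have fI: "finite I" by (simp add: I_def)
    have "I \<subseteq> T \<union> (\<Union>p\<in>P. V p)" unfolding T_def I_def Tr_def V_def
      using sc by (auto simp: padic_square_classes.trunc_def)
    moreover have "finite (V p)" for p unfolding V_def by (rule finite_subset[of _ "{x..<x + int N}"]) auto
    moreover have "finite T" by (simp add: T_def)
    ultimately have "card I \<le> card (T \<union> (\<Union>p\<in>P. V p))" using fP by (intro card_mono) auto
    also have "\<dots> \<le> card T + card (\<Union>p\<in>P. V p)" by (rule card_Un_le)
    also have "\<dots> \<le> card T + (\<Sum>p\<in>P. card (V p))" using fP by (intro add_left_mono card_UN_le)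
    finally have "real (card I) \<le> real (card T) + (\<Sum>p\<in>P. real (card (V p)))" by (simp flip: of_nat_sum of_nat_add)
    also have "(\<Sum>p\<in>P. real (card (V p))) \<le> (\<Sum>p\<in>P. (1 / 4) ^ j * N + 1)"
    proof (rule sum_mono)
      fix p assume p: "p \<in> P"
      have "real (card (V p)) \<le> N / real_of_int (int p ^ (2 * j)) + 1"
        unfolding V_def using p2[OF p] by (intro card_multiples_interval) auto
      also have "N / real_of_int (int p ^ (2 * j)) \<le> N / 4 ^ j"
      proof -
        have "(2::real) ^ (2 * j) \<le> real p ^ (2 * j)" using p2[OF p] by (intro power_mono) auto
        hence "(4::real) ^ j \<le> real p ^ (2 * j)" by (simp add: power_mult)
        thus ?thesis using p2[OF p] by (auto intro!: divide_left_mono mult_pos_pos)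
      qed
      finally show "real (card (V p)) \<le> (1 / 4) ^ j * N + 1" by (simp add: power_one_over)
    qed
    also have "\<dots> = real (card P) * (1 / 4) ^ j * N + card P" by (simp add: algebra_simps)
    also have "real (card P) * (1 / 4) ^ j * N \<le> \<epsilon> / 4 * N" using j(2) by (intro mult_right_mono) auto
    finally have up: "real (card I) \<le> real (card T) + \<epsilon> / 4 * N + card P" by simp
    have lowr: "real (card T) \<le> real (card I)" using card_mono[OF fI TI] by simp
    have cT: "\<bar>real (card T) - Dj * N\<bar> \<le> M" unfolding T_def by (rule periodic_density_interval[OF pd])
    have "\<bar>Dj - D\<bar> * N \<le> \<epsilon> / 4 * N" using j(1) by (intro mult_right_mono) (auto simp: Dj_def)
    hence cD: "\<bar>Dj * N - D * N\<bar> \<le> \<epsilon> / 4 * N" by (simp add: abs_mult flip: left_diff_distrib)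
    have "(M + card P) / (\<epsilon> / 4) \<le> N" using N unfolding N0_def by linarith
    hence "M + card P \<le> \<epsilon> / 4 * N" using \<epsilon> by (simp add: field_simps)
    hence cM: "real_of_int M + card P \<le> \<epsilon> / 4 * N" by simp
    have "real (card P) \<ge> 0" "\<epsilon> / 4 * N \<ge> 0" using \<epsilon> by auto
    thus ?thesis unfolding I_def[symmetric] using up lowr cT cD cM by linarith
  qed
  thus ?thesis by blast
qed

lemma density_tendsto:
  fixes D :: real and c :: "nat \<Rightarrow> nat"
  assumes "\<And>\<epsilon>::real. \<epsilon> > 0 \<Longrightarrow> \<exists>N0. \<forall>N\<ge>N0. \<bar>real (c N) - D * N\<bar> \<le> \<epsilon> * N"
  shows "(\<lambda>N. real (c N) / N) \<longlonglongrightarrow> D"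
proof (rule LIMSEQ_I)
  fix r :: real assume r: "r > 0"
  obtain N0 where N0: "\<And>N. N \<ge> N0 \<Longrightarrow> \<bar>real (c N) - D * N\<bar> \<le> r / 2 * N" using assms[of "r / 2"] r by auto
  have "norm (real (c N) / N - D) < r" if "N \<ge> max N0 1" for N
  proof -
    have N: "real N > 0" using that by simp
    have "real (c N) / N - D = (real (c N) - D * N) / N" using N by (simp add: field_simps)
    hence "\<bar>real (c N) / N - D\<bar> = \<bar>real (c N) - D * N\<bar> / N" by simp
    also have "\<dots> \<le> (r / 2 * N) / N" using N0[of N] that by (intro divide_right_mono) auto
    also have "\<dots> = r / 2" using N by simp
    finally show ?thesis using r by simp
  qed
  thus "\<exists>no. \<forall>n\<ge>no. norm (real (c n) / n - D) < r" by blast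
qed

text \<open>Values lie in every \<open>Loc f p\<close>, and by \<open>almost_all_represented\<close>
  the positive ones exhaust the intersection up to density zero.\<close>

lemma positive_values_density:
  assumes f: "nondegenerate f" and e: "tform_eval f e > 0" and fP: "finite P"
    and sc: "\<And>p. p \<in> P \<Longrightarrow> padic_square_classes p (Loc f p)"
    and P: "\<And>p. prime p \<Longrightarrow> p \<notin> P \<Longrightarrow> Loc f p = UNIV"
  shows "(\<lambda>N. real (card (range (tform_eval f) \<inter> {1..int N})) / N) \<longlonglongrightarrow> (\<Prod>p\<in>P. padic_square_classes.\<delta> p (Loc f p))"
proof (rule density_tendsto)
  fix \<epsilon> :: real assume \<epsilon>: "\<epsilon> > 0"
  define D where "D = (\<Prod>p\<in>P. padic_square_classes.\<delta> p (Loc f p))"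
  obtain h1 h2 where h: "polar f e h1 = 0" "polar f e h2 = 0" "polar f h1 h2 = 0"
    "tform_eval f h1 \<noteq> 0" "tform_eval f h2 \<noteq> 0" using orthogonal_triple_exists[OF f] e by (metis less_irrefl)
  define I where "I = (\<Inter>p\<in>P. Loc f p)"
  obtain N0 where N0: "\<And>Y. Y \<ge> N0 \<Longrightarrow> real (card {n. 0 < n \<and> real_of_int n \<le> Y \<and> (\<forall>p. prime p \<longrightarrow> n \<in> Loc f p) \<and> n \<notin> range (tform_eval f)}) \<le> \<epsilon> / 2 * Y"
    using almost_all_represented[OF h(1-3) e h(4,5), of "\<epsilon> / 2"] \<epsilon> by auto
  obtain N1 where N1: "\<And>x N. N \<ge> N1 \<Longrightarrow> \<bar>real (card (I \<inter> {x..<x + int N})) - D * N\<bar> \<le> \<epsilon> / 2 * N"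
    using Inter_uniform_density[OF fP sc, of "\<epsilon> / 2"] \<epsilon> unfolding I_def D_def by auto
  have "\<bar>real (card (range (tform_eval f) \<inter> {1..int N})) - D * N\<bar> \<le> \<epsilon> * N" if N: "N \<ge> max N1 (nat \<lceil>N0\<rceil>)" for N
  proof -
    define R where "R = range (tform_eval f) \<inter> {1..int N}"
    define E where "E = {n. 0 < n \<and> real_of_int n \<le> real N \<and> (\<forall>p. prime p \<longrightarrow> n \<in> Loc f p) \<and> n \<notin> range (tform_eval f)}"
    have iv: "{1..<1 + int N} = {1..int N}" by auto
    have "R \<subseteq> I \<inter> {1..int N}" unfolding R_def I_def using range_subset_Loc by blast
    hence lo: "card R \<le> card (I \<inter> {1..int N})" by (intro card_mono) auto
    have fE: "finite E" by (rule finite_subset[of _ "{1..int N}"]) (auto simp: E_def)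
    have "I \<inter> {1..int N} \<subseteq> R \<union> E"
    proof
      fix n assume n: "n \<in> I \<inter> {1..int N}"
      have "n \<in> Loc f p" if "prime p" for p using n P[OF that] by (cases "p \<in> P") (auto simp: I_def)
      thus "n \<in> R \<union> E" using n by (auto simp: R_def E_def)
    qed
    hence "card (I \<inter> {1..int N}) \<le> card (R \<union> E)" using fE by (intro card_mono) (auto simp: R_def)
    also have "\<dots> \<le> card R + card E" by (rule card_Un_le)
    finally have "real (card (I \<inter> {1..int N})) \<le> real (card R) + real (card E)" by linarith
    moreover have "real (card E) \<le> \<epsilon> / 2 * N" unfolding E_def by (rule N0) (use N in linarith)
    moreover have "\<bar>real (card (I \<inter> {1..int N})) - D * N\<bar> \<le> \<epsilon> / 2 * N" using N1[of N 1] N unfolding iv by simp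
    ultimately show ?thesis unfolding R_def[symmetric] using lo by linarith
  qed
  thus "\<exists>N0. \<forall>N\<ge>N0. \<bar>real (card (range (tform_eval f) \<inter> {1..int N})) - (\<Prod>p\<in>P. padic_square_classes.\<delta> p (Loc f p)) * N\<bar> \<le> \<epsilon> * N"
    unfolding D_def by blast
qed

text \<open>Negation reflects a period, and by periodicity every window of the length of a period
  has the same count.\<close>

lemma \<delta>_uminus:
  assumes sc: "padic_square_classes p L" and sc': "padic_square_classes p L'" and neg: "\<And>n. n \<in> L' \<longleftrightarrow> - n \<in> L"
  shows "padic_square_classes.\<delta> p L' = padic_square_classes.\<delta> p L"
proof -
  interpret A: padic_square_classes p L by (rule sc)
  interpret B: padic_square_classes p L' by (rule sc')
  have "B.cnt v = A.cnt v" for v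
  proof -
    have 1: "n \<in> B.A v \<longleftrightarrow> - n \<in> A.A v" for n by (simp add: A.A_def B.A_def neg)
    have "card (B.A v \<inter> {0..<m}) = card (A.A v \<inter> {1 - m..<1})" for m
      by (rule bij_betw_same_card[of uminus], rule bij_betw_byWitness[where f' = uminus]) (auto simp: 1)
    from this[of "int p ^ A.ex"] have "real (B.cnt v) = real (card (A.A v \<inter> {1 - int p ^ A.ex..<(1 - int p ^ A.ex) + int p ^ A.ex}))" by (simp add: B.cnt_def)
    also have "\<dots> = real (A.cnt v) / p ^ A.ex * real_of_int (int p ^ A.ex)" by (rule periodic_density_period[OF A.A_periodic])
    also have "\<dots> = A.cnt v" using A.p_pos by simp
    finally show ?thesis by linarith
  qed
  thus ?thesis by (simp add: A.\<delta>_def B.\<delta>_def)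
qed

text \<open>Negative values are positive values of the negated form, which has the same local
  densities. In the indefinite case both signs have the product as density, and division by 2 N
  takes their mean.\<close>

theorem form_density_eq_prod:
  assumes f: "nondegenerate f" and cl: "\<And>p n. prime p \<Longrightarrow> (int p)\<^sup>2 * n \<in> Loc f p \<Longrightarrow> n \<in> Loc f p"
  shows "\<exists>P. finite P \<and> (\<forall>p\<in>P. padic_square_classes p (Loc f p)) \<and> form_density f = (\<Prod>p\<in>P. padic_square_classes.\<delta> p (Loc f p))"
proof -
  obtain e0 where e0: "tform_eval f e0 \<noteq> 0" using nondegenerate_nonzero[OF f] by blast
  obtain h1 h2 where h: "polar f e0 h1 = 0" "polar f e0 h2 = 0" "polar f h1 h2 = 0"
    "tform_eval f h1 \<noteq> 0" "tform_eval f h2 \<noteq> 0" using orthogonal_triple_exists[OF f e0] by metis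
  define q where "q = 2 * tform_eval f e0 * tform_eval f h1 * tform_eval f h2"
  have q0: "q \<noteq> 0" using e0 h by (simp add: q_def)
  define P where "P = {p. prime p \<and> int p dvd q}"
  have fP: "finite P"
  proof (rule finite_subset)
    show "P \<subseteq> {..nat \<bar>q\<bar>}"
    proof
      fix p assume "p \<in> P"
      hence "int p \<le> \<bar>q\<bar>" using q0 dvd_imp_le_int[of q "int p"] by (auto simp: P_def)
      thus "p \<in> {..nat \<bar>q\<bar>}" by auto
    qed
  qed simp
  have U: "Loc f p = UNIV" if "prime p" "p \<notin> P" for p
    using Loc_unramified[OF that(1) h(1-3)] that by (simp add: P_def q_def)
  have sc: "padic_square_classes p (Loc f p)" if "p \<in> P" for p
    using Loc_padic_square_classes cl that by (simp add: P_def)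
  define D where "D = (\<Prod>p\<in>P. padic_square_classes.\<delta> p (Loc f p))"
  define R where "R = range (tform_eval f)"
  have pos: "(\<lambda>N. real (card (R \<inter> {1..int N})) / N) \<longlonglongrightarrow> D" if "\<exists>e. tform_eval f e > 0"
    using positive_values_density[OF f _ fP sc U] that unfolding D_def R_def by blast
  have neg: "(\<lambda>N. real (card (R \<inter> {- int N..-1})) / N) \<longlonglongrightarrow> D" if ne: "\<exists>e. tform_eval f e < 0"
  proof -
    obtain e where e: "tform_eval (neg_tform f) e > 0" using ne by (auto simp: neg_tform_eval)
    have sc': "padic_square_classes p (Loc (neg_tform f) p)" if "p \<in> P" for p
    proof (rule Loc_padic_square_classes)
      show "prime p" using that by (simp add: P_def)
      show "n \<in> Loc (neg_tform f) p" if "(int p)\<^sup>2 * n \<in> Loc (neg_tform f) p" for n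
        using that cl[of p "- n"] \<open>prime p\<close> by (simp add: mem_Loc_neg_tform)
    qed
    have U': "Loc (neg_tform f) p = UNIV" if "prime p" "p \<notin> P" for p
      using U[OF that] by (auto simp: mem_Loc_neg_tform)
    have "(\<Prod>p\<in>P. padic_square_classes.\<delta> p (Loc (neg_tform f) p)) = D"
      unfolding D_def by (intro prod.cong refl \<delta>_uminus sc sc') (auto simp: mem_Loc_neg_tform)
    moreover have "card (range (tform_eval (neg_tform f)) \<inter> {1..int N}) = card (R \<inter> {- int N..-1})" for N
      by (rule bij_betw_same_card[of uminus], rule bij_betw_byWitness[where f' = uminus]) (auto simp: R_def neg_tform_eval)
    ultimately show ?thesis
      using positive_values_density[OF neg_tform_nondegenerate[OF f] e fP sc' U'] by simp
  qed
  have RP: "represented_nonzero f = R - {0}" by (simp add: represented_nonzero_def R_def)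
  have "form_density f = D"
  proof (cases "\<forall>x\<in>R - {0}. x \<ge> 0")
    case True
    have "\<exists>e. tform_eval f e > 0"
    proof -
      have "tform_eval f e0 \<in> R - {0}" using e0 by (simp add: R_def)
      hence "tform_eval f e0 \<ge> 0" using True by blast
      thus ?thesis using e0 by (intro exI[of _ e0]) simp
    qed
    moreover have "(R - {0}) \<inter> {1..int N} = R \<inter> {1..int N}" for N by auto
    ultimately show ?thesis using pos unfolding form_density_def int_density_def RP if_P[OF True] by (simp add: limI)
  next
    case nT: False
    show ?thesis
    proof (cases "\<forall>x\<in>R - {0}. x \<le> 0")
      case True
      have "\<exists>e. tform_eval f e < 0" using nT by (auto simp: R_def not_le)
      moreover have "(R - {0}) \<inter> {- int N..-1} = R \<inter> {- int N..-1}" for N by auto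
      ultimately show ?thesis using neg unfolding form_density_def int_density_def RP if_not_P[OF nT] if_P[OF True] by (simp add: limI)
    next
      case False
      have "\<exists>e. tform_eval f e > 0" "\<exists>e. tform_eval f e < 0" using False nT by (auto simp: R_def not_le)
      hence "(\<lambda>N. (real (card (R \<inter> {1..int N})) / N + real (card (R \<inter> {- int N..-1})) / N) / 2) \<longlonglongrightarrow> (D + D) / 2"
        by (intro tendsto_intros pos neg) auto
      moreover have "(real (card (R \<inter> {1..int N})) / N + real (card (R \<inter> {- int N..-1})) / N) / 2 = real (card ((R - {0}) \<inter> {- int N..int N})) / (2 * real N)" for N
      proof -
        have eq: "(R - {0}) \<inter> {- int N..int N} = (R \<inter> {1..int N}) \<union> (R \<inter> {- int N..-1})" by auto
        have "card ((R - {0}) \<inter> {- int N..int N}) = card (R \<inter> {1..int N}) + card (R \<inter> {- int N..-1})"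
          unfolding eq by (rule card_Un_disjoint) auto
        thus ?thesis by (simp add: add_divide_distrib)
      qed
      ultimately have "(\<lambda>N. real (card ((R - {0}) \<inter> {- int N..int N})) / (2 * real N)) \<longlonglongrightarrow> D" by simp
      thus ?thesis unfolding form_density_def int_density_def RP if_not_P[OF nT] if_not_P[OF False] by (simp add: limI)
    qed
  qed
  thus ?thesis using fP sc D_def by blast
qed

section \<open>Counting rationals by height\<close>

lemma quotient_of_bounds:
  assumes "rat_height r \<le> int N"
  shows "snd (quotient_of r) \<in> {1..int N}" "r = of_int (fst (quotient_of r)) / of_int (snd (quotient_of r))"
proof -
  obtain a b where q: "quotient_of r = (a, b)" by (cases "quotient_of r")
  have "b > 0" using quotient_of_denom_pos[OF q] .
  thus "snd (quotient_of r) \<in> {1..int N}" using assms by (simp add: rat_height_def q)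
  show "r = of_int (fst (quotient_of r)) / of_int (snd (quotient_of r))"
    unfolding q fst_conv snd_conv by (rule quotient_of_div[OF q])
qed

lemma card_rats_le:
  fixes S :: "rat set" and B :: "int set" and x y :: "int \<Rightarrow> real"
  assumes B: "finite B" and S: "\<And>r. r \<in> S \<Longrightarrow> snd (quotient_of r) \<in> B \<and> x (snd (quotient_of r)) \<le> fst (quotient_of r) \<and> fst (quotient_of r) \<le> y (snd (quotient_of r))"
    and xy: "\<And>b. b \<in> B \<Longrightarrow> x b \<le> y b + 1"
  shows "finite S" "real (card S) \<le> (\<Sum>b\<in>B. y b - x b + 1)"
proof -
  define A where "A b = {a::int. x b \<le> a \<and> a \<le> y b}" for b
  have A: "finite (A b)" "real (card (A b)) \<le> y b - x b + 1" if "b \<in> B" for b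
    using card_int_real_interval[of "A b" "x b" "y b"] xy[OF that] by (auto simp: A_def)
  have fS: "finite (Sigma B A)" using B A by auto
  have inj: "inj_on (\<lambda>r. (snd (quotient_of r), fst (quotient_of r))) S"
  proof (rule inj_onI)
    fix r s assume "(snd (quotient_of r), fst (quotient_of r)) = (snd (quotient_of s), fst (quotient_of s))"
    hence "quotient_of r = quotient_of s" by (simp add: prod_eq_iff)
    thus "r = s" using quotient_of_inject by blast
  qed
  have sub: "(\<lambda>r. (snd (quotient_of r), fst (quotient_of r))) ` S \<subseteq> Sigma B A" using S by (auto simp: A_def)
  show "finite S" using inj sub fS inj_on_finite by blast
  have "card S \<le> card (Sigma B A)" by (rule card_inj_on_le[OF inj sub fS])
  also have "\<dots> = (\<Sum>b\<in>B. card (A b))" using B A by simp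
  finally have "real (card S) \<le> (\<Sum>b\<in>B. real (card (A b)))" by (simp flip: of_nat_sum)
  also have "\<dots> \<le> (\<Sum>b\<in>B. y b - x b + 1)" by (intro sum_mono A)
  finally show "real (card S) \<le> (\<Sum>b\<in>B. y b - x b + 1)" .
qed

lemma card_rats_near:
  fixes y \<rho> :: real
  assumes \<rho>: "\<rho> \<ge> 0"
  shows "finite {r. \<bar>of_rat r - y\<bar> \<le> \<rho> \<and> rat_height r \<le> int N}"
    "real (card {r. \<bar>of_rat r - y\<bar> \<le> \<rho> \<and> rat_height r \<le> int N}) \<le> 2 * \<rho> * (real N)\<^sup>2 + N"
proof -
  define S where "S = {r. \<bar>of_rat r - y\<bar> \<le> \<rho> \<and> rat_height r \<le> int N}"
  define l where "l b = real_of_int b * (y - \<rho>)" for b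
  define u where "u b = real_of_int b * (y + \<rho>)" for b
  have 1: "snd (quotient_of r) \<in> {1..int N} \<and> l (snd (quotient_of r)) \<le> fst (quotient_of r) \<and> fst (quotient_of r) \<le> u (snd (quotient_of r))" if "r \<in> S" for r
  proof -
    have h: "rat_height r \<le> int N" and c: "\<bar>of_rat r - y\<bar> \<le> \<rho>" using that by (auto simp: S_def)
    define a b where "a = fst (quotient_of r)" and "b = snd (quotient_of r)"
    have b: "b \<in> {1..int N}" and r: "r = of_int a / of_int b" using quotient_of_bounds[OF h] by (auto simp: a_def b_def)
    have b0: "real_of_int b > 0" using b by simp
    have "of_rat r = real_of_int a / real_of_int b" unfolding r by (simp add: of_rat_divide)
    hence "y - \<rho> \<le> real_of_int a / b" "real_of_int a / b \<le> y + \<rho>" using c by auto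
    hence "l b \<le> a" "a \<le> u b" using b0 by (simp_all add: l_def u_def field_simps)
    thus ?thesis using b by (simp add: a_def b_def)
  qed
  have 2: "l b \<le> u b + 1" if "b \<in> {1..int N}" for b
  proof -
    have "real_of_int b * (y - \<rho>) \<le> real_of_int b * (y + \<rho>)" using that \<rho> by (intro mult_left_mono) auto
    thus ?thesis by (simp add: l_def u_def)
  qed
  show "finite {r. \<bar>of_rat r - y\<bar> \<le> \<rho> \<and> rat_height r \<le> int N}"
    using card_rats_le(1)[of "{1..int N}" S l u] 1 2 by (simp add: S_def)
  have "real (card S) \<le> (\<Sum>b\<in>{1..int N}. u b - l b + 1)" using card_rats_le(2)[of "{1..int N}" S l u] 1 2 by simp
  also have "\<dots> \<le> (\<Sum>b\<in>{1..int N}. 2 * \<rho> * N + 1)"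
  proof (rule sum_mono)
    fix b assume b: "b \<in> {1..int N}"
    have "u b - l b = 2 * \<rho> * b" by (simp add: l_def u_def algebra_simps)
    also have "\<dots> \<le> 2 * \<rho> * N"
    proof (rule mult_left_mono)
      have "real_of_int b \<le> real_of_int (int N)" using b by (simp only: of_int_le_iff) auto
      thus "real_of_int b \<le> N" by simp
    qed (use \<rho> in auto)
    finally show "u b - l b + 1 \<le> 2 * \<rho> * N + 1" by simp
  qed
  also have "\<dots> = 2 * \<rho> * (real N)\<^sup>2 + N" by (simp add: power2_eq_square algebra_simps)
  finally show "real (card {r. \<bar>of_rat r - y\<bar> \<le> \<rho> \<and> rat_height r \<le> int N}) \<le> 2 * \<rho> * (real N)\<^sup>2 + N" by (simp add: S_def)
qed

lemma card_rats_denom_multiple: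
  fixes m :: int
  assumes m: "m > 0"
  shows "finite {r. 0 \<le> r \<and> r \<le> 1 \<and> m dvd snd (quotient_of r) \<and> rat_height r \<le> int N}"
    "real (card {r. 0 \<le> r \<and> r \<le> 1 \<and> m dvd snd (quotient_of r) \<and> rat_height r \<le> int N}) \<le> 2 * (real N)\<^sup>2 / m"
proof -
  define S where "S = {r. 0 \<le> r \<and> r \<le> 1 \<and> m dvd snd (quotient_of r) \<and> rat_height r \<le> int N}"
  define B where "B = (\<lambda>k. m * k) ` {1..int N div m}"
  have fB: "finite B" by (simp add: B_def)
  have 1: "snd (quotient_of r) \<in> B \<and> 0 \<le> real_of_int (fst (quotient_of r)) \<and> fst (quotient_of r) \<le> real_of_int (snd (quotient_of r))" if "r \<in> S" for r
  proof -
    have h: "rat_height r \<le> int N" "0 \<le> r" "r \<le> 1" using that by (auto simp: S_def)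
    define a b where "a = fst (quotient_of r)" and "b = snd (quotient_of r)"
    have b: "b \<in> {1..int N}" and r: "r = of_int a / of_int b" using quotient_of_bounds[OF h(1)] by (auto simp: a_def b_def)
    have a: "0 \<le> a" "a \<le> b" using h(2,3) b unfolding r by (auto simp: zero_le_divide_iff divide_le_eq_1)
    have "m dvd b" using that by (simp add: S_def b_def)
    then obtain k where k: "b = m * k" by blast
    have "k \<ge> 1" using b k m by (metis atLeastAtMost_iff int_one_le_iff_zero_less zero_less_mult_pos)
    moreover have "k \<le> int N div m" using b k m by (metis atLeastAtMost_iff nonzero_mult_div_cancel_left less_irrefl zdiv_mono1)
    ultimately have "b \<in> B" using k by (auto simp: B_def)
    thus ?thesis using a by (simp add: a_def b_def)
  qed
  have 2: "0 \<le> real_of_int b + 1" if "b \<in> B" for b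
  proof -
    have "b \<ge> 0" using that m by (auto simp: B_def)
    thus ?thesis by linarith
  qed
  show "finite {r. 0 \<le> r \<and> r \<le> 1 \<and> m dvd snd (quotient_of r) \<and> rat_height r \<le> int N}"
    unfolding S_def[symmetric] by (rule card_rats_le(1)[OF fB 1 2])
  have "real (card S) \<le> (\<Sum>b\<in>B. real_of_int b - 0 + 1)"
    by (rule card_rats_le(2)[OF fB 1 2])
  also have "\<dots> \<le> (\<Sum>b\<in>B. 2 * real N)"
  proof (rule sum_mono)
    fix b assume "b \<in> B"
    then obtain k where bk: "b = m * k" "k \<in> {1..int N div m}" unfolding B_def by blast
    hence k: "b = m * k" "1 \<le> k" "k \<le> int N div m" by auto
    have "m * k \<le> m * (int N div m)" using k m by simp
    also have "\<dots> \<le> int N" using m by (simp add: minus_mod_eq_mult_div[symmetric])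
    finally have "b \<le> int N" by (simp add: k)
    moreover have "b \<ge> 1" using k m by (simp add: int_one_le_iff_zero_less)
    ultimately show "real_of_int b - 0 + 1 \<le> 2 * real N" by linarith
  qed
  also have "\<dots> = card B * (2 * real N)" by simp
  also have "\<dots> \<le> (N / m) * (2 * real N)"
  proof (rule mult_right_mono)
    have "card B \<le> card {1..int N div m}" unfolding B_def by (rule card_image_le) simp
    hence "real (card B) \<le> real (nat (int N div m))" by simp
    also have "\<dots> = real_of_int (int N div m)" using m by (simp add: pos_imp_zdiv_nonneg_iff)
    also have "\<dots> \<le> real_of_int (int N) / m" by (rule real_of_int_div4)
    finally show "real (card B) \<le> N / m" by simp
  qed simp
  finally show "real (card {r. 0 \<le> r \<and> r \<le> 1 \<and> m dvd snd (quotient_of r) \<and> rat_height r \<le> int N}) \<le> 2 * (real N)\<^sup>2 / m"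
    by (simp add: S_def power2_eq_square mult_ac)
qed

text \<open>At least N^2 (1 - 3/4) pairs in [1, N]^2 are coprime, as the sum of 1/d^2 over d \<ge> 2
  bounds the proportion of the others. By symmetry at least half of the coprime pairs have a \<le>
  b.\<close>

lemma height_count_unit_interval: "(real N)\<^sup>2 / 8 \<le> height_count {0..1} N"
proof (cases "N = 0")
  case False
  define I where "I = {1..N}"
  define C where "C = {(a, b) \<in> I \<times> I. coprime a b}"
  have sq: "(\<Sum>d=2..N. 1 / (real d)\<^sup>2) \<le> 3 / 4"
  proof (cases "N \<ge> 2")
    case True
    \<comment> \<open>The additional - 1/n makes the telescoping induction close; at n = 2 the bound
      is an equality.\<close>
    have "(\<Sum>d=2..n. 1 / (real d)\<^sup>2) \<le> 3 / 4 - 1 / n" if "n \<ge> 2" for n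
      using that
    proof (induction n rule: nat_induct_at_least)
      case (Suc n)
      have "1 / (real (Suc n))\<^sup>2 \<le> 1 / (real n * (real n + 1))"
      proof (rule frac_le)
        show "0 < real n * (real n + 1)" using Suc.hyps by simp
        show "real n * (real n + 1) \<le> (real (Suc n))\<^sup>2" by (simp add: power2_eq_square algebra_simps)
      qed auto
      also have "\<dots> = 1 / n - 1 / Suc n" using Suc.hyps by (simp add: field_simps)
      finally have "1 / (real (Suc n))\<^sup>2 \<le> 1 / n - 1 / Suc n" .
      thus ?case using Suc by simp
    qed simp
    from this[OF True] show ?thesis by (smt (verit) divide_nonneg_nonneg of_nat_0_le_iff)
  qed simp
  have "I \<times> I \<subseteq> C \<union> (\<Union>d\<in>{2..N}. {(a, b) \<in> I \<times> I. d dvd a \<and> d dvd b})"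
  proof
    fix v assume v: "v \<in> I \<times> I"
    obtain a b where e: "v = (a, b)" by (cases v)
    have ab: "a \<in> I" "b \<in> I" using v by (auto simp: e)
    show "v \<in> C \<union> (\<Union>d\<in>{2..N}. {(a, b) \<in> I \<times> I. d dvd a \<and> d dvd b})"
    proof (cases "coprime a b")
      case True
      thus ?thesis using ab by (simp add: C_def e)
    next
      case False
      hence "gcd a b \<noteq> 1" unfolding coprime_iff_gcd_eq_1 .
      moreover have "gcd a b > 0" using ab by (auto simp: I_def)
      moreover have "gcd a b \<le> a" using ab by (intro gcd_le1_nat) (auto simp: I_def)
      moreover have "a \<le> N" using ab by (simp add: I_def)
      ultimately have "gcd a b \<in> {2..N}" by (simp only: atLeastAtMost_iff) linarith
      moreover have "v \<in> {(x, y) \<in> I \<times> I. gcd a b dvd x \<and> gcd a b dvd y}" using ab by (simp add: e)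
      ultimately show ?thesis by blast
    qed
  qed
  moreover have fC: "finite C" by (rule finite_subset[of _ "I \<times> I"]) (auto simp: C_def I_def)
  moreover have fD: "finite {(a, b) \<in> I \<times> I. d dvd a \<and> d dvd b}" for d by (rule finite_subset[of _ "I \<times> I"]) (auto simp: I_def)
  ultimately have "card (I \<times> I) \<le> card (C \<union> (\<Union>d\<in>{2..N}. {(a, b) \<in> I \<times> I. d dvd a \<and> d dvd b}))" by (intro card_mono) auto
  also have "\<dots> \<le> card C + card (\<Union>d\<in>{2..N}. {(a, b) \<in> I \<times> I. d dvd a \<and> d dvd b})" by (rule card_Un_le)
  also have "\<dots> \<le> card C + (\<Sum>d\<in>{2..N}. card {(a, b) \<in> I \<times> I. d dvd a \<and> d dvd b})" by (intro add_left_mono card_UN_le) simp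
  finally have "real (card (I \<times> I)) \<le> card C + (\<Sum>d\<in>{2..N}. real (card {(a, b) \<in> I \<times> I. d dvd a \<and> d dvd b}))"
    by (simp flip: of_nat_sum of_nat_add)
  also have "(\<Sum>d\<in>{2..N}. real (card {(a, b) \<in> I \<times> I. d dvd a \<and> d dvd b})) \<le> (\<Sum>d\<in>{2..N}. (real N)\<^sup>2 * (1 / (real d)\<^sup>2))"
  proof (rule sum_mono)
    fix d assume d: "d \<in> {2..N}"
    have "{(a, b) \<in> I \<times> I. d dvd a \<and> d dvd b} \<subseteq> (\<lambda>(i, j). (d * i, d * j)) ` ({1..N div d} \<times> {1..N div d})"
    proof
      fix v assume v: "v \<in> {(a, b) \<in> I \<times> I. d dvd a \<and> d dvd b}"
      obtain a b where e: "v = (a, b)" by (cases v)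
      have ab: "a \<in> I" "b \<in> I" "d dvd a" "d dvd b" using v by (auto simp: e)
      have m: "x div d \<in> {1..N div d} \<and> d * (x div d) = x" if "x \<in> I" "d dvd x" for x
      proof -
        have "x div d \<le> N div d" using that by (intro div_le_mono) (simp add: I_def)
        moreover have "x div d \<noteq> 0" using that by (auto simp: I_def dvd_div_eq_0_iff)
        ultimately show ?thesis using that by simp
      qed
      have "v = (\<lambda>(i, j). (d * i, d * j)) (a div d, b div d)" using m[of a] m[of b] ab by (simp add: e)
      moreover have "(a div d, b div d) \<in> {1..N div d} \<times> {1..N div d}" using m[of a] m[of b] ab by blast
      ultimately show "v \<in> (\<lambda>(i, j). (d * i, d * j)) ` ({1..N div d} \<times> {1..N div d})" by (rule image_eqI)
    qed
    hence "card {(a, b) \<in> I \<times> I. d dvd a \<and> d dvd b} \<le> card ({1..N div d} \<times> {1..N div d})"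
      by (meson card_image_le card_mono finite_SigmaI finite_atLeastAtMost finite_imageI le_trans)
    also have "\<dots> = (N div d)\<^sup>2" by (simp add: power2_eq_square)
    finally have "real (card {(a, b) \<in> I \<times> I. d dvd a \<and> d dvd b}) \<le> real ((N div d)\<^sup>2)" by (rule of_nat_mono)
    also have "\<dots> = (real (N div d))\<^sup>2" by (rule of_nat_power)
    also have "(real (N div d))\<^sup>2 \<le> (real N / d)\<^sup>2" by (intro power_mono of_nat_div_le_of_nat) auto
    finally show "real (card {(a, b) \<in> I \<times> I. d dvd a \<and> d dvd b}) \<le> (real N)\<^sup>2 * (1 / (real d)\<^sup>2)" by (simp add: power_divide)
  qed
  also have "\<dots> = (real N)\<^sup>2 * (\<Sum>d\<in>{2..N}. 1 / (real d)\<^sup>2)" by (simp add: sum_distrib_left)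
  also have "\<dots> \<le> (real N)\<^sup>2 * (3 / 4)" using sq by (intro mult_left_mono) auto
  also have "real (card (I \<times> I)) = (real N)\<^sup>2" by (simp add: I_def power2_eq_square)
  finally have cC: "(real N)\<^sup>2 / 4 \<le> card C" by simp
  define C1 where "C1 = {(a, b) \<in> C. a \<le> b}"
  have fC1: "finite C1" by (rule finite_subset[OF _ fC]) (auto simp: C1_def)
  have "C \<subseteq> C1 \<union> (\<lambda>(a, b). (b, a)) ` C1" by (auto simp: C1_def C_def coprime_commute image_iff)
  hence "card C \<le> card (C1 \<union> (\<lambda>(a, b). (b, a)) ` C1)" using fC1 by (intro card_mono) auto
  also have "\<dots> \<le> card C1 + card C1" using card_Un_le[of C1 "(\<lambda>(a, b). (b, a)) ` C1"] card_image_le[OF fC1, of "\<lambda>(a, b). (b, a)"] by linarith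
  finally have cC1: "(real N)\<^sup>2 / 8 \<le> card C1" using cC by linarith
  define S where "S = {r :: rat. of_rat r \<in> {0..1::real} \<and> rat_height r \<le> int N}"
  have fS: "finite S"
  proof (rule finite_subset)
    show "S \<subseteq> {r. \<bar>of_rat r - 0\<bar> \<le> (1::real) \<and> rat_height r \<le> int N}" by (auto simp: S_def)
    show "finite {r. \<bar>of_rat r - 0\<bar> \<le> (1::real) \<and> rat_height r \<le> int N}" by (rule card_rats_near) simp
  qed
  have q: "quotient_of (of_nat a / of_nat b :: rat) = (int a, int b)" if "(a, b) \<in> C1" for a b
  proof -
    have ab: "coprime a b" "b \<ge> 1" using that by (auto simp: C1_def C_def I_def)
    have "of_nat a / of_nat b = Fract (int a) (int b)" by (simp add: Fract_of_int_quotient)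
    thus ?thesis using ab by (simp add: quotient_of_Fract normalize_stable)
  qed
  have "card C1 \<le> card S"
  proof (rule card_inj_on_le[of "\<lambda>(a, b). of_nat a / of_nat b"])
    show "inj_on (\<lambda>(a, b). of_nat a / of_nat b :: rat) C1"
    proof (rule inj_onI)
      fix x y assume xy: "x \<in> C1" "y \<in> C1" "(\<lambda>(a, b). of_nat a / of_nat b :: rat) x = (\<lambda>(a, b). of_nat a / of_nat b) y"
      obtain a b where x: "x = (a, b)" by (cases x)
      obtain a' b' where y: "y = (a', b')" by (cases y)
      have e: "(of_nat a / of_nat b :: rat) = of_nat a' / of_nat b'" using xy(3) unfolding x y by (simp only: case_prod_conv)
      have "(int a, int b) = quotient_of (of_nat a / of_nat b)" by (rule q[symmetric]) (use xy(1) x in simp)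
      also have "\<dots> = quotient_of (of_nat a' / of_nat b')" by (simp only: e)
      also have "\<dots> = (int a', int b')" by (rule q) (use xy(2) y in simp)
      finally have "(int a, int b) = (int a', int b')" .
      thus "x = y" by (simp add: x y)
    qed
    show "(\<lambda>(a, b). of_nat a / of_nat b) ` C1 \<subseteq> S"
    proof (rule image_subsetI)
      fix x assume x1: "x \<in> C1"
      obtain a b where x: "x = (a, b)" by (cases x)
      have ab: "a \<le> b" "b \<ge> 1" "b \<le> N" using x1 by (auto simp: x C1_def C_def I_def)
      have "rat_height (of_nat a / of_nat b) \<le> int N" using q x1 ab by (simp add: rat_height_def x)
      moreover have "of_rat (of_nat a / of_nat b) \<in> {0..1::real}" using ab by (simp add: of_rat_divide)
      ultimately show "(\<lambda>(a, b). of_nat a / of_nat b) x \<in> S" by (simp add: S_def x)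
    qed
  qed (rule fS)
  thus ?thesis using cC1 by (simp add: height_count_def S_def)
qed simp

text \<open>Coverings by finitely many closed intervals (centre, radius) of small total length.\<close>

definition thin :: "real set \<Rightarrow> bool" where
  "thin A \<longleftrightarrow> (\<forall>\<epsilon>>0. \<exists>xs. (\<forall>y \<rho>. (y, \<rho>) \<in> set xs \<longrightarrow> \<rho> \<ge> 0) \<and> sum_list (map snd xs) \<le> \<epsilon> \<and>
     (\<forall>x\<in>A. \<exists>y \<rho>. (y, \<rho>) \<in> set xs \<and> \<bar>x - y\<bar> \<le> \<rho>))"

lemma thinD:
  assumes "thin A" "\<epsilon> > 0"
  obtains xs where "\<And>y \<rho>. (y, \<rho>) \<in> set xs \<Longrightarrow> \<rho> \<ge> 0" "sum_list (map snd xs) \<le> \<epsilon>"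
    "\<And>x. x \<in> A \<Longrightarrow> \<exists>y \<rho>. (y, \<rho>) \<in> set xs \<and> \<bar>x - y\<bar> \<le> \<rho>"
  using assms unfolding thin_def by blast

lemma thinI:
  assumes "\<And>\<epsilon>. \<epsilon> > 0 \<Longrightarrow> \<exists>xs. (\<forall>y \<rho>. (y, \<rho>) \<in> set xs \<longrightarrow> \<rho> \<ge> 0) \<and> sum_list (map snd xs) \<le> \<epsilon> \<and> (\<forall>x\<in>A. \<exists>y \<rho>. (y, \<rho>) \<in> set xs \<and> \<bar>x - y\<bar> \<le> \<rho>)"
  shows "thin A"
  unfolding thin_def using assms by (intro allI impI)

lemma thin_finite: assumes "finite A" shows "thin A"
proof (rule thinI)
  fix \<epsilon> :: real assume "\<epsilon> > 0"
  obtain ys where ys: "set ys = A" using assms finite_list by blast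
  have s0: "sum_list (map snd (map (\<lambda>y. (y, 0::real)) ys)) = 0" by (induction ys) auto
  show "\<exists>xs. (\<forall>y \<rho>. (y, \<rho>) \<in> set xs \<longrightarrow> \<rho> \<ge> 0) \<and> sum_list (map snd xs) \<le> \<epsilon> \<and> (\<forall>x\<in>A. \<exists>y \<rho>. (y, \<rho>) \<in> set xs \<and> \<bar>x - y\<bar> \<le> \<rho>)"
  proof (intro exI[of _ "map (\<lambda>y. (y, 0::real)) ys"] conjI allI impI ballI)
    show "\<rho> \<ge> 0" if "(y, \<rho>) \<in> set (map (\<lambda>y. (y, 0::real)) ys)" for y \<rho> using that by auto
    show "sum_list (map snd (map (\<lambda>y. (y, 0::real)) ys)) \<le> \<epsilon>" unfolding s0 using \<open>\<epsilon> > 0\<close> by simp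
    fix x assume "x \<in> A"
    hence "(x, 0) \<in> set (map (\<lambda>y. (y, 0::real)) ys) \<and> \<bar>x - x\<bar> \<le> 0" using ys by auto
    thus "\<exists>y \<rho>. (y, \<rho>) \<in> set (map (\<lambda>y. (y, 0::real)) ys) \<and> \<bar>x - y\<bar> \<le> \<rho>" by blast
  qed
qed

lemma thin_Un: assumes "thin A" "thin B" shows "thin (A \<union> B)"
proof (rule thinI)
  fix \<epsilon> :: real assume e: "\<epsilon> > 0"
  obtain xs where xs: "\<And>y \<rho>. (y, \<rho>) \<in> set xs \<Longrightarrow> \<rho> \<ge> 0" "sum_list (map snd xs) \<le> \<epsilon> / 2"
    "\<And>x. x \<in> A \<Longrightarrow> \<exists>y \<rho>. (y, \<rho>) \<in> set xs \<and> \<bar>x - y\<bar> \<le> \<rho>" using thinD[OF assms(1), of "\<epsilon> / 2"] e by auto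
  obtain ys where ys: "\<And>y \<rho>. (y, \<rho>) \<in> set ys \<Longrightarrow> \<rho> \<ge> 0" "sum_list (map snd ys) \<le> \<epsilon> / 2"
    "\<And>x. x \<in> B \<Longrightarrow> \<exists>y \<rho>. (y, \<rho>) \<in> set ys \<and> \<bar>x - y\<bar> \<le> \<rho>" using thinD[OF assms(2), of "\<epsilon> / 2"] e by auto
  show "\<exists>xs. (\<forall>y \<rho>. (y, \<rho>) \<in> set xs \<longrightarrow> \<rho> \<ge> 0) \<and> sum_list (map snd xs) \<le> \<epsilon> \<and> (\<forall>x\<in>A \<union> B. \<exists>y \<rho>. (y, \<rho>) \<in> set xs \<and> \<bar>x - y\<bar> \<le> \<rho>)"
  proof (intro exI[of _ "xs @ ys"] conjI allI impI ballI)
    show "\<rho> \<ge> 0" if "(y, \<rho>) \<in> set (xs @ ys)" for y \<rho> using that xs(1) ys(1) by auto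
    show "sum_list (map snd (xs @ ys)) \<le> \<epsilon>" using xs(2) ys(2) by simp
    fix x assume "x \<in> A \<union> B"
    thus "\<exists>y \<rho>. (y, \<rho>) \<in> set (xs @ ys) \<and> \<bar>x - y\<bar> \<le> \<rho>"
    proof
      assume "x \<in> A" from xs(3)[OF this] show ?thesis by auto
    next
      assume "x \<in> B" from ys(3)[OF this] show ?thesis by auto
    qed
  qed
qed

lemma thin_UN: "finite I \<Longrightarrow> (\<And>i. i \<in> I \<Longrightarrow> thin (A i)) \<Longrightarrow> thin (\<Union>i\<in>I. A i)"
  by (induction I rule: finite_induct) (auto intro: thin_Un thin_finite)

lemma thin_scale:
  assumes A: "thin A" and c: "0 \<le> c" "c \<le> 1"
  shows "thin ((\<lambda>x. x * c) ` A)"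
proof (rule thinI)
  fix \<epsilon> :: real assume e: "\<epsilon> > 0"
  obtain xs where xs: "\<And>y \<rho>. (y, \<rho>) \<in> set xs \<Longrightarrow> \<rho> \<ge> 0" "sum_list (map snd xs) \<le> \<epsilon>"
    "\<And>x. x \<in> A \<Longrightarrow> \<exists>y \<rho>. (y, \<rho>) \<in> set xs \<and> \<bar>x - y\<bar> \<le> \<rho>" using thinD[OF A e] by auto
  define ys where "ys = map (\<lambda>(y, \<rho>). (y * c, \<rho>)) xs"
  have m: "map snd ys = map snd xs" by (simp add: ys_def case_prod_beta)
  show "\<exists>xs. (\<forall>y \<rho>. (y, \<rho>) \<in> set xs \<longrightarrow> \<rho> \<ge> 0) \<and> sum_list (map snd xs) \<le> \<epsilon> \<and> (\<forall>x\<in>(\<lambda>x. x * c) ` A. \<exists>y \<rho>. (y, \<rho>) \<in> set xs \<and> \<bar>x - y\<bar> \<le> \<rho>)"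
  proof (intro exI[of _ ys] conjI allI impI ballI)
    show "\<rho> \<ge> 0" if "(y, \<rho>) \<in> set ys" for y \<rho> using that xs(1) by (auto simp: ys_def)
    show "sum_list (map snd ys) \<le> \<epsilon>" using xs(2) m by simp
    fix z assume "z \<in> (\<lambda>x. x * c) ` A"
    then obtain x where x: "x \<in> A" "z = x * c" by auto
    obtain y \<rho> where y: "(y, \<rho>) \<in> set xs" "\<bar>x - y\<bar> \<le> \<rho>" using xs(3)[OF x(1)] by blast
    have "z - y * c = (x - y) * c" by (simp add: x algebra_simps)
    hence "\<bar>z - y * c\<bar> = \<bar>x - y\<bar> * c" using c by (simp add: abs_mult)
    also have "\<dots> \<le> \<bar>x - y\<bar> * 1" using c by (intro mult_left_mono) auto
    finally have "\<bar>z - y * c\<bar> \<le> \<rho>" using y by simp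
    moreover have "(y * c, \<rho>) \<in> set ys" using y(1) by (force simp: ys_def)
    ultimately show "\<exists>y \<rho>. (y, \<rho>) \<in> set ys \<and> \<bar>z - y\<bar> \<le> \<rho>" by blast
  qed
qed

section \<open>Products of boundedly many local factors\<close>

definition local_factor :: "nat \<Rightarrow> nat \<Rightarrow> nat \<Rightarrow> real" where "local_factor p i j = (real i * real p + real j) / (2 * (real p + 1))"

definition local_factors :: "real set" where "local_factors = {local_factor p i j | p i j. i \<le> 2 \<and> j \<le> 2}"

lemma local_factor_bounds: assumes "i \<le> 2" "j \<le> 2" shows "0 \<le> local_factor p i j" "local_factor p i j \<le> 1" "\<bar>local_factor p i j - real i / 2\<bar> \<le> 1 / (real p + 1)"
proof -
  have p: "real p + 1 > 0" by (simp add: add_nonneg_pos)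
  show "0 \<le> local_factor p i j" by (simp add: local_factor_def)
  have "real i * real p \<le> 2 * real p" using assms by (intro mult_right_mono) auto
  moreover have "real j \<le> 2" using assms by simp
  ultimately have "real i * real p + real j \<le> 2 * real p + 2" by (rule add_mono)
  hence "real i * real p + real j \<le> 2 * (real p + 1)" by simp
  thus "local_factor p i j \<le> 1" using p by (simp add: local_factor_def divide_le_eq)
  have "local_factor p i j - real i / 2 = (real j - real i) / 2 / (real p + 1)" using p by (simp add: local_factor_def field_simps)
  hence "\<bar>local_factor p i j - real i / 2\<bar> = (\<bar>real j - real i\<bar> / 2) / (real p + 1)" using p by simp
  also have "\<dots> \<le> 1 / (real p + 1)" using p assms by (intro divide_right_mono) auto
  finally show "\<bar>local_factor p i j - real i / 2\<bar> \<le> 1 / (real p + 1)" .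
qed

text \<open>Only finitely many \<open>p\<close> give a factor away from the limit points \<open>0\<close>, \<open>1/2\<close>, \<open>1\<close>.\<close>

lemma thin_mult_local_factors:
  assumes A: "thin A" "A \<subseteq> {0..1}"
  shows "thin {x * r | x r. x \<in> A \<and> r \<in> local_factors}"
proof (rule thinI)
  fix \<epsilon> :: real assume e: "\<epsilon> > 0"
  obtain xs where xs: "\<And>y \<rho>. (y, \<rho>) \<in> set xs \<Longrightarrow> \<rho> \<ge> 0" "sum_list (map snd xs) \<le> \<epsilon> / 12"
    "\<And>x. x \<in> A \<Longrightarrow> \<exists>y \<rho>. (y, \<rho>) \<in> set xs \<and> \<bar>x - y\<bar> \<le> \<rho>" using thinD[OF A(1), of "\<epsilon> / 12"] e by auto
  \<comment> \<open>Widening every interval of \<open>xs\<close> by \<eta> costs at most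
    \<epsilon>/12 in total. The three rescaled lists then cost \<epsilon>/6 each, and
    \<open>zs\<close> takes the other half of \<epsilon>.\<close>
  define \<eta> where "\<eta> = \<epsilon> / (12 * (real (length xs) + 1))"
  have \<eta>: "\<eta> > 0" using e by (simp add: \<eta>_def add_nonneg_pos)
  \<comment> \<open>Beyond \<open>P\<close> every factor is within \<eta> of
    \<open>i / 2\<close>.\<close>
  obtain P :: nat where P: "1 / \<eta> < real P" using reals_Archimedean2 by blast
  define ys where "ys i = map (\<lambda>(y, \<rho>). (y * (real i / 2), \<rho> + \<eta>)) xs" for i :: nat
  have sy: "sum_list (map snd (ys i)) \<le> \<epsilon> / 6" for i
  proof -
    have "sum_list (map snd (ys i)) = sum_list (map snd xs) + length xs * \<eta>"
      unfolding ys_def by (induction xs) (auto simp: algebra_simps)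
    also have "length xs * \<eta> \<le> \<epsilon> / 12"
    proof -
      have "length xs * \<eta> \<le> (real (length xs) + 1) * \<eta>" using \<eta> by (intro mult_right_mono) auto
      also have "\<dots> = \<epsilon> / 12"
      proof -
        have "real (length xs) + 1 \<noteq> 0" by linarith
        thus ?thesis unfolding \<eta>_def by (simp add: divide_simps)
      qed
      finally show ?thesis .
    qed
    finally show ?thesis using xs(2) by simp
  qed
  have tU: "thin (\<Union>(p, i, j)\<in>{..P} \<times> {..2} \<times> {..2}. (\<lambda>x. x * local_factor p i j) ` A)"
  proof (rule thin_UN)
    fix v assume v: "v \<in> {..P} \<times> {..2::nat} \<times> {..2::nat}"
    obtain p i j where e: "v = (p, i, j)" by (metis prod_cases3)
    have "i \<le> 2" "j \<le> 2" using v by (auto simp: e)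
    thus "thin (case v of (p, i, j) \<Rightarrow> (\<lambda>x. x * local_factor p i j) ` A)" unfolding e case_prod_conv by (intro thin_scale[OF A(1)] local_factor_bounds)
  qed simp
  obtain zs where zs: "\<And>y \<rho>. (y, \<rho>) \<in> set zs \<Longrightarrow> \<rho> \<ge> 0" "sum_list (map snd zs) \<le> \<epsilon> / 2"
    "\<And>x. x \<in> (\<Union>(p, i, j)\<in>{..P} \<times> {..2} \<times> {..2}. (\<lambda>x. x * local_factor p i j) ` A) \<Longrightarrow> \<exists>y \<rho>. (y, \<rho>) \<in> set zs \<and> \<bar>x - y\<bar> \<le> \<rho>"
    using thinD[OF tU, of "\<epsilon> / 2"] e by auto
  show "\<exists>xs. (\<forall>y \<rho>. (y, \<rho>) \<in> set xs \<longrightarrow> \<rho> \<ge> 0) \<and> sum_list (map snd xs) \<le> \<epsilon> \<and> (\<forall>x\<in>{x * r | x r. x \<in> A \<and> r \<in> local_factors}. \<exists>y \<rho>. (y, \<rho>) \<in> set xs \<and> \<bar>x - y\<bar> \<le> \<rho>)"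
  proof (intro exI[of _ "zs @ ys 0 @ ys 1 @ ys 2"] conjI allI impI ballI)
    show "\<rho> \<ge> 0" if "(y, \<rho>) \<in> set (zs @ ys 0 @ ys 1 @ ys 2)" for y \<rho>
      using that zs(1) xs(1) \<eta> by (fastforce simp: ys_def)
    show "sum_list (map snd (zs @ ys 0 @ ys 1 @ ys 2)) \<le> \<epsilon>" using zs(2) sy[of 0] sy[of 1] sy[of 2] by simp
    fix v assume "v \<in> {x * r | x r. x \<in> A \<and> r \<in> local_factors}"
    then obtain x p i j where v: "v = x * local_factor p i j" "x \<in> A" "i \<le> 2" "j \<le> 2" by (auto simp: local_factors_def)
    show "\<exists>y \<rho>. (y, \<rho>) \<in> set (zs @ ys 0 @ ys 1 @ ys 2) \<and> \<bar>v - y\<bar> \<le> \<rho>"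
    proof (cases "p \<le> P")
      case True
      have "v \<in> (\<Union>(p, i, j)\<in>{..P} \<times> {..2} \<times> {..2}. (\<lambda>x. x * local_factor p i j) ` A)"
        using v True by (intro UN_I[of "(p, i, j)"]) auto
      from zs(3)[OF this] show ?thesis by auto
    next
      case False
      obtain y \<rho> where y: "(y, \<rho>) \<in> set xs" "\<bar>x - y\<bar> \<le> \<rho>" using xs(3)[OF v(2)] by blast
      have x01: "0 \<le> x" "x \<le> 1" using v A by auto
      have "1 / \<eta> \<le> real p + 1" using P False by linarith
      hence "1 / (real p + 1) \<le> \<eta>" using \<eta> by (simp add: field_simps)
      hence f: "\<bar>local_factor p i j - real i / 2\<bar> \<le> \<eta>" using local_factor_bounds(3)[OF v(3,4), of p] by linarith
      have "v - y * (real i / 2) = x * (local_factor p i j - real i / 2) + (x - y) * (real i / 2)" unfolding v(1) by (simp add: field_simps)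
      also have "\<bar>\<dots>\<bar> \<le> \<bar>x * (local_factor p i j - real i / 2)\<bar> + \<bar>(x - y) * (real i / 2)\<bar>" by (rule abs_triangle_ineq)
      also have "\<bar>x * (local_factor p i j - real i / 2)\<bar> = x * \<bar>local_factor p i j - real i / 2\<bar>" using x01 by (simp add: abs_mult)
      also have "\<dots> \<le> 1 * \<eta>" using x01 f by (intro mult_mono) auto
      also have "\<bar>(x - y) * (real i / 2)\<bar> = \<bar>x - y\<bar> * (real i / 2)" by (simp add: abs_mult)
      also have "\<dots> \<le> \<bar>x - y\<bar> * 1" using v by (intro mult_left_mono) auto
      finally have "\<bar>v - y * (real i / 2)\<bar> \<le> \<rho> + \<eta>" using y by simp
      moreover have "(y * (real i / 2), \<rho> + \<eta>) \<in> set (ys i)" unfolding ys_def using y(1) by (force intro: image_eqI[of _ _ "(y, \<rho>)"])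
      moreover have "set (ys i) \<subseteq> set (zs @ ys 0 @ ys 1 @ ys 2)"
      proof -
        have "i = 0 \<or> i = 1 \<or> i = 2" using v by auto
        thus ?thesis by auto
      qed
      ultimately show ?thesis by blast
    qed
  qed
qed

fun value_products :: "nat \<Rightarrow> real set" where
  "value_products 0 = (\<lambda>j. real j / 12) ` {..12}"
| "value_products (Suc k) = value_products k \<union> {x * r | x r. x \<in> value_products k \<and> r \<in> local_factors}"

lemma value_products_bounds: "value_products k \<subseteq> {0..1}"
proof (induction k)
  case (Suc k)
  have "x * r \<in> {0..1}" if "x \<in> value_products k" "r \<in> local_factors" for x r
  proof -
    have "0 \<le> x" "x \<le> 1" using that Suc by auto
    moreover have "0 \<le> r" "r \<le> 1" using that local_factor_bounds by (auto simp: local_factors_def)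
    ultimately show ?thesis by (simp add: mult_le_one)
  qed
  thus ?case using Suc by auto
qed auto

lemma value_products_thin: "thin (value_products k)"
  by (induction k) (auto intro: thin_finite thin_Un thin_mult_local_factors[OF _ value_products_bounds])

lemma value_products_mono: "k \<le> l \<Longrightarrow> value_products k \<subseteq> value_products l"
  by (rule lift_Suc_mono_le[of value_products]) auto

lemma prod_in_value_products:
  assumes "finite S" "\<And>p. p \<in> S \<Longrightarrow> r p \<in> local_factors" "j \<le> 12"
  shows "real j / 12 * (\<Prod>p\<in>S. r p) \<in> value_products (card S)"
  using assms
proof (induction S rule: finite_induct)
  case (insert p S)
  have "real j / 12 * (\<Prod>p\<in>insert p S. r p) = (real j / 12 * (\<Prod>p\<in>S. r p)) * r p" using insert.hyps by (simp add: mult_ac)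
  moreover have "real j / 12 * (\<Prod>p\<in>S. r p) \<in> value_products (card S)" by (rule insert.IH) (use insert.prems in auto)
  moreover have "r p \<in> local_factors" using insert.prems(1) by simp
  moreover have "card (insert p S) = Suc (card S)" using insert.hyps by simp
  ultimately show ?case unfolding value_products.simps(2) by (metis (mono_tags, lifting) UnI2 mem_Collect_eq value_products.simps(2))
qed simp

text \<open>An interval of radius \<rho> contains at most 2 \<rho> N^2 + N rationals of height at
  most \<open>N\<close>. For a fixed covering the terms linear in \<open>N\<close> are
  negligible.\<close>

lemma thin_height_count:
  assumes A: "thin A" and \<epsilon>: "\<epsilon> > 0"
  shows "eventually (\<lambda>N. finite {r :: rat. of_rat r \<in> A \<and> rat_height r \<le> int N} \<and>
    real (card {r :: rat. of_rat r \<in> A \<and> rat_height r \<le> int N}) \<le> \<epsilon> * (real N)\<^sup>2) sequentially"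
proof -
  obtain xs where xs: "\<And>y \<rho>. (y, \<rho>) \<in> set xs \<Longrightarrow> \<rho> \<ge> 0" "sum_list (map snd xs) \<le> \<epsilon> / 4"
    "\<And>x. x \<in> A \<Longrightarrow> \<exists>y \<rho>. (y, \<rho>) \<in> set xs \<and> \<bar>x - y\<bar> \<le> \<rho>" using thinD[OF A, of "\<epsilon> / 4"] \<epsilon> by auto
  have main: "finite {r :: rat. (\<exists>y \<rho>. (y, \<rho>) \<in> set ys \<and> \<bar>of_rat r - y\<bar> \<le> \<rho>) \<and> rat_height r \<le> int N} \<and>
    real (card {r :: rat. (\<exists>y \<rho>. (y, \<rho>) \<in> set ys \<and> \<bar>of_rat r - y\<bar> \<le> \<rho>) \<and> rat_height r \<le> int N}) \<le> 2 * sum_list (map snd ys) * (real N)\<^sup>2 + length ys * N"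
    if "\<And>y \<rho>. (y, \<rho>) \<in> set ys \<Longrightarrow> \<rho> \<ge> 0" for ys N
    using that
  proof (induction ys)
    case (Cons z ys)
    obtain y \<rho> where z: "z = (y, \<rho>)" by (cases z)
    define S1 where "S1 = {r. \<bar>of_rat r - y\<bar> \<le> \<rho> \<and> rat_height r \<le> int N}"
    define S2 where "S2 = {r :: rat. (\<exists>y \<rho>. (y, \<rho>) \<in> set ys \<and> \<bar>of_rat r - y\<bar> \<le> \<rho>) \<and> rat_height r \<le> int N}"
    have e: "{r :: rat. (\<exists>y \<rho>. (y, \<rho>) \<in> set (z # ys) \<and> \<bar>of_rat r - y\<bar> \<le> \<rho>) \<and> rat_height r \<le> int N} = S1 \<union> S2"
      by (auto simp: S1_def S2_def z)
    have "\<rho> \<ge> 0" using Cons.prems[of y \<rho>] z by auto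
    hence 1: "finite S1" "real (card S1) \<le> 2 * \<rho> * (real N)\<^sup>2 + N" unfolding S1_def by (rule card_rats_near)+
    have 2: "finite S2" "real (card S2) \<le> 2 * sum_list (map snd ys) * (real N)\<^sup>2 + length ys * N"
      using Cons.IH Cons.prems unfolding S2_def by auto
    have "real (card (S1 \<union> S2)) \<le> real (card S1) + real (card S2)" using card_Un_le[of S1 S2] by linarith
    also have "\<dots> \<le> 2 * sum_list (map snd (z # ys)) * (real N)\<^sup>2 + length (z # ys) * N" using 1 2 by (simp add: z algebra_simps)
    finally show ?case unfolding e using 1 2 by simp
  qed simp
  have ev: "eventually (\<lambda>N::nat. real (length xs) / (\<epsilon> / 2) \<le> real N) sequentially"
    using filterlim_real_sequentially unfolding filterlim_at_top by blast
  show ?thesis using ev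
  proof eventually_elim
    case (elim N)
    define S where "S = {r :: rat. (\<exists>y \<rho>. (y, \<rho>) \<in> set xs \<and> \<bar>of_rat r - y\<bar> \<le> \<rho>) \<and> rat_height r \<le> int N}"
    have sub: "{r :: rat. of_rat r \<in> A \<and> rat_height r \<le> int N} \<subseteq> S" using xs(3) by (auto simp: S_def)
    have fS: "finite S" and cS: "real (card S) \<le> 2 * sum_list (map snd xs) * (real N)\<^sup>2 + real (length xs) * real N"
      using main[OF xs(1), where N = N] unfolding S_def by simp_all
    have "real (card {r :: rat. of_rat r \<in> A \<and> rat_height r \<le> int N}) \<le> real (card S)" using card_mono[OF fS sub] by simp
    also note cS
    also have "2 * sum_list (map snd xs) * (real N)\<^sup>2 \<le> 2 * (\<epsilon> / 4) * (real N)\<^sup>2" using xs(2) by (intro mult_right_mono) auto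
    also have "real (length xs) * real N \<le> \<epsilon> / 2 * real N * N"
    proof (rule mult_right_mono)
      show "real (length xs) \<le> \<epsilon> / 2 * real N" using elim \<epsilon> by (simp add: field_simps)
    qed simp
    also have "2 * (\<epsilon> / 4) * (real N)\<^sup>2 + \<epsilon> / 2 * real N * N = \<epsilon> * (real N)\<^sup>2" by (simp add: power2_eq_square algebra_simps)
    finally show ?case using finite_subset[OF sub fS] by simp
  qed
qed

section \<open>Maximal and ADC forms\<close>

lemma std_lattice_rvec: "v \<in> std_lattice \<Longrightarrow> \<exists>x. v = rvec x"
proof -
  assume "v \<in> std_lattice"
  hence "\<forall>i. \<exists>k. v $ i = of_int k" by (auto simp: std_lattice_def Ints_def)
  then obtain k where k: "\<And>i. v $ i = of_int (k i)" by metis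
  have "v = rvec (\<chi> i. k i)" by (simp add: rvec_def vec_eq_iff k)
  thus ?thesis by blast
qed

text \<open>Otherwise the lattice generated by the standard one and \<open>v\<close> would be a larger integral one.\<close>

lemma maximal_form_integral_vector:
  assumes mx: "maximal_form f" and q: "tform_q f v \<in> \<int>" and po: "\<And>i. tform_polar f v (axis i 1) \<in> \<int>"
  shows "v \<in> std_lattice"
proof (rule ccontr)
  assume nv: "v \<notin> std_lattice"
  define B where "B = insert v (range (\<lambda>i::3. axis i (1::rat)))"
  have ax: "axis i 1 \<in> (std_lattice :: (rat ^ 3) set)" for i by (auto simp: std_lattice_def axis_def)
  have vB: "v \<notin> range (\<lambda>i::3. axis i (1::rat))" using nv ax by auto
  have inj: "inj (\<lambda>i::3. axis i (1::rat))" by (auto simp: inj_on_def axis_eq_axis)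
  have sumB: "(\<Sum>b\<in>B. of_int (c b) *s b) = of_int (c v) *s v + rvec (\<chi> i. c (axis i 1))" for c :: "rat ^ 3 \<Rightarrow> int"
  proof -
    have "(\<Sum>b\<in>B. of_int (c b) *s b) = of_int (c v) *s v + (\<Sum>b\<in>range (\<lambda>i::3. axis i (1::rat)). of_int (c b) *s b)"
      unfolding B_def by (rule sum.insert) (use vB in auto)
    also have "(\<Sum>b\<in>range (\<lambda>i::3. axis i (1::rat)). of_int (c b) *s b) = (\<Sum>i\<in>UNIV. of_int (c (axis i 1)) *s axis (i::3) (1::rat))"
      by (subst sum.reindex[OF inj]) simp
    also have "\<dots> = rvec (\<chi> i. c (axis i 1))"
      by (simp add: vec_eq_iff rvec_def forall_3 sum_3 axis_def)
    finally show ?thesis .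
  qed
  have span: "int_span B = {of_int k *s v + rvec x | k x. True}"
  proof (intro equalityI subsetI)
    fix y assume "y \<in> int_span B"
    then obtain c where "y = (\<Sum>b\<in>B. of_int (c b) *s b)" by (auto simp: int_span_def)
    thus "y \<in> {of_int k *s v + rvec x | k x. True}" unfolding sumB by blast
  next
    fix y assume "y \<in> {of_int k *s v + rvec x | k x. True}"
    then obtain k x where y: "y = of_int k *s v + rvec x" by blast
    \<comment> \<open>Coefficients in \<open>int_span\<close> are indexed by the vectors themselves;
      \<open>THE\<close> reads the index off a basis vector.\<close>
    define c where "c b = (if b = v then k else x $ (THE i. b = axis i 1))" for b
    have "c (axis i 1) = x $ i" for i
    proof -
      have "axis i 1 \<noteq> v" using vB by auto
      moreover have "(THE j. (axis i 1 :: rat ^ 3) = axis j 1) = i" by (rule the_equality) (auto simp: axis_eq_axis)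
      ultimately show ?thesis by (simp add: c_def)
    qed
    hence "(\<chi> i. c (axis i 1)) = x" by (simp add: vec_eq_iff)
    moreover have "c v = k" by (simp add: c_def)
    ultimately have "(\<Sum>b\<in>B. of_int (c b) *s b) = y" unfolding sumB y by simp
    thus "y \<in> int_span B" by (auto simp: int_span_def)
  qed
  have "vec.span (int_span B) = UNIV"
  proof -
    have "y \<in> vec.span (int_span B)" for y :: "rat ^ 3"
    proof -
      have m: "axis i 1 \<in> int_span B" for i :: 3
      proof -
        have "axis i 1 = of_int 0 *s v + rvec (axis i 1)" by (simp add: rvec_axis)
        thus ?thesis unfolding span by blast
      qed
      have "y = (y $ 1) *s axis 1 1 + (y $ 2) *s axis 2 1 + (y $ 3) *s axis 3 1"
        by (simp add: vec_eq_iff forall_3 axis_def)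
      moreover have "(y $ 1) *s axis 1 1 + (y $ 2) *s axis 2 1 + (y $ 3) *s axis 3 1 \<in> vec.span (int_span B)"
        by (intro vec.span_add vec.span_scale vec.span_base m)
      ultimately show ?thesis by simp
    qed
    thus ?thesis by auto
  qed
  hence "is_lattice (int_span B)" unfolding is_lattice_def by (intro conjI exI[of _ B]) (auto simp: B_def)
  moreover have "std_lattice \<subset> int_span B"
  proof -
    have "y \<in> int_span B" if ys: "y \<in> std_lattice" for y
    proof -
      obtain x where "y = rvec x" using std_lattice_rvec[OF ys] by blast
      hence "y = of_int 0 *s v + rvec x" by simp
      thus ?thesis unfolding span by blast
    qed
    moreover have "v \<in> int_span B"
    proof -
      have "v = of_int 1 *s v + rvec 0" by (simp add: rvec_def vec_eq_iff)
      thus ?thesis unfolding span by blast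
    qed
    ultimately show ?thesis using nv by blast
  qed
  moreover have "\<forall>y\<in>int_span B. tform_q f y \<in> \<int>"
  proof
    fix y assume "y \<in> int_span B"
    then obtain k x where y: "y = of_int k *s v + rvec x" unfolding span by blast
    have "tform_q f y = tform_q f (of_int k *s v) + tform_q f (rvec x) + tform_polar f (of_int k *s v) (rvec x)"
      by (simp add: tform_polar_def y)
    also have "\<dots> = (of_int k)\<^sup>2 * tform_q f v + of_int (tform_eval f x) + of_int k * (\<Sum>i\<in>UNIV. of_int (x $ i) * tform_polar f v (axis i 1))"
      by (simp add: tform_q_scale tform_q_rvec tform_polar_scale_left tform_polar_eq_sum_axis[of f v "rvec x"]) (simp add: rvec_def)
    also have "\<dots> \<in> \<int>" using q po by (intro Ints_add Ints_mult Ints_power Ints_sum) auto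
    finally show "tform_q f y \<in> \<int>" .
  qed
  ultimately show False using mx unfolding maximal_form_def by blast
qed

text \<open>A nonzero vector of the radical, scaled to have a coordinate 1/2, has value 0 and polar
  form 0 with all vectors, so maximality would make it integral.\<close>

lemma maximal_form_nondegenerate:
  assumes mx: "maximal_form f"
  shows "nondegenerate f"
  unfolding nondegenerate_def
proof (intro allI impI)
  fix x assume x: "\<forall>y. tform_polar f x y = 0"
  show "x = 0"
  proof (rule ccontr)
    assume "x \<noteq> 0"
    then obtain i where i: "x $ i \<noteq> 0" by (auto simp: vec_eq_iff)
    define v where "v = (1 / (2 * x $ i)) *s x"
    have "tform_polar f x x = 2 * tform_q f x"
      by (cases f) (simp add: tform_polar_def tform_q_def power2_eq_square algebra_simps)
    hence "tform_q f x = 0" using x by simp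
    hence "v \<in> std_lattice"
      by (intro maximal_form_integral_vector[OF mx]) (use x in \<open>auto simp: v_def tform_q_scale tform_polar_scale_left\<close>)
    hence "v $ i \<in> \<int>" by (simp add: std_lattice_def)
    moreover have "v $ i = 1 / 2" using i by (simp add: v_def)
    ultimately obtain k where "(1 / 2 :: rat) = of_int k" by (auto simp: Ints_def)
    hence "(of_int (2 * k) :: rat) = of_int 1" by simp
    hence "2 * k = 1" by (simp only: of_int_eq_iff)
    thus False by presburger
  qed
qed

text \<open>x / p has an integral value and integral polar form with the standard basis, so by
  maximality it is an integral vector.\<close>

lemma maximal_form_div_p:
  assumes mx: "maximal_form f" and p: "prime p" and f2: "(int p)\<^sup>2 dvd tform_eval f x"
    and po: "\<And>i. int p dvd polar f x (axis i 1)"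
  shows "\<exists>y. x = int p *s y"
proof -
  have p0: "(of_int (int p) :: rat) \<noteq> 0" using p by (simp add: prime_gt_0_nat)
  define v where "v = (1 / of_int (int p)) *s rvec x"
  have "v \<in> std_lattice"
  proof (rule maximal_form_integral_vector[OF mx])
    obtain k where k: "tform_eval f x = (int p)\<^sup>2 * k" using f2 by blast
    have "tform_q f v = of_int k" unfolding v_def tform_q_scale tform_q_rvec k using p0 by (simp add: power_divide)
    thus "tform_q f v \<in> \<int>" by simp
    fix i
    obtain j where j: "polar f x (axis i 1) = int p * j" using po[of i] by blast
    have "tform_polar f v (axis i 1) = (1 / of_int (int p)) * tform_polar f (rvec x) (rvec (axis i 1))"
      unfolding v_def tform_polar_scale_left rvec_axis ..
    also have "\<dots> = of_int j" unfolding tform_polar_rvec j using p0 by simp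
    finally show "tform_polar f v (axis i 1) \<in> \<int>" by simp
  qed
  then obtain y where y: "v = rvec y" using std_lattice_rvec by blast
  have "x $ i = (int p *s y) $ i" for i
  proof -
    have "(of_int (x $ i) :: rat) = of_int (int p) * v $ i" using p0 by (simp add: v_def rvec_def)
    also have "\<dots> = of_int (int p * y $ i)" by (simp add: y rvec_def)
    finally show ?thesis by (simp only: of_int_eq_iff vector_smult_component)
  qed
  thus ?thesis by (auto simp: vec_eq_iff)
qed

text \<open>The cases are isotropic and anisotropic at \<open>p\<close>. If primitive vectors
  \<open>x\<close> with value divisible by arbitrarily high powers of \<open>p\<close> exist, such
  an \<open>x\<close> has a partner \<open>w\<close> with polar value prime to \<open>p\<close>, and
  w + c x attains every residue modulo p^k. Otherwise p^2 dividing the value at \<open>x\<close>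
  forces \<open>p\<close> to divide \<open>x\<close>, since a primitive \<open>x\<close> could be
  lifted to a vector of the excluded kind; then p^2 cancels.\<close>

lemma maximal_form_Loc_cancel:
  assumes mx: "maximal_form f" and p: "prime p" and n: "(int p)\<^sup>2 * n \<in> Loc f p"
  shows "n \<in> Loc f p"
proof (cases "\<forall>k. \<exists>x. (\<nexists>y. x = int p *s y) \<and> int p ^ k dvd tform_eval f x")
  case True
  show ?thesis unfolding Loc_def
  proof (intro CollectI allI)
    fix k
    obtain x where x: "\<nexists>y. x = int p *s y" "int p ^ (k + 2) dvd tform_eval f x" using True by blast
    have "int p ^ 2 dvd tform_eval f x" using x(2) by (rule dvd_power_mono_int) simp
    then obtain i where i: "\<not> int p dvd polar f x (axis i 1)" using maximal_form_div_p[OF mx p] x(1) by blast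
    define w where "w = (axis i 1 :: int ^ 3)"
    have "coprime (polar f x w) (int p ^ k)"
      using i p by (metis coprime_commute coprime_power_left_iff prime_imp_coprime prime_nat_int_transfer w_def)
    then obtain z where z: "[polar f x w * z = 1] (mod int p ^ k)" using cong_solve_coprime_int by blast
    define c where "c = z * (n - tform_eval f w)"
    have "tform_eval f (w + c *s x) - n = (polar f x w * z - 1) * (n - tform_eval f w) + c\<^sup>2 * tform_eval f x"
      unfolding tform_eval_add tform_eval_scale polar_simps polar_sym[of f w x] by (simp add: c_def algebra_simps)
    moreover have "int p ^ k dvd polar f x w * z - 1" using z by (simp add: cong_iff_dvd_diff)
    moreover have "int p ^ k dvd tform_eval f x" using x(2) by (rule dvd_power_mono_int) simp
    ultimately have "int p ^ k dvd tform_eval f (w + c *s x) - n" by (simp only:) (intro dvd_add dvd_mult2 dvd_mult)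
    thus "\<exists>x. int p ^ k dvd tform_eval f x - n" by blast
  qed
next
  case False
  then obtain K where K: "\<And>x. int p ^ K dvd tform_eval f x \<Longrightarrow> \<exists>y. x = int p *s y" by blast
  show ?thesis unfolding Loc_def
  proof (intro CollectI allI)
    fix k
    obtain x where x: "int p ^ (k + 2) dvd tform_eval f x - (int p)\<^sup>2 * n" using LocD[OF n] by blast
    have "int p ^ 2 dvd tform_eval f x - (int p)\<^sup>2 * n" using x by (rule dvd_power_mono_int) simp
    hence "int p ^ 2 dvd (tform_eval f x - (int p)\<^sup>2 * n) + (int p)\<^sup>2 * n" by (intro dvd_add) auto
    hence x2: "(int p)\<^sup>2 dvd tform_eval f x" by simp
    have "\<exists>y. x = int p *s y"
    proof (cases "\<exists>i. \<not> int p dvd polar f x (axis i 1)")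
      case False thus ?thesis using maximal_form_div_p[OF mx p x2] by blast
    next
      case True
      then obtain i where i: "\<not> int p dvd polar f x (axis i 1)" by blast
      define w where "w = (axis i 1 :: int ^ 3)"
      obtain j where j: "tform_eval f x = (int p)\<^sup>2 * j" using x2 by blast
      \<comment> \<open>The lift moves \<open>x\<close> by a multiple of \<open>p\<close>, so if the
        new vector is divisible by \<open>p\<close>, then so is \<open>x\<close>.\<close>
      obtain m where m: "int p ^ K dvd polar f x w * m + int p * tform_eval f w * m\<^sup>2 - (- (int p * j))"
        using hensel_exists[OF p i[folded w_def]] by blast
      have "tform_eval f (x + (int p * m) *s w) = int p * (polar f x w * m + int p * tform_eval f w * m\<^sup>2 - (- (int p * j)))"
        unfolding tform_eval_add tform_eval_scale polar_simps j by (simp add: algebra_simps power2_eq_square)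
      hence "int p ^ K dvd tform_eval f (x + (int p * m) *s w)" using m by simp
      then obtain y where y: "x + (int p * m) *s w = int p *s y" using K by blast
      have "x = int p *s (y - m *s w)"
      proof -
        have "x $ i = int p * y $ i - int p * m * w $ i" for i
          using y by (metis (no_types, lifting) add_diff_cancel_right' vector_add_component vector_smult_component)
        thus ?thesis by (simp add: vec_eq_iff algebra_simps)
      qed
      thus ?thesis by blast
    qed
    then obtain y where y: "x = int p *s y" by blast
    have "int p ^ 2 * int p ^ k dvd int p ^ 2 * (tform_eval f y - n)"
      using x unfolding y tform_eval_scale by (simp add: power_add power2_eq_square algebra_simps)
    hence "int p ^ k dvd tform_eval f y - n" using p by (simp add: prime_gt_0_nat)
    thus "\<exists>x. int p ^ k dvd tform_eval f x - n" by blast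
  qed
qed

section \<open>The p-adic field as classes of Cauchy sequences\<close>

context
  fixes p :: nat
  assumes p: "prime p"
begin

abbreviation "cR \<equiv> padic_cauchy_ring p"
abbreviation "nI \<equiv> {X. padic_null p X}"

lemma nI_ideal: "ideal nI cR" by (rule padic_null_ideal[OF p])

definition cl :: "(nat \<Rightarrow> rat) \<Rightarrow> (nat \<Rightarrow> rat) set" where "cl X = nI +>\<^bsub>cR\<^esub> X"

lemma cl_carrier: "padic_cauchy p X \<Longrightarrow> cl X \<in> carrier (padic_field p)"
  unfolding cl_def padic_field_def FactRing_def
  by (auto simp: A_RCOSETS_def' padic_cauchy_ring_def)

lemma carrier_cl: "x \<in> carrier (padic_field p) \<Longrightarrow> \<exists>X. padic_cauchy p X \<and> x = cl X"
  unfolding cl_def padic_field_def FactRing_def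
  by (auto simp: A_RCOSETS_def' padic_cauchy_ring_def)

lemma mem_cl: "padic_cauchy p X \<Longrightarrow> Y \<in> cl X \<longleftrightarrow> padic_null p (\<lambda>n. Y n - X n)"
proof
  assume "Y \<in> cl X"
  then obtain Z where "padic_null p Z" "Y = (\<lambda>n. Z n + X n)"
    by (auto simp: cl_def a_r_coset_def' padic_cauchy_ring_def)
  thus "padic_null p (\<lambda>n. Y n - X n)" by simp
next
  assume "padic_null p (\<lambda>n. Y n - X n)"
  thus "Y \<in> cl X"
    by (auto simp: cl_def a_r_coset_def' padic_cauchy_ring_def intro!: exI[of _ "\<lambda>n. Y n - X n"])
qed

lemma cl_self: "padic_cauchy p X \<Longrightarrow> X \<in> cl X"
  by (simp add: mem_cl padic_null_def)

lemma cl_eq: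
  assumes X: "padic_cauchy p X" and Y: "padic_cauchy p Y"
  shows "cl X = cl Y \<longleftrightarrow> padic_null p (\<lambda>n. X n - Y n)"
proof
  assume "cl X = cl Y"
  thus "padic_null p (\<lambda>n. X n - Y n)" using cl_self[OF X] mem_cl[OF Y] by simp
next
  assume n: "padic_null p (\<lambda>n. X n - Y n)"
  have 1: "padic_null p (\<lambda>n. Z n - Y n)" if "padic_null p (\<lambda>n. Z n - X n)" for Z
    using padic_null_add[OF p that n] by simp
  have 2: "padic_null p (\<lambda>n. Z n - X n)" if "padic_null p (\<lambda>n. Z n - Y n)" for Z
    using padic_null_add[OF p that padic_null_minus[OF p n]] by simp
  show "cl X = cl Y" using 1 2 mem_cl[OF X] mem_cl[OF Y] by blast
qed

lemma cl_add:
  assumes "padic_cauchy p X" "padic_cauchy p Y"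
  shows "cl X \<oplus>\<^bsub>padic_field p\<^esub> cl Y = cl (\<lambda>n. X n + Y n)"
proof -
  interpret ideal nI cR by (rule nI_ideal)
  have c: "X \<in> carrier cR" "Y \<in> carrier cR" using assms by (simp_all add: padic_cauchy_ring_def)
  have "cl X \<oplus>\<^bsub>padic_field p\<^esub> cl Y = nI +>\<^bsub>cR\<^esub> (X \<oplus>\<^bsub>cR\<^esub> Y)"
    unfolding cl_def padic_field_def FactRing_def using a_rcos_sum[OF c] by simp
  thus ?thesis by (simp add: cl_def padic_cauchy_ring_def)
qed

lemma cl_mult:
  assumes "padic_cauchy p X" "padic_cauchy p Y"
  shows "cl X \<otimes>\<^bsub>padic_field p\<^esub> cl Y = cl (\<lambda>n. X n * Y n)"
proof -
  interpret ideal nI cR by (rule nI_ideal)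
  have c: "X \<in> carrier cR" "Y \<in> carrier cR" using assms by (simp_all add: padic_cauchy_ring_def)
  have "cl X \<otimes>\<^bsub>padic_field p\<^esub> cl Y = nI +>\<^bsub>cR\<^esub> (X \<otimes>\<^bsub>cR\<^esub> Y)"
    unfolding cl_def padic_field_def FactRing_def using rcoset_mult_add[OF c] by simp
  thus ?thesis by (simp add: cl_def padic_cauchy_ring_def)
qed

lemma cl_one: "\<one>\<^bsub>padic_field p\<^esub> = cl (\<lambda>_. 1)"
  unfolding cl_def padic_field_def FactRing_def by (simp add: padic_cauchy_ring_def)

lemma cl_zero: "\<zero>\<^bsub>padic_field p\<^esub> = cl (\<lambda>_. 0)"
proof -
  have "\<zero>\<^bsub>padic_field p\<^esub> = nI" unfolding padic_field_def FactRing_def by simp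
  also have "nI = cl (\<lambda>_. 0)" using mem_cl[OF padic_cauchy_const] by auto
  finally show ?thesis .
qed

lemma padic_of_int_cl: "padic_of_int p k = cl (\<lambda>_. of_int k)"
proof -
  interpret F: cring "padic_field p" by (rule padic_field_cring[OF p])
  have nat: "[(int n)] \<cdot>\<^bsub>padic_field p\<^esub> \<one>\<^bsub>padic_field p\<^esub> = cl (\<lambda>_. of_nat n)" for n
  proof (induction n)
    case 0
    show ?case using cl_zero by (simp add: add_pow_def)
  next
    case (Suc n)
    have "[(int (Suc n))] \<cdot>\<^bsub>padic_field p\<^esub> \<one>\<^bsub>padic_field p\<^esub> = [(int n)] \<cdot>\<^bsub>padic_field p\<^esub> \<one>\<^bsub>padic_field p\<^esub> \<oplus>\<^bsub>padic_field p\<^esub> \<one>\<^bsub>padic_field p\<^esub>"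
      using F.add.int_pow_mult[of "\<one>\<^bsub>padic_field p\<^esub>" "int n" 1] by (simp add: add.commute)
    also have "\<dots> = cl (\<lambda>_. of_nat n) \<oplus>\<^bsub>padic_field p\<^esub> \<one>\<^bsub>padic_field p\<^esub>" unfolding Suc ..
    also have "\<dots> = cl (\<lambda>_. of_nat n + 1)" unfolding cl_one by (simp add: cl_add)
    finally show ?case by (simp add: add.commute)
  qed
  show ?thesis
  proof (cases "k \<ge> 0")
    case True
    thus ?thesis using nat[of "nat k"] by (simp add: padic_of_int_def)
  next
    case False
    define n where "n = nat (- k)"
    have k: "k = - int n" using False by (simp add: n_def)
    have "padic_of_int p k = \<ominus>\<^bsub>padic_field p\<^esub> cl (\<lambda>_. of_nat n)"
      unfolding padic_of_int_def k nat[symmetric] by (rule F.add.int_pow_neg) simp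
    also have "\<dots> = cl (\<lambda>_. - of_nat n)"
    proof (rule F.minus_equality)
      show "cl (\<lambda>_. - of_nat n) \<oplus>\<^bsub>padic_field p\<^esub> cl (\<lambda>_. of_nat n) = \<zero>\<^bsub>padic_field p\<^esub>"
        by (simp add: cl_add cl_zero)
    qed (auto intro: cl_carrier)
    finally show ?thesis by (simp add: k)
  qed
qed

definition qv :: "int tform \<Rightarrow> (3 \<Rightarrow> nat \<Rightarrow> rat) \<Rightarrow> nat \<Rightarrow> rat" where
  "qv f X n = tform_q f (\<chi> i. X i n)"

lemma tform_eval_in_cl:
  assumes X: "\<And>i. padic_cauchy p (X i)"
  shows "tform_eval_in (padic_field p) (map_tform (padic_of_int p) f) (\<chi> i. cl (X i)) = cl (qv f X)" "padic_cauchy p (qv f X)"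
proof -
  obtain a b c d e g where f: "f = TForm a b c d e g" by (cases f)
  note cc = padic_cauchy_add[OF p] padic_cauchy_mult[OF p] padic_cauchy_const X
  have q: "qv f X = (\<lambda>n. of_int a * (X 1 n * X 1 n) + of_int b * (X 2 n * X 2 n) + of_int c * (X 3 n * X 3 n) + of_int d * (X 1 n * X 2 n) + of_int e * (X 1 n * X 3 n) + of_int g * (X 2 n * X 3 n))"
    by (rule ext) (simp add: qv_def f tform_q_def power2_eq_square mult.assoc)
  show "padic_cauchy p (qv f X)" unfolding q by (intro cc)
  show "tform_eval_in (padic_field p) (map_tform (padic_of_int p) f) (\<chi> i. cl (X i)) = cl (qv f X)"
    unfolding f tform.map tform_eval_in.simps vec_lambda_beta padic_of_int_cl
    unfolding q f[symmetric] by (simp add: cl_mult cl_add cc)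
qed

text \<open>The denominator of \<open>r\<close> is prime to \<open>p\<close> and can be inverted
  modulo p^k.\<close>

lemma padic_abs_le_one_approx:
  assumes r: "padic_abs p r \<le> 1"
  shows "\<exists>m::int. padic_abs p (r - of_int m) \<le> 1 / p ^ k"
proof -
  obtain a b where q: "quotient_of r = (a, b)" by (cases "quotient_of r")
  have b0: "b > 0" using quotient_of_denom_pos[OF q] .
  have rab: "r = of_int a / of_int b" using quotient_of_div[OF q] .
  have cop: "coprime a b" using quotient_of_coprime[OF q] .
  have p1: "real p > 1" using prime_gt_1_nat[OF p] by simp
  have nb: "\<not> int p dvd b"
  proof
    assume pb: "int p dvd b"
    hence "\<not> int p dvd a" using cop p by (metis coprime_common_divisor not_prime_unit prime_nat_int_transfer)
    hence ma: "multiplicity (int p) a = 0" and a0: "a \<noteq> 0" by (auto simp: not_dvd_imp_multiplicity_0)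
    have mb: "multiplicity (int p) b \<ge> 1"
      using pb b0 p by (intro multiplicity_geI) (auto simp: not_prime_unit)
    have "padic_abs p r = real p powi (int (multiplicity (int p) b))"
      unfolding rab using a0 b0 ma by (subst padic_abs_frac[OF p]) auto
    also have "\<dots> = real p ^ multiplicity (int p) b" by simp
    also have "\<dots> \<ge> real p ^ 1" using mb p1 by (intro power_increasing) auto
    finally show False using r p1 by simp
  qed
  hence "coprime b (int p ^ k)" using p by (metis coprime_commute coprime_power_left_iff prime_imp_coprime prime_nat_int_transfer)
  then obtain y where y: "[b * y = 1] (mod int p ^ k)" using cong_solve_coprime_int by blast
  define m where "m = a * y"
  have d: "int p ^ k dvd a - b * m"
  proof -
    have "a - b * m = - a * (b * y - 1)" by (simp add: m_def algebra_simps)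
    thus ?thesis using y by (simp add: cong_iff_dvd_diff)
  qed
  have e: "r - of_int m = of_int (a - b * m) / of_int b" using b0 by (simp add: rab field_simps)
  have "padic_abs p (r - of_int m) \<le> 1 / p ^ k"
  proof (cases "a - b * m = 0")
    case True
    thus ?thesis unfolding e by simp
  next
    case False
    have "multiplicity (int p) (a - b * m) \<ge> k" using d False p by (intro multiplicity_geI) (auto simp: not_prime_unit)
    moreover have "multiplicity (int p) b = 0" using nb by (rule not_dvd_imp_multiplicity_0)
    ultimately have "padic_abs p (r - of_int m) \<le> real p powi (- int k)"
      unfolding e using False b0 p1 by (subst padic_abs_frac[OF p]) (auto intro!: power_int_increasing)
    thus ?thesis by (simp add: power_int_minus divide_inverse)
  qed
  thus ?thesis by blast
qed

lemma padic_abs_of_int_le: "padic_abs p (of_int n) \<le> 1 / p ^ k \<longleftrightarrow> int p ^ k dvd n"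
proof (cases "n = 0")
  case False
  have p1: "real p > 1" using prime_gt_1_nat[OF p] by simp
  have "padic_abs p (of_int n) = real p powi (- int (multiplicity (int p) n))"
    using padic_abs_frac[OF p False, of 1] by (simp add: multiplicity_unit_right)
  also have "\<dots> = 1 / p ^ multiplicity (int p) n" by (simp add: power_int_minus divide_inverse)
  finally have x: "padic_abs p (of_int n) = 1 / p ^ multiplicity (int p) n" .
  have "1 / real p ^ m \<le> 1 / real p ^ k \<longleftrightarrow> real p ^ k \<le> real p ^ m" for m
  proof -
    have "real p ^ m > 0" "real p ^ k > 0" using p1 by auto
    thus ?thesis by (simp only: divide_le_cancel frac_le_eq mult_1 pos_divide_le_eq pos_le_divide_eq times_divide_eq_left)
  qed
  hence "padic_abs p (of_int n) \<le> 1 / p ^ k \<longleftrightarrow> real p ^ k \<le> real p ^ multiplicity (int p) n"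
    unfolding x by simp
  also have "\<dots> \<longleftrightarrow> k \<le> multiplicity (int p) n" using p1 by simp
  also have "\<dots> \<longleftrightarrow> int p ^ k dvd n" using False p by (intro power_dvd_iff_le_multiplicity[symmetric]) (auto simp: not_prime_unit)
  finally show ?thesis .
qed simp

lemma padic_power_small: "e > 0 \<Longrightarrow> \<exists>k. 1 / real p ^ k < e"
proof -
  assume e: "e > 0"
  have p1: "real p > 1" using prime_gt_1_nat[OF p] by simp
  obtain k where "1 / e < real p ^ k" using real_arch_pow[OF p1] by blast
  hence "1 / real p ^ k < e" using e p1 by (simp add: field_simps)
  thus ?thesis by blast
qed

end

text \<open>Every difference of monomials is a sum of coordinate differences times p-adically
  integral numbers.\<close>

lemma tform_q_diff_le:
  fixes x y :: "rat ^ 3"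
  assumes p: "prime p" and x: "\<And>i. padic_abs p (x $ i) \<le> 1" and y: "\<And>i. padic_abs p (y $ i) \<le> 1"
    and d: "\<And>i. padic_abs p (x $ i - y $ i) \<le> \<epsilon>" and \<epsilon>: "\<epsilon> \<ge> 0"
  shows "padic_abs p (tform_q f x - tform_q f y) \<le> \<epsilon>"
proof -
  obtain a b c d' e g where f: "f = TForm a b c d' e g" by (cases f)
  have int: "padic_abs p (of_int k) \<le> 1" for k using padic_abs_of_int_le[OF p, of k 0] by simp
  have add: "padic_abs p (r + s) \<le> z" if "padic_abs p r \<le> z" "padic_abs p s \<le> z" for r s z
    using padic_abs_add[OF p, of r s] that by simp
  have mul: "padic_abs p (r * s) \<le> \<epsilon>" if "padic_abs p r \<le> \<epsilon>" "padic_abs p s \<le> 1" for r s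
    using mult_mono[OF that \<epsilon>] by (simp add: padic_abs_mult[OF p])
  have mul1: "padic_abs p (r * s) \<le> 1" if "padic_abs p r \<le> 1" "padic_abs p s \<le> 1" for r s
    using mult_mono[OF that] by (simp add: padic_abs_mult[OF p])
  have "tform_q f x - tform_q f y =
      (x $ 1 - y $ 1) * (of_int a * (x $ 1 + y $ 1)) + (x $ 2 - y $ 2) * (of_int b * (x $ 2 + y $ 2)) + (x $ 3 - y $ 3) * (of_int c * (x $ 3 + y $ 3))
      + ((x $ 1 - y $ 1) * (of_int d' * x $ 2) + (x $ 2 - y $ 2) * (of_int d' * y $ 1))
      + ((x $ 1 - y $ 1) * (of_int e * x $ 3) + (x $ 3 - y $ 3) * (of_int e * y $ 1))
      + ((x $ 2 - y $ 2) * (of_int g * x $ 3) + (x $ 3 - y $ 3) * (of_int g * y $ 2))"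
    by (simp add: f tform_q_def power2_eq_square algebra_simps)
  also have "padic_abs p \<dots> \<le> \<epsilon>"
    by (intro add mul mul1 d int x y)
  finally show ?thesis .
qed

text \<open>Solutions modulo different powers of \<open>p\<close> need not be compatible. One
  approximate solution is therefore fixed and varied only along an axis whose derivative has bounded
  valuation; there \<open>hensel_unique\<close> makes the corrections a Cauchy sequence. The bound
  on the valuation comes from m \<noteq> 0.\<close>

lemma Loc_imp_padic_sequence:
  assumes p: "prime p" and m: "m \<in> Loc f p" "m \<noteq> 0"
  obtains X :: "nat \<Rightarrow> int ^ 3" where "\<And>k. int p ^ k dvd tform_eval f (X k) - m"
    "\<And>k l i. k \<le> l \<Longrightarrow> int p ^ Suc k dvd (X k - X l) $ i"
proof -
  have "finite {k. int p ^ k dvd m}" using m(2) p by (intro finite_divisor_powers) (auto simp: not_prime_unit)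
  hence "{k. int p ^ k dvd m} \<noteq> UNIV" by auto
  then obtain K where K: "\<not> int p ^ K dvd m" by blast
  obtain x where x: "int p ^ (2 * K + 1) dvd tform_eval f x - m" using LocD[OF m(1)] by blast
  have "int p ^ Suc K dvd tform_eval f x - m" using x by (rule dvd_power_mono_int) simp
  then obtain i where i: "\<not> int p ^ Suc K dvd polar f x (axis i 1)" using exists_axis_not_dvd[OF p K] by blast
  define g where "g = (axis i 1 :: int ^ 3)"
  obtain r b where rb: "polar f x g = int p ^ r * b" "\<not> int p dvd b" "r \<le> K"
    using prime_power_split[OF p] i unfolding g_def by metis
  have "int p ^ (2 * r + 1) dvd tform_eval f x - m" using x by (rule dvd_power_mono_int) (use rb in simp)
  then obtain R where R: "tform_eval f x - m = int p ^ (2 * r + 1) * R" by blast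
  have "\<forall>k. \<exists>u. int p ^ k dvd b * u + int p * tform_eval f g * u\<^sup>2 - (- R)" using hensel_exists[OF p rb(2)] by blast
  then obtain u where u: "\<And>k. int p ^ k dvd b * u k + int p * tform_eval f g * (u k)\<^sup>2 - (- R)" by metis
  define X where "X k = x + (int p ^ (r + 1) * u k) *s g" for k
  have "int p ^ k dvd tform_eval f (X k) - m" for k
  proof -
    have e1: "int p ^ (r + 1) * int p ^ r = int p ^ (2 * r + 1)" and e2: "int p ^ (r + 1) * int p ^ (r + 1) = int p ^ (2 * r + 1) * int p"
      by (simp_all add: mult_2 flip: power_add)
    have "tform_eval f (X k) - m = (tform_eval f x - m) + (int p ^ (r + 1) * int p ^ r) * (b * u k) + (int p ^ (r + 1) * int p ^ (r + 1)) * (tform_eval f g * (u k)\<^sup>2)"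
      unfolding X_def tform_eval_add tform_eval_scale polar_simps rb(1) by (simp add: algebra_simps power2_eq_square)
    also have "\<dots> = int p ^ (2 * r + 1) * (b * u k + int p * tform_eval f g * (u k)\<^sup>2 - (- R))"
      unfolding e1 e2 R by (simp add: algebra_simps)
    finally show ?thesis using u[of k] by (metis dvd_mult)
  qed
  moreover have "int p ^ Suc k dvd (X k - X l) $ j" if "k \<le> l" for k l j
  proof -
    have "int p ^ k dvd b * u l + int p * tform_eval f g * (u l)\<^sup>2 - (- R)" using u[of l] that by (rule dvd_power_mono_int)
    hence "int p ^ k dvd u k - u l" using hensel_unique[OF p rb(2) u[of k]] by blast
    hence "int p * int p ^ k dvd int p * (u k - u l)" by simp
    moreover have "(X k - X l) $ j = int p * (u k - u l) * (int p ^ r * g $ j)" by (simp add: X_def algebra_simps)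
    ultimately show ?thesis by simp
  qed
  ultimately show ?thesis using that by blast
qed

text \<open>A p-adically integral vector of value p^2 n, divided by \<open>p\<close>, represents
  \<open>n\<close> over the p-adic field. The ADC property yields an integral representation, whose
  terms are then approximated by integer vectors. For n = 0 the zero vector serves.\<close>

lemma locally_ADC_Loc_cancel:
  assumes adc: "locally_ADC f" and p: "prime p" and n: "(int p)\<^sup>2 * n \<in> Loc f p"
  shows "n \<in> Loc f p"
proof (cases "n = 0")
  case True
  have "tform_eval f 0 = n" using True by simp
  thus ?thesis using range_subset_Loc[of f p] by blast
next
  case False
  define m where "m = (int p)\<^sup>2 * n"
  have p0: "(of_int (int p) :: rat) \<noteq> 0" using p by (simp add: prime_gt_0_nat)
  have "m \<noteq> 0" using False p by (simp add: m_def prime_gt_0_nat)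
  then obtain X where X: "\<And>k. int p ^ k dvd tform_eval f (X k) - m" "\<And>k l i. k \<le> l \<Longrightarrow> int p ^ Suc k dvd (X k - X l) $ i"
    using Loc_imp_padic_sequence[OF p n[folded m_def]] by metis
  \<comment> \<open>The shift by 2 pays for the division by \<open>p\<close>, which costs p^2 in the
    value of the form.\<close>
  define W where "W i k = (of_int (X (k + 2) $ i) :: rat) / of_int (int p)" for i k
  have Wd: "padic_abs p (W i k - W i l) \<le> 1 / real p ^ k" if "k \<le> l" for i k l
  proof -
    have "int p ^ Suc (k + 2) dvd (X (k + 2) - X (l + 2)) $ i" by (rule X(2)) (use that in simp)
    then obtain j where j: "(X (k + 2) - X (l + 2)) $ i = int p ^ Suc (k + 2) * j" by blast
    have "W i k - W i l = of_int ((X (k + 2) - X (l + 2)) $ i) / of_int (int p)" by (simp add: W_def diff_divide_distrib)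
    also have "\<dots> = of_int (int p ^ (k + 2) * j)" unfolding j using p0 by simp
    finally have "W i k - W i l = of_int (int p ^ (k + 2) * j)" .
    thus ?thesis using padic_abs_of_int_le[OF p, of "int p ^ (k + 2) * j" k] by (simp add: power_add)
  qed
  have Wc: "padic_cauchy p (W i)" for i unfolding padic_cauchy_def
  proof (intro allI impI)
    fix e :: real assume "e > 0"
    then obtain M where M: "1 / real p ^ M < e" using padic_power_small[OF p] by blast
    have p1: "real p \<ge> 1" using prime_ge_1_nat[OF p] by simp
    have "padic_abs p (W i k - W i l) < e" if "k \<ge> M" "l \<ge> M" for k l
    proof -
      have "padic_abs p (W i k - W i l) \<le> 1 / real p ^ min k l"
      proof (cases "k \<le> l")
        case True thus ?thesis using Wd[OF True] by (simp add: min_def)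
      next
        case False
        have "padic_abs p (W i k - W i l) = padic_abs p (W i l - W i k)" using padic_abs_minus[OF p, of "W i l - W i k"] by simp
        thus ?thesis using Wd[of l k] False by (simp add: min_def)
      qed
      also have "\<dots> \<le> 1 / real p ^ M" using that p1 by (intro divide_left_mono power_increasing) auto
      finally show ?thesis using M by simp
    qed
    thus "\<exists>M. \<forall>k\<ge>M. \<forall>l\<ge>M. padic_abs p (W i k - W i l) < e" by blast
  qed
  have "padic_null p (\<lambda>k. qv f W k - of_int n)" unfolding padic_null_iff
  proof (intro allI impI)
    fix e :: real assume "e > 0"
    then obtain M where M: "1 / real p ^ M < e" using padic_power_small[OF p] by blast
    have "padic_abs p (qv f W k - of_int n) < e" if "k \<ge> M" for k
    proof -
      obtain j where j: "tform_eval f (X (k + 2)) - m = int p ^ (k + 2) * j" using X(1)[of "k + 2"] by blast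
      have "(\<chi> i. W i k) = (1 / of_int (int p)) *s rvec (X (k + 2))" by (simp add: vec_eq_iff W_def rvec_def)
      hence "qv f W k = of_int (tform_eval f (X (k + 2))) / (of_int (int p))\<^sup>2" unfolding qv_def[OF p] by (simp add: tform_q_scale tform_q_rvec power_divide)
      also have "tform_eval f (X (k + 2)) = (int p)\<^sup>2 * (n + int p ^ k * j)" using j by (simp add: m_def power_add power2_eq_square algebra_simps)
      finally have "qv f W k - of_int n = of_int (int p ^ k * j)" using p0 by simp
      hence "padic_abs p (qv f W k - of_int n) \<le> 1 / real p ^ M"
        using padic_abs_of_int_le[OF p, of "int p ^ k * j" M] that by (simp add: le_imp_power_dvd dvd_mult2)
      thus ?thesis using M by simp
    qed
    thus "\<exists>M. \<forall>k\<ge>M. padic_abs p (qv f W k - of_int n) < e" by blast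
  qed
  hence "cl p (qv f W) = cl p (\<lambda>_. of_int n)"
    by (rule iffD2[OF cl_eq[OF p tform_eval_in_cl(2)[OF p Wc] padic_cauchy_const]])
  hence "cl p (qv f W) = padic_of_int p n" unfolding padic_of_int_cl[OF p] .
  hence "tform_eval_in (padic_field p) (map_tform (padic_of_int p) f) (\<chi> i. cl p (W i)) = padic_of_int p n"
    using tform_eval_in_cl(1)[OF p Wc] by simp
  hence "represented_over (padic_field p) (carrier (padic_field p)) (map_tform (padic_of_int p) f) (padic_of_int p n)"
    unfolding represented_over_def using cl_carrier[OF p Wc] by (intro exI[of _ "\<chi> i. cl p (W i)"]) auto
  moreover have "padic_of_int p n \<in> padic_ints p"
  proof -
    have "padic_abs p (of_int n) \<le> 1" using padic_abs_of_int_le[OF p, of n 0] by simp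
    hence "\<exists>X\<in>cl p (\<lambda>_. of_int n). \<forall>k. padic_abs p (X k) \<le> 1"
      by (intro bexI[OF _ cl_self[OF p padic_cauchy_const]] allI)
    thus ?thesis unfolding padic_ints_def padic_of_int_cl[OF p]
      by (intro CollectI conjI cl_carrier[OF p padic_cauchy_const])
  qed
  ultimately have "represented_over (padic_field p) (padic_ints p) (map_tform (padic_of_int p) f) (padic_of_int p n)"
    using adc p unfolding locally_ADC_def padic_ADC_def by blast
  then obtain t where t: "\<And>i. t $ i \<in> padic_ints p" "tform_eval_in (padic_field p) (map_tform (padic_of_int p) f) t = padic_of_int p n"
    unfolding represented_over_def by blast
  have "\<exists>Y. padic_cauchy p Y \<and> t $ i = cl p Y \<and> (\<forall>k. padic_abs p (Y k) \<le> 1)" for i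
  proof -
    obtain Y where Y: "Y \<in> t $ i" "\<forall>k. padic_abs p (Y k) \<le> 1" and tc: "t $ i \<in> carrier (padic_field p)" using t(1)[of i] by (auto simp: padic_ints_def)
    obtain Z where Z: "padic_cauchy p Z" "t $ i = cl p Z" using carrier_cl[OF p tc] by blast
    have nu: "padic_null p (\<lambda>k. Y k - Z k)" using Y(1) Z mem_cl[OF p] by blast
    have "padic_cauchy p (\<lambda>k. (Y k - Z k) + Z k)" by (rule padic_cauchy_add[OF p padic_null_imp_cauchy[OF p nu] Z(1)])
    hence Yc: "padic_cauchy p Y" by simp
    thus ?thesis using cl_eq[OF p Yc Z(1)] nu Y(2) Z(2) by blast
  qed
  then obtain Y where Y: "\<And>i. padic_cauchy p (Y i)" "\<And>i. t $ i = cl p (Y i)" "\<And>i k. padic_abs p (Y i k) \<le> 1" by metis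
  have "t = (\<chi> i. cl p (Y i))" using Y(2) by (simp add: vec_eq_iff)
  hence "cl p (qv f Y) = cl p (\<lambda>_. of_int n)" using t(2) tform_eval_in_cl(1)[OF p Y(1)] padic_of_int_cl[OF p] by simp
  hence nu: "padic_null p (\<lambda>k. qv f Y k - of_int n)"
    by (rule iffD1[OF cl_eq[OF p tform_eval_in_cl(2)[OF p Y(1)] padic_cauchy_const]])
  show ?thesis unfolding Loc_def
  proof (intro CollectI allI)
    fix k
    have pk: "1 / real p ^ k > 0" using p by (simp add: prime_gt_0_nat)
    then obtain M where M: "padic_abs p (qv f Y M - of_int n) < 1 / real p ^ k" using nu unfolding padic_null_iff by blast
    have "\<forall>i. \<exists>z::int. padic_abs p (Y i M - of_int z) \<le> 1 / real p ^ k" using padic_abs_le_one_approx[OF p Y(3)] unfolding of_nat_power by blast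
    then obtain z where z: "\<And>i. padic_abs p (Y i M - of_int (z i)) \<le> 1 / real p ^ k" by metis
    define x where "x = (\<chi> i. z i)"
    have "padic_abs p (tform_q f (\<chi> i. Y i M) - tform_q f (rvec x)) \<le> 1 / real p ^ k"
    proof (rule tform_q_diff_le[OF p])
      show "padic_abs p (rvec x $ i) \<le> 1" for i using padic_abs_of_int_le[OF p, of "x $ i" 0] by (simp add: rvec_def)
      show "padic_abs p ((\<chi> i. Y i M) $ i - rvec x $ i) \<le> 1 / real p ^ k" for i using z by (simp add: rvec_def x_def)
    qed (use Y(3) pk in auto)
    hence "padic_abs p (qv f Y M - of_int (tform_eval f x)) \<le> 1 / real p ^ k" by (simp add: qv_def[OF p] tform_q_rvec)
    hence 1: "padic_abs p (- (qv f Y M - of_int (tform_eval f x))) \<le> 1 / real p ^ k" by (simp only: padic_abs_minus[OF p])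
    have "of_int (tform_eval f x - n) = - (qv f Y M - of_int (tform_eval f x)) + (qv f Y M - of_int n)" by simp
    hence "padic_abs p (of_int (tform_eval f x - n)) \<le> max (padic_abs p (- (qv f Y M - of_int (tform_eval f x)))) (padic_abs p (qv f Y M - of_int n))"
      using padic_abs_add[OF p] by metis
    hence "padic_abs p (of_int (tform_eval f x - n)) \<le> 1 / real p ^ k" using 1 M by linarith
    hence "int p ^ k dvd tform_eval f x - n" using padic_abs_of_int_le[OF p, of "tform_eval f x - n" k] by simp
    thus "\<exists>x. int p ^ k dvd tform_eval f x - n" by (rule exI)
  qed
qed

section \<open>Values of the density\<close>

text \<open>For odd \<open>p\<close> the denominator 2 (p + 1) is divisible by 4, while the
  numerator i p + j is odd or twice an odd number, except for the numerator p + 1, where the factor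
  is 1/2, and for the excluded factors 0 and 1.\<close>

lemma local_factor_two_adic:
  assumes p: "odd p" and ij: "i \<le> 2" "j \<le> 2" and f: "local_factor p i j \<noteq> 0" "local_factor p i j \<noteq> 1"
  shows "\<exists>a b :: int. odd a \<and> b > 0 \<and> local_factor p i j = real_of_int a / (2 * real_of_int b)"
proof -
  obtain q where q: "p = 2 * q + 1" using p by (elim oddE)
  have p1: "real p + 1 \<noteq> 0" by linarith
  have q1: "real q + 1 \<noteq> 0" by linarith
  have I: "?thesis" if "odd a" "b > 0" "local_factor p i j = real_of_int a / (2 * real_of_int b)" for a b :: int using that by blast
  have c: "(i = 0 \<or> i = 1 \<or> i = 2) \<and> (j = 0 \<or> j = 1 \<or> j = 2)" using ij by auto
  have half: "x / (2 * (real p + 1)) = (x / 2) / (2 * (real q + 1))" for x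
    unfolding q using q1 by (simp add: field_simps)
  consider "i = 0" "j = 0" | "i = 0" "j = 1" | "i = 0" "j = 2" | "i = 1" "j = 0" | "i = 1" "j = 1" | "i = 1" "j = 2"
    | "i = 2" "j = 0" | "i = 2" "j = 1" | "i = 2" "j = 2" using c by blast
  thus ?thesis
  proof cases
    case 1 thus ?thesis using f by (simp add: local_factor_def)
  next
    case 2 show ?thesis by (rule I[of 1 "int p + 1"]) (simp_all add: local_factor_def 2)
  next
    case 3
    have "local_factor p i j = 1 / (2 * (real q + 1))" unfolding local_factor_def 3 half by simp
    thus ?thesis by (intro I[of 1 "int q + 1"]) simp_all
  next
    case 4 show ?thesis by (rule I[of "int p" "int p + 1"]) (use p in \<open>simp_all add: local_factor_def 4\<close>)
  next
    case 5 show ?thesis by (rule I[of 1 1]) (use p1 in \<open>simp_all add: local_factor_def 5\<close>)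
  next
    case 6 show ?thesis by (rule I[of "int p + 2" "int p + 1"]) (use p in \<open>simp_all add: local_factor_def 6\<close>)
  next
    case 7
    have "local_factor p i j = real p / (2 * (real q + 1))" unfolding local_factor_def 7 half by simp
    thus ?thesis using p by (intro I[of "int p" "int q + 1"]) simp_all
  next
    case 8 show ?thesis by (rule I[of "2 * int p + 1" "int p + 1"]) (simp_all add: local_factor_def 8)
  next
    case 9
    have "local_factor p i j = 1" using p1 by (simp add: local_factor_def 9 field_simps)
    thus ?thesis using f by simp
  qed
qed

lemma prod_local_factor_two_adic:
  assumes "finite S" "\<And>p. p \<in> S \<Longrightarrow> \<exists>a b :: int. odd a \<and> b > 0 \<and> r p = real_of_int a / (2 * real_of_int b)"
  shows "\<exists>a b :: int. odd a \<and> b > 0 \<and> (\<Prod>p\<in>S. r p) = real_of_int a / (2 ^ card S * real_of_int b)"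
  using assms
proof (induction S rule: finite_induct)
  case empty
  show ?case by (intro exI[of _ 1]) simp
next
  case (insert p S)
  obtain a b :: int where ab: "odd a" "b > 0" "(\<Prod>p\<in>S. r p) = real_of_int a / (2 ^ card S * real_of_int b)" using insert by auto
  obtain a' b' :: int where ab': "odd a'" "b' > 0" "r p = real_of_int a' / (2 * real_of_int b')" using insert.prems[of p] by auto
  have "(\<Prod>p\<in>insert p S. r p) = real_of_int (a' * a) / (2 ^ card (insert p S) * real_of_int (b' * b))"
    using insert.hyps ab ab' by simp
  moreover have "odd (a' * a)" "b' * b > 0" using ab ab' by auto
  ultimately show ?case by blast
qed

text \<open>A value outside the given set has at least m + 3 local factors different from 1, each
  putting a 2 into the denominator. The numerator j \<le> 12 cancels at most 2^3 of this.\<close>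

lemma density_value_denominator:
  assumes fS: "finite S" and S: "\<And>p. p \<in> S \<Longrightarrow> odd p" "\<And>p. p \<in> S \<Longrightarrow> \<exists>i j. i \<le> 2 \<and> j \<le> 2 \<and> r p = local_factor p i j" and j: "j \<le> 12"
    and q: "of_rat q = real j / 12 * (\<Prod>p\<in>S. r p)" and nC: "of_rat q \<notin> insert 0 (value_products (m + 3))"
  shows "0 \<le> q \<and> q \<le> 1 \<and> 2 ^ m dvd snd (quotient_of q)"
proof -
  have local_factors: "r p \<in> local_factors" if "p \<in> S" for p using S(2)[OF that] by (auto simp: local_factors_def)
  have "of_rat q \<in> {0..1::real}" using prod_in_value_products[of S r j] fS local_factors j value_products_bounds unfolding q by blast
  hence q01: "0 \<le> q" "q \<le> 1" by auto
  define T where "T = {p\<in>S. r p \<noteq> 1}"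
  have fT: "finite T" using fS by (simp add: T_def)
  have pT: "(\<Prod>p\<in>S. r p) = (\<Prod>p\<in>T. r p)" unfolding T_def using fS by (intro prod.mono_neutral_right) auto
  have "real j / 12 * (\<Prod>p\<in>T. r p) \<in> value_products (card T)" using fT local_factors j by (intro prod_in_value_products) (auto simp: T_def)
  hence "card T \<ge> m + 3" using nC value_products_mono[of "card T" "m + 3"] unfolding q pT by force
  have q0: "real j / 12 * (\<Prod>p\<in>T. r p) \<noteq> 0" using nC unfolding q pT by simp
  hence j0: "j \<noteq> 0" and r0: "\<And>p. p \<in> T \<Longrightarrow> r p \<noteq> 0" using fT by (auto simp: prod_zero_iff)
  have "\<exists>a b :: int. odd a \<and> b > 0 \<and> r p = real_of_int a / (2 * real_of_int b)" if p: "p \<in> T" for p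
  proof -
    have pS: "p \<in> S" and r1: "r p \<noteq> 1" using p by (auto simp: T_def)
    obtain i k where ik: "i \<le> 2" "k \<le> 2" "r p = local_factor p i k" using S(2)[OF pS] by blast
    show ?thesis unfolding ik(3) by (rule local_factor_two_adic[OF S(1)[OF pS] ik(1,2)]) (use r0[OF p] r1 ik(3) in auto)
  qed
  then obtain a b :: int where ab: "odd a" "b > 0" "(\<Prod>p\<in>T. r p) = real_of_int a / (2 ^ card T * real_of_int b)" using prod_local_factor_two_adic[OF fT] by metis
  obtain x y where xy: "quotient_of q = (x, y)" by (cases "quotient_of q")
  have y0: "y > 0" using quotient_of_denom_pos[OF xy] .
  have "of_rat q = real_of_int x / real_of_int y" using quotient_of_div[OF xy] by (simp add: of_rat_divide)
  hence "real_of_int x / real_of_int y = real j / 12 * (real_of_int a / (2 ^ card T * real_of_int b))" using q pT ab(3) by simp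
  hence "real_of_int x * (12 * (2 ^ card T * real_of_int b)) = real j * real_of_int a * real_of_int y"
    using y0 ab(2) by (simp add: field_simps)
  hence "real_of_int (x * (12 * (2 ^ card T * b))) = real_of_int (int j * a * y)" by simp
  hence e: "x * (12 * (2 ^ card T * b)) = int j * a * y" by (simp only: of_int_eq_iff)
  have "2 ^ (m + 3) dvd (2::int) ^ card T" using \<open>card T \<ge> m + 3\<close> by (rule le_imp_power_dvd)
  hence "2 ^ (m + 3) dvd x * (12 * (2 ^ card T * b))" by (intro dvd_mult dvd_mult2)
  hence "2 ^ (m + 3) dvd a * (int j * y)" unfolding e by (simp add: mult_ac)
  moreover have "coprime (2 ^ (m + 3)) a" using ab(1) by simp
  ultimately have d1: "2 ^ (m + 3) dvd int j * y" by (simp only: coprime_dvd_mult_right_iff)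
  \<comment> \<open>\<open>27720 = 8 \<cdot> 3465\<close> is the least common multiple of \<open>1, \<dots>, 12\<close>.\<close>
  have "int j dvd 27720"
  proof -
    have "j \<in> {1, 2, 3, 4, 5, 6, 7, 8, 9, 10, 11, 12}" unfolding insert_iff empty_iff using j j0 by presburger
    thus ?thesis by auto
  qed
  hence "int j * y dvd 27720 * y" by (rule mult_dvd_mono) simp
  hence "2 ^ (m + 3) dvd 27720 * y" using d1 dvd_trans by blast
  hence "8 * 2 ^ m dvd 8 * (3465 * y)" by (simp add: power_add mult.commute)
  hence "(8::int) = 0 \<or> 2 ^ m dvd 3465 * y" by (rule iffD1[OF dvd_mult_cancel_left])
  hence "2 ^ m dvd 3465 * y" by simp
  moreover have "coprime (2 ^ m) (3465::int)" by simp
  ultimately have "2 ^ m dvd y" by (simp only: coprime_dvd_mult_right_iff)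
  thus ?thesis using q01 by (simp add: xy)
qed

lemma form_density_value:
  assumes f: "nondegenerate f" and cl: "\<And>p n. prime p \<Longrightarrow> (int p)\<^sup>2 * n \<in> Loc f p \<Longrightarrow> n \<in> Loc f p"
  shows "\<exists>S r j. finite S \<and> (\<forall>p\<in>S. odd p \<and> (\<exists>i k. i \<le> 2 \<and> k \<le> 2 \<and> r p = local_factor p i k)) \<and> j \<le> 12 \<and>
     form_density f = real j / 12 * (\<Prod>p\<in>S. r p)"
proof -
  obtain P where P: "finite P" "\<And>p. p \<in> P \<Longrightarrow> padic_square_classes p (Loc f p)"
    "form_density f = (\<Prod>p\<in>P. padic_square_classes.\<delta> p (Loc f p))" using form_density_eq_prod[OF f cl] by auto
  define r where "r p = padic_square_classes.\<delta> p (Loc f p)" for p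
  define S where "S = P - {2}"
  have "odd p \<and> (\<exists>i k. i \<le> 2 \<and> k \<le> 2 \<and> r p = local_factor p i k)" if p: "p \<in> S" for p
  proof -
    have pP: "p \<in> P" "p \<noteq> 2" using p by (auto simp: S_def)
    have "prime p" using padic_square_classes.p[OF P(2)[OF pP(1)]] .
    hence "odd p" using pP(2) primes_dvd_imp_eq two_is_prime_nat by blast
    moreover obtain i k where ik: "i \<le> 2" "k \<le> 2" "padic_square_classes.\<delta> p (Loc f p) = (real i * real p + real k) / (2 * (real p + 1))"
      using padic_square_classes.\<delta>_odd[OF P(2)[OF pP(1)] \<open>odd p\<close>] by auto
    ultimately show ?thesis unfolding r_def local_factor_def by auto
  qed
  moreover obtain j where "j \<le> 12" "form_density f = real j / 12 * (\<Prod>p\<in>S. r p)"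
  proof (cases "2 \<in> P")
    case True
    obtain j where j: "j \<le> 12" "padic_square_classes.\<delta> 2 (Loc f 2) = real j / 12"
      using padic_square_classes.\<delta>_two[OF P(2)[OF True]] by auto
    have "form_density f = r 2 * (\<Prod>p\<in>S. r p)" unfolding P(3) r_def[symmetric] S_def using P(1) True by (rule prod.remove)
    hence "form_density f = real j / 12 * (\<Prod>p\<in>S. r p)" using j(2) by (simp add: r_def)
    thus ?thesis using that j(1) by blast
  next
    case False
    hence "S = P" by (simp add: S_def)
    \<comment> \<open>Without a condition at 2 the factor there is 1.\<close>
    hence "form_density f = real 12 / 12 * (\<Prod>p\<in>S. r p)" unfolding P(3) r_def by simp
    thus ?thesis using that[of 12] by blast
  qed
  ultimately show ?thesis using P(1) unfolding S_def by (metis finite_Diff)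
qed

lemma density_values_sparse:
  assumes V: "\<And>v. v \<in> V \<Longrightarrow> \<exists>f. v = form_density f \<and> nondegenerate f \<and> (\<forall>p n. prime p \<longrightarrow> (int p)\<^sup>2 * n \<in> Loc f p \<longrightarrow> n \<in> Loc f p)"
  shows "(\<lambda>N. real (height_count V N)) \<in> o(\<lambda>N. real (height_count {0..1} N))"
proof (rule landau_o.smallI)
  fix c :: real assume c: "c > 0"
  \<comment> \<open>The rationals with denominator divisible by 2^m then contribute at most c/16
    N^2. Together with the c/16 N^2 of the covering this is c/8 N^2, which
    \<open>height_count_unit_interval\<close> allows.\<close>
  obtain m where m: "32 / c < 2 ^ m" using real_arch_pow[of 2 "32 / c"] by auto
  have m2: "2 / (2::real) ^ m \<le> c / 16" using m c by (simp add: field_simps)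
  have "thin ({0} \<union> value_products (m + 3))" by (intro thin_Un thin_finite value_products_thin) simp
  hence t: "thin (insert 0 (value_products (m + 3)))" by simp
  have "eventually (\<lambda>N. finite {q :: rat. of_rat q \<in> insert 0 (value_products (m + 3)) \<and> rat_height q \<le> int N} \<and>
    real (card {q :: rat. of_rat q \<in> insert 0 (value_products (m + 3)) \<and> rat_height q \<le> int N}) \<le> c / 16 * (real N)\<^sup>2) sequentially"
    using thin_height_count[OF t, of "c / 16"] c by simp
  thus "eventually (\<lambda>N. norm (real (height_count V N)) \<le> c * norm (real (height_count {0..1} N))) sequentially"
  proof eventually_elim
    case (elim N)
    define A where "A = {q :: rat. of_rat q \<in> insert 0 (value_products (m + 3)) \<and> rat_height q \<le> int N}"
    define B where "B = {q. 0 \<le> q \<and> q \<le> 1 \<and> 2 ^ m dvd snd (quotient_of q) \<and> rat_height q \<le> int N}"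
    have A: "finite A" "real (card A) \<le> c / 16 * (real N)\<^sup>2" using elim by (auto simp: A_def)
    have B: "finite B" "real (card B) \<le> 2 * (real N)\<^sup>2 / real_of_int (2 ^ m)" unfolding B_def by (rule card_rats_denom_multiple; simp)+
    have sub: "{q :: rat. of_rat q \<in> V \<and> rat_height q \<le> int N} \<subseteq> A \<union> B"
    proof
      fix q assume "q \<in> {q :: rat. of_rat q \<in> V \<and> rat_height q \<le> int N}"
      hence q: "of_rat q \<in> V" "rat_height q \<le> int N" by auto
      obtain f where f: "of_rat q = form_density f" "nondegenerate f" "\<And>p n. prime p \<Longrightarrow> (int p)\<^sup>2 * n \<in> Loc f p \<Longrightarrow> n \<in> Loc f p"
        using V[OF q(1)] by blast
      obtain S r j where S: "finite S" "\<forall>p\<in>S. odd p \<and> (\<exists>i k. i \<le> 2 \<and> k \<le> 2 \<and> r p = local_factor p i k)" "j \<le> 12"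
        "form_density f = real j / 12 * (\<Prod>p\<in>S. r p)" using form_density_value[OF f(2,3)] by metis
      show "q \<in> A \<union> B"
      proof (cases "of_rat q \<in> insert 0 (value_products (m + 3))")
        case True
        hence "q \<in> A" using q(2) unfolding A_def by (intro CollectI conjI)
        thus ?thesis by (rule UnI1)
      next
        case False
        have "0 \<le> q \<and> q \<le> 1 \<and> 2 ^ m dvd snd (quotient_of q)"
          by (rule density_value_denominator[where r = r, OF S(1) _ _ S(3) _ False]) (use S(2,4) f(1) in auto)
        hence "q \<in> B" using q(2) by (simp add: B_def)
        thus ?thesis by (rule UnI2)
      qed
    qed
    have "height_count V N \<le> card (A \<union> B)" unfolding height_count_def using A B by (intro card_mono sub) auto
    also have "\<dots> \<le> card A + card B" by (rule card_Un_le)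
    finally have "real (height_count V N) \<le> c / 16 * (real N)\<^sup>2 + 2 * (real N)\<^sup>2 / real_of_int (2 ^ m)" using A B by linarith
    also have "2 * (real N)\<^sup>2 / real_of_int (2 ^ m) = 2 / 2 ^ m * (real N)\<^sup>2" by simp
    also have "\<dots> \<le> c / 16 * (real N)\<^sup>2" using m2 by (intro mult_right_mono) auto
    also have "c / 16 * (real N)\<^sup>2 + c / 16 * (real N)\<^sup>2 = c * ((real N)\<^sup>2 / 8)" by simp
    also have "\<dots> \<le> c * real (height_count {0..1} N)" using c by (intro mult_left_mono height_count_unit_interval) auto
    finally show ?case by simp
  qed
qed

theorem theorem1p14:
  shows "(\<lambda>N. real (height_count {form_density f | f. nondegenerate f \<and> locally_ADC f} N))
           \<in> o(\<lambda>N. real (height_count {0..1} N))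
       \<and> (\<lambda>N. real (height_count {form_density f | f. maximal_form f} N))
           \<in> o(\<lambda>N. real (height_count {0..1} N))"
proof (intro conjI density_values_sparse)
  fix v assume "v \<in> {form_density f | f. nondegenerate f \<and> locally_ADC f}"
  thus "\<exists>f. v = form_density f \<and> nondegenerate f \<and> (\<forall>p n. prime p \<longrightarrow> (int p)\<^sup>2 * n \<in> Loc f p \<longrightarrow> n \<in> Loc f p)"
    using locally_ADC_Loc_cancel by blast
next
  fix v assume "v \<in> {form_density f | f. maximal_form f}"
  thus "\<exists>f. v = form_density f \<and> nondegenerate f \<and> (\<forall>p n. prime p \<longrightarrow> (int p)\<^sup>2 * n \<in> Loc f p \<longrightarrow> n \<in> Loc f p)"
    using maximal_form_nondegenerate maximal_form_Loc_cancel by blast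
qed

end
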